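(* Let $H$ be a ribbon Hopf algebra with universal $R$-matrix $R\in H\otimes H$ and ribbon element $\nu\in H$, let $\phi:H\to H$ be a Hopf algebra involution with $(\phi\otimes\phi)(R)=R$ and $\phi(\nu)=\nu$, and let $B\subset H$ be a quasi-triangular coideal subalgebra with universal $K$-matrix $K$. Let $H\text{-mod}_{\mathrm{f.d.}}$ and $B\text{-mod}_{\mathrm{f.d.}}$ be the categories of finite dimensional modules. Then $(H\text{-mod}_{\mathrm{f.d.}},B\text{-mod}_{\mathrm{f.d.}})$, with the canonical structure described in the context, is a $\mathbb{Z}_2$-braided pair.
   Context: **Hopf-algebraic notions.** A coideal subalgebra is a subalgebra $B\subset H$ with $\Delta(B)\subset B\otimes H$. With $R^\phi:=(\phi\otimes\mathrm{id})(R)=(\mathrm{id}\otimes\phi)(R)$, the coideal subalgebra $B$ is *quasi-triangular* if there is an invertible $K\in B\otimes H$ (a universal $K$-matrix) with $K\Delta(b)=(\mathrm{id}\otimes\phi)(\Delta(b))K$ for all $b\in B$; $(\Delta\otimes\mathrm{id})(K)=R^\phi_{32}K_{13}R_{23}$; $(\mathrm{id}\otimes\Delta)(K)=R_{32}K_{13}R^\phi_{23}K_{12}$. A balancing on a braided monoidal category is a natural automorphism $\theta$ of the identity functor with $\theta_{X\otimes Y}=\sigma_{Y,X}(\theta_Y\otimes\theta_X)\sigma_{X,Y}$. A ribbon Hopf algebra is a quasi-triangular Hopf algebra with a ribbon element, i.e. a central invertible $\nu$ whose action defines a balancing $\theta$ on the braided monoidal category of modules (braiding $\sigma=\mathrm{flip}\circ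 R$). **$\mathbb{Z}_2$-braided pairs.** An *anti-involution* of a monoidal category $\mathcal{A}$ is a monoidal functor $\Phi:\mathcal{A}\to\mathcal{A}^{\otimes\text{-op}}$ ($\mathcal{A}$ with reversed tensor product; so $\Phi_2:\Phi(Y)\otimes\Phi(X)\cong\Phi(X\otimes Y)$) with a monoidal isomorphism $t:\Phi^2\Rightarrow\mathrm{id}$ with $\Phi(t_X)=t_{\Phi(X)}$. A *$\mathbb{Z}_2$-braided pair* $(\mathcal{A},\mathcal{M})$ is a braided monoidal category $\mathcal{A}$ with an anti-involution which is braided ($\Phi(\sigma_{X,Y})\circ\Phi_2=\Phi_2\circ\sigma_{\Phi(Y),\Phi(X)}$), a right $\mathcal{A}$-module category $\mathcal{M}$ with a distinguished object, and natural isomorphisms $\kappa_{M,X}:M\otimes X\to M\otimes\Phi(X)$ such that for all $M\in\mathcal{M}$, $X,Y\in\mathcal{A}$ (associativity isomorphisms suppressed) (BP1) $\kappa_{M\otimes X,Y}=(\mathrm{id}_M\otimes\sigma_{\Phi(Y),X})\circ(\kappa_{M,Y}\otimes\mathrm{id}_X)\circ(\mathrm{id}_M\otimes\sigma_{X,Y})$; (BP2) $\kappa_{M,X\otimes Y}=(\mathrm{id}_M\otimes\Phi_2)\circ(\kappa_{M,Y}\otimes\mathrm{id}_{\Phi(X)})\circ(\mathrm{id}_M\otimes\sigma_{\Phi(X),Y})\circ(\kappa_{M,X}\otimes\mathrm{id}_Y)$. **The canonical structure.** $H$-modules have the braiding $\sigma$ from $R$; $\Phi(X)=X^\phi$ is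 $X$ with action twisted by $\phi$; $\Phi_2=\sigma_{\Phi(X),\Phi(Y)}:\Phi(X)\otimes\Phi(Y)\to\Phi(Y)\otimes\Phi(X)=\Phi(Y\otimes X)$ and $\Phi_0=\mathrm{id}$; $t:\Phi^2\cong\mathrm{id}$ is given by the balancing (with these conventions $t_X=\theta_X^{-1}$, the action of $\nu^{-1}$); $M\otimes X$ for a $B$-module $M$ and $H$-module $X$ is a $B$-module via $\Delta:B\to B\otimes H$; the distinguished object is the trivial $B$-module (restriction of the counit); $\kappa_{M,X}$ is the action of $K$. *)

theory Defs
  imports "HOL-Algebra.Module" "HOL-Algebra.Subrings"
begin

section \<open>Braided monoidal categories and $\mathbb{Z}_2$-braided pairs\<close>

record ('o, 'm) cat =
  obj :: "'o set"
  mor :: "'o \<Rightarrow> 'o \<Rightarrow> 'm set"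
  idm :: "'o \<Rightarrow> 'm"
  cmp :: "'m \<Rightarrow> 'm \<Rightarrow> 'm"  (infixr \<open>\<bullet>\<index>\<close> 55)

locale category =
  fixes C :: "('o, 'm, 'z) cat_scheme" (structure)
  assumes idm_mor: "X \<in> obj C \<Longrightarrow> idm C X \<in> mor C X X"
    and cmp_mor: "\<lbrakk>X \<in> obj C; Y \<in> obj C; Z \<in> obj C; f \<in> mor C X Y; g \<in> mor C Y Z\<rbrakk>
      \<Longrightarrow> g \<bullet> f \<in> mor C X Z"
    and cmp_idm: "\<lbrakk>X \<in> obj C; Y \<in> obj C; f \<in> mor C X Y\<rbrakk> \<Longrightarrow> f \<bullet> idm C X = f"
    and idm_cmp: "\<lbrakk>X \<in> obj C; Y \<in> obj C; f \<in> mor C X Y\<rbrakk> \<Longrightarrow> idm C Y \<bullet> f = f"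
    and cmp_assoc: "\<lbrakk>W \<in> obj C; X \<in> obj C; Y \<in> obj C; Z \<in> obj C;
        f \<in> mor C W X; g \<in> mor C X Y; h \<in> mor C Y Z\<rbrakk>
      \<Longrightarrow> (h \<bullet> g) \<bullet> f = h \<bullet> (g \<bullet> f)"

definition inverse_mors :: "('o, 'm, 'z) cat_scheme \<Rightarrow> 'o \<Rightarrow> 'o \<Rightarrow> 'm \<Rightarrow> 'm \<Rightarrow> bool" where
  "inverse_mors C X Y f g \<longleftrightarrow> f \<in> mor C X Y \<and> g \<in> mor C Y X \<and>
     g \<bullet>\<^bsub>C\<^esub> f = idm C X \<and> f \<bullet>\<^bsub>C\<^esub> g = idm C Y"

definition iso_mor :: "('o, 'm, 'z) cat_scheme \<Rightarrow> 'o \<Rightarrow> 'o \<Rightarrow> 'm \<Rightarrow> bool" where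
  "iso_mor C X Y f \<longleftrightarrow> (\<exists>g. inverse_mors C X Y f g)"

definition inv_mor :: "('o, 'm, 'z) cat_scheme \<Rightarrow> 'o \<Rightarrow> 'o \<Rightarrow> 'm \<Rightarrow> 'm" where
  "inv_mor C X Y f = (THE g. inverse_mors C X Y f g)"

record ('o, 'm) moncat = "('o, 'm) cat" +
  tob :: "'o \<Rightarrow> 'o \<Rightarrow> 'o"  (infixl \<open>\<boxtimes>\<index>\<close> 70)
  tmo :: "'m \<Rightarrow> 'm \<Rightarrow> 'm"  (infixl \<open>\<star>\<index>\<close> 70)
  unt :: "'o"
  asc :: "'o \<Rightarrow> 'o \<Rightarrow> 'o \<Rightarrow> 'm"
  lun :: "'o \<Rightarrow> 'm"
  run :: "'o \<Rightarrow> 'm"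

locale monoidal_category = category C
  for C :: "('o, 'm, 'z) moncat_scheme" (structure) +
  assumes tob_obj: "\<lbrakk>X \<in> obj C; Y \<in> obj C\<rbrakk> \<Longrightarrow> X \<boxtimes> Y \<in> obj C"
    and tmo_mor: "\<lbrakk>X \<in> obj C; X' \<in> obj C; Y \<in> obj C; Y' \<in> obj C; f \<in> mor C X X'; g \<in> mor C Y Y'\<rbrakk>
      \<Longrightarrow> f \<star> g \<in> mor C (X \<boxtimes> Y) (X' \<boxtimes> Y')"
    and tmo_idm: "\<lbrakk>X \<in> obj C; Y \<in> obj C\<rbrakk> \<Longrightarrow> idm C X \<star> idm C Y = idm C (X \<boxtimes> Y)"
    and tmo_cmp: "\<lbrakk>X \<in> obj C; X' \<in> obj C; X'' \<in> obj C; Y \<in> obj C; Y' \<in> obj C; Y'' \<in> obj C;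
        f \<in> mor C X X'; f' \<in> mor C X' X''; g \<in> mor C Y Y'; g' \<in> mor C Y' Y''\<rbrakk>
      \<Longrightarrow> (f' \<bullet> f) \<star> (g' \<bullet> g) = (f' \<star> g') \<bullet> (f \<star> g)"
    and unt_obj: "unt C \<in> obj C"
    and asc_iso: "\<lbrakk>X \<in> obj C; Y \<in> obj C; Z \<in> obj C\<rbrakk>
      \<Longrightarrow> iso_mor C ((X \<boxtimes> Y) \<boxtimes> Z) (X \<boxtimes> (Y \<boxtimes> Z)) (asc C X Y Z)"
    and asc_nat: "\<lbrakk>X \<in> obj C; X' \<in> obj C; Y \<in> obj C; Y' \<in> obj C; Z \<in> obj C; Z' \<in> obj C;
        f \<in> mor C X X'; g \<in> mor C Y Y'; h \<in> mor C Z Z'\<rbrakk>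
      \<Longrightarrow> asc C X' Y' Z' \<bullet> ((f \<star> g) \<star> h) = (f \<star> (g \<star> h)) \<bullet> asc C X Y Z"
    and lun_iso: "X \<in> obj C \<Longrightarrow> iso_mor C (unt C \<boxtimes> X) X (lun C X)"
    and lun_nat: "\<lbrakk>X \<in> obj C; X' \<in> obj C; f \<in> mor C X X'\<rbrakk>
      \<Longrightarrow> lun C X' \<bullet> (idm C (unt C) \<star> f) = f \<bullet> lun C X"
    and run_iso: "X \<in> obj C \<Longrightarrow> iso_mor C (X \<boxtimes> unt C) X (run C X)"
    and run_nat: "\<lbrakk>X \<in> obj C; X' \<in> obj C; f \<in> mor C X X'\<rbrakk>
      \<Longrightarrow> run C X' \<bullet> (f \<star> idm C (unt C)) = f \<bullet> run C X"
    and pentagon: "\<lbrakk>W \<in> obj C; X \<in> obj C; Y \<in> obj C; Z \<in> obj C\<rbrakk>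
      \<Longrightarrow> asc C W X (Y \<boxtimes> Z) \<bullet> asc C (W \<boxtimes> X) Y Z
        = (idm C W \<star> asc C X Y Z) \<bullet> asc C W (X \<boxtimes> Y) Z \<bullet> (asc C W X Y \<star> idm C Z)"
    and triangle: "\<lbrakk>X \<in> obj C; Y \<in> obj C\<rbrakk>
      \<Longrightarrow> (idm C X \<star> lun C Y) \<bullet> asc C X (unt C) Y = run C X \<star> idm C Y"

record ('o, 'm) brcat = "('o, 'm) moncat" +
  brd :: "'o \<Rightarrow> 'o \<Rightarrow> 'm"

locale braided_monoidal_category = monoidal_category C
  for C :: "('o, 'm, 'z) brcat_scheme" (structure) +
  assumes brd_iso: "\<lbrakk>X \<in> obj C; Y \<in> obj C\<rbrakk> \<Longrightarrow> iso_mor C (X \<boxtimes> Y) (Y \<boxtimes> X) (brd C X Y)"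
    and brd_nat: "\<lbrakk>X \<in> obj C; X' \<in> obj C; Y \<in> obj C; Y' \<in> obj C; f \<in> mor C X X'; g \<in> mor C Y Y'\<rbrakk>
      \<Longrightarrow> brd C X' Y' \<bullet> (f \<star> g) = (g \<star> f) \<bullet> brd C X Y"
    and hexagon1: "\<lbrakk>X \<in> obj C; Y \<in> obj C; Z \<in> obj C\<rbrakk>
      \<Longrightarrow> asc C Y Z X \<bullet> brd C X (Y \<boxtimes> Z) \<bullet> asc C X Y Z
        = (idm C Y \<star> brd C X Z) \<bullet> asc C Y X Z \<bullet> (brd C X Y \<star> idm C Z)"
    and hexagon2: "\<lbrakk>X \<in> obj C; Y \<in> obj C; Z \<in> obj C\<rbrakk>
      \<Longrightarrow> inv_mor C ((Z \<boxtimes> X) \<boxtimes> Y) (Z \<boxtimes> (X \<boxtimes> Y)) (asc C Z X Y) \<bullet> brd C (X \<boxtimes> Y) Z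
            \<bullet> inv_mor C ((X \<boxtimes> Y) \<boxtimes> Z) (X \<boxtimes> (Y \<boxtimes> Z)) (asc C X Y Z)
        = (brd C X Z \<star> idm C Y)
            \<bullet> inv_mor C ((X \<boxtimes> Z) \<boxtimes> Y) (X \<boxtimes> (Z \<boxtimes> Y)) (asc C X Z Y) \<bullet> (idm C X \<star> brd C Y Z)"

definition balancing :: "('o, 'm, 'z) brcat_scheme \<Rightarrow> ('o \<Rightarrow> 'm) \<Rightarrow> bool" where
  "balancing C \<theta> \<longleftrightarrow>
     (\<forall>X\<in>obj C. iso_mor C X X (\<theta> X)) \<and>
     (\<forall>X\<in>obj C. \<forall>Y\<in>obj C. \<forall>f\<in>mor C X Y. \<theta> Y \<bullet>\<^bsub>C\<^esub> f = f \<bullet>\<^bsub>C\<^esub> \<theta> X) \<and>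
     (\<forall>X\<in>obj C. \<forall>Y\<in>obj C.
        \<theta> (X \<boxtimes>\<^bsub>C\<^esub> Y) = brd C Y X \<bullet>\<^bsub>C\<^esub> (\<theta> Y \<star>\<^bsub>C\<^esub> \<theta> X) \<bullet>\<^bsub>C\<^esub> brd C X Y)"

text \<open>The category with reversed tensor product.\<close>

definition mon_op :: "('o, 'm, 'z) moncat_scheme \<Rightarrow> ('o, 'm, 'z) moncat_scheme" where
  "mon_op C = C\<lparr>tob := \<lambda>X Y. Y \<boxtimes>\<^bsub>C\<^esub> X, tmo := \<lambda>f g. g \<star>\<^bsub>C\<^esub> f,
     asc := \<lambda>X Y Z. inv_mor C ((Z \<boxtimes>\<^bsub>C\<^esub> Y) \<boxtimes>\<^bsub>C\<^esub> X) (Z \<boxtimes>\<^bsub>C\<^esub> (Y \<boxtimes>\<^bsub>C\<^esub> X)) (asc C Z Y X),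
     lun := run C, run := lun C\<rparr>"

record ('o, 'm, 'p, 'n) mfun =
  fob :: "'o \<Rightarrow> 'p"
  fmo :: "'m \<Rightarrow> 'n"
  f2 :: "'o \<Rightarrow> 'o \<Rightarrow> 'n"
  f0 :: "'n"

definition monoidal_functor ::
  "('o, 'm, 'y) moncat_scheme \<Rightarrow> ('p, 'n, 'z) moncat_scheme \<Rightarrow> ('o, 'm, 'p, 'n) mfun \<Rightarrow> bool" where
  "monoidal_functor C D F \<longleftrightarrow>
     (\<forall>X\<in>obj C. fob F X \<in> obj D) \<and>
     (\<forall>X\<in>obj C. \<forall>Y\<in>obj C. \<forall>f\<in>mor C X Y. fmo F f \<in> mor D (fob F X) (fob F Y)) \<and>
     (\<forall>X\<in>obj C. fmo F (idm C X) = idm D (fob F X)) \<and>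
     (\<forall>X\<in>obj C. \<forall>Y\<in>obj C. \<forall>Z\<in>obj C. \<forall>f\<in>mor C X Y. \<forall>g\<in>mor C Y Z.
        fmo F (g \<bullet>\<^bsub>C\<^esub> f) = fmo F g \<bullet>\<^bsub>D\<^esub> fmo F f) \<and>
     (\<forall>X\<in>obj C. \<forall>Y\<in>obj C. iso_mor D (fob F X \<boxtimes>\<^bsub>D\<^esub> fob F Y) (fob F (X \<boxtimes>\<^bsub>C\<^esub> Y)) (f2 F X Y)) \<and>
     (\<forall>X\<in>obj C. \<forall>X'\<in>obj C. \<forall>Y\<in>obj C. \<forall>Y'\<in>obj C. \<forall>f\<in>mor C X X'. \<forall>g\<in>mor C Y Y'.
        f2 F X' Y' \<bullet>\<^bsub>D\<^esub> (fmo F f \<star>\<^bsub>D\<^esub> fmo F g) = fmo F (f \<star>\<^bsub>C\<^esub> g) \<bullet>\<^bsub>D\<^esub> f2 F X Y) \<and>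
     iso_mor D (unt D) (fob F (unt C)) (f0 F) \<and>
     (\<forall>X\<in>obj C. \<forall>Y\<in>obj C. \<forall>Z\<in>obj C.
        fmo F (asc C X Y Z) \<bullet>\<^bsub>D\<^esub> f2 F (X \<boxtimes>\<^bsub>C\<^esub> Y) Z \<bullet>\<^bsub>D\<^esub> (f2 F X Y \<star>\<^bsub>D\<^esub> idm D (fob F Z))
        = f2 F X (Y \<boxtimes>\<^bsub>C\<^esub> Z) \<bullet>\<^bsub>D\<^esub> (idm D (fob F X) \<star>\<^bsub>D\<^esub> f2 F Y Z)
            \<bullet>\<^bsub>D\<^esub> asc D (fob F X) (fob F Y) (fob F Z)) \<and>
     (\<forall>X\<in>obj C.
        fmo F (lun C X) \<bullet>\<^bsub>D\<^esub> f2 F (unt C) X \<bullet>\<^bsub>D\<^esub> (f0 F \<star>\<^bsub>D\<^esub> idm D (fob F X)) = lun D (fob F X)) \<and>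
     (\<forall>X\<in>obj C.
        fmo F (run C X) \<bullet>\<^bsub>D\<^esub> f2 F X (unt C) \<bullet>\<^bsub>D\<^esub> (idm D (fob F X) \<star>\<^bsub>D\<^esub> f0 F) = run D (fob F X))"

definition mfun_id :: "('o, 'm, 'z) moncat_scheme \<Rightarrow> ('o, 'm, 'o, 'm) mfun" where
  "mfun_id C = \<lparr>fob = \<lambda>X. X, fmo = \<lambda>f. f, f2 = \<lambda>X Y. idm C (X \<boxtimes>\<^bsub>C\<^esub> Y), f0 = idm C (unt C)\<rparr>"

definition mfun_comp :: "('q, 'l, 'z) moncat_scheme \<Rightarrow> ('p, 'n, 'q, 'l) mfun \<Rightarrow>
    ('o, 'm, 'p, 'n) mfun \<Rightarrow> ('o, 'm, 'q, 'l) mfun" where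
  "mfun_comp E G F = \<lparr>fob = \<lambda>X. fob G (fob F X), fmo = \<lambda>f. fmo G (fmo F f),
     f2 = \<lambda>X Y. fmo G (f2 F X Y) \<bullet>\<^bsub>E\<^esub> f2 G (fob F X) (fob F Y),
     f0 = fmo G (f0 F) \<bullet>\<^bsub>E\<^esub> f0 G\<rparr>"

text \<open>A monoidal functor from \<open>C\<close> to \<open>D\<close>, regarded as one from \<open>mon_op C\<close> to \<open>mon_op D\<close>.\<close>

definition mfun_op :: "('o, 'm, 'p, 'n) mfun \<Rightarrow> ('o, 'm, 'p, 'n) mfun" where
  "mfun_op F = F\<lparr>f2 := \<lambda>X Y. f2 F Y X\<rparr>"

definition monoidal_iso :: "('o, 'm, 'y) moncat_scheme \<Rightarrow> ('p, 'n, 'z) moncat_scheme \<Rightarrow>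
    ('o, 'm, 'p, 'n) mfun \<Rightarrow> ('o, 'm, 'p, 'n) mfun \<Rightarrow> ('o \<Rightarrow> 'n) \<Rightarrow> bool" where
  "monoidal_iso C D F G t \<longleftrightarrow>
     (\<forall>X\<in>obj C. iso_mor D (fob F X) (fob G X) (t X)) \<and>
     (\<forall>X\<in>obj C. \<forall>Y\<in>obj C. \<forall>f\<in>mor C X Y. t Y \<bullet>\<^bsub>D\<^esub> fmo F f = fmo G f \<bullet>\<^bsub>D\<^esub> t X) \<and>
     (\<forall>X\<in>obj C. \<forall>Y\<in>obj C. t (X \<boxtimes>\<^bsub>C\<^esub> Y) \<bullet>\<^bsub>D\<^esub> f2 F X Y = f2 G X Y \<bullet>\<^bsub>D\<^esub> (t X \<star>\<^bsub>D\<^esub> t Y)) \<and>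
     t (unt C) \<bullet>\<^bsub>D\<^esub> f0 F = f0 G"

text \<open>Since \<open>\<Phi>\<close> goes from \<open>A\<close> to \<open>mon_op A\<close>, the morphism \<open>f2 \<Phi> X Y\<close> goes from
  \<open>\<Phi> Y \<boxtimes> \<Phi> X\<close> to \<open>\<Phi> (X \<boxtimes> Y)\<close>, where \<open>\<boxtimes>\<close> is the tensor product of \<open>A\<close>.\<close>

definition anti_involution ::
  "('o, 'm, 'z) moncat_scheme \<Rightarrow> ('o, 'm, 'o, 'm) mfun \<Rightarrow> ('o \<Rightarrow> 'm) \<Rightarrow> bool" where
  "anti_involution A \<Phi> t \<longleftrightarrow>
     monoidal_functor A (mon_op A) \<Phi> \<and>
     monoidal_iso A A (mfun_comp A (mfun_op \<Phi>) \<Phi>) (mfun_id A) t \<and>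
     (\<forall>X\<in>obj A. fmo \<Phi> (t X) = t (fob \<Phi> X))"

definition braided_anti_involution ::
  "('o, 'm, 'z) brcat_scheme \<Rightarrow> ('o, 'm, 'o, 'm) mfun \<Rightarrow> ('o \<Rightarrow> 'm) \<Rightarrow> bool" where
  "braided_anti_involution A \<Phi> t \<longleftrightarrow> anti_involution A \<Phi> t \<and>
     (\<forall>X\<in>obj A. \<forall>Y\<in>obj A.
        fmo \<Phi> (brd A X Y) \<bullet>\<^bsub>A\<^esub> f2 \<Phi> X Y = f2 \<Phi> Y X \<bullet>\<^bsub>A\<^esub> brd A (fob \<Phi> Y) (fob \<Phi> X))"

record ('p, 'n, 'o, 'm) modcat = "('p, 'n) cat" +
  aob :: "'p \<Rightarrow> 'o \<Rightarrow> 'p"  (infixl \<open>\<triangleleft>\<index>\<close> 70)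
  amo :: "'n \<Rightarrow> 'm \<Rightarrow> 'n"  (infixl \<open>\<ltimes>\<index>\<close> 70)
  masc :: "'p \<Rightarrow> 'o \<Rightarrow> 'o \<Rightarrow> 'n"
  mun :: "'p \<Rightarrow> 'n"
  dob :: "'p"

locale pointed_module_category = A?: monoidal_category A + D?: category D
  for A :: "('o, 'm, 'y) moncat_scheme" (structure)
    and D :: "('p, 'n, 'o, 'm, 'z) modcat_scheme" (structure) +
  assumes aob_obj: "\<lbrakk>M \<in> obj D; X \<in> obj A\<rbrakk> \<Longrightarrow> M \<triangleleft>\<^bsub>D\<^esub> X \<in> obj D"
    and amo_mor: "\<lbrakk>M \<in> obj D; M' \<in> obj D; X \<in> obj A; X' \<in> obj A; f \<in> mor D M M'; g \<in> mor A X X'\<rbrakk>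
      \<Longrightarrow> f \<ltimes>\<^bsub>D\<^esub> g \<in> mor D (M \<triangleleft>\<^bsub>D\<^esub> X) (M' \<triangleleft>\<^bsub>D\<^esub> X')"
    and amo_idm: "\<lbrakk>M \<in> obj D; X \<in> obj A\<rbrakk> \<Longrightarrow> idm D M \<ltimes>\<^bsub>D\<^esub> idm A X = idm D (M \<triangleleft>\<^bsub>D\<^esub> X)"
    and amo_cmp: "\<lbrakk>M \<in> obj D; M' \<in> obj D; M'' \<in> obj D; X \<in> obj A; X' \<in> obj A; X'' \<in> obj A;
        f \<in> mor D M M'; f' \<in> mor D M' M''; g \<in> mor A X X'; g' \<in> mor A X' X''\<rbrakk>
      \<Longrightarrow> (f' \<bullet>\<^bsub>D\<^esub> f) \<ltimes>\<^bsub>D\<^esub> (g' \<bullet>\<^bsub>A\<^esub> g) = (f' \<ltimes>\<^bsub>D\<^esub> g') \<bullet>\<^bsub>D\<^esub> (f \<ltimes>\<^bsub>D\<^esub> g)"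
    and masc_iso: "\<lbrakk>M \<in> obj D; X \<in> obj A; Y \<in> obj A\<rbrakk>
      \<Longrightarrow> iso_mor D ((M \<triangleleft>\<^bsub>D\<^esub> X) \<triangleleft>\<^bsub>D\<^esub> Y) (M \<triangleleft>\<^bsub>D\<^esub> (X \<boxtimes>\<^bsub>A\<^esub> Y)) (masc D M X Y)"
    and masc_nat: "\<lbrakk>M \<in> obj D; M' \<in> obj D; X \<in> obj A; X' \<in> obj A; Y \<in> obj A; Y' \<in> obj A;
        f \<in> mor D M M'; g \<in> mor A X X'; h \<in> mor A Y Y'\<rbrakk>
      \<Longrightarrow> masc D M' X' Y' \<bullet>\<^bsub>D\<^esub> ((f \<ltimes>\<^bsub>D\<^esub> g) \<ltimes>\<^bsub>D\<^esub> h) = (f \<ltimes>\<^bsub>D\<^esub> (g \<star>\<^bsub>A\<^esub> h)) \<bullet>\<^bsub>D\<^esub> masc D M X Y"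
    and mun_iso: "M \<in> obj D \<Longrightarrow> iso_mor D (M \<triangleleft>\<^bsub>D\<^esub> unt A) M (mun D M)"
    and mun_nat: "\<lbrakk>M \<in> obj D; M' \<in> obj D; f \<in> mor D M M'\<rbrakk>
      \<Longrightarrow> mun D M' \<bullet>\<^bsub>D\<^esub> (f \<ltimes>\<^bsub>D\<^esub> idm A (unt A)) = f \<bullet>\<^bsub>D\<^esub> mun D M"
    and module_pentagon: "\<lbrakk>M \<in> obj D; X \<in> obj A; Y \<in> obj A; Z \<in> obj A\<rbrakk>
      \<Longrightarrow> masc D M X (Y \<boxtimes>\<^bsub>A\<^esub> Z) \<bullet>\<^bsub>D\<^esub> masc D (M \<triangleleft>\<^bsub>D\<^esub> X) Y Z
        = (idm D M \<ltimes>\<^bsub>D\<^esub> asc A X Y Z) \<bullet>\<^bsub>D\<^esub> masc D M (X \<boxtimes>\<^bsub>A\<^esub> Y) Z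
            \<bullet>\<^bsub>D\<^esub> (masc D M X Y \<ltimes>\<^bsub>D\<^esub> idm A Z)"
    and module_triangle: "\<lbrakk>M \<in> obj D; X \<in> obj A\<rbrakk>
      \<Longrightarrow> (idm D M \<ltimes>\<^bsub>D\<^esub> lun A X) \<bullet>\<^bsub>D\<^esub> masc D M (unt A) X = mun D M \<ltimes>\<^bsub>D\<^esub> idm A X"
    and dob_obj: "dob D \<in> obj D"

abbreviation masc_inv ::
  "('o, 'm, 'y) moncat_scheme \<Rightarrow> ('p, 'n, 'o, 'm, 'z) modcat_scheme \<Rightarrow> 'p \<Rightarrow> 'o \<Rightarrow> 'o \<Rightarrow> 'n" where
  "masc_inv A D M X Y \<equiv>
     inv_mor D ((M \<triangleleft>\<^bsub>D\<^esub> X) \<triangleleft>\<^bsub>D\<^esub> Y) (M \<triangleleft>\<^bsub>D\<^esub> (X \<boxtimes>\<^bsub>A\<^esub> Y)) (masc D M X Y)"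

locale Z2_braided_pair =
  A?: braided_monoidal_category A + D?: pointed_module_category A D
  for A :: "('o, 'm, 'y) brcat_scheme" (structure)
    and D :: "('p, 'n, 'o, 'm, 'z) modcat_scheme" (structure) +
  fixes \<Phi> :: "('o, 'm, 'o, 'm) mfun" and t :: "'o \<Rightarrow> 'm" and \<kappa> :: "'p \<Rightarrow> 'o \<Rightarrow> 'n"
  assumes braided_anti_invol: "braided_anti_involution A \<Phi> t"
    and \<kappa>_iso: "\<lbrakk>M \<in> obj D; X \<in> obj A\<rbrakk>
      \<Longrightarrow> iso_mor D (M \<triangleleft>\<^bsub>D\<^esub> X) (M \<triangleleft>\<^bsub>D\<^esub> fob \<Phi> X) (\<kappa> M X)"
    and \<kappa>_nat: "\<lbrakk>M \<in> obj D; M' \<in> obj D; X \<in> obj A; X' \<in> obj A; f \<in> mor D M M'; g \<in> mor A X X'\<rbrakk>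
      \<Longrightarrow> \<kappa> M' X' \<bullet>\<^bsub>D\<^esub> (f \<ltimes>\<^bsub>D\<^esub> g) = (f \<ltimes>\<^bsub>D\<^esub> fmo \<Phi> g) \<bullet>\<^bsub>D\<^esub> \<kappa> M X"
    and BP1: "\<lbrakk>M \<in> obj D; X \<in> obj A; Y \<in> obj A\<rbrakk>
      \<Longrightarrow> \<kappa> (M \<triangleleft>\<^bsub>D\<^esub> X) Y
        = masc_inv A D M X (fob \<Phi> Y) \<bullet>\<^bsub>D\<^esub> (idm D M \<ltimes>\<^bsub>D\<^esub> brd A (fob \<Phi> Y) X)
            \<bullet>\<^bsub>D\<^esub> masc D M (fob \<Phi> Y) X \<bullet>\<^bsub>D\<^esub> (\<kappa> M Y \<ltimes>\<^bsub>D\<^esub> idm A X)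
            \<bullet>\<^bsub>D\<^esub> masc_inv A D M Y X \<bullet>\<^bsub>D\<^esub> (idm D M \<ltimes>\<^bsub>D\<^esub> brd A X Y)
            \<bullet>\<^bsub>D\<^esub> masc D M X Y"
    and BP2: "\<lbrakk>M \<in> obj D; X \<in> obj A; Y \<in> obj A\<rbrakk>
      \<Longrightarrow> \<kappa> M (X \<boxtimes>\<^bsub>A\<^esub> Y)
        = (idm D M \<ltimes>\<^bsub>D\<^esub> f2 \<Phi> X Y)
            \<bullet>\<^bsub>D\<^esub> masc D M (fob \<Phi> Y) (fob \<Phi> X) \<bullet>\<^bsub>D\<^esub> (\<kappa> M Y \<ltimes>\<^bsub>D\<^esub> idm A (fob \<Phi> X))
            \<bullet>\<^bsub>D\<^esub> masc_inv A D M Y (fob \<Phi> X) \<bullet>\<^bsub>D\<^esub> (idm D M \<ltimes>\<^bsub>D\<^esub> brd A (fob \<Phi> X) Y)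
            \<bullet>\<^bsub>D\<^esub> masc D M (fob \<Phi> X) Y \<bullet>\<^bsub>D\<^esub> (\<kappa> M X \<ltimes>\<^bsub>D\<^esub> idm A Y)
            \<bullet>\<^bsub>D\<^esub> masc_inv A D M X Y"


section \<open>Tensor products over a field\<close>

text \<open>A list \<open>[(x1, y1), \<dots>, (xn, yn)]\<close> stands for the formal sum of the \<open>xi \<otimes> yi\<close>;
  \<open>teq\<close> is the congruence generated by bilinearity. An element of \<open>V \<otimes> W\<close> is an equivalence
  class, represented by a chosen member \<open>tnf\<close>. Working with representatives instead of classes
  allows the tensor product of two modules to live in the same type as the factors
  (see the type \<open>univ\<close> below), which a type of sets of formal sums would not.\<close>

inductive teq :: "'k ring \<Rightarrow> ('k, 'a, 'y) module_scheme \<Rightarrow> ('k, 'b, 'z) module_scheme \<Rightarrow>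
    ('a \<times> 'b) list \<Rightarrow> ('a \<times> 'b) list \<Rightarrow> bool"
  for k V W where
  teq_refl: "xs \<in> lists (carrier V \<times> carrier W) \<Longrightarrow> teq k V W xs xs"
| teq_sym: "teq k V W xs ys \<Longrightarrow> teq k V W ys xs"
| teq_trans: "\<lbrakk>teq k V W xs ys; teq k V W ys zs\<rbrakk> \<Longrightarrow> teq k V W xs zs"
| teq_append: "\<lbrakk>teq k V W xs xs'; teq k V W ys ys'\<rbrakk> \<Longrightarrow> teq k V W (xs @ ys) (xs' @ ys')"
| teq_commute: "\<lbrakk>xs \<in> lists (carrier V \<times> carrier W); ys \<in> lists (carrier V \<times> carrier W)\<rbrakk>
    \<Longrightarrow> teq k V W (xs @ ys) (ys @ xs)"
| teq_add_left: "\<lbrakk>x \<in> carrier V; x' \<in> carrier V; y \<in> carrier W\<rbrakk>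
    \<Longrightarrow> teq k V W [(x \<oplus>\<^bsub>V\<^esub> x', y)] [(x, y), (x', y)]"
| teq_add_right: "\<lbrakk>x \<in> carrier V; y \<in> carrier W; y' \<in> carrier W\<rbrakk>
    \<Longrightarrow> teq k V W [(x, y \<oplus>\<^bsub>W\<^esub> y')] [(x, y), (x, y')]"
| teq_smult: "\<lbrakk>c \<in> carrier k; x \<in> carrier V; y \<in> carrier W\<rbrakk>
    \<Longrightarrow> teq k V W [(c \<odot>\<^bsub>V\<^esub> x, y)] [(x, c \<odot>\<^bsub>W\<^esub> y)]"
| teq_zero: "y \<in> carrier W \<Longrightarrow> teq k V W [(\<zero>\<^bsub>V\<^esub>, y)] []"

definition tnf :: "'k ring \<Rightarrow> ('k, 'a, 'y) module_scheme \<Rightarrow> ('k, 'b, 'z) module_scheme \<Rightarrow>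
    ('a \<times> 'b) list \<Rightarrow> ('a \<times> 'b) list" where
  "tnf k V W xs = (SOME ys. teq k V W xs ys)"

text \<open>The tensor product of vector spaces; \<open>mult\<close> and \<open>one\<close> give the tensor product of algebras
  if \<open>V\<close> and \<open>W\<close> are algebras and are meaningless otherwise.\<close>

definition tensor :: "'k ring \<Rightarrow> ('k, 'a, 'y) module_scheme \<Rightarrow> ('k, 'b, 'z) module_scheme \<Rightarrow>
    ('k, ('a \<times> 'b) list) module" where
  "tensor k V W =
     \<lparr>carrier = tnf k V W ` lists (carrier V \<times> carrier W),
      mult = \<lambda>s t. tnf k V W (map (\<lambda>((x, y), (x', y')). (x \<otimes>\<^bsub>V\<^esub> x', y \<otimes>\<^bsub>W\<^esub> y')) (List.product s t)),
      one = tnf k V W [(\<one>\<^bsub>V\<^esub>, \<one>\<^bsub>W\<^esub>)],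
      zero = tnf k V W [],
      add = \<lambda>s t. tnf k V W (s @ t),
      smult = \<lambda>c t. tnf k V W (map (\<lambda>(x, y). (c \<odot>\<^bsub>V\<^esub> x, y)) t)\<rparr>"

definition pure :: "'k ring \<Rightarrow> ('k, 'a, 'y) module_scheme \<Rightarrow> ('k, 'b, 'z) module_scheme \<Rightarrow>
    'a \<Rightarrow> 'b \<Rightarrow> ('a \<times> 'b) list" where
  "pure k V W x y = tnf k V W [(x, y)]"

text \<open>\<open>tmap k V W f g\<close> is \<open>f \<otimes> g\<close> with values in \<open>V \<otimes> W\<close>, \<open>tlift U f\<close> is the linear map to \<open>U\<close>
  induced by the bilinear map \<open>f\<close>, and \<open>tflip k V W\<close> is the flip from \<open>V \<otimes> W\<close> to \<open>W \<otimes> V\<close>.\<close>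

definition tmap :: "'k ring \<Rightarrow> ('k, 'a, 'y) module_scheme \<Rightarrow> ('k, 'b, 'z) module_scheme \<Rightarrow>
    ('c \<Rightarrow> 'a) \<Rightarrow> ('d \<Rightarrow> 'b) \<Rightarrow> ('c \<times> 'd) list \<Rightarrow> ('a \<times> 'b) list" where
  "tmap k V W f g t = tnf k V W (map (\<lambda>(x, y). (f x, g y)) t)"

definition tlift :: "('u, 'z) ring_scheme \<Rightarrow> ('a \<Rightarrow> 'b \<Rightarrow> 'u) \<Rightarrow> ('a \<times> 'b) list \<Rightarrow> 'u" where
  "tlift U f t = foldr (\<lambda>(x, y) s. f x y \<oplus>\<^bsub>U\<^esub> s) t \<zero>\<^bsub>U\<^esub>"

definition tflip :: "'k ring \<Rightarrow> ('k, 'a, 'y) module_scheme \<Rightarrow> ('k, 'b, 'z) module_scheme \<Rightarrow>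
    ('a \<times> 'b) list \<Rightarrow> ('b \<times> 'a) list" where
  "tflip k V W t = tnf k W V (map prod.swap t)"

definition klin :: "'k ring \<Rightarrow> ('k, 'a, 'y) module_scheme \<Rightarrow> ('k, 'b, 'z) module_scheme \<Rightarrow>
    ('a \<Rightarrow> 'b) set" where
  "klin k V W = {f \<in> carrier V \<rightarrow> carrier W.
     (\<forall>x\<in>carrier V. \<forall>y\<in>carrier V. f (x \<oplus>\<^bsub>V\<^esub> y) = f x \<oplus>\<^bsub>W\<^esub> f y) \<and>
     (\<forall>c\<in>carrier k. \<forall>x\<in>carrier V. f (c \<odot>\<^bsub>V\<^esub> x) = c \<odot>\<^bsub>W\<^esub> f x)}"

definition fin_dim :: "'k ring \<Rightarrow> ('k, 'a, 'z) module_scheme \<Rightarrow> bool" where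
  "fin_dim k V \<longleftrightarrow> (\<exists>S. finite S \<and> S \<subseteq> carrier V \<and>
     (\<forall>x\<in>carrier V. \<exists>c\<in>S \<rightarrow> carrier k. x = finsum V (\<lambda>s. c s \<odot>\<^bsub>V\<^esub> s) S))"


section \<open>Quasi-triangular Hopf algebras and coideal subalgebras\<close>

record ('k, 'h) hopf = "('k, 'h) module" +
  comult :: "'h \<Rightarrow> ('h \<times> 'h) list"
  counit :: "'h \<Rightarrow> 'k"
  antipode :: "'h \<Rightarrow> 'h"

text \<open>The locale \<open>algebra\<close> of the library is about commutative algebras.\<close>

definition assoc_algebra :: "'k ring \<Rightarrow> ('k, 'h, 'z) module_scheme \<Rightarrow> bool" where
  "assoc_algebra k A \<longleftrightarrow> ring A \<and> module k A \<and>
     (\<forall>c\<in>carrier k. \<forall>a\<in>carrier A. \<forall>b\<in>carrier A.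
        (c \<odot>\<^bsub>A\<^esub> a) \<otimes>\<^bsub>A\<^esub> b = c \<odot>\<^bsub>A\<^esub> (a \<otimes>\<^bsub>A\<^esub> b) \<and> a \<otimes>\<^bsub>A\<^esub> (c \<odot>\<^bsub>A\<^esub> b) = c \<odot>\<^bsub>A\<^esub> (a \<otimes>\<^bsub>A\<^esub> b))"

abbreviation tensor2 :: "'k ring \<Rightarrow> ('k, 'h) hopf \<Rightarrow> ('k, ('h \<times> 'h) list) module" where
  "tensor2 k H \<equiv> tensor k H H"

text \<open>\<open>tensor3\<close> is \<open>(H \<otimes> H) \<otimes> H\<close>.\<close>

abbreviation tensor3 ::
  "'k ring \<Rightarrow> ('k, 'h) hopf \<Rightarrow> ('k, (('h \<times> 'h) list \<times> 'h) list) module" where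
  "tensor3 k H \<equiv> tensor k (tensor2 k H) H"

definition comult_left ::
  "'k ring \<Rightarrow> ('k, 'h) hopf \<Rightarrow> ('h \<times> 'h) list \<Rightarrow> (('h \<times> 'h) list \<times> 'h) list" where
  "comult_left k H = tmap k (tensor2 k H) H (comult H) (\<lambda>y. y)"

text \<open>\<open>id \<otimes> \<Delta>\<close>, followed by the identification of \<open>H \<otimes> (H \<otimes> H)\<close> with \<open>(H \<otimes> H) \<otimes> H\<close>.\<close>

definition comult_right ::
  "'k ring \<Rightarrow> ('k, 'h) hopf \<Rightarrow> ('h \<times> 'h) list \<Rightarrow> (('h \<times> 'h) list \<times> 'h) list" where
  "comult_right k H t = tnf k (tensor2 k H) H
     (concat (map (\<lambda>(x, y). map (\<lambda>(y1, y2). (pure k H H x y1, y2)) (comult H y)) t))"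

definition hopf_algebra :: "'k ring \<Rightarrow> ('k, 'h) hopf \<Rightarrow> bool" where
  "hopf_algebra k H \<longleftrightarrow> field k \<and> assoc_algebra k H \<and>
     comult H \<in> klin k H (tensor2 k H) \<inter> ring_hom H (tensor2 k H) \<and>
     counit H \<in> ring_hom H k \<and>
     (\<forall>c\<in>carrier k. \<forall>h\<in>carrier H. counit H (c \<odot>\<^bsub>H\<^esub> h) = c \<otimes>\<^bsub>k\<^esub> counit H h) \<and>
     antipode H \<in> klin k H H \<and>
     (\<forall>h\<in>carrier H.
        comult_left k H (comult H h) = comult_right k H (comult H h) \<and>
        tlift H (\<lambda>x y. counit H x \<odot>\<^bsub>H\<^esub> y) (comult H h) = h \<and>
        tlift H (\<lambda>x y. counit H y \<odot>\<^bsub>H\<^esub> x) (comult H h) = h \<and>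
        tlift H (\<lambda>x y. antipode H x \<otimes>\<^bsub>H\<^esub> y) (comult H h) = counit H h \<odot>\<^bsub>H\<^esub> \<one>\<^bsub>H\<^esub> \<and>
        tlift H (\<lambda>x y. x \<otimes>\<^bsub>H\<^esub> antipode H y) (comult H h) = counit H h \<odot>\<^bsub>H\<^esub> \<one>\<^bsub>H\<^esub>)"

text \<open>Leg numbering: for \<open>t\<close> the sum of the \<open>xi \<otimes> yi\<close>, the element \<open>legij\<close> has the \<open>xi\<close> in
  position \<open>i\<close> and the \<open>yi\<close> in position \<open>j\<close>.\<close>

definition leg12 ::
  "'k ring \<Rightarrow> ('k, 'h) hopf \<Rightarrow> ('h \<times> 'h) list \<Rightarrow> (('h \<times> 'h) list \<times> 'h) list" where
  "leg12 k H t = pure k (tensor2 k H) H t \<one>\<^bsub>H\<^esub>"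

definition leg13 ::
  "'k ring \<Rightarrow> ('k, 'h) hopf \<Rightarrow> ('h \<times> 'h) list \<Rightarrow> (('h \<times> 'h) list \<times> 'h) list" where
  "leg13 k H = tmap k (tensor2 k H) H (\<lambda>x. pure k H H x \<one>\<^bsub>H\<^esub>) (\<lambda>y. y)"

definition leg23 ::
  "'k ring \<Rightarrow> ('k, 'h) hopf \<Rightarrow> ('h \<times> 'h) list \<Rightarrow> (('h \<times> 'h) list \<times> 'h) list" where
  "leg23 k H = tmap k (tensor2 k H) H (\<lambda>x. pure k H H \<one>\<^bsub>H\<^esub> x) (\<lambda>y. y)"

definition leg32 ::
  "'k ring \<Rightarrow> ('k, 'h) hopf \<Rightarrow> ('h \<times> 'h) list \<Rightarrow> (('h \<times> 'h) list \<times> 'h) list" where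
  "leg32 k H t = leg23 k H (tflip k H H t)"

definition universal_R_matrix :: "'k ring \<Rightarrow> ('k, 'h) hopf \<Rightarrow> ('h \<times> 'h) list \<Rightarrow> bool" where
  "universal_R_matrix k H R \<longleftrightarrow> R \<in> Units (tensor2 k H) \<and>
     (\<forall>h\<in>carrier H.
        R \<otimes>\<^bsub>tensor2 k H\<^esub> comult H h = tflip k H H (comult H h) \<otimes>\<^bsub>tensor2 k H\<^esub> R) \<and>
     comult_left k H R = leg13 k H R \<otimes>\<^bsub>tensor3 k H\<^esub> leg23 k H R \<and>
     comult_right k H R = leg13 k H R \<otimes>\<^bsub>tensor3 k H\<^esub> leg12 k H R"

definition hopf_involution :: "'k ring \<Rightarrow> ('k, 'h) hopf \<Rightarrow> ('h \<Rightarrow> 'h) \<Rightarrow> bool" where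
  "hopf_involution k H \<phi> \<longleftrightarrow> \<phi> \<in> klin k H H \<inter> ring_hom H H \<and>
     (\<forall>h\<in>carrier H. comult H (\<phi> h) = tmap k H H \<phi> \<phi> (comult H h) \<and>
        counit H (\<phi> h) = counit H h \<and> antipode H (\<phi> h) = \<phi> (antipode H h) \<and> \<phi> (\<phi> h) = h)"

abbreviation sub_algebra :: "('k, 'h) hopf \<Rightarrow> 'h set \<Rightarrow> ('k, 'h) hopf" where
  "sub_algebra H B \<equiv> H\<lparr>carrier := B\<rparr>"

text \<open>The map from \<open>B \<otimes> H\<close> to \<open>H \<otimes> H\<close> induced by the inclusion; it is injective because the
  tensor product is over a field. Its image is \<open>B \<otimes> H\<close> as a subset of \<open>H \<otimes> H\<close>.\<close>

definition BH_incl :: "'k ring \<Rightarrow> ('k, 'h) hopf \<Rightarrow> ('h \<times> 'h) list \<Rightarrow> ('h \<times> 'h) list" where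
  "BH_incl k H = tmap k H H (\<lambda>x. x) (\<lambda>y. y)"

definition BH :: "'k ring \<Rightarrow> ('k, 'h) hopf \<Rightarrow> 'h set \<Rightarrow> ('h \<times> 'h) list set" where
  "BH k H B = BH_incl k H ` carrier (tensor k (sub_algebra H B) H)"

definition BH_restrict ::
  "'k ring \<Rightarrow> ('k, 'h) hopf \<Rightarrow> 'h set \<Rightarrow> ('h \<times> 'h) list \<Rightarrow> ('h \<times> 'h) list" where
  "BH_restrict k H B = inv_into (carrier (tensor k (sub_algebra H B) H)) (BH_incl k H)"

definition coideal_subalgebra :: "'k ring \<Rightarrow> ('k, 'h) hopf \<Rightarrow> 'h set \<Rightarrow> bool" where
  "coideal_subalgebra k H B \<longleftrightarrow> subring B H \<and>
     (\<forall>c\<in>carrier k. \<forall>b\<in>B. c \<odot>\<^bsub>H\<^esub> b \<in> B) \<and>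
     (\<forall>b\<in>B. comult H b \<in> BH k H B)"

definition R_twist ::
  "'k ring \<Rightarrow> ('k, 'h) hopf \<Rightarrow> ('h \<Rightarrow> 'h) \<Rightarrow> ('h \<times> 'h) list \<Rightarrow> ('h \<times> 'h) list" where
  "R_twist k H \<phi> R = tmap k H H \<phi> (\<lambda>y. y) R"

definition universal_K_matrix :: "'k ring \<Rightarrow> ('k, 'h) hopf \<Rightarrow> ('h \<times> 'h) list \<Rightarrow> ('h \<Rightarrow> 'h) \<Rightarrow>
    'h set \<Rightarrow> ('h \<times> 'h) list \<Rightarrow> bool" where
  "universal_K_matrix k H R \<phi> B K \<longleftrightarrow>
     K \<in> BH k H B \<and>
     (\<exists>K'\<in>BH k H B. K \<otimes>\<^bsub>tensor2 k H\<^esub> K' = \<one>\<^bsub>tensor2 k H\<^esub> \<and> K' \<otimes>\<^bsub>tensor2 k H\<^esub> K = \<one>\<^bsub>tensor2 k H\<^esub>) \<and>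
     (\<forall>b\<in>B. K \<otimes>\<^bsub>tensor2 k H\<^esub> comult H b
        = tmap k H H (\<lambda>x. x) \<phi> (comult H b) \<otimes>\<^bsub>tensor2 k H\<^esub> K) \<and>
     comult_left k H K
        = leg32 k H (R_twist k H \<phi> R) \<otimes>\<^bsub>tensor3 k H\<^esub> leg13 k H K \<otimes>\<^bsub>tensor3 k H\<^esub> leg23 k H R \<and>
     comult_right k H K
        = leg32 k H R \<otimes>\<^bsub>tensor3 k H\<^esub> leg13 k H K
            \<otimes>\<^bsub>tensor3 k H\<^esub> leg23 k H (R_twist k H \<phi> R) \<otimes>\<^bsub>tensor3 k H\<^esub> leg12 k H K"


section \<open>Categories of modules\<close>

text \<open>The type in which the elements of modules live: it contains the field \<open>'k\<close> (for the tensor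
  unit) and an arbitrary type \<open>'a\<close>, and is closed under forming tensor products. The underlying
  set of a module may be any subset of this type.\<close>

datatype (dead 'k, dead 'a) univ =
  Scal (unscal: 'k)
| Elem 'a
| Tens (untens: "(('k, 'a) univ \<times> ('k, 'a) univ) list")

text \<open>The fields \<open>mult\<close> and \<open>one\<close> of a module are irrelevant.\<close>

record ('k, 'h, 'u) amod = "('k, 'u) module" +
  act :: "'h \<Rightarrow> 'u \<Rightarrow> 'u"

datatype ('o, 'u) arrow = Arrow (src: 'o) (fnc: "'u \<Rightarrow> 'u") (tgt: 'o)

type_synonym ('k, 'h, 'a) mob = "('k, 'h, ('k, 'a) univ) amod"
type_synonym ('k, 'h, 'a) mar = "(('k, 'h, 'a) mob, ('k, 'a) univ) arrow"

definition amodule :: "'k ring \<Rightarrow> ('k, 'h) hopf \<Rightarrow> ('k, 'h, 'u) amod \<Rightarrow> bool" where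
  "amodule k A X \<longleftrightarrow> module k X \<and>
     (\<forall>a\<in>carrier A. act X a \<in> klin k X X) \<and>
     (\<forall>x\<in>carrier X.
        (\<forall>a\<in>carrier A. \<forall>b\<in>carrier A. act X (a \<oplus>\<^bsub>A\<^esub> b) x = act X a x \<oplus>\<^bsub>X\<^esub> act X b x) \<and>
        (\<forall>c\<in>carrier k. \<forall>a\<in>carrier A. act X (c \<odot>\<^bsub>A\<^esub> a) x = c \<odot>\<^bsub>X\<^esub> act X a x) \<and>
        (\<forall>a\<in>carrier A. \<forall>b\<in>carrier A. act X (a \<otimes>\<^bsub>A\<^esub> b) x = act X a (act X b x)) \<and>
        act X \<one>\<^bsub>A\<^esub> x = x)"

definition mk_arrow :: "('k, 'h, 'u) amod \<Rightarrow> ('u \<Rightarrow> 'u) \<Rightarrow> ('k, 'h, 'u) amod \<Rightarrow>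
    (('k, 'h, 'u) amod, 'u) arrow" where
  "mk_arrow X f Y = Arrow X (restrict f (carrier X)) Y"

definition amod_mor :: "'k ring \<Rightarrow> ('k, 'h) hopf \<Rightarrow> ('k, 'h, 'u) amod \<Rightarrow> ('k, 'h, 'u) amod \<Rightarrow>
    (('k, 'h, 'u) amod, 'u) arrow set" where
  "amod_mor k A X Y = {mk_arrow X f Y | f. f \<in> klin k X Y \<and>
     (\<forall>a\<in>carrier A. \<forall>x\<in>carrier X. f (act X a x) = act Y a (f x))}"

definition amod_id :: "('k, 'h, 'u) amod \<Rightarrow> (('k, 'h, 'u) amod, 'u) arrow" where
  "amod_id X = mk_arrow X (\<lambda>x. x) X"

definition amod_comp :: "(('k, 'h, 'u) amod, 'u) arrow \<Rightarrow> (('k, 'h, 'u) amod, 'u) arrow \<Rightarrow>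
    (('k, 'h, 'u) amod, 'u) arrow" where
  "amod_comp g f = mk_arrow (src f) (fnc g \<circ> fnc f) (tgt g)"

text \<open>The action on \<open>X \<otimes> Y\<close> of an element \<open>t\<close> of a tensor product of algebras.\<close>

definition tact :: "'k ring \<Rightarrow> ('k, 'h, 'a) mob \<Rightarrow> ('k, 'h, 'a) mob \<Rightarrow> ('h \<times> 'h) list \<Rightarrow>
    ('k, 'a) univ \<Rightarrow> ('k, 'a) univ" where
  "tact k X Y t u = Tens (tnf k X Y
     (map (\<lambda>((h, h'), (x, y)). (act X h x, act Y h' y)) (List.product t (untens u))))"

text \<open>\<open>X \<otimes> Y\<close>, on which \<open>a\<close> acts as the element \<open>\<delta> a\<close> of a tensor product of algebras.\<close>

definition mod_tensor :: "'k ring \<Rightarrow> ('h \<Rightarrow> ('h \<times> 'h) list) \<Rightarrow>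
    ('k, 'h, 'a) mob \<Rightarrow> ('k, 'h, 'a) mob \<Rightarrow> ('k, 'h, 'a) mob" where
  "mod_tensor k \<delta> X Y =
     \<lparr>carrier = Tens ` carrier (tensor k X Y), mult = undefined, one = undefined,
      zero = Tens \<zero>\<^bsub>tensor k X Y\<^esub>,
      add = \<lambda>u v. Tens (untens u \<oplus>\<^bsub>tensor k X Y\<^esub> untens v),
      smult = \<lambda>c u. Tens (c \<odot>\<^bsub>tensor k X Y\<^esub> untens u),
      act = \<lambda>a. tact k X Y (\<delta> a)\<rparr>"

definition mod_tensor_mor :: "'k ring \<Rightarrow> ('h \<Rightarrow> ('h \<times> 'h) list) \<Rightarrow>
    ('k, 'h, 'a) mar \<Rightarrow> ('k, 'h, 'a) mar \<Rightarrow> ('k, 'h, 'a) mar" where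
  "mod_tensor_mor k \<delta> f g = mk_arrow (mod_tensor k \<delta> (src f) (src g))
     (\<lambda>u. Tens (tmap k (tgt f) (tgt g) (fnc f) (fnc g) (untens u)))
     (mod_tensor k \<delta> (tgt f) (tgt g))"

definition mod_unit :: "'k ring \<Rightarrow> ('k, 'h) hopf \<Rightarrow> ('k, 'h, 'a) mob" where
  "mod_unit k H =
     \<lparr>carrier = Scal ` carrier k, mult = undefined, one = undefined, zero = Scal \<zero>\<^bsub>k\<^esub>,
      add = \<lambda>u v. Scal (unscal u \<oplus>\<^bsub>k\<^esub> unscal v),
      smult = \<lambda>c u. Scal (c \<otimes>\<^bsub>k\<^esub> unscal u),
      act = \<lambda>a u. Scal (counit H a \<otimes>\<^bsub>k\<^esub> unscal u)\<rparr>"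

text \<open>The associator \<open>(x \<otimes> y) \<otimes> z \<mapsto> x \<otimes> (y \<otimes> z)\<close>. Here \<open>\<delta>\<close> describes tensor products whose
  left factor is \<open>X\<close> or \<open>X \<otimes> Y\<close>; it is \<open>\<Delta>\<close> if \<open>X\<close> is an \<open>H\<close>-module, and \<open>\<Delta>\<close> with values in \<open>B \<otimes> H\<close>
  if \<open>X\<close> is a \<open>B\<close>-module.\<close>

definition mod_assoc :: "'k ring \<Rightarrow> ('k, 'h) hopf \<Rightarrow> ('h \<Rightarrow> ('h \<times> 'h) list) \<Rightarrow>
    ('k, 'h, 'a) mob \<Rightarrow> ('k, 'h, 'a) mob \<Rightarrow> ('k, 'h, 'a) mob \<Rightarrow> ('k, 'h, 'a) mar" where
  "mod_assoc k H \<delta> X Y Z = mk_arrow (mod_tensor k \<delta> (mod_tensor k \<delta> X Y) Z)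
     (\<lambda>u. Tens (tnf k X (mod_tensor k (comult H) Y Z)
        (concat (map (\<lambda>(s, z). map (\<lambda>(x, y). (x, Tens (pure k Y Z y z))) (untens s)) (untens u)))))
     (mod_tensor k \<delta> X (mod_tensor k (comult H) Y Z))"

definition mod_lunit :: "'k ring \<Rightarrow> ('k, 'h) hopf \<Rightarrow> ('k, 'h, 'a) mob \<Rightarrow> ('k, 'h, 'a) mar" where
  "mod_lunit k H X = mk_arrow (mod_tensor k (comult H) (mod_unit k H) X)
     (\<lambda>u. tlift X (\<lambda>c x. unscal c \<odot>\<^bsub>X\<^esub> x) (untens u)) X"

definition mod_runit :: "'k ring \<Rightarrow> ('k, 'h) hopf \<Rightarrow> ('h \<Rightarrow> ('h \<times> 'h) list) \<Rightarrow>
    ('k, 'h, 'a) mob \<Rightarrow> ('k, 'h, 'a) mar" where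
  "mod_runit k H \<delta> X = mk_arrow (mod_tensor k \<delta> X (mod_unit k H))
     (\<lambda>u. tlift X (\<lambda>x c. unscal c \<odot>\<^bsub>X\<^esub> x) (untens u)) X"

definition mod_flip_R :: "'k ring \<Rightarrow> ('h \<times> 'h) list \<Rightarrow> ('k, 'h, 'a) mob \<Rightarrow> ('k, 'h, 'a) mob \<Rightarrow>
    ('k, 'a) univ \<Rightarrow> ('k, 'a) univ" where
  "mod_flip_R k R X Y u = Tens (tflip k X Y (untens (tact k X Y R u)))"

definition mod_braid :: "'k ring \<Rightarrow> ('k, 'h) hopf \<Rightarrow> ('h \<times> 'h) list \<Rightarrow>
    ('k, 'h, 'a) mob \<Rightarrow> ('k, 'h, 'a) mob \<Rightarrow> ('k, 'h, 'a) mar" where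
  "mod_braid k H R X Y = mk_arrow (mod_tensor k (comult H) X Y) (mod_flip_R k R X Y)
     (mod_tensor k (comult H) Y X)"

text \<open>The braided monoidal category of those \<open>H\<close>-modules that satisfy \<open>P\<close>.\<close>

definition Hmod :: "'k ring \<Rightarrow> ('k, 'h) hopf \<Rightarrow> ('h \<times> 'h) list \<Rightarrow> (('k, 'h, 'a) mob \<Rightarrow> bool) \<Rightarrow>
    (('k, 'h, 'a) mob, ('k, 'h, 'a) mar) brcat" where
  "Hmod k H R P =
     \<lparr>obj = {X. amodule k H X \<and> P X}, mor = amod_mor k H, idm = amod_id, cmp = amod_comp,
      tob = mod_tensor k (comult H), tmo = mod_tensor_mor k (comult H), unt = mod_unit k H,
      asc = mod_assoc k H (comult H), lun = mod_lunit k H, run = mod_runit k H (comult H),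
      brd = mod_braid k H R\<rparr>"

text \<open>The balancing condition is imposed on the category of all modules; its objects include the
  regular module, with underlying set \<open>Elem ` carrier H\<close>.\<close>

definition ribbon_element :: "'k ring \<Rightarrow> ('k, 'h) hopf \<Rightarrow> ('h \<times> 'h) list \<Rightarrow> 'h \<Rightarrow> bool" where
  "ribbon_element k H R \<nu> \<longleftrightarrow> \<nu> \<in> Units H \<and> (\<forall>h\<in>carrier H. \<nu> \<otimes>\<^bsub>H\<^esub> h = h \<otimes>\<^bsub>H\<^esub> \<nu>) \<and>
     balancing (Hmod k H R (\<lambda>_. True) :: (('k, 'h, 'h) mob, ('k, 'h, 'h) mar) brcat)
       (\<lambda>X. mk_arrow X (act X \<nu>) X)"

definition ribbon_hopf_algebra :: "'k ring \<Rightarrow> ('k, 'h) hopf \<Rightarrow> ('h \<times> 'h) list \<Rightarrow> 'h \<Rightarrow> bool" where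
  "ribbon_hopf_algebra k H R \<nu> \<longleftrightarrow>
     hopf_algebra k H \<and> universal_R_matrix k H R \<and> ribbon_element k H R \<nu>"

definition Hmod_fd :: "'k ring \<Rightarrow> ('k, 'h) hopf \<Rightarrow> ('h \<times> 'h) list \<Rightarrow>
    (('k, 'h, 'a) mob, ('k, 'h, 'a) mar) brcat" where
  "Hmod_fd k H R = Hmod k H R (fin_dim k)"

definition coaction :: "'k ring \<Rightarrow> ('k, 'h) hopf \<Rightarrow> 'h set \<Rightarrow> 'h \<Rightarrow> ('h \<times> 'h) list" where
  "coaction k H B b = BH_restrict k H B (comult H b)"

definition Bmod_fd :: "'k ring \<Rightarrow> ('k, 'h) hopf \<Rightarrow> 'h set \<Rightarrow>
    (('k, 'h, 'a) mob, ('k, 'h, 'a) mar, ('k, 'h, 'a) mob, ('k, 'h, 'a) mar) modcat" where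
  "Bmod_fd k H B =
     \<lparr>obj = {M. amodule k (sub_algebra H B) M \<and> fin_dim k M}, mor = amod_mor k (sub_algebra H B),
      idm = amod_id, cmp = amod_comp,
      aob = mod_tensor k (coaction k H B), amo = mod_tensor_mor k (coaction k H B),
      masc = mod_assoc k H (coaction k H B), mun = mod_runit k H (coaction k H B),
      dob = mod_unit k H\<rparr>"

definition twist :: "('h \<Rightarrow> 'h) \<Rightarrow> ('k, 'h, 'u) amod \<Rightarrow> ('k, 'h, 'u) amod" where
  "twist \<phi> X = X\<lparr>act := \<lambda>h. act X (\<phi> h)\<rparr>"

definition twist_functor :: "'k ring \<Rightarrow> ('k, 'h) hopf \<Rightarrow> ('h \<times> 'h) list \<Rightarrow> ('h \<Rightarrow> 'h) \<Rightarrow>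
    (('k, 'h, 'a) mob, ('k, 'h, 'a) mar, ('k, 'h, 'a) mob, ('k, 'h, 'a) mar) mfun" where
  "twist_functor k H R \<phi> =
     \<lparr>fob = twist \<phi>,
      fmo = \<lambda>f. Arrow (twist \<phi> (src f)) (fnc f) (twist \<phi> (tgt f)),
      f2 = \<lambda>X Y. mk_arrow (mod_tensor k (comult H) (twist \<phi> Y) (twist \<phi> X))
        (mod_flip_R k R (twist \<phi> Y) (twist \<phi> X)) (twist \<phi> (mod_tensor k (comult H) X Y)),
      f0 = mk_arrow (mod_unit k H) (\<lambda>x. x) (twist \<phi> (mod_unit k H))\<rparr>"

definition twist_square_iso :: "('k, 'h) hopf \<Rightarrow> ('h \<Rightarrow> 'h) \<Rightarrow> 'h \<Rightarrow>
    ('k, 'h, 'a) mob \<Rightarrow> ('k, 'h, 'a) mar" where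
  "twist_square_iso H \<phi> \<nu> X = mk_arrow (twist \<phi> (twist \<phi> X)) (act X (inv\<^bsub>H\<^esub> \<nu>)) X"

definition K_action :: "'k ring \<Rightarrow> ('k, 'h) hopf \<Rightarrow> ('h \<Rightarrow> 'h) \<Rightarrow> 'h set \<Rightarrow> ('h \<times> 'h) list \<Rightarrow>
    ('k, 'h, 'a) mob \<Rightarrow> ('k, 'h, 'a) mob \<Rightarrow> ('k, 'h, 'a) mar" where
  "K_action k H \<phi> B K M X = mk_arrow (mod_tensor k (coaction k H B) M X)
     (tact k M X (BH_restrict k H B K)) (mod_tensor k (coaction k H B) M (twist \<phi> X))"

end

theory Submission
  imports Defs
begin

text \<open>
  Elements of tensor products are finite sums of pure tensors, so two elements agree iff every
  bilinear (for triple products: trilinear) map has the same sum over both. Coassociativity, the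
  hexagon axioms of \<open>R\<close> and the two coproduct axioms of \<open>K\<close> are used in this form throughout.
  A coherence condition of the braided pair is an equation of linear maps between tensor products of
  modules; on a pure tensor it becomes one of these sum identities, applied to the multilinear
  map obtained by acting on the tensor factors. For example (BP1) is
  \<open>(\<Delta> \<otimes> id)(K) = R\<^sup>\<phi>\<^sub>3\<^sub>2 K\<^sub>1\<^sub>3 R\<^sub>2\<^sub>3\<close>, and (BP2) is \<open>(id \<otimes> \<Delta>)(K) = R\<^sub>3\<^sub>2 K\<^sub>1\<^sub>3 R\<^sup>\<phi>\<^sub>2\<^sub>3 K\<^sub>1\<^sub>2\<close>,
  where \<open>R\<^sub>3\<^sub>2\<close> is the action of \<open>\<Phi>\<^sub>2 = \<sigma>\<close>. That \<open>\<nu>\<inverse>\<close> gives a monoidal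
  isomorphism \<open>\<Phi>\<^sup>2 \<cong> id\<close> rests on \<open>\<Delta>(\<nu>) = R\<^sub>2\<^sub>1 (\<nu> \<otimes> \<nu>) R\<close>, which is the
  balancing evaluated at \<open>1 \<otimes> 1\<close> in the square of the regular module.
\<close>

section \<open>Tensor products and multilinear maps\<close>

text \<open>Applied to a pure tensor, a composite of morphisms nests its sums with the operator
  applied first outermost, whereas a product such as \<open>R32 K13 R23\<close> nests them with the
  leftmost factor outermost; the Fubini lemmas pass from one order to the other. The map
  \<open>f2\<close> is a braiding of twisted modules, and
  \<open>(\<phi> \<otimes> \<phi>)(R) = R\<close> makes it the braiding map of the untwisted ones.
  Its coherence with the associator is then the Yang-Baxter equation, and its coherence with the
  unit is \<open>(\<epsilon> \<otimes> id)(R) = 1 = (id \<otimes> \<epsilon>)(R)\<close>, a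
  consequence of the hexagons and of the invertibility of \<open>R\<close>. A braiding with only one
  twisted factor keeps one \<open>\<phi>\<close>, and this is where the twisted R-matrix in the
  axioms of \<open>K\<close> comes from. The balancing is given on modules whose elements come from
  the type of \<open>H\<close>; the formula for the coproduct of \<open>\<nu>\<close> that it yields
  lives in \<open>H \<otimes> H\<close> and therefore acts on modules over every type.\<close>

definition bilin :: "'k ring \<Rightarrow> ('k, 'a, 'x) module_scheme \<Rightarrow> ('k, 'b, 'y) module_scheme \<Rightarrow>
    ('k, 'u, 'z) module_scheme \<Rightarrow> ('a \<Rightarrow> 'b \<Rightarrow> 'u) \<Rightarrow> bool" where
  "bilin k V W U f \<longleftrightarrow> (\<forall>x\<in>carrier V. f x \<in> klin k W U) \<and>
     (\<forall>y\<in>carrier W. (\<lambda>x. f x y) \<in> klin k V U)"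

definition trilin :: "'k ring \<Rightarrow> ('k, 'a, 'x) module_scheme \<Rightarrow> ('k, 'b, 'y) module_scheme \<Rightarrow>
    ('k, 'c, 'w) module_scheme \<Rightarrow> ('k, 'u, 'z) module_scheme \<Rightarrow> ('a \<Rightarrow> 'b \<Rightarrow> 'c \<Rightarrow> 'u) \<Rightarrow> bool" where
  "trilin k V W X U f \<longleftrightarrow> (\<forall>x\<in>carrier V. bilin k W X U (f x)) \<and>
     (\<forall>y\<in>carrier W. \<forall>z\<in>carrier X. (\<lambda>x. f x y z) \<in> klin k V U)"

abbreviation pairs :: "('k, 'a, 'x) module_scheme \<Rightarrow> ('k, 'b, 'y) module_scheme \<Rightarrow> ('a \<times> 'b) list set" where
  "pairs V W \<equiv> lists (carrier V \<times> carrier W)"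

lemma tlift_Nil [simp]: "tlift U f [] = \<zero>\<^bsub>U\<^esub>"
  and tlift_Cons: "tlift U f (p # t) = f (fst p) (snd p) \<oplus>\<^bsub>U\<^esub> tlift U f t"
  by (simp_all add: tlift_def split_beta)

lemma pairsD: "t \<in> pairs V W \<Longrightarrow> (a, b) \<in> set t \<Longrightarrow> a \<in> carrier V \<and> b \<in> carrier W"
  by auto

lemma pairsI: "(\<And>a b. (a, b) \<in> set t \<Longrightarrow> a \<in> carrier V \<and> b \<in> carrier W) \<Longrightarrow> t \<in> pairs V W"
  by auto

text \<open>As a congruence rule it hands the simplifier the membership of \<open>(a, b)\<close> in
  the list while the summand is rewritten, so that closure facts such as \<open>comult_set\<close>
  apply under the sum.\<close>

lemma tlift_cong [cong]:
  assumes "t = t'" "\<And>a b. (a, b) \<in> set t' \<Longrightarrow> f a b = g a b"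
  shows "tlift U f t = tlift U g t'"
proof -
  have "tlift U f t' = tlift U g t'"
    using assms(2) by (induction t') (auto simp: tlift_Cons)
  then show ?thesis using assms(1) by simp
qed

lemma tlift_map: "tlift U f (map (\<lambda>(x, y). (g x y, h x y)) t) = tlift U (\<lambda>x y. f (g x y) (h x y)) t"
  by (induction t) (auto simp: tlift_Cons)

lemma tlift_map_fun: "tlift U f (map h t) = tlift U (\<lambda>a b. f (fst (h (a, b))) (snd (h (a, b)))) t"
  by (induction t) (auto simp: tlift_Cons)

lemma tlift_swap_map: "tlift U f (map prod.swap t) = tlift U (\<lambda>x y. f y x) t"
  by (induction t) (auto simp: tlift_Cons)

section \<open>Finite sums and linear maps over a field\<close>

locale over_field =
  fixes k :: "'k ring"
  assumes field_k: "field k"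
begin

lemma cring_k: "cring k"
  using field_k by (simp add: domain_def field_def)

lemma field_closed [simp]: "\<one>\<^bsub>k\<^esub> \<in> carrier k" "\<zero>\<^bsub>k\<^esub> \<in> carrier k"
  "a \<in> carrier k \<Longrightarrow> b \<in> carrier k \<Longrightarrow> a \<otimes>\<^bsub>k\<^esub> b \<in> carrier k"
  "a \<in> carrier k \<Longrightarrow> b \<in> carrier k \<Longrightarrow> a \<oplus>\<^bsub>k\<^esub> b \<in> carrier k"
proof -
  interpret cring k by (rule cring_k)
  show "\<one>\<^bsub>k\<^esub> \<in> carrier k" "\<zero>\<^bsub>k\<^esub> \<in> carrier k"
    "a \<in> carrier k \<Longrightarrow> b \<in> carrier k \<Longrightarrow> a \<otimes>\<^bsub>k\<^esub> b \<in> carrier k"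
    "a \<in> carrier k \<Longrightarrow> b \<in> carrier k \<Longrightarrow> a \<oplus>\<^bsub>k\<^esub> b \<in> carrier k" by auto
qed

context
  fixes U :: "('k, 'u, 'z) module_scheme"
  assumes U: "module k U"
begin

interpretation U: module k U by (rule U)

text \<open>The module laws are exported with \<open>module k U\<close> as a premise, many of them
  as simplification rules, because a single calculation involves several modules at once.\<close>

lemma mod_zero [simp]: "\<zero>\<^bsub>U\<^esub> \<in> carrier U" by simp
lemma mod_add [simp]: "x \<in> carrier U \<Longrightarrow> y \<in> carrier U \<Longrightarrow> x \<oplus>\<^bsub>U\<^esub> y \<in> carrier U" by simp
lemma mod_smult [simp]: "c \<in> carrier k \<Longrightarrow> x \<in> carrier U \<Longrightarrow> c \<odot>\<^bsub>U\<^esub> x \<in> carrier U" by simp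
lemma mod_l0 [simp]: "x \<in> carrier U \<Longrightarrow> \<zero>\<^bsub>U\<^esub> \<oplus>\<^bsub>U\<^esub> x = x" by simp
lemma mod_r0 [simp]: "x \<in> carrier U \<Longrightarrow> x \<oplus>\<^bsub>U\<^esub> \<zero>\<^bsub>U\<^esub> = x" by simp
lemma mod_assoc: "x \<in> carrier U \<Longrightarrow> y \<in> carrier U \<Longrightarrow> z \<in> carrier U \<Longrightarrow>
  x \<oplus>\<^bsub>U\<^esub> y \<oplus>\<^bsub>U\<^esub> z = x \<oplus>\<^bsub>U\<^esub> (y \<oplus>\<^bsub>U\<^esub> z)" by (rule U.a_assoc)
lemma mod_comm: "x \<in> carrier U \<Longrightarrow> y \<in> carrier U \<Longrightarrow> x \<oplus>\<^bsub>U\<^esub> y = y \<oplus>\<^bsub>U\<^esub> x"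
  by (rule U.a_comm)
lemma mod_lcomm: "x \<in> carrier U \<Longrightarrow> y \<in> carrier U \<Longrightarrow> z \<in> carrier U \<Longrightarrow>
  x \<oplus>\<^bsub>U\<^esub> (y \<oplus>\<^bsub>U\<^esub> z) = y \<oplus>\<^bsub>U\<^esub> (x \<oplus>\<^bsub>U\<^esub> z)" by (rule U.a_lcomm)
lemma mod_sz [simp]: "c \<in> carrier k \<Longrightarrow> c \<odot>\<^bsub>U\<^esub> \<zero>\<^bsub>U\<^esub> = \<zero>\<^bsub>U\<^esub>" by simp
lemma mod_zs [simp]: "x \<in> carrier U \<Longrightarrow> \<zero>\<^bsub>k\<^esub> \<odot>\<^bsub>U\<^esub> x = \<zero>\<^bsub>U\<^esub>" by simp
lemma mod_one [simp]: "x \<in> carrier U \<Longrightarrow> \<one>\<^bsub>k\<^esub> \<odot>\<^bsub>U\<^esub> x = x" by simp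
lemma mod_sadd: "c \<in> carrier k \<Longrightarrow> x \<in> carrier U \<Longrightarrow> y \<in> carrier U \<Longrightarrow>
  c \<odot>\<^bsub>U\<^esub> (x \<oplus>\<^bsub>U\<^esub> y) = c \<odot>\<^bsub>U\<^esub> x \<oplus>\<^bsub>U\<^esub> c \<odot>\<^bsub>U\<^esub> y" by (rule U.smult_r_distr)
lemma mod_adds: "c \<in> carrier k \<Longrightarrow> d \<in> carrier k \<Longrightarrow> x \<in> carrier U \<Longrightarrow>
  (c \<oplus>\<^bsub>k\<^esub> d) \<odot>\<^bsub>U\<^esub> x = c \<odot>\<^bsub>U\<^esub> x \<oplus>\<^bsub>U\<^esub> d \<odot>\<^bsub>U\<^esub> x" by (rule U.smult_l_distr)
lemma mod_mults: "c \<in> carrier k \<Longrightarrow> d \<in> carrier k \<Longrightarrow> x \<in> carrier U \<Longrightarrow>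
  (c \<otimes>\<^bsub>k\<^esub> d) \<odot>\<^bsub>U\<^esub> x = c \<odot>\<^bsub>U\<^esub> (d \<odot>\<^bsub>U\<^esub> x)" by (rule U.smult_assoc1)
lemma mod_scomm: "c \<in> carrier k \<Longrightarrow> d \<in> carrier k \<Longrightarrow> x \<in> carrier U \<Longrightarrow>
  c \<odot>\<^bsub>U\<^esub> (d \<odot>\<^bsub>U\<^esub> x) = d \<odot>\<^bsub>U\<^esub> (c \<odot>\<^bsub>U\<^esub> x)"
  by (metis U.m_comm U.smult_assoc1)
lemma mod_neg: "x \<in> carrier U \<Longrightarrow> (\<ominus>\<^bsub>k\<^esub> \<one>\<^bsub>k\<^esub>) \<odot>\<^bsub>U\<^esub> x \<oplus>\<^bsub>U\<^esub> x = \<zero>\<^bsub>U\<^esub>"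
  by (metis U.smult_l_minus U.R.one_closed U.smult_one U.M.l_neg)
lemma tlift_closed [simp]:
  "(\<And>a b. (a, b) \<in> set t \<Longrightarrow> f a b \<in> carrier U) \<Longrightarrow> tlift U f t \<in> carrier U"
  by (induction t) (auto simp: tlift_Cons)

lemma tlift_append:
  assumes "\<And>a b. (a, b) \<in> set (s @ t) \<Longrightarrow> f a b \<in> carrier U"
  shows "tlift U f (s @ t) = tlift U f s \<oplus>\<^bsub>U\<^esub> tlift U f t"
  using assms by (induction s) (auto simp: tlift_Cons mod_assoc)

lemma tlift_zero [simp]: "tlift U (\<lambda>a b. \<zero>\<^bsub>U\<^esub>) t = \<zero>\<^bsub>U\<^esub>"
  by (induction t) (auto simp: tlift_Cons)

lemma tlift_add:
  assumes "\<And>a b. (a, b) \<in> set t \<Longrightarrow> f a b \<in> carrier U" "\<And>a b. (a, b) \<in> set t \<Longrightarrow> g a b \<in> carrier U"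
  shows "tlift U (\<lambda>a b. f a b \<oplus>\<^bsub>U\<^esub> g a b) t = tlift U f t \<oplus>\<^bsub>U\<^esub> tlift U g t"
  using assms by (induction t) (auto simp: tlift_Cons mod_assoc mod_lcomm)

lemma tlift_smult:
  assumes "c \<in> carrier k" "\<And>a b. (a, b) \<in> set t \<Longrightarrow> f a b \<in> carrier U"
  shows "tlift U (\<lambda>a b. c \<odot>\<^bsub>U\<^esub> f a b) t = c \<odot>\<^bsub>U\<^esub> tlift U f t"
  using assms by (induction t) (auto simp: tlift_Cons mod_sadd)

lemma tlift_concat:
  assumes "\<And>p a b. p \<in> set t \<Longrightarrow> (a, b) \<in> set (g p) \<Longrightarrow> f a b \<in> carrier U"
  shows "tlift U f (concat (map g t)) = tlift U (\<lambda>x y. tlift U f (g (x, y))) t"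
  using assms
proof (induction t)
  case (Cons p t)
  have "tlift U f (g p @ concat (map g t)) = tlift U f (g p) \<oplus>\<^bsub>U\<^esub> tlift U f (concat (map g t))"
  proof (rule tlift_append)
    fix a b assume "(a, b) \<in> set (g p @ concat (map g t))"
    then have "\<exists>q\<in>set (p # t). (a, b) \<in> set (g q)" unfolding set_append set_concat set_map by (simp only: list.set) blast
    then obtain q where "q \<in> set (p # t)" "(a, b) \<in> set (g q)" by blast
    then show "f a b \<in> carrier U" using Cons.prems by (rule_tac Cons.prems)
  qed
  moreover have "tlift U f (concat (map g t)) = tlift U (\<lambda>x y. tlift U f (g (x, y))) t"
    by (rule Cons.IH) (meson Cons.prems list.set_intros(2))
  ultimately show ?case by (simp add: tlift_Cons)
qed simp

lemma tlift_Fubini: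
  assumes "\<And>a b c d. (a, b) \<in> set s \<Longrightarrow> (c, d) \<in> set t \<Longrightarrow> f a b c d \<in> carrier U"
  shows "tlift U (\<lambda>a b. tlift U (\<lambda>c d. f a b c d) t) s = tlift U (\<lambda>c d. tlift U (\<lambda>a b. f a b c d) s) t"
  using assms
proof (induction s)
  case (Cons p s)
  have "tlift U (\<lambda>a b. tlift U (\<lambda>c d. f a b c d) t) (p # s)
     = tlift U (\<lambda>c d. f (fst p) (snd p) c d) t \<oplus>\<^bsub>U\<^esub> tlift U (\<lambda>c d. tlift U (\<lambda>a b. f a b c d) s) t"
    using Cons by (simp add: tlift_Cons)
  also have "\<dots> = tlift U (\<lambda>c d. tlift U (\<lambda>a b. f a b c d) (p # s)) t"
    unfolding tlift_Cons by (rule tlift_add[symmetric]) (use Cons.prems in auto)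
  finally show ?case .
qed simp

text \<open>Both the product of \<open>tensor\<close> and the action \<open>tact\<close> run over
  \<open>List.product\<close>; this rule turns them into iterated sums.\<close>

lemma tlift_product:
  assumes "\<And>p q a b. p \<in> set s \<Longrightarrow> q \<in> set t \<Longrightarrow> f (fst (g p q)) (snd (g p q)) \<in> carrier U"
  shows "tlift U f (map (\<lambda>(p, q). g p q) (List.product s t)) =
    tlift U (\<lambda>a b. tlift U (\<lambda>c d. f (fst (g (a, b) (c, d))) (snd (g (a, b) (c, d)))) t) s"
  using assms
proof (induction s)
  case (Cons p s)
  have "tlift U f (map (\<lambda>(p, q). g p q) (List.product (p # s) t))
    = tlift U f (map (g p) t @ map (\<lambda>(p, q). g p q) (List.product s t))"
    by (simp add: comp_def)
  also have "\<dots> = tlift U f (map (g p) t) \<oplus>\<^bsub>U\<^esub> tlift U f (map (\<lambda>(p, q). g p q) (List.product s t))"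
  proof (rule tlift_append)
    fix a b assume "(a, b) \<in> set (map (g p) t @ map (\<lambda>(p, q). g p q) (List.product s t))"
    then have "(a, b) \<in> set (map (\<lambda>(p, q). g p q) (List.product (p # s) t))" by (simp add: comp_def)
    then obtain r where r: "r \<in> set (List.product (p # s) t)" "(a, b) = (\<lambda>(p, q). g p q) r"
      unfolding set_map by (rule imageE)
    then have "(a, b) = g (fst r) (snd r)" "fst r \<in> set (p # s)" "snd r \<in> set t"
      by (simp_all only: set_product mem_Times_iff split_beta)
    then show "f a b \<in> carrier U" using Cons.prems[of "fst r" "snd r"] by (metis fst_conv snd_conv)
  qed
  also have "tlift U f (map (\<lambda>(p, q). g p q) (List.product s t)) =
    tlift U (\<lambda>a b. tlift U (\<lambda>c d. f (fst (g (a, b) (c, d))) (snd (g (a, b) (c, d)))) t) s"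
    using Cons by simp
  finally show ?case by (simp add: tlift_Cons tlift_map_fun)
qed simp

end

lemma klin_cl: "f \<in> klin k V W \<Longrightarrow> x \<in> carrier V \<Longrightarrow> f x \<in> carrier W"
  and klin_add: "f \<in> klin k V W \<Longrightarrow> x \<in> carrier V \<Longrightarrow> y \<in> carrier V \<Longrightarrow> f (x \<oplus>\<^bsub>V\<^esub> y) = f x \<oplus>\<^bsub>W\<^esub> f y"
  and klin_smult: "f \<in> klin k V W \<Longrightarrow> c \<in> carrier k \<Longrightarrow> x \<in> carrier V \<Longrightarrow> f (c \<odot>\<^bsub>V\<^esub> x) = c \<odot>\<^bsub>W\<^esub> f x"
  by (auto simp: klin_def)

lemma klinI:
  "(\<And>x. x \<in> carrier V \<Longrightarrow> f x \<in> carrier W) \<Longrightarrow>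
   (\<And>x y. x \<in> carrier V \<Longrightarrow> y \<in> carrier V \<Longrightarrow> f (x \<oplus>\<^bsub>V\<^esub> y) = f x \<oplus>\<^bsub>W\<^esub> f y) \<Longrightarrow>
   (\<And>c x. c \<in> carrier k \<Longrightarrow> x \<in> carrier V \<Longrightarrow> f (c \<odot>\<^bsub>V\<^esub> x) = c \<odot>\<^bsub>W\<^esub> f x) \<Longrightarrow> f \<in> klin k V W"
  by (auto simp: klin_def)

lemma klin_zero:
  assumes "module k V" "module k W" "f \<in> klin k V W"
  shows "f \<zero>\<^bsub>V\<^esub> = \<zero>\<^bsub>W\<^esub>"
  by (metis assms mod_zs mod_zero klin_smult klin_cl field_closed(2))

lemma klin_id: "(\<lambda>x. x) \<in> klin k V V"
  by (rule klinI) auto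

lemma klin_comp: "g \<in> klin k W U \<Longrightarrow> f \<in> klin k V W \<Longrightarrow> (\<lambda>x. g (f x)) \<in> klin k V U"
  by (intro klinI) (simp_all add: klin_cl klin_add klin_smult)

lemma klin_cong:
  assumes "module k V" "f \<in> klin k V W" "\<And>x. x \<in> carrier V \<Longrightarrow> g x = f x"
  shows "g \<in> klin k V W"
  using assms by (auto simp: klin_def)

text \<open>The rule by which a morphism is evaluated on a sum of pure tensors.\<close>

lemma klin_tlift:
  assumes "g \<in> klin k U U'" "module k U" "module k U'"
    "\<And>a b. (a, b) \<in> set t \<Longrightarrow> f a b \<in> carrier U"
  shows "g (tlift U f t) = tlift U' (\<lambda>a b. g (f a b)) t"
  using assms by (induction t) (auto simp: tlift_Cons klin_add klin_zero)

lemma klin_tlift_fun: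
  assumes "module k U" "\<And>a b. (a, b) \<in> set t \<Longrightarrow> (\<lambda>v. f v a b) \<in> klin k V U"
  shows "(\<lambda>v. tlift U (f v) t) \<in> klin k V U"
proof (rule klinI)
  have *: "f v a b \<in> carrier U" if "v \<in> carrier V" "(a, b) \<in> set t" for v a b
    using assms(2)[OF that(2)] that(1) by (rule klin_cl)
  show "tlift U (f v) t \<in> carrier U" if "v \<in> carrier V" for v
    using assms(1) * that by simp
  show "tlift U (f (x \<oplus>\<^bsub>V\<^esub> y)) t = tlift U (f x) t \<oplus>\<^bsub>U\<^esub> tlift U (f y) t"
    if "x \<in> carrier V" "y \<in> carrier V" for x y
    using assms(1) that by (simp add: tlift_add[symmetric] * klin_add[OF assms(2)])
  show "tlift U (f (c \<odot>\<^bsub>V\<^esub> x)) t = c \<odot>\<^bsub>U\<^esub> tlift U (f x) t"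
    if "c \<in> carrier k" "x \<in> carrier V" for c x
    using assms(1) that by (simp add: tlift_smult[symmetric] * klin_smult[OF assms(2)])
qed

lemma bilinD1: "bilin k V W U f \<Longrightarrow> x \<in> carrier V \<Longrightarrow> f x \<in> klin k W U"
  and bilinD2: "bilin k V W U f \<Longrightarrow> y \<in> carrier W \<Longrightarrow> (\<lambda>x. f x y) \<in> klin k V U"
  by (auto simp: bilin_def)

lemma bilinI: "(\<And>x. x \<in> carrier V \<Longrightarrow> (\<lambda>y. f x y) \<in> klin k W U) \<Longrightarrow>
  (\<And>y. y \<in> carrier W \<Longrightarrow> (\<lambda>x. f x y) \<in> klin k V U) \<Longrightarrow> bilin k V W U f"
  by (auto simp: bilin_def)

lemma bilin_cl: "bilin k V W U f \<Longrightarrow> x \<in> carrier V \<Longrightarrow> y \<in> carrier W \<Longrightarrow> f x y \<in> carrier U"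
  by (meson bilinD1 klin_cl)

lemma trilinI: "(\<And>x y. x \<in> carrier V \<Longrightarrow> y \<in> carrier W \<Longrightarrow> (\<lambda>z. f x y z) \<in> klin k X U) \<Longrightarrow>
  (\<And>x z. x \<in> carrier V \<Longrightarrow> z \<in> carrier X \<Longrightarrow> (\<lambda>y. f x y z) \<in> klin k W U) \<Longrightarrow>
  (\<And>y z. y \<in> carrier W \<Longrightarrow> z \<in> carrier X \<Longrightarrow> (\<lambda>x. f x y z) \<in> klin k V U) \<Longrightarrow> trilin k V W X U f"
  by (auto simp: trilin_def bilin_def)

lemma trilinD1: "trilin k V W X U f \<Longrightarrow> y \<in> carrier W \<Longrightarrow> z \<in> carrier X \<Longrightarrow> (\<lambda>x. f x y z) \<in> klin k V U"
  and trilinD2: "trilin k V W X U f \<Longrightarrow> x \<in> carrier V \<Longrightarrow> z \<in> carrier X \<Longrightarrow> (\<lambda>y. f x y z) \<in> klin k W U"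
  and trilinD3: "trilin k V W X U f \<Longrightarrow> x \<in> carrier V \<Longrightarrow> y \<in> carrier W \<Longrightarrow> (\<lambda>z. f x y z) \<in> klin k X U"
  by (auto simp: trilin_def bilin_def)

lemma trilin_cl: "trilin k V W X U f \<Longrightarrow> x \<in> carrier V \<Longrightarrow> y \<in> carrier W \<Longrightarrow> z \<in> carrier X \<Longrightarrow> f x y z \<in> carrier U"
  by (meson trilinD3 klin_cl)

section \<open>The tensor product as a module, and its universal property\<close>

context
  fixes V :: "('k, 'a, 'x) module_scheme" and W :: "('k, 'b, 'y) module_scheme"
  assumes V: "module k V" and W: "module k W"
begin

lemma teq_L:
  assumes "teq k V W xs ys"
  shows "xs \<in> pairs V W \<and> ys \<in> pairs V W"
  using assms by induction (auto simp: V W)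

text \<open>Each generating relation of \<open>teq\<close> follows from bilinearity of
  \<open>f\<close> or from the laws of addition in \<open>U\<close>; this is what makes
  \<open>tlift\<close> meaningful on equivalence classes.\<close>

lemma tlift_teq:
  assumes "teq k V W xs ys" "module k U" "bilin k V W U f"
  shows "tlift U f xs = tlift U f ys"
  using assms(1)
proof (induction rule: teq.induct)
  have cl: "f a b \<in> carrier U" if "(a, b) \<in> set t" "t \<in> pairs V W" for a b t
    using that assms(3) by (auto intro: bilin_cl)
  {
    case (teq_append xs xs' ys ys')
    have "xs \<in> pairs V W" "xs' \<in> pairs V W" "ys \<in> pairs V W" "ys' \<in> pairs V W"
      using teq_append teq_L by blast+
    then show ?case
      using teq_append.IH by (subst (1 2) tlift_append[OF assms(2)]) (auto intro: bilin_cl[OF assms(3)])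
  next
    case (teq_commute xs ys)
    then have *: "tlift U f xs \<in> carrier U" "tlift U f ys \<in> carrier U"
      using assms(2) cl by simp_all
    from teq_commute show ?case
      by (subst (1 2) tlift_append[OF assms(2)]) (auto intro: bilin_cl[OF assms(3)] mod_comm[OF assms(2)] *)
  next
    case (teq_add_left x x' y)
    then show ?case
      using assms(2) klin_add[OF bilinD2[OF assms(3)]] bilin_cl[OF assms(3)] V by (simp add: tlift_Cons)
  next
    case (teq_add_right x y y')
    then show ?case
      using assms(2) klin_add[OF bilinD1[OF assms(3)]] bilin_cl[OF assms(3)] W by (simp add: tlift_Cons)
  next
    case (teq_smult c x y)
    then show ?case
      using assms(2) klin_smult[OF bilinD1[OF assms(3)]] klin_smult[OF bilinD2[OF assms(3)]]
        bilin_cl[OF assms(3)] W V by (simp add: tlift_Cons)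
  next
    case (teq_zero y)
    then show ?case
      using assms(2) klin_zero[OF V assms(2) bilinD2[OF assms(3)]] V W by (simp add: tlift_Cons)
  }
qed auto

lemma teq_cons: "teq k V W xs ys \<Longrightarrow> x \<in> carrier V \<Longrightarrow> y \<in> carrier W \<Longrightarrow> teq k V W ((x, y) # xs) ((x, y) # ys)"
  using teq_append[of k V W "[(x, y)]" "[(x, y)]" xs ys] by (simp add: teq_refl)

lemma tnf_teq: "xs \<in> pairs V W \<Longrightarrow> teq k V W xs (tnf k V W xs)"
  unfolding tnf_def by (rule someI) (rule teq_refl)

text \<open>Equivalent lists define the same predicate \<open>teq k V W xs\<close>, and
  \<open>SOME\<close> returns equal values on equal predicates.\<close>

lemma tnf_eq: "teq k V W xs ys \<Longrightarrow> tnf k V W xs = tnf k V W ys"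
proof -
  assume a: "teq k V W xs ys"
  have "teq k V W xs = teq k V W ys"
    by (intro ext iffI) (erule teq_trans[OF teq_sym[OF a]] teq_trans[OF a])+
  then show ?thesis by (simp add: tnf_def)
qed

lemma tnf_L: "xs \<in> pairs V W \<Longrightarrow> tnf k V W xs \<in> pairs V W"
  using tnf_teq teq_L by blast

lemma tnf_idem: "xs \<in> pairs V W \<Longrightarrow> tnf k V W (tnf k V W xs) = tnf k V W xs"
  by (metis tnf_eq tnf_teq)

lemma tens_L: "t \<in> carrier (tensor k V W) \<Longrightarrow> t \<in> pairs V W"
  unfolding tensor_def using tnf_L by fastforce

lemma tens_tnf: "t \<in> carrier (tensor k V W) \<Longrightarrow> tnf k V W t = t"
  unfolding tensor_def using tnf_idem by fastforce

lemma tnf_tens: "xs \<in> pairs V W \<Longrightarrow> tnf k V W xs \<in> carrier (tensor k V W)"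
  by (auto simp: tensor_def)

lemma tlift_tnf:
  "module k U \<Longrightarrow> bilin k V W U f \<Longrightarrow> xs \<in> pairs V W \<Longrightarrow> tlift U f (tnf k V W xs) = tlift U f xs"
  by (metis tlift_teq tnf_teq)

lemma pure_cl [simp]: "x \<in> carrier V \<Longrightarrow> y \<in> carrier W \<Longrightarrow> pure k V W x y \<in> carrier (tensor k V W)"
  unfolding pure_def by (rule tnf_tens) auto

lemma tens_add: "xs \<in> pairs V W \<Longrightarrow> ys \<in> pairs V W \<Longrightarrow>
  tnf k V W xs \<oplus>\<^bsub>tensor k V W\<^esub> tnf k V W ys = tnf k V W (xs @ ys)"
proof -
  assume "xs \<in> pairs V W" "ys \<in> pairs V W"
  then have "teq k V W (tnf k V W xs @ tnf k V W ys) (xs @ ys)"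
    using teq_append tnf_teq teq_sym by metis
  from tnf_eq[OF this] show ?thesis by (simp add: tensor_def)
qed

lemma smult_L: "t \<in> pairs V W \<Longrightarrow> c \<in> carrier k \<Longrightarrow> map (\<lambda>(x, y). (c \<odot>\<^bsub>V\<^esub> x, y)) t \<in> pairs V W"
proof (rule pairsI)
  fix a b assume *: "t \<in> pairs V W" "c \<in> carrier k" "(a, b) \<in> set (map (\<lambda>(x, y). (c \<odot>\<^bsub>V\<^esub> x, y)) t)"
  then obtain x where "(x, b) \<in> set t" "a = c \<odot>\<^bsub>V\<^esub> x" by auto
  then show "a \<in> carrier V \<and> b \<in> carrier W" using * pairsD[of t V W] mod_smult[OF V] by auto
qed

text \<open>Scalar multiplication on \<open>tensor\<close> works on the chosen representative, so it
  has to respect the congruence.\<close>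

lemma teq_smult_list:
  assumes "teq k V W xs ys" "c \<in> carrier k"
  shows "teq k V W (map (\<lambda>(x, y). (c \<odot>\<^bsub>V\<^esub> x, y)) xs) (map (\<lambda>(x, y). (c \<odot>\<^bsub>V\<^esub> x, y)) ys)"
  using assms(1)
proof induction
  case (teq_refl xs)
  then show ?case using assms(2) by (intro teq.teq_refl smult_L)
next
  case (teq_sym xs ys)
  then show ?case by (rule_tac teq.teq_sym)
next
  case (teq_trans xs ys zs)
  then show ?case by (rule_tac teq.teq_trans)
next
  case (teq_append xs xs' ys ys')
  then show ?case by (simp add: teq.teq_append)
next
  case (teq_commute xs ys)
  then show ?case using teq.teq_commute[OF smult_L smult_L] assms(2) by simp
next
  case (teq_add_left x x' y)
  then show ?case using assms(2) V by (simp add: mod_sadd teq.teq_add_left)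
next
  case (teq_add_right x y y')
  then show ?case using assms(2) V by (simp add: teq.teq_add_right)
next
  case (teq_smult d x y)
  then show ?case using assms(2) V W by (simp add: teq.teq_smult mod_scomm[of _ c d])
next
  case (teq_zero y)
  then show ?case using assms(2) V by (simp add: teq.teq_zero)
qed

lemma tens_smult: "xs \<in> pairs V W \<Longrightarrow> c \<in> carrier k \<Longrightarrow>
  c \<odot>\<^bsub>tensor k V W\<^esub> tnf k V W xs = tnf k V W (map (\<lambda>(x, y). (c \<odot>\<^bsub>V\<^esub> x, y)) xs)"
proof -
  assume "xs \<in> pairs V W" "c \<in> carrier k"
  then have "teq k V W (map (\<lambda>(x, y). (c \<odot>\<^bsub>V\<^esub> x, y)) (tnf k V W xs)) (map (\<lambda>(x, y). (c \<odot>\<^bsub>V\<^esub> x, y)) xs)"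
    using teq_smult_list tnf_teq teq_sym by metis
  from tnf_eq[OF this] show ?thesis by (simp add: tensor_def)
qed

lemma tens_cases:
  assumes "t \<in> carrier (tensor k V W)"
  obtains xs where "xs \<in> pairs V W" "t = tnf k V W xs"
  using assms by (auto simp: tensor_def)

text \<open>Formal sums carry no subtraction. Scaling the left entries by minus one supplies the
  additive inverse: each entry meets its negative, the two merge by \<open>teq_add_left\<close>, and
  \<open>teq_zero\<close> removes them.\<close>

lemma teq_neg: "t \<in> pairs V W \<Longrightarrow> teq k V W (map (\<lambda>(x, y). ((\<ominus>\<^bsub>k\<^esub> \<one>\<^bsub>k\<^esub>) \<odot>\<^bsub>V\<^esub> x, y)) t @ t) []"
proof (induction t)
  case (Cons p t)
  obtain x y where p: "p = (x, y)" by force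
  let ?m = "\<lambda>t. map (\<lambda>(x, y). ((\<ominus>\<^bsub>k\<^esub> \<one>\<^bsub>k\<^esub>) \<odot>\<^bsub>V\<^esub> x, y)) t"
  interpret K: cring k by (rule cring_k)
  have m1: "\<ominus>\<^bsub>k\<^esub> \<one>\<^bsub>k\<^esub> \<in> carrier k" by simp
  have xy: "x \<in> carrier V" "y \<in> carrier W" and t: "t \<in> pairs V W" using Cons.prems unfolding p by auto
  have mt: "?m t \<in> pairs V W" using smult_L[OF t m1] .
  have nx: "(\<ominus>\<^bsub>k\<^esub> \<one>\<^bsub>k\<^esub>) \<odot>\<^bsub>V\<^esub> x \<in> carrier V" using V m1 xy by simp
  \<comment> \<open>The entry \<open>(x, y)\<close> stands behind the whole negated tail and is
    first moved next to its own negative.\<close>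
  have 1: "teq k V W (?m t @ [(x, y)] @ t) ([(x, y)] @ ?m t @ t)"
    using teq_append[OF teq_commute[OF mt, of "[(x, y)]"] teq_refl[OF t]] xy by simp
  have "teq k V W [((\<ominus>\<^bsub>k\<^esub> \<one>\<^bsub>k\<^esub>) \<odot>\<^bsub>V\<^esub> x \<oplus>\<^bsub>V\<^esub> x, y)] [((\<ominus>\<^bsub>k\<^esub> \<one>\<^bsub>k\<^esub>) \<odot>\<^bsub>V\<^esub> x, y), (x, y)]"
    using nx xy by (intro teq_add_left)
  then have 2: "teq k V W [((\<ominus>\<^bsub>k\<^esub> \<one>\<^bsub>k\<^esub>) \<odot>\<^bsub>V\<^esub> x, y), (x, y)] []"
    using mod_neg[OF V] xy teq_zero teq_sym teq_trans by metis
  have 3: "teq k V W ([((\<ominus>\<^bsub>k\<^esub> \<one>\<^bsub>k\<^esub>) \<odot>\<^bsub>V\<^esub> x, y), (x, y)] @ (?m t @ t)) ([] @ [])"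
    using teq_append[OF 2 Cons.IH[OF t]] .
  have "teq k V W (((\<ominus>\<^bsub>k\<^esub> \<one>\<^bsub>k\<^esub>) \<odot>\<^bsub>V\<^esub> x, y) # ?m t @ [(x, y)] @ t)
      (((\<ominus>\<^bsub>k\<^esub> \<one>\<^bsub>k\<^esub>) \<odot>\<^bsub>V\<^esub> x, y) # [(x, y)] @ ?m t @ t)"
    using 1 nx xy by (intro teq_cons)
  then show ?case using 3 p by (auto intro: teq_trans)
qed (simp add: teq_refl)

text \<open>This distributive law needs a reordering: every entry splits into two, and the
  interleaved halves have to be sorted into two lists.\<close>

lemma teq_smult_add:
  assumes c: "c \<in> carrier k" "d \<in> carrier k"
  shows "t \<in> pairs V W \<Longrightarrow> teq k V W (map (\<lambda>(x, y). ((c \<oplus>\<^bsub>k\<^esub> d) \<odot>\<^bsub>V\<^esub> x, y)) t)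
    (map (\<lambda>(x, y). (c \<odot>\<^bsub>V\<^esub> x, y)) t @ map (\<lambda>(x, y). (d \<odot>\<^bsub>V\<^esub> x, y)) t)"
proof (induction t)
  case (Cons p t)
  obtain x y where p: "p = (x, y)" by force
  let ?m = "\<lambda>c t. map (\<lambda>(x, y). (c \<odot>\<^bsub>V\<^esub> x, y)) t"
  have xy: "x \<in> carrier V" "y \<in> carrier W" and t: "t \<in> pairs V W" using Cons.prems unfolding p by auto
  have mt: "?m c t \<in> pairs V W" "?m d t \<in> pairs V W" using smult_L[OF t] c by auto
  have nx: "c \<odot>\<^bsub>V\<^esub> x \<in> carrier V" "d \<odot>\<^bsub>V\<^esub> x \<in> carrier V" using V c xy by simp_all
  have "teq k V W [((c \<oplus>\<^bsub>k\<^esub> d) \<odot>\<^bsub>V\<^esub> x, y)] [(c \<odot>\<^bsub>V\<^esub> x, y), (d \<odot>\<^bsub>V\<^esub> x, y)]"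
    using teq_add_left[OF nx xy(2), of k] V c xy by (simp add: mod_adds)
  then have 1: "teq k V W ((x', y') # ?m (c \<oplus>\<^bsub>k\<^esub> d) t)
     ([(c \<odot>\<^bsub>V\<^esub> x, y), (d \<odot>\<^bsub>V\<^esub> x, y)] @ ?m c t @ ?m d t)" if "x' = (c \<oplus>\<^bsub>k\<^esub> d) \<odot>\<^bsub>V\<^esub> x" "y' = y" for x' y'
    using teq_append Cons.IH[OF t] that by fastforce
  have "teq k V W ([(d \<odot>\<^bsub>V\<^esub> x, y)] @ ?m c t @ ?m d t) (?m c t @ [(d \<odot>\<^bsub>V\<^esub> x, y)] @ ?m d t)"
    using teq_append[OF teq_commute[of "[(d \<odot>\<^bsub>V\<^esub> x, y)]" V W "?m c t" k] teq_refl[OF mt(2)]] nx xy mt by simp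
  then have "teq k V W ((c \<odot>\<^bsub>V\<^esub> x, y) # [(d \<odot>\<^bsub>V\<^esub> x, y)] @ ?m c t @ ?m d t)
      ((c \<odot>\<^bsub>V\<^esub> x, y) # ?m c t @ [(d \<odot>\<^bsub>V\<^esub> x, y)] @ ?m d t)"
    using nx xy by (intro teq_cons)
  then show ?case using 1 p by (auto intro: teq_trans)
qed (simp add: teq_refl)

lemma tens_sel: "add (tensor k V W) = (\<lambda>s t. tnf k V W (s @ t))" "\<zero>\<^bsub>tensor k V W\<^esub> = tnf k V W []"
  "carrier (tensor k V W) = tnf k V W ` pairs V W"
  by (simp_all add: tensor_def)

lemma module_tensor: "module k (tensor k V W)"
proof (rule moduleI)
  interpret K: cring k by (rule cring_k)
  let ?T = "tensor k V W"
  have m1: "\<ominus>\<^bsub>k\<^esub> \<one>\<^bsub>k\<^esub> \<in> carrier k" by simp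
  show "cring k" by (rule cring_k)
  have app: "xs @ ys \<in> pairs V W" if "xs \<in> pairs V W" "ys \<in> pairs V W" for xs ys using that by auto
  show "abelian_group ?T"
  proof (rule abelian_groupI)
    fix x y z assume "x \<in> carrier ?T" "y \<in> carrier ?T" "z \<in> carrier ?T"
    then obtain xs ys zs where pairs: "xs \<in> pairs V W" "ys \<in> pairs V W" "zs \<in> pairs V W"
      and e: "x = tnf k V W xs" "y = tnf k V W ys" "z = tnf k V W zs" by (elim tens_cases)
    show "x \<oplus>\<^bsub>?T\<^esub> y \<oplus>\<^bsub>?T\<^esub> z = x \<oplus>\<^bsub>?T\<^esub> (y \<oplus>\<^bsub>?T\<^esub> z)"
      using pairs by (simp only: e tens_add app append_assoc)
  next
    fix x y assume "x \<in> carrier ?T" "y \<in> carrier ?T"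
    then obtain xs ys where pairs: "xs \<in> pairs V W" "ys \<in> pairs V W"
      and e: "x = tnf k V W xs" "y = tnf k V W ys" by (elim tens_cases)
    show "x \<oplus>\<^bsub>?T\<^esub> y \<in> carrier ?T" using pairs by (simp only: e tens_add app tnf_tens)
    show "x \<oplus>\<^bsub>?T\<^esub> y = y \<oplus>\<^bsub>?T\<^esub> x"
      using pairs by (simp only: e tens_add) (intro tnf_eq teq_commute)
  next
    fix x assume "x \<in> carrier ?T"
    then obtain xs where pairs: "xs \<in> pairs V W" and e: "x = tnf k V W xs" by (elim tens_cases)
    show "\<zero>\<^bsub>?T\<^esub> \<oplus>\<^bsub>?T\<^esub> x = x"
      using tens_add[of "[]" xs] pairs by (simp add: tens_sel(2) e)
    have "tnf k V W (map (\<lambda>(x, y). ((\<ominus>\<^bsub>k\<^esub> \<one>\<^bsub>k\<^esub>) \<odot>\<^bsub>V\<^esub> x, y)) xs) \<oplus>\<^bsub>?T\<^esub> x = \<zero>\<^bsub>?T\<^esub>"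
      using tens_add[OF smult_L[OF pairs m1] pairs] teq_neg[OF pairs] by (simp add: tens_sel(2) e tnf_eq)
    then show "\<exists>y\<in>carrier ?T. y \<oplus>\<^bsub>?T\<^esub> x = \<zero>\<^bsub>?T\<^esub>"
      using tnf_tens[OF smult_L[OF pairs m1]] by blast
  next
    show "\<zero>\<^bsub>?T\<^esub> \<in> carrier ?T" by (simp add: tens_sel(2) tnf_tens)
  qed
  show "\<one>\<^bsub>k\<^esub> \<odot>\<^bsub>?T\<^esub> x = x" if "x \<in> carrier ?T" for x
  proof -
    obtain xs where pairs: "xs \<in> pairs V W" and e: "x = tnf k V W xs" using \<open>x \<in> carrier ?T\<close> by (elim tens_cases)
    have "map (\<lambda>(x, y). (\<one>\<^bsub>k\<^esub> \<odot>\<^bsub>V\<^esub> x, y)) xs = xs" using pairs V by (intro map_idI) auto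
    then show ?thesis using tens_smult[OF pairs field_closed(1)] e by simp
  qed
  fix c d x y assume c: "c \<in> carrier k" and x: "x \<in> carrier ?T"
  then obtain xs where pairs: "xs \<in> pairs V W" and e: "x = tnf k V W xs" by (elim tens_cases)
  note sL = smult_L[OF pairs]
  show "c \<odot>\<^bsub>?T\<^esub> x \<in> carrier ?T" using pairs c by (simp only: e tens_smult tnf_tens sL)
  show "(c \<oplus>\<^bsub>k\<^esub> d) \<odot>\<^bsub>?T\<^esub> x = c \<odot>\<^bsub>?T\<^esub> x \<oplus>\<^bsub>?T\<^esub> d \<odot>\<^bsub>?T\<^esub> x" if d: "d \<in> carrier k"
    using pairs c d by (simp only: e tens_smult sL tens_add field_closed) (intro tnf_eq teq_smult_add)
  show "(c \<otimes>\<^bsub>k\<^esub> d) \<odot>\<^bsub>?T\<^esub> x = c \<odot>\<^bsub>?T\<^esub> (d \<odot>\<^bsub>?T\<^esub> x)" if d: "d \<in> carrier k"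
  proof -
    have "map (\<lambda>(x, y). ((c \<otimes>\<^bsub>k\<^esub> d) \<odot>\<^bsub>V\<^esub> x, y)) xs
      = map (\<lambda>(x, y). (c \<odot>\<^bsub>V\<^esub> x, y)) (map (\<lambda>(x, y). (d \<odot>\<^bsub>V\<^esub> x, y)) xs)"
      using pairs c d V by (auto simp: mod_mults)
    then show ?thesis using pairs c d by (simp only: e tens_smult sL field_closed)
  qed
  show "c \<odot>\<^bsub>?T\<^esub> (x \<oplus>\<^bsub>?T\<^esub> y) = c \<odot>\<^bsub>?T\<^esub> x \<oplus>\<^bsub>?T\<^esub> c \<odot>\<^bsub>?T\<^esub> y" if y: "y \<in> carrier ?T"
  proof -
    obtain ys where L': "ys \<in> pairs V W" and e': "y = tnf k V W ys" using y by (elim tens_cases)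
    show ?thesis using pairs L' c by (simp only: e e' tens_smult sL smult_L[OF L'] tens_add app map_append)
  qed
qed

lemma bilin_pure: "bilin k V W (tensor k V W) (pure k V W)"
proof -
  let ?T = "tensor k V W"
  have add: "pure k V W x (y \<oplus>\<^bsub>W\<^esub> y') = pure k V W x y \<oplus>\<^bsub>?T\<^esub> pure k V W x y'"
    if "x \<in> carrier V" "y \<in> carrier W" "y' \<in> carrier W" for x y y'
    using that by (simp add: pure_def tens_add) (intro tnf_eq teq_add_right)
  have add': "pure k V W (x \<oplus>\<^bsub>V\<^esub> x') y = pure k V W x y \<oplus>\<^bsub>?T\<^esub> pure k V W x' y"
    if "x \<in> carrier V" "x' \<in> carrier V" "y \<in> carrier W" for x x' y
    using that by (simp add: pure_def tens_add) (intro tnf_eq teq_add_left)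
  have sm: "pure k V W (c \<odot>\<^bsub>V\<^esub> x) y = c \<odot>\<^bsub>?T\<^esub> pure k V W x y"
    if "x \<in> carrier V" "y \<in> carrier W" "c \<in> carrier k" for x y c
    using that by (simp add: pure_def tens_smult)
  have sm': "pure k V W x (c \<odot>\<^bsub>W\<^esub> y) = c \<odot>\<^bsub>?T\<^esub> pure k V W x y"
    if "x \<in> carrier V" "y \<in> carrier W" "c \<in> carrier k" for x y c
    using that by (simp add: pure_def tens_smult) (intro tnf_eq teq_sym[OF teq_smult])
  show ?thesis by (intro bilinI klinI) (simp_all add: add add' sm sm')
qed

text \<open>The universal bilinear map \<open>pure\<close> reproduces the tensor itself, so
  tensor-valued maps can be treated as sums without reference to representatives.\<close>

lemma tnf_tlift: "xs \<in> pairs V W \<Longrightarrow> tnf k V W xs = tlift (tensor k V W) (pure k V W) xs"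
proof (induction xs)
  case Nil
  show ?case by (simp add: tens_sel)
next
  case (Cons p xs)
  obtain x y where p: "p = (x, y)" by force
  have pairs: "xs \<in> pairs V W" "[(x, y)] \<in> pairs V W" using Cons.prems p by auto
  have "tnf k V W (p # xs) = tnf k V W [(x, y)] \<oplus>\<^bsub>tensor k V W\<^esub> tnf k V W xs"
    using tens_add[OF pairs(2,1)] p by simp
  then show ?case using Cons.IH[OF pairs(1)] p by (simp add: tlift_Cons pure_def)
qed

lemma tens_tlift: "t \<in> carrier (tensor k V W) \<Longrightarrow> tlift (tensor k V W) (pure k V W) t = t"
  by (metis tens_L tens_tnf tnf_tlift)

lemma tlift_klin:
  assumes U: "module k U" and f: "bilin k V W U f"
  shows "tlift U f \<in> klin k (tensor k V W) U"
proof (rule klinI)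
  have cl: "f a b \<in> carrier U" if "(a, b) \<in> set t" "t \<in> pairs V W" for a b t
    using that f by (auto intro: bilin_cl)
  fix x assume "x \<in> carrier (tensor k V W)"
  then obtain xs where pairs: "xs \<in> pairs V W" and e: "x = tnf k V W xs" by (elim tens_cases)
  show "tlift U f x \<in> carrier U"
    unfolding e tlift_tnf[OF U f pairs] using U cl[OF _ pairs] by simp
  show "tlift U f (x \<oplus>\<^bsub>tensor k V W\<^esub> y) = tlift U f x \<oplus>\<^bsub>U\<^esub> tlift U f y" if "y \<in> carrier (tensor k V W)" for y
  proof -
    obtain ys where L': "ys \<in> pairs V W" and e': "y = tnf k V W ys" using \<open>y \<in> carrier (tensor k V W)\<close> by (elim tens_cases)
    have "xs @ ys \<in> pairs V W" using pairs L' by auto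
    then show ?thesis
      using pairs L' U f cl[OF _ \<open>xs @ ys \<in> pairs V W\<close>]
      by (simp only: e e' tens_add tlift_tnf) (rule tlift_append; simp)
  qed
  show "tlift U f (c \<odot>\<^bsub>tensor k V W\<^esub> x) = c \<odot>\<^bsub>U\<^esub> tlift U f x" if c: "c \<in> carrier k" for c
  proof -
    have "tlift U f (map (\<lambda>(x, y). (c \<odot>\<^bsub>V\<^esub> x, y)) xs) = tlift U (\<lambda>x y. c \<odot>\<^bsub>U\<^esub> f x y) xs"
      unfolding tlift_map using pairs c klin_smult[OF bilinD2[OF f]] by (intro tlift_cong) auto
    then show ?thesis
      using pairs U f c smult_L[OF pairs c] tlift_smult[OF U c cl[OF _ pairs]] by (simp only: e tens_smult tlift_tnf)
  qed
qed

lemma tlift_pure: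
  "module k U \<Longrightarrow> bilin k V W U f \<Longrightarrow> x \<in> carrier V \<Longrightarrow> y \<in> carrier W \<Longrightarrow> tlift U f (pure k V W x y) = f x y"
  unfolding pure_def by (subst tlift_tnf) (auto simp: tlift_Cons bilin_cl)

text \<open>A tensor is the sum of the pure tensors in its representative; this is the uniqueness
  half of the universal property.\<close>

lemma tens_ext:
  assumes "module k U" "f \<in> klin k (tensor k V W) U" "g \<in> klin k (tensor k V W) U"
    "\<And>x y. x \<in> carrier V \<Longrightarrow> y \<in> carrier W \<Longrightarrow> f (pure k V W x y) = g (pure k V W x y)"
    "t \<in> carrier (tensor k V W)"
  shows "f t = g t"
proof -
  have t: "t \<in> pairs V W" using tens_L assms(5) .
  have "f (tlift (tensor k V W) (pure k V W) t) = g (tlift (tensor k V W) (pure k V W) t)"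
    using t by (subst (1 2) klin_tlift[OF _ module_tensor assms(1)]) (auto simp: assms(2-4) intro!: tlift_cong)
  then show ?thesis by (simp add: tens_tlift assms(5))
qed

end

end

section \<open>Sweedler calculus\<close>

context over_field
begin

text \<open>Introduction rules for linearity in one variable of a compound expression: each removes
  one operation and leaves the linearity of its argument, so that \<open>intro\<close> proves
  multilinearity by recursion on the term.\<close>

lemma klin_bil1: "bilin k V W U f \<Longrightarrow> y \<in> carrier W \<Longrightarrow> g \<in> klin k X V \<Longrightarrow> (\<lambda>v. f (g v) y) \<in> klin k X U"
  by (drule (1) bilinD2, drule (1) klin_comp)

lemma klin_bil2: "bilin k V W U f \<Longrightarrow> x \<in> carrier V \<Longrightarrow> g \<in> klin k X W \<Longrightarrow> (\<lambda>v. f x (g v)) \<in> klin k X U"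
  by (drule (1) bilinD1, drule (1) klin_comp)

lemma klin_tri1: "trilin k V W Y U f \<Longrightarrow> y \<in> carrier W \<Longrightarrow> z \<in> carrier Y \<Longrightarrow> g \<in> klin k X V \<Longrightarrow>
    (\<lambda>v. f (g v) y z) \<in> klin k X U"
  by (drule (2) trilinD1, drule (1) klin_comp)

lemma klin_tri2: "trilin k V W Y U f \<Longrightarrow> x \<in> carrier V \<Longrightarrow> z \<in> carrier Y \<Longrightarrow> g \<in> klin k X W \<Longrightarrow>
    (\<lambda>v. f x (g v) z) \<in> klin k X U"
  by (drule (2) trilinD2, drule (1) klin_comp)

lemma klin_tri3: "trilin k V W Y U f \<Longrightarrow> x \<in> carrier V \<Longrightarrow> y \<in> carrier W \<Longrightarrow> g \<in> klin k X Y \<Longrightarrow>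
    (\<lambda>v. f x y (g v)) \<in> klin k X U"
  by (drule (2) trilinD3, drule (1) klin_comp)

text \<open>Here the variable sits in the tensor that is summed over; in
  \<open>klin_tlift_fun\<close> it sits in the summand.\<close>

lemma klin_tlift_arg:
  "module k V \<Longrightarrow> module k W \<Longrightarrow> module k U \<Longrightarrow> bilin k V W U f \<Longrightarrow> g \<in> klin k X (tensor k V W) \<Longrightarrow>
   (\<lambda>v. tlift U f (g v)) \<in> klin k X U"
  using klin_comp[OF tlift_klin] by blast

lemma bilin_cong:
  assumes "module k V" "module k W" "bilin k V W U f"
    and "\<And>x y. x \<in> carrier V \<Longrightarrow> y \<in> carrier W \<Longrightarrow> g x y = f x y"
  shows "bilin k V W U g"
proof (rule bilinI)
  show "(\<lambda>y. g x y) \<in> klin k W U" if "x \<in> carrier V" for x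
    by (rule klin_cong[OF assms(2) bilinD1[OF assms(3) that]]) (simp add: assms(4) that)
  show "(\<lambda>x. g x y) \<in> klin k V U" if "y \<in> carrier W" for y
    by (rule klin_cong[OF assms(1) bilinD2[OF assms(3) that]]) (simp add: assms(4) that)
qed

text \<open>Collects exactly what the evaluation of products in a tensor power uses; by
  \<open>bilinear_algebra_tensor\<close> it passes on to tensor products, in particular to
  \<open>H \<otimes> H\<close> as the left factor of \<open>tensor3\<close>.\<close>

definition bilinear_algebra :: "('k, 'a, 'z) module_scheme \<Rightarrow> bool" where
  "bilinear_algebra A \<longleftrightarrow> module k A \<and> \<one>\<^bsub>A\<^esub> \<in> carrier A \<and> bilin k A A A (mult A)"

lemma bilinear_algebra_module: "bilinear_algebra A \<Longrightarrow> module k A" and bilinear_algebra_one: "bilinear_algebra A \<Longrightarrow> \<one>\<^bsub>A\<^esub> \<in> carrier A"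
  and bilinear_algebra_bilin: "bilinear_algebra A \<Longrightarrow> bilin k A A A (mult A)"
  and bilinear_algebra_mult: "bilinear_algebra A \<Longrightarrow> x \<in> carrier A \<Longrightarrow> y \<in> carrier A \<Longrightarrow> x \<otimes>\<^bsub>A\<^esub> y \<in> carrier A"
  by (auto simp: bilinear_algebra_def intro: bilin_cl)

lemma klin_mult1: "bilinear_algebra A \<Longrightarrow> y \<in> carrier A \<Longrightarrow> g \<in> klin k X A \<Longrightarrow> (\<lambda>v. g v \<otimes>\<^bsub>A\<^esub> y) \<in> klin k X A"
  and klin_mult2: "bilinear_algebra A \<Longrightarrow> x \<in> carrier A \<Longrightarrow> g \<in> klin k X A \<Longrightarrow> (\<lambda>v. x \<otimes>\<^bsub>A\<^esub> g v) \<in> klin k X A"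
  by (simp_all add: klin_bil1[OF bilinear_algebra_bilin] klin_bil2[OF bilinear_algebra_bilin])

lemma assoc_algebra_bilinear: "assoc_algebra k A \<Longrightarrow> bilinear_algebra A"
proof -
  assume A: "assoc_algebra k A"
  then interpret ring A by (simp add: assoc_algebra_def)
  show ?thesis using A unfolding bilinear_algebra_def assoc_algebra_def
    by (auto intro!: bilinI klinI simp: l_distr r_distr)
qed

context
  fixes V :: "('k, 'a, 'x) module_scheme" and W :: "('k, 'b, 'y) module_scheme"
  assumes V: "module k V" and W: "module k W"
begin

lemma tmap_cl:
  assumes "\<And>a b. (a, b) \<in> set t \<Longrightarrow> g a \<in> carrier V \<and> h b \<in> carrier W"
  shows "tmap k V W g h t \<in> carrier (tensor k V W)"
  unfolding tmap_def by (rule tnf_tens[OF V W]) (use assms in auto)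

lemma tlift_tmap:
  assumes "module k U" "bilin k V W U f"
    and "\<And>a b. (a, b) \<in> set t \<Longrightarrow> g a \<in> carrier V \<and> h b \<in> carrier W"
  shows "tlift U f (tmap k V W g h t) = tlift U (\<lambda>a b. f (g a) (h b)) t"
proof -
  have "map (\<lambda>(x, y). (g x, h y)) t \<in> pairs V W" using assms(3) by auto
  then show ?thesis unfolding tmap_def by (simp add: tlift_tnf[OF V W assms(1,2)] tlift_map)
qed

lemma tflip_cl: "t \<in> pairs W V \<Longrightarrow> tflip k W V t \<in> carrier (tensor k V W)"
  unfolding tflip_def by (rule tnf_tens[OF V W]) auto

lemma tlift_tflip:
  assumes "module k U" "bilin k V W U f" "t \<in> pairs W V"
  shows "tlift U f (tflip k W V t) = tlift U (\<lambda>a b. f b a) t"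
proof -
  have "map prod.swap t \<in> pairs V W" using assms(3) by auto
  then show ?thesis unfolding tflip_def by (simp add: tlift_tnf[OF V W assms(1,2)] tlift_swap_map)
qed

lemma klin_pure1: "y \<in> carrier W \<Longrightarrow> g \<in> klin k X V \<Longrightarrow> (\<lambda>v. pure k V W (g v) y) \<in> klin k X (tensor k V W)"
  and klin_pure2: "x \<in> carrier V \<Longrightarrow> g' \<in> klin k X W \<Longrightarrow> (\<lambda>v. pure k V W x (g' v)) \<in> klin k X (tensor k V W)"
  by (simp_all add: klin_bil1[OF bilin_pure[OF V W]] klin_bil2[OF bilin_pure[OF V W]])

end

context
  fixes V :: "('k, 'a, 'x) module_scheme" and W :: "('k, 'b, 'y) module_scheme"
  assumes V: "bilinear_algebra V" and W: "bilinear_algebra W"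
begin

lemma mult_list_L:
  "s \<in> pairs V W \<Longrightarrow> t \<in> pairs V W \<Longrightarrow>
    map (\<lambda>((x, y), (x', y')). (x \<otimes>\<^bsub>V\<^esub> x', y \<otimes>\<^bsub>W\<^esub> y')) (List.product s t) \<in> pairs V W"
  using V W by (auto 0 3 intro: bilinear_algebra_mult)

lemma tens_mult_cl: "s \<in> pairs V W \<Longrightarrow> t \<in> pairs V W \<Longrightarrow> s \<otimes>\<^bsub>tensor k V W\<^esub> t \<in> carrier (tensor k V W)"
  using tnf_tens[OF bilinear_algebra_module[OF V] bilinear_algebra_module[OF W] mult_list_L] by (simp add: tensor_def)

text \<open>The axioms of \<open>R\<close> and \<open>K\<close> are equations between products in
  tensor powers; this rule makes iterated sums of them.\<close>

lemma tlift_mult: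
  assumes "module k U" "bilin k V W U f" "s \<in> pairs V W" "t \<in> pairs V W"
  shows "tlift U f (s \<otimes>\<^bsub>tensor k V W\<^esub> t) =
    tlift U (\<lambda>a b. tlift U (\<lambda>c d. f (a \<otimes>\<^bsub>V\<^esub> c) (b \<otimes>\<^bsub>W\<^esub> d)) t) s"
proof -
  let ?g = "\<lambda>p q. (fst p \<otimes>\<^bsub>V\<^esub> fst q, snd p \<otimes>\<^bsub>W\<^esub> snd q)"
  have "(\<lambda>((x, y), (x', y')). (x \<otimes>\<^bsub>V\<^esub> x', y \<otimes>\<^bsub>W\<^esub> y')) = (\<lambda>(p, q). ?g p q)"
    by (auto simp: fun_eq_iff)
  then have "tlift U f (s \<otimes>\<^bsub>tensor k V W\<^esub> t) = tlift U f (map (\<lambda>(p, q). ?g p q) (List.product s t))"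
    using tlift_tnf[OF bilinear_algebra_module[OF V] bilinear_algebra_module[OF W] assms(1,2) mult_list_L[OF assms(3,4)]]
    by (simp add: tensor_def)
  also have "\<dots> = tlift U (\<lambda>a b. tlift U (\<lambda>c d. f (a \<otimes>\<^bsub>V\<^esub> c) (b \<otimes>\<^bsub>W\<^esub> d)) t) s"
    by (subst tlift_product[OF assms(1)])
      (use assms(3,4) V W in \<open>auto intro!: bilin_cl[OF assms(2)] bilinear_algebra_mult\<close>)
  finally show ?thesis .
qed

lemma tlift_one:
  assumes "module k U" "bilin k V W U f"
  shows "tlift U f \<one>\<^bsub>tensor k V W\<^esub> = f \<one>\<^bsub>V\<^esub> \<one>\<^bsub>W\<^esub>"
  using tlift_pure[OF bilinear_algebra_module[OF V] bilinear_algebra_module[OF W] assms, of "\<one>\<^bsub>V\<^esub>" "\<one>\<^bsub>W\<^esub>"] bilinear_algebra_one[OF V] bilinear_algebra_one[OF W]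
  by (simp add: pure_def tensor_def)

lemma bilinear_algebra_tensor: "bilinear_algebra (tensor k V W)"
proof -
  let ?T = "tensor k V W"
  note mV = bilinear_algebra_module[OF V] and mW = bilinear_algebra_module[OF W]
  note mT = module_tensor[OF mV mW]
  have one: "\<one>\<^bsub>?T\<^esub> \<in> carrier ?T"
    using pure_cl[OF mV mW] bilinear_algebra_one[OF V] bilinear_algebra_one[OF W] by (simp add: tensor_def pure_def)
  \<comment> \<open>Written as a double sum of pure tensors, the product shows its linearity in
    either argument.\<close>
  have eq: "s \<otimes>\<^bsub>?T\<^esub> t = tlift ?T (\<lambda>a b. tlift ?T (\<lambda>c d. pure k V W (a \<otimes>\<^bsub>V\<^esub> c) (b \<otimes>\<^bsub>W\<^esub> d)) t) s"
    if "s \<in> carrier ?T" "t \<in> carrier ?T" for s t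
    using tlift_mult[OF mT bilin_pure[OF mV mW] tens_L[OF mV mW] tens_L[OF mV mW], OF that]
      tens_tlift[OF mV mW tens_mult_cl] tens_L[OF mV mW] that by simp
  have pr: "(a \<in> carrier V \<and> b \<in> carrier W)" if "s \<in> carrier ?T" "(a, b) \<in> set s" for s a b
    using tens_L[OF mV mW that(1)] that(2) by auto
  have 1: "(\<lambda>t. tlift ?T (\<lambda>c d. pure k V W (a \<otimes>\<^bsub>V\<^esub> c) (b \<otimes>\<^bsub>W\<^esub> d)) t) \<in> klin k ?T ?T"
    if "a \<in> carrier V" "b \<in> carrier W" for a b
    using that by (intro tlift_klin mV mW mT bilinI klin_pure1 klin_pure2 klin_mult2 V W klin_id bilinear_algebra_mult)
  have 2: "bilin k V W ?T (\<lambda>a b. tlift ?T (\<lambda>c d. pure k V W (a \<otimes>\<^bsub>V\<^esub> c) (b \<otimes>\<^bsub>W\<^esub> d)) t)"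
    if "t \<in> carrier ?T" for t
    using pr[OF that]
    by (intro bilinI klin_tlift_fun mT klin_pure1 klin_pure2 mV mW klin_mult1 V W klin_id bilinear_algebra_mult) auto
  have "bilin k ?T ?T ?T (\<lambda>s t. tlift ?T (\<lambda>a b. tlift ?T (\<lambda>c d. pure k V W (a \<otimes>\<^bsub>V\<^esub> c) (b \<otimes>\<^bsub>W\<^esub> d)) t) s)"
    using pr by (intro bilinI klin_tlift_fun mT tlift_klin mV mW 1 2) auto
  then have "bilin k ?T ?T ?T (mult ?T)"
    by (rule bilin_cong[OF mT mT]) (simp add: eq)
  then show ?thesis using mT one by (simp add: bilinear_algebra_def)
qed

end

text \<open>Elements of \<open>tensor3\<close> are lists whose left entries are themselves tensors;
  a trilinear map is evaluated on them as a bilinear one on \<open>V \<otimes> W\<close> and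
  \<open>X\<close>.\<close>

lemma bilin_tri:
  assumes "trilin k V W X U f" "module k U" "module k V" "module k W"
  shows "bilin k (tensor k V W) X U (\<lambda>s c. tlift U (\<lambda>a b. f a b c) s)"
proof (intro bilinI)
  fix s assume "s \<in> carrier (tensor k V W)"
  then have "s \<in> pairs V W" by (rule tens_L[OF assms(3,4)])
  then show "(\<lambda>c. tlift U (\<lambda>a b. f a b c) s) \<in> klin k X U"
    by (intro klin_tlift_fun assms trilinD3[OF assms(1)]) auto
next
  fix c assume "c \<in> carrier X"
  then show "(\<lambda>s. tlift U (\<lambda>a b. f a b c) s) \<in> klin k (tensor k V W) U"
    by (intro tlift_klin assms bilinI trilinD1[OF assms(1)] trilinD2[OF assms(1)])
qed

end

section \<open>Complements and retractions of subspaces\<close>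

context over_field
begin

definition subspace :: "('k, 'a, 'z) module_scheme \<Rightarrow> 'a set \<Rightarrow> bool" where
  "subspace V W \<longleftrightarrow> W \<subseteq> carrier V \<and> \<zero>\<^bsub>V\<^esub> \<in> W \<and> (\<forall>x\<in>W. \<forall>y\<in>W. x \<oplus>\<^bsub>V\<^esub> y \<in> W) \<and>
     (\<forall>c\<in>carrier k. \<forall>x\<in>W. c \<odot>\<^bsub>V\<^esub> x \<in> W)"

text \<open>Zorn's lemma, since \<open>V\<close> may have infinite dimension: a subspace maximal
  among those meeting \<open>B\<close> only in zero is a complement, because a vector outside the
  sum could be adjoined to it.\<close>

lemma subspace_complement:
  assumes V: "module k V" and B: "subspace V B"
  shows "\<exists>W. subspace V W \<and> W \<inter> B = {\<zero>\<^bsub>V\<^esub>} \<and> (\<forall>v\<in>carrier V. \<exists>b\<in>B. \<exists>w\<in>W. v = b \<oplus>\<^bsub>V\<^esub> w)"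
proof -
  interpret V: module k V by (rule V)
  interpret K: field k by (rule field_k)
  define \<A> where "\<A> = {W. subspace V W \<and> W \<inter> B = {\<zero>\<^bsub>V\<^esub>}}"
  have "\<exists>M\<in>\<A>. \<forall>X\<in>\<A>. M \<subseteq> X \<longrightarrow> X = M"
  proof (rule subset_Zorn_nonempty)
    have "{\<zero>\<^bsub>V\<^esub>} \<in> \<A>" using B by (auto simp: \<A>_def subspace_def)
    then show "\<A> \<noteq> {}" by blast
  next
    fix \<C> assume ne: "\<C> \<noteq> {}" and ch: "subset.chain \<A> \<C>"
    have sub: "\<And>W. W \<in> \<C> \<Longrightarrow> subspace V W \<and> W \<inter> B = {\<zero>\<^bsub>V\<^esub>}"
      using ch by (auto simp: subset.chain_def \<A>_def)
    have tot: "\<And>W W'. W \<in> \<C> \<Longrightarrow> W' \<in> \<C> \<Longrightarrow> W \<subseteq> W' \<or> W' \<subseteq> W"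
      using ch by (auto simp: subset.chain_def)
    have "x \<oplus>\<^bsub>V\<^esub> y \<in> \<Union>\<C>" if "x \<in> \<Union>\<C>" "y \<in> \<Union>\<C>" for x y
    proof -
      obtain W W' where "x \<in> W" "W \<in> \<C>" "y \<in> W'" "W' \<in> \<C>" using \<open>x \<in> \<Union>\<C>\<close> \<open>y \<in> \<Union>\<C>\<close> by blast
      then show ?thesis using tot[of W W'] sub unfolding subspace_def by blast
    qed
    moreover have "\<Union>\<C> \<subseteq> carrier V" "\<zero>\<^bsub>V\<^esub> \<in> \<Union>\<C>" "\<And>c x. c \<in> carrier k \<Longrightarrow> x \<in> \<Union>\<C> \<Longrightarrow> c \<odot>\<^bsub>V\<^esub> x \<in> \<Union>\<C>"
      using sub ne unfolding subspace_def by blast+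
    moreover have "\<Union>\<C> \<inter> B = {\<zero>\<^bsub>V\<^esub>}" using sub ne by blast
    ultimately show "\<Union>\<C> \<in> \<A>" by (auto simp: \<A>_def subspace_def)
  qed
  then obtain W where W: "subspace V W" "W \<inter> B = {\<zero>\<^bsub>V\<^esub>}"
    and max: "\<And>X. X \<in> \<A> \<Longrightarrow> W \<subseteq> X \<Longrightarrow> X = W" by (auto simp: \<A>_def)
  have WV: "\<And>w. w \<in> W \<Longrightarrow> w \<in> carrier V" and BV: "\<And>b. b \<in> B \<Longrightarrow> b \<in> carrier V"
    using W B by (auto simp: subspace_def)
  have neg: "\<ominus>\<^bsub>V\<^esub> w = (\<ominus>\<^bsub>k\<^esub> \<one>\<^bsub>k\<^esub>) \<odot>\<^bsub>V\<^esub> w" if "w \<in> carrier V" for w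
    using that V.smult_l_minus[of "\<one>\<^bsub>k\<^esub>" w] by simp
  have "\<exists>b\<in>B. \<exists>w\<in>W. v = b \<oplus>\<^bsub>V\<^esub> w" if v: "v \<in> carrier V" for v
  proof (rule ccontr)
    assume no: "\<not> ?thesis"
    \<comment> \<open>The span of \<open>W\<close> and \<open>v\<close>. It will again meet
      \<open>B\<close> only in zero, so maximality forces \<open>v\<close> into
      \<open>W\<close>.\<close>
    define W' where "W' = {w \<oplus>\<^bsub>V\<^esub> c \<odot>\<^bsub>V\<^esub> v | w c. w \<in> W \<and> c \<in> carrier k}"
    have sW': "subspace V W'"
      unfolding subspace_def
    proof (intro conjI ballI)
      show "W' \<subseteq> carrier V" using v WV by (auto simp: W'_def)
      show "\<zero>\<^bsub>V\<^esub> \<in> W'" unfolding W'_def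
        using W v by (auto simp: subspace_def intro!: exI[of _ "\<zero>\<^bsub>V\<^esub>"] exI[of _ "\<zero>\<^bsub>k\<^esub>"])
      fix x assume "x \<in> W'"
      then obtain w c where x: "x = w \<oplus>\<^bsub>V\<^esub> c \<odot>\<^bsub>V\<^esub> v" "w \<in> W" "c \<in> carrier k" by (auto simp: W'_def)
      show "d \<odot>\<^bsub>V\<^esub> x \<in> W'" if "d \<in> carrier k" for d
      proof -
        have "d \<odot>\<^bsub>V\<^esub> x = d \<odot>\<^bsub>V\<^esub> w \<oplus>\<^bsub>V\<^esub> (d \<otimes>\<^bsub>k\<^esub> c) \<odot>\<^bsub>V\<^esub> v"
          using x v that WV by (simp add: V.smult_r_distr V.smult_assoc1)
        moreover have "d \<odot>\<^bsub>V\<^esub> w \<in> W" using W(1) x that by (auto simp: subspace_def)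
        ultimately show ?thesis using x that by (auto simp: W'_def)
      qed
      fix y assume "y \<in> W'"
      then obtain w' c' where y: "y = w' \<oplus>\<^bsub>V\<^esub> c' \<odot>\<^bsub>V\<^esub> v" "w' \<in> W" "c' \<in> carrier k" by (auto simp: W'_def)
      have "x \<oplus>\<^bsub>V\<^esub> y = (w \<oplus>\<^bsub>V\<^esub> w') \<oplus>\<^bsub>V\<^esub> (c \<oplus>\<^bsub>k\<^esub> c') \<odot>\<^bsub>V\<^esub> v"
        using x y v WV by (simp add: V.smult_l_distr V.M.a_ac)
      moreover have "w \<oplus>\<^bsub>V\<^esub> w' \<in> W" using W(1) x y by (auto simp: subspace_def)
      ultimately show "x \<oplus>\<^bsub>V\<^esub> y \<in> W'" using x y by (auto simp: W'_def)
    qed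
    have "z = \<zero>\<^bsub>V\<^esub>" if "z \<in> W'" "z \<in> B" for z
    proof -
      obtain w c where z: "z = w \<oplus>\<^bsub>V\<^esub> c \<odot>\<^bsub>V\<^esub> v" "w \<in> W" "c \<in> carrier k" using \<open>z \<in> W'\<close> by (auto simp: W'_def)
      have "c = \<zero>\<^bsub>k\<^esub>"
      proof (rule ccontr)
        \<comment> \<open>In a field \<open>c\<close> could be inverted, and
          \<open>z = w + c v\<close> would exhibit \<open>v\<close> as an element of
          \<open>B + W\<close>.\<close>
        assume "c \<noteq> \<zero>\<^bsub>k\<^esub>"
        then have u: "c \<in> Units k" using z K.field_Units by auto
        let ?i = "inv\<^bsub>k\<^esub> c"
        have i: "?i \<in> carrier k" "?i \<otimes>\<^bsub>k\<^esub> c = \<one>\<^bsub>k\<^esub>" using u by auto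
        have zV: "z \<in> carrier V" using that BV by blast
        have "c \<odot>\<^bsub>V\<^esub> v = \<ominus>\<^bsub>V\<^esub> w \<oplus>\<^bsub>V\<^esub> z" using z v WV by (simp add: V.M.r_neg1)
        then have "?i \<odot>\<^bsub>V\<^esub> (c \<odot>\<^bsub>V\<^esub> v) = ?i \<odot>\<^bsub>V\<^esub> z \<oplus>\<^bsub>V\<^esub> ?i \<odot>\<^bsub>V\<^esub> (\<ominus>\<^bsub>V\<^esub> w)"
          using i zV z(2) WV by (simp add: V.smult_r_distr V.M.a_comm)
        then have "v = ?i \<odot>\<^bsub>V\<^esub> z \<oplus>\<^bsub>V\<^esub> ?i \<odot>\<^bsub>V\<^esub> (\<ominus>\<^bsub>V\<^esub> w)"
          using i z(3) v V.smult_assoc1[of ?i c v, symmetric] by simp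
        moreover have "?i \<odot>\<^bsub>V\<^esub> z \<in> B" using i that B by (auto simp: subspace_def)
        moreover have "?i \<odot>\<^bsub>V\<^esub> (\<ominus>\<^bsub>V\<^esub> w) \<in> W" using i z W(1) WV by (simp add: neg subspace_def)
        ultimately show False using no by blast
      qed
      then have "z = w" using z v WV by simp
      then show ?thesis using z W(2) that by blast
    qed
    moreover have "\<zero>\<^bsub>V\<^esub> \<in> W'" "\<zero>\<^bsub>V\<^esub> \<in> B" using sW' B by (auto simp: subspace_def)
    ultimately have "W' \<inter> B = {\<zero>\<^bsub>V\<^esub>}" by blast
    then have "W' \<in> \<A>" using sW' by (simp add: \<A>_def)
    moreover have "W \<subseteq> W'"
    proof
      fix w assume "w \<in> W"
      then have "w = w \<oplus>\<^bsub>V\<^esub> \<zero>\<^bsub>k\<^esub> \<odot>\<^bsub>V\<^esub> v" using v WV by simp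
      then show "w \<in> W'" using \<open>w \<in> W\<close> by (auto simp: W'_def)
    qed
    ultimately have "W' = W" using max by blast
    moreover have "v \<in> W'"
    proof -
      have "v = \<zero>\<^bsub>V\<^esub> \<oplus>\<^bsub>V\<^esub> \<one>\<^bsub>k\<^esub> \<odot>\<^bsub>V\<^esub> v" using v by simp
      moreover have "\<zero>\<^bsub>V\<^esub> \<in> W" using W(1) by (simp add: subspace_def)
      ultimately show ?thesis unfolding W'_def by blast
    qed
    ultimately have "v \<in> W" by simp
    moreover have "\<zero>\<^bsub>V\<^esub> \<in> B" using B by (simp add: subspace_def)
    moreover have "v = \<zero>\<^bsub>V\<^esub> \<oplus>\<^bsub>V\<^esub> v" using v by simp
    ultimately show False using no by blast
  qed
  then show ?thesis using W by blast
qed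

text \<open>
  The axioms of \<open>K\<close> and of the coaction are stated inside tensor powers of \<open>H\<close>. Precomposing a
  multilinear map on \<open>B \<otimes> H\<close> with a linear retraction \<open>H \<rightarrow> B\<close> extends it to \<open>H \<otimes> H\<close>, which
  transfers these identities to \<open>B \<otimes> H\<close>.
\<close>

lemma retraction_exists:
  fixes V :: "('k, 'a, 'z) module_scheme"
  assumes V: "module k V" and B: "subspace V B"
  shows "\<exists>r. r \<in> klin k V (V\<lparr>carrier := B\<rparr>) \<and> (\<forall>b\<in>B. r b = b)"
proof -
  interpret V: module k V by (rule V)
  obtain W where W: "subspace V W" "W \<inter> B = {\<zero>\<^bsub>V\<^esub>}"
    and dec: "\<And>v. v \<in> carrier V \<Longrightarrow> \<exists>b\<in>B. \<exists>w\<in>W. v = b \<oplus>\<^bsub>V\<^esub> w" using subspace_complement[OF V B] by blast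
  have WV: "\<And>w. w \<in> W \<Longrightarrow> w \<in> carrier V" and BV: "\<And>b. b \<in> B \<Longrightarrow> b \<in> carrier V"
    using W B by (auto simp: subspace_def)
  have neg: "\<ominus>\<^bsub>V\<^esub> w = (\<ominus>\<^bsub>k\<^esub> \<one>\<^bsub>k\<^esub>) \<odot>\<^bsub>V\<^esub> w" if "w \<in> carrier V" for w
    using that V.smult_l_minus[of "\<one>\<^bsub>k\<^esub>" w] by simp
  \<comment> \<open>The two components in \<open>B\<close> differ by an element that also lies in
    \<open>W\<close>, hence by zero; so the component in \<open>B\<close> is well defined.\<close>
  have uniq: "b = b'" if "b \<in> B" "b' \<in> B" "w \<in> W" "w' \<in> W" "b \<oplus>\<^bsub>V\<^esub> w = b' \<oplus>\<^bsub>V\<^esub> w'" for b b' w w'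
  proof -
    note c = WV[OF that(3)] WV[OF that(4)] BV[OF that(1)] BV[OF that(2)]
    have "b \<oplus>\<^bsub>V\<^esub> \<ominus>\<^bsub>V\<^esub> b' = (b \<oplus>\<^bsub>V\<^esub> w) \<oplus>\<^bsub>V\<^esub> (\<ominus>\<^bsub>V\<^esub> w \<oplus>\<^bsub>V\<^esub> \<ominus>\<^bsub>V\<^esub> b')"
      using c by (simp add: V.M.a_assoc V.M.r_neg2)
    also have "\<dots> = w' \<oplus>\<^bsub>V\<^esub> \<ominus>\<^bsub>V\<^esub> w"
    proof -
      have "(b' \<oplus>\<^bsub>V\<^esub> w') \<oplus>\<^bsub>V\<^esub> (\<ominus>\<^bsub>V\<^esub> w \<oplus>\<^bsub>V\<^esub> \<ominus>\<^bsub>V\<^esub> b') = (w' \<oplus>\<^bsub>V\<^esub> \<ominus>\<^bsub>V\<^esub> w) \<oplus>\<^bsub>V\<^esub> (b' \<oplus>\<^bsub>V\<^esub> \<ominus>\<^bsub>V\<^esub> b')"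
        using c by (simp add: V.M.a_ac)
      also have "\<dots> = w' \<oplus>\<^bsub>V\<^esub> \<ominus>\<^bsub>V\<^esub> w" using c by (simp add: V.M.r_neg)
      finally show ?thesis unfolding that(5) .
    qed
    finally have e: "b \<oplus>\<^bsub>V\<^esub> \<ominus>\<^bsub>V\<^esub> b' = w' \<oplus>\<^bsub>V\<^esub> \<ominus>\<^bsub>V\<^esub> w" .
    have "b \<oplus>\<^bsub>V\<^esub> \<ominus>\<^bsub>V\<^esub> b' \<in> B" using B that c by (simp add: neg subspace_def)
    moreover have "w' \<oplus>\<^bsub>V\<^esub> \<ominus>\<^bsub>V\<^esub> w \<in> W" using W(1) that c by (simp add: neg subspace_def)
    ultimately have "b \<oplus>\<^bsub>V\<^esub> \<ominus>\<^bsub>V\<^esub> b' = \<zero>\<^bsub>V\<^esub>" using e W(2) by auto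
    then have "b = \<ominus>\<^bsub>V\<^esub> (\<ominus>\<^bsub>V\<^esub> b')" using V.M.minus_equality[of b "\<ominus>\<^bsub>V\<^esub> b'"] c by simp
    then show ?thesis using c by simp
  qed
  define r where "r v = (THE b. b \<in> B \<and> (\<exists>w\<in>W. v = b \<oplus>\<^bsub>V\<^esub> w))" for v
  have r: "r v = b" if "b \<in> B" "w \<in> W" "v = b \<oplus>\<^bsub>V\<^esub> w" for v b w
    unfolding r_def by (rule the_equality) (use that uniq in blast)+
  have "r \<in> klin k V (V\<lparr>carrier := B\<rparr>)"
  proof (rule klinI)
    fix x assume "x \<in> carrier V"
    then obtain b w where x: "b \<in> B" "w \<in> W" "x = b \<oplus>\<^bsub>V\<^esub> w" using dec by blast
    note cx = WV[OF x(2)] BV[OF x(1)]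
    show "r x \<in> carrier (V\<lparr>carrier := B\<rparr>)" using r[OF x] x by simp
    show "r (x \<oplus>\<^bsub>V\<^esub> y) = r x \<oplus>\<^bsub>V\<lparr>carrier := B\<rparr>\<^esub> r y" if y: "y \<in> carrier V" for y
    proof -
      obtain b' w' where y: "b' \<in> B" "w' \<in> W" "y = b' \<oplus>\<^bsub>V\<^esub> w'" using dec y by blast
      note cy = WV[OF y(2)] BV[OF y(1)]
      have "r (x \<oplus>\<^bsub>V\<^esub> y) = b \<oplus>\<^bsub>V\<^esub> b'"
        by (rule r[of _ "w \<oplus>\<^bsub>V\<^esub> w'"]) (use x y cx cy B W(1) in \<open>auto simp: subspace_def V.M.a_ac\<close>)
      then show ?thesis using r[OF x] r[OF y] by simp
    qed
    show "r (c \<odot>\<^bsub>V\<^esub> x) = c \<odot>\<^bsub>V\<lparr>carrier := B\<rparr>\<^esub> r x" if "c \<in> carrier k" for c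
    proof -
      have "r (c \<odot>\<^bsub>V\<^esub> x) = c \<odot>\<^bsub>V\<^esub> b"
        by (rule r[of _ "c \<odot>\<^bsub>V\<^esub> w"]) (use x cx that B W(1) in \<open>auto simp: subspace_def V.smult_r_distr\<close>)
      then show ?thesis using r[OF x] by simp
    qed
  qed
  moreover have "r b = b" if "b \<in> B" for b
    by (rule r[of _ "\<zero>\<^bsub>V\<^esub>"]) (use that W(1) BV in \<open>auto simp: subspace_def\<close>)
  ultimately show ?thesis by blast
qed

lemma module_subspace:
  assumes V: "module k V" and B: "subspace V B"
  shows "module k (V\<lparr>carrier := B\<rparr>)"
proof (rule moduleI)
  interpret V: module k V by (rule V)
  have BV: "\<And>b. b \<in> B \<Longrightarrow> b \<in> carrier V" using B by (auto simp: subspace_def)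
  show "abelian_group (V\<lparr>carrier := B\<rparr>)"
  proof (rule abelian_groupI; simp)
    show "\<exists>y\<in>B. y \<oplus>\<^bsub>V\<^esub> x = \<zero>\<^bsub>V\<^esub>" if "x \<in> B" for x
      using mod_neg[OF V BV[OF that]] that B V.R.a_inv_closed[OF field_closed(1)] unfolding subspace_def by blast
  qed (use B BV in \<open>auto simp: subspace_def V.M.a_ac\<close>)
qed (use B module.smult_l_distr[OF V] module.smult_r_distr[OF V] module.smult_assoc1[OF V] module.smult_one[OF V] cring_k
   in \<open>auto simp: subspace_def subset_iff\<close>)

end

section \<open>Hopf algebras: sums over coproducts and over legs\<close>

abbreviation tlift3 :: "('u, 'z) ring_scheme \<Rightarrow> ('a \<Rightarrow> 'b \<Rightarrow> 'c \<Rightarrow> 'u) \<Rightarrow> (('a \<times> 'b) list \<times> 'c) list \<Rightarrow> 'u" where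
  "tlift3 U f w \<equiv> tlift U (\<lambda>s c. tlift U (\<lambda>a b. f a b c) s) w"

locale hopf_alg = over_field k for k :: "'k ring" +
  fixes H :: "('k, 'h) hopf"
  assumes hopf: "hopf_algebra k H"
begin

abbreviation \<Delta> where "\<Delta> \<equiv> comult H"
abbreviation \<epsilon> where "\<epsilon> \<equiv> counit H"
abbreviation H_times (infixl \<open>\<cdot>\<close> 70) where "x \<cdot> y \<equiv> x \<otimes>\<^bsub>H\<^esub> y"

lemma algebra_H: "bilinear_algebra H"
  using hopf by (simp add: hopf_algebra_def assoc_algebra_bilinear)

lemma module_H: "module k H" using algebra_H by (rule bilinear_algebra_module)

lemma H_one [simp]: "\<one>\<^bsub>H\<^esub> \<in> carrier H" using algebra_H by (rule bilinear_algebra_one)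

lemma H_mult [simp]: "x \<in> carrier H \<Longrightarrow> y \<in> carrier H \<Longrightarrow> x \<cdot> y \<in> carrier H"
  using algebra_H by (rule bilinear_algebra_mult)

lemma ring_H: "ring H" using hopf by (simp add: hopf_algebra_def assoc_algebra_def)

lemma H_monoid [simp]: "x \<in> carrier H \<Longrightarrow> \<one>\<^bsub>H\<^esub> \<cdot> x = x" "x \<in> carrier H \<Longrightarrow> x \<cdot> \<one>\<^bsub>H\<^esub> = x"
proof -
  interpret ring H by (rule ring_H)
  show "x \<in> carrier H \<Longrightarrow> \<one>\<^bsub>H\<^esub> \<cdot> x = x" "x \<in> carrier H \<Longrightarrow> x \<cdot> \<one>\<^bsub>H\<^esub> = x" by simp_all
qed

lemma H_assoc: "x \<in> carrier H \<Longrightarrow> y \<in> carrier H \<Longrightarrow> z \<in> carrier H \<Longrightarrow>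
  x \<cdot> y \<cdot> z = x \<cdot> (y \<cdot> z)"
proof -
  interpret ring H by (rule ring_H)
  show "x \<in> carrier H \<Longrightarrow> y \<in> carrier H \<Longrightarrow> z \<in> carrier H \<Longrightarrow> x \<cdot> y \<cdot> z = x \<cdot> (y \<cdot> z)"
    by (rule m_assoc)
qed

lemma module_HH: "module k (tensor k H H)" by (rule module_tensor[OF module_H module_H])

lemma algebra_HH: "bilinear_algebra (tensor k H H)" by (rule bilinear_algebra_tensor[OF algebra_H algebra_H])

lemma comult_klin: "\<Delta> \<in> klin k H (tensor k H H)"
  using hopf by (simp add: hopf_algebra_def)

lemma comult_closed: "h \<in> carrier H \<Longrightarrow> \<Delta> h \<in> carrier (tensor k H H)"
  using comult_klin by (rule klin_cl)

lemma comult_pairs: "h \<in> carrier H \<Longrightarrow> \<Delta> h \<in> pairs H H"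
  using tens_L[OF module_H module_H comult_closed] .

lemma comult_set [simp]: "(a, b) \<in> set (\<Delta> h) \<Longrightarrow> h \<in> carrier H \<Longrightarrow> a \<in> carrier H"
  "(a, b) \<in> set (\<Delta> h) \<Longrightarrow> h \<in> carrier H \<Longrightarrow> b \<in> carrier H"
  using comult_pairs by blast+

lemma comult_ring_hom: "\<Delta> \<in> ring_hom H (tensor k H H)"
  using hopf by (simp add: hopf_algebra_def)

lemma tlift_comult_mult:
  assumes "module k U" "bilin k H H U f" "x \<in> carrier H" "y \<in> carrier H"
  shows "tlift U f (\<Delta> (x \<cdot> y)) = tlift U (\<lambda>a b. tlift U (\<lambda>c d. f (a \<cdot> c) (b \<cdot> d)) (\<Delta> y)) (\<Delta> x)"
  using tlift_mult[OF algebra_H algebra_H assms(1,2) comult_pairs comult_pairs, of x y] comult_ring_hom assms(3,4) by (simp add: ring_hom_mult)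

lemma tlift_comult_one:
  assumes "module k U" "bilin k H H U f"
  shows "tlift U f (\<Delta> \<one>\<^bsub>H\<^esub>) = f \<one>\<^bsub>H\<^esub> \<one>\<^bsub>H\<^esub>"
  using tlift_one[OF algebra_H algebra_H assms] comult_ring_hom by (simp add: ring_hom_one)

lemma klin_comult:
  assumes "module k U" "bilin k H H U f" "g \<in> klin k X H"
  shows "(\<lambda>v. tlift U f (\<Delta> (g v))) \<in> klin k X U"
  by (rule klin_tlift_arg[OF module_H module_H assms(1,2) klin_comp[OF comult_klin assms(3)]])

lemma counit_closed [simp]: "h \<in> carrier H \<Longrightarrow> \<epsilon> h \<in> carrier k"
  and counit_one [simp]: "\<epsilon> \<one>\<^bsub>H\<^esub> = \<one>\<^bsub>k\<^esub>"
  and counit_mult: "x \<in> carrier H \<Longrightarrow> y \<in> carrier H \<Longrightarrow> \<epsilon> (x \<cdot> y) = \<epsilon> x \<otimes>\<^bsub>k\<^esub> \<epsilon> y"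
  and counit_add: "x \<in> carrier H \<Longrightarrow> y \<in> carrier H \<Longrightarrow> \<epsilon> (x \<oplus>\<^bsub>H\<^esub> y) = \<epsilon> x \<oplus>\<^bsub>k\<^esub> \<epsilon> y"
  and counit_smult: "c \<in> carrier k \<Longrightarrow> x \<in> carrier H \<Longrightarrow> \<epsilon> (c \<odot>\<^bsub>H\<^esub> x) = c \<otimes>\<^bsub>k\<^esub> \<epsilon> x"
  using hopf by (auto simp: hopf_algebra_def ring_hom_def)

lemma klin_counit:
  assumes "module k U" "x \<in> carrier U" "g \<in> klin k X H"
  shows "(\<lambda>v. \<epsilon> (g v) \<odot>\<^bsub>U\<^esub> x) \<in> klin k X U"
  using assms(1,2)
  by (intro klinI) (simp_all add: klin_cl[OF assms(3)] klin_add[OF assms(3)] klin_smult[OF assms(3)]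
      counit_add counit_smult mod_adds mod_mults)

lemma klin_scal:
  assumes "module k U" "c \<in> carrier k" "g \<in> klin k X U"
  shows "(\<lambda>v. c \<odot>\<^bsub>U\<^esub> g v) \<in> klin k X U"
  using assms(1,2)
  by (intro klinI) (simp_all add: klin_cl[OF assms(3)] klin_add[OF assms(3)] klin_smult[OF assms(3)]
      mod_sadd mod_scomm[OF assms(1)])

text \<open>The counit axiom is an identity in \<open>H\<close>. A linear map \<open>g\<close>
  carries it to any target; in the applications \<open>g\<close> is the action on a fixed vector or
  multiplication by a fixed element.\<close>

lemma counit_left:
  assumes "module k U" "g \<in> klin k H U" "h \<in> carrier H"
  shows "tlift U (\<lambda>x y. \<epsilon> x \<odot>\<^bsub>U\<^esub> g y) (\<Delta> h) = g h"
proof -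
  have "tlift H (\<lambda>x y. \<epsilon> x \<odot>\<^bsub>H\<^esub> y) (\<Delta> h) = h" using hopf assms(3) by (simp add: hopf_algebra_def)
  then have "g h = tlift U (\<lambda>x y. g (\<epsilon> x \<odot>\<^bsub>H\<^esub> y)) (\<Delta> h)"
    using klin_tlift[OF assms(2) module_H assms(1), of "\<Delta> h" "\<lambda>x y. \<epsilon> x \<odot>\<^bsub>H\<^esub> y"] assms(3) module_H by (simp)
  then show ?thesis using assms(3) by (simp add: klin_smult[OF assms(2)])
qed

lemma counit_right:
  assumes "module k U" "g \<in> klin k H U" "h \<in> carrier H"
  shows "tlift U (\<lambda>x y. \<epsilon> y \<odot>\<^bsub>U\<^esub> g x) (\<Delta> h) = g h"
proof -
  have "tlift H (\<lambda>x y. \<epsilon> y \<odot>\<^bsub>H\<^esub> x) (\<Delta> h) = h" using hopf assms(3) by (simp add: hopf_algebra_def)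
  then have "g h = tlift U (\<lambda>x y. g (\<epsilon> y \<odot>\<^bsub>H\<^esub> x)) (\<Delta> h)"
    using klin_tlift[OF assms(2) module_H assms(1), of "\<Delta> h" "\<lambda>x y. \<epsilon> y \<odot>\<^bsub>H\<^esub> x"] assms(3) module_H by (simp)
  then show ?thesis using assms(3) by (simp add: klin_smult[OF assms(2)])
qed

context
  fixes U :: "('k, 'u, 'z) module_scheme" and f :: "'h \<Rightarrow> 'h \<Rightarrow> 'h \<Rightarrow> 'u"
  assumes U: "module k U" and f: "trilin k H H H U f"
begin

lemmas bil3 = bilin_tri[OF f U module_H module_H]

text \<open>With this and the following rules, each ingredient of the hexagon axioms becomes an
  iterated sum of values of one trilinear map.\<close>

lemma tlift3_comult_left:
  assumes "t \<in> pairs H H"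
  shows "tlift3 U f (comult_left k H t) = tlift U (\<lambda>a c. tlift U (\<lambda>a1 a2. f a1 a2 c) (\<Delta> a)) t"
  unfolding comult_left_def
  by (rule tlift_tmap[OF module_HH module_H U bil3]) (use pairsD[OF assms] comult_closed in blast)

lemma tlift3_comult_right:
  assumes t: "t \<in> pairs H H"
  shows "tlift3 U f (comult_right k H t) = tlift U (\<lambda>a c. tlift U (\<lambda>c1 c2. f a c1 c2) (\<Delta> c)) t"
proof -
  note sq_iso = pairsD[OF t]
  let ?l = "concat (map (\<lambda>(x, y). map (\<lambda>(y1, y2). (pure k H H x y1, y2)) (\<Delta> y)) t)"
  have l: "?l \<in> pairs (tensor k H H) H"
    by (rule pairsI) (auto dest!: sq_iso intro: comult_set pure_cl[OF module_H module_H])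
  have "tlift3 U f (comult_right k H t) = tlift3 U f ?l"
    unfolding comult_right_def by (rule tlift_tnf[OF module_HH module_H U bil3 l])
  also have "\<dots> = tlift U (\<lambda>x y. tlift3 U f (case (x, y) of (x, y) \<Rightarrow> map (\<lambda>(y1, y2). (pure k H H x y1, y2)) (\<Delta> y))) t"
  proof (rule tlift_concat[OF U])
    fix p a b
    assume p: "p \<in> set t" "(a, b) \<in> set (case p of (x, y) \<Rightarrow> map (\<lambda>(y1, y2). (pure k H H x y1, y2)) (\<Delta> y))"
    then have "(a, b) \<in> set ?l" unfolding set_concat set_map by blast
    then have "a \<in> carrier (tensor k H H) \<and> b \<in> carrier H" using pairsD[OF l] by blast
    then show "tlift U (\<lambda>a' b'. f a' b' b) a \<in> carrier U" using bilin_cl[OF bil3] by blast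
  qed
  also have "\<dots> = tlift U (\<lambda>a c. tlift U (\<lambda>c1 c2. f a c1 c2) (\<Delta> c)) t"
  proof (rule tlift_cong[OF refl], simp add: tlift_map, rule tlift_cong[OF refl])
    fix x y c1 c2 assume "(x, y) \<in> set t" "(c1, c2) \<in> set (\<Delta> y)"
    then have "x \<in> carrier H" "c1 \<in> carrier H" "c2 \<in> carrier H" using sq_iso comult_set by blast+
    then show "tlift U (\<lambda>a b. f a b c2) (pure k H H x c1) = f x c1 c2"
      by (intro tlift_pure module_H U bilinI trilinD1[OF f] trilinD2[OF f])
  qed
  finally show ?thesis .
qed

lemma tlift3_leg12:
  assumes "t \<in> carrier (tensor k H H)"
  shows "tlift3 U f (leg12 k H t) = tlift U (\<lambda>a b. f a b \<one>\<^bsub>H\<^esub>) t"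
  unfolding leg12_def by (rule tlift_pure[OF module_HH module_H U bil3 assms H_one])

lemma tlift3_leg13:
  assumes "t \<in> pairs H H"
  shows "tlift3 U f (leg13 k H t) = tlift U (\<lambda>a b. f a \<one>\<^bsub>H\<^esub> b) t"
  unfolding leg13_def
  by (subst tlift_tmap[OF module_HH module_H U bil3])
    (use pairsD[OF assms] in \<open>auto intro!: tlift_cong[OF refl] tlift_pure module_H U bilinI trilinD1[OF f] trilinD2[OF f] pure_cl\<close>)

lemma tlift3_leg23:
  assumes "t \<in> pairs H H"
  shows "tlift3 U f (leg23 k H t) = tlift U (\<lambda>a b. f \<one>\<^bsub>H\<^esub> a b) t"
  unfolding leg23_def
  by (subst tlift_tmap[OF module_HH module_H U bil3])
    (use pairsD[OF assms] in \<open>auto intro!: tlift_cong[OF refl] tlift_pure module_H U bilinI trilinD1[OF f] trilinD2[OF f] pure_cl\<close>)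

text \<open>Multiplying in \<open>(H \<otimes> H) \<otimes> H\<close> produces four nested sums,
  over \<open>w\<close>, \<open>w'\<close> and the left entries \<open>s\<close>, \<open>s'\<close>.
  Swapping the two middle ones puts everything from \<open>w\<close> outside everything from
  \<open>w'\<close>.\<close>

lemma tlift3_mult:
  assumes w: "w \<in> pairs (tensor k H H) H" and w': "w' \<in> pairs (tensor k H H) H"
  shows "tlift3 U f (w \<otimes>\<^bsub>tensor3 k H\<^esub> w') =
    tlift3 U (\<lambda>a b c. tlift3 U (\<lambda>a' b' c'. f (a \<cdot> a') (b \<cdot> b') (c \<cdot> c')) w') w"
proof -
  have cl: "(a \<in> carrier H \<and> b \<in> carrier H) \<and> c \<in> carrier H \<and> s \<in> pairs H H"
    if "(s, c) \<in> set v" "(a, b) \<in> set s" "v \<in> pairs (tensor k H H) H" for s c a b v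
    using pairsD[OF that(3,1)] tens_L[OF module_H module_H, of s] that(2) by blast
  have cl': "c \<in> carrier H \<and> s \<in> pairs H H" if "(s, c) \<in> set v" "v \<in> pairs (tensor k H H) H" for s c v
    using pairsD[OF that(2,1)] tens_L[OF module_H module_H, of s] by blast
  have "tlift3 U f (w \<otimes>\<^bsub>tensor3 k H\<^esub> w') = tlift U (\<lambda>s c. tlift U (\<lambda>s' c'. tlift U (\<lambda>a b. f a b (c \<cdot> c')) (s \<otimes>\<^bsub>tensor k H H\<^esub> s')) w') w"
    by (rule tlift_mult[OF algebra_HH algebra_H U bil3 w w'])
  also have "\<dots> = tlift U (\<lambda>s c. tlift U (\<lambda>s' c'. tlift U (\<lambda>a b. tlift U (\<lambda>a' b'. f (a \<cdot> a') (b \<cdot> b') (c \<cdot> c')) s') s) w') w"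
  proof (intro tlift_cong[OF refl] tlift_mult algebra_H U)
    fix s c s' c' assume *: "(s, c) \<in> set w" "(s', c') \<in> set w'"
    show "s \<in> pairs H H" "s' \<in> pairs H H" using cl'[OF *(1) w] cl'[OF *(2) w'] by auto
    show "bilin k H H U (\<lambda>a b. f a b (c \<cdot> c'))"
      using cl'[OF *(1) w] cl'[OF *(2) w'] by (intro bilinI trilinD1[OF f] trilinD2[OF f]) auto
  qed
  also have "\<dots> = tlift3 U (\<lambda>a b c. tlift3 U (\<lambda>a' b' c'. f (a \<cdot> a') (b \<cdot> b') (c \<cdot> c')) w') w"
  proof (rule tlift_cong[OF refl], rule tlift_Fubini[OF U])
    fix s c s' c' a b assume "(s, c) \<in> set w" "(s', c') \<in> set w'" "(a, b) \<in> set s"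
    then show "tlift U (\<lambda>a' b'. f (a \<cdot> a') (b \<cdot> b') (c \<cdot> c')) s' \<in> carrier U"
      using cl[OF _ _ w] cl[OF _ _ w'] cl'[OF _ w'] by (intro tlift_closed[OF U] trilin_cl[OF f] H_mult) blast+
  qed
  finally show ?thesis .
qed

lemma coassoc:
  assumes "h \<in> carrier H"
  shows "tlift U (\<lambda>a c. tlift U (\<lambda>a1 a2. f a1 a2 c) (\<Delta> a)) (\<Delta> h) = tlift U (\<lambda>a c. tlift U (\<lambda>c1 c2. f a c1 c2) (\<Delta> c)) (\<Delta> h)"
  using tlift3_comult_left[OF comult_pairs[OF assms]] tlift3_comult_right[OF comult_pairs[OF assms]] hopf assms
  by (simp add: hopf_algebra_def)

end

end

context hopf_alg
begin

lemmas linH = klin_id klin_mult1[OF algebra_H] klin_mult2[OF algebra_H]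

lemma trilin_shift:
  assumes "trilin k H H H U f" "a \<in> carrier H" "b \<in> carrier H" "c \<in> carrier H"
  shows "trilin k H H H U (\<lambda>a' b' c'. f (a \<cdot> a') (b \<cdot> b') (c \<cdot> c'))"
  using assms(2-4)
  by (intro trilinI klin_tri1[OF assms(1)] klin_tri2[OF assms(1)] klin_tri3[OF assms(1)] linH H_mult)

lemma HH_set: "w \<in> pairs (tensor k H H) H \<Longrightarrow> (s, c) \<in> set w \<Longrightarrow> s \<in> pairs H H"
  "w \<in> pairs (tensor k H H) H \<Longrightarrow> (s, c) \<in> set w \<Longrightarrow> c \<in> carrier H"
  using pairsD[of w "tensor k H H" H s c] tens_L[OF module_H module_H, of s] by blast+

text \<open>A product of legs is evaluated from its last factor on, and the function that has
  absorbed a factor must again be trilinear for the next one.\<close>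

lemma trilin_tlift3:
  assumes "trilin k H H H U f" "module k U" "w \<in> pairs (tensor k H H) H"
  shows "trilin k H H H U (\<lambda>a b c. tlift3 U (\<lambda>a' b' c'. f (a \<cdot> a') (b \<cdot> b') (c \<cdot> c')) w)"
proof -
  have *: "c' \<in> carrier H" "a' \<in> carrier H" "b' \<in> carrier H" if "(s, c') \<in> set w" "(a', b') \<in> set s" for s c' a' b'
    using HH_set[OF assms(3) that(1)] that(2) by auto
  show ?thesis
    by (intro trilinI klin_tlift_fun assms(2) klin_tri1[OF assms(1)] klin_tri2[OF assms(1)]
      klin_tri3[OF assms(1)] linH H_mult) (auto dest: *)
qed

lemma leg12_L: "t \<in> carrier (tensor k H H) \<Longrightarrow> leg12 k H t \<in> pairs (tensor k H H) H"
  unfolding leg12_def by (intro tens_L module_HH module_H pure_cl H_one)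

lemma leg13_L: "t \<in> pairs H H \<Longrightarrow> leg13 k H t \<in> pairs (tensor k H H) H"
  unfolding leg13_def by (intro tens_L module_HH module_H tmap_cl) (use pairsD in \<open>auto intro!: pure_cl module_H\<close>)

lemma leg23_L: "t \<in> pairs H H \<Longrightarrow> leg23 k H t \<in> pairs (tensor k H H) H"
  unfolding leg23_def by (intro tens_L module_HH module_H tmap_cl) (use pairsD in \<open>auto intro!: pure_cl module_H\<close>)

lemma leg32_L: "t \<in> pairs H H \<Longrightarrow> leg32 k H t \<in> pairs (tensor k H H) H"
  unfolding leg32_def by (rule leg23_L[OF tens_L[OF module_H module_H tflip_cl[OF module_H module_H]]])

lemma mult3_L: "w \<in> pairs (tensor k H H) H \<Longrightarrow> w' \<in> pairs (tensor k H H) H \<Longrightarrow>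
    w \<otimes>\<^bsub>tensor3 k H\<^esub> w' \<in> pairs (tensor k H H) H"
  by (rule tens_L[OF module_HH module_H tens_mult_cl[OF algebra_HH algebra_H]])

text \<open>The first entry of \<open>t\<close> lands in the third position, which is why
  \<open>a\<close> and \<open>b\<close> exchange places.\<close>

lemma tlift3_leg32:
  assumes "module k U" "trilin k H H H U f" "t \<in> pairs H H"
  shows "tlift3 U f (leg32 k H t) = tlift U (\<lambda>a b. f \<one>\<^bsub>H\<^esub> b a) t"
  unfolding leg32_def tlift3_leg23[OF assms(1,2) tens_L[OF module_H module_H tflip_cl[OF module_H module_H assms(3)]]]
  by (rule tlift_tflip[OF module_H module_H assms(1) _ assms(3)])
    (intro bilinI trilinD2[OF assms(2)] trilinD3[OF assms(2)] H_one)

end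

section \<open>Quasi-triangular Hopf algebras\<close>

locale qt_hopf = hopf_alg k H for k :: "'k ring" and H :: "('k, 'h) hopf" +
  fixes R :: "('h \<times> 'h) list"
  assumes R_universal: "universal_R_matrix k H R"
begin

lemma R_closed: "R \<in> carrier (tensor k H H)"
  using R_universal by (auto simp: universal_R_matrix_def Units_def)

lemma R_pairs: "R \<in> pairs H H"
  using tens_L[OF module_H module_H R_closed] .

lemma R_set [simp]: "(a, b) \<in> set R \<Longrightarrow> a \<in> carrier H" "(a, b) \<in> set R \<Longrightarrow> b \<in> carrier H"
  using R_pairs by blast+

definition R_inv where
  "R_inv = (SOME R'. R' \<in> carrier (tensor k H H) \<and> R \<otimes>\<^bsub>tensor k H H\<^esub> R' = \<one>\<^bsub>tensor k H H\<^esub> \<and>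
    R' \<otimes>\<^bsub>tensor k H H\<^esub> R = \<one>\<^bsub>tensor k H H\<^esub>)"

lemma R_inv: "R_inv \<in> carrier (tensor k H H)" "R \<otimes>\<^bsub>tensor k H H\<^esub> R_inv = \<one>\<^bsub>tensor k H H\<^esub>"
    "R_inv \<otimes>\<^bsub>tensor k H H\<^esub> R = \<one>\<^bsub>tensor k H H\<^esub>"
proof -
  have "\<exists>R'. R' \<in> carrier (tensor k H H) \<and> R \<otimes>\<^bsub>tensor k H H\<^esub> R' = \<one>\<^bsub>tensor k H H\<^esub> \<and>
    R' \<otimes>\<^bsub>tensor k H H\<^esub> R = \<one>\<^bsub>tensor k H H\<^esub>"
    using R_universal by (auto simp: universal_R_matrix_def Units_def)
  from someI_ex[OF this] show "R_inv \<in> carrier (tensor k H H)" "R \<otimes>\<^bsub>tensor k H H\<^esub> R_inv = \<one>\<^bsub>tensor k H H\<^esub>"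
    "R_inv \<otimes>\<^bsub>tensor k H H\<^esub> R = \<one>\<^bsub>tensor k H H\<^esub>"
    unfolding R_inv_def by blast+
qed

lemma R_inv_pairs: "R_inv \<in> pairs H H"
  using tens_L[OF module_H module_H R_inv(1)] .

lemma R_inv_set [simp]: "(a, b) \<in> set R_inv \<Longrightarrow> a \<in> carrier H" "(a, b) \<in> set R_inv \<Longrightarrow> b \<in> carrier H"
  using R_inv_pairs by blast+

context
  fixes U :: "('k, 'u, 'z) module_scheme" and f :: "'h \<Rightarrow> 'h \<Rightarrow> 'u"
  assumes U: "module k U" and f: "bilin k H H U f"
begin

lemma tlift_R_R_inv: "tlift U (\<lambda>a b. tlift U (\<lambda>c d. f (a \<cdot> c) (b \<cdot> d)) R_inv) R = f \<one>\<^bsub>H\<^esub> \<one>\<^bsub>H\<^esub>"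
  using tlift_mult[OF algebra_H algebra_H U f R_pairs R_inv_pairs] R_inv(2) tlift_one[OF algebra_H algebra_H U f] by simp

lemma tlift_R_inv_R: "tlift U (\<lambda>a b. tlift U (\<lambda>c d. f (a \<cdot> c) (b \<cdot> d)) R) R_inv = f \<one>\<^bsub>H\<^esub> \<one>\<^bsub>H\<^esub>"
  using tlift_mult[OF algebra_H algebra_H U f R_inv_pairs R_pairs] R_inv(3) tlift_one[OF algebra_H algebra_H U f] by simp

text \<open>The axiom \<open>R \<Delta>(h) = \<Delta>\<^sup>o\<^sup>p(h) R\<close> in summed form;
  for modules it will say that the flip after \<open>R\<close> is \<open>H\<close>-linear.\<close>

lemma R_comm:
  assumes h: "h \<in> carrier H"
  shows "tlift U (\<lambda>a b. tlift U (\<lambda>c d. f (a \<cdot> c) (b \<cdot> d)) (\<Delta> h)) R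
    = tlift U (\<lambda>c d. tlift U (\<lambda>a b. f (d \<cdot> a) (c \<cdot> b)) R) (\<Delta> h)"
proof -
  have fl: "tflip k H H (\<Delta> h) \<in> pairs H H" by (intro tens_L module_H tflip_cl comult_pairs h)
  have "tlift U (\<lambda>a b. tlift U (\<lambda>c d. f (a \<cdot> c) (b \<cdot> d)) (\<Delta> h)) R = tlift U f (R \<otimes>\<^bsub>tensor k H H\<^esub> \<Delta> h)"
    by (rule tlift_mult[OF algebra_H algebra_H U f R_pairs comult_pairs[OF h], symmetric])
  also have "\<dots> = tlift U f (tflip k H H (\<Delta> h) \<otimes>\<^bsub>tensor k H H\<^esub> R)"
    using R_universal h by (simp add: universal_R_matrix_def)
  also have "\<dots> = tlift U (\<lambda>c d. tlift U (\<lambda>a b. f (c \<cdot> a) (d \<cdot> b)) R) (tflip k H H (\<Delta> h))"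
    by (rule tlift_mult[OF algebra_H algebra_H U f fl R_pairs])
  also have "\<dots> = tlift U (\<lambda>c d. tlift U (\<lambda>a b. f (d \<cdot> a) (c \<cdot> b)) R) (\<Delta> h)"
    by (rule tlift_tflip[OF module_H module_H U _ comult_pairs[OF h]])
      (intro bilinI klin_tlift_fun U klin_bil1[OF f] klin_bil2[OF f] linH; simp)
  finally show ?thesis .
qed

end

context
  fixes U :: "('k, 'u, 'z) module_scheme" and f :: "'h \<Rightarrow> 'h \<Rightarrow> 'h \<Rightarrow> 'u"
  assumes U: "module k U" and f: "trilin k H H H U f"
begin

text \<open>Unfolds \<open>(\<Delta> \<otimes> id)(R) = R13 R23\<close>: the third legs of the two
  copies of \<open>R\<close> are multiplied.\<close>

lemma R_hex1: "tlift U (\<lambda>a c. tlift U (\<lambda>a1 a2. f a1 a2 c) (\<Delta> a)) R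
    = tlift U (\<lambda>a b. tlift U (\<lambda>a' b'. f a a' (b \<cdot> b')) R) R"
proof -
  have "tlift U (\<lambda>a c. tlift U (\<lambda>a1 a2. f a1 a2 c) (\<Delta> a)) R = tlift3 U f (leg13 k H R \<otimes>\<^bsub>tensor3 k H\<^esub> leg23 k H R)"
    using tlift3_comult_left[OF U f R_pairs] R_universal by (simp add: universal_R_matrix_def)
  also have "\<dots> = tlift U (\<lambda>a b. tlift3 U (\<lambda>a' b' c'. f (a \<cdot> a') (\<one>\<^bsub>H\<^esub> \<cdot> b') (b \<cdot> c')) (leg23 k H R)) R"
    by (simp add: tlift3_mult[OF U f leg13_L[OF R_pairs] leg23_L[OF R_pairs]]
      tlift3_leg13[OF U trilin_tlift3[OF f U leg23_L[OF R_pairs]] R_pairs])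
  also have "\<dots> = tlift U (\<lambda>a b. tlift U (\<lambda>a' b'. f a a' (b \<cdot> b')) R) R"
    by (rule tlift_cong[OF refl]) (simp add: tlift3_leg23[OF U trilin_shift[OF f] R_pairs])
  finally show ?thesis .
qed

lemma R_hex2: "tlift U (\<lambda>a c. tlift U (\<lambda>c1 c2. f a c1 c2) (\<Delta> c)) R
    = tlift U (\<lambda>a b. tlift U (\<lambda>a' b'. f (a \<cdot> a') b' b) R) R"
proof -
  have "tlift U (\<lambda>a c. tlift U (\<lambda>c1 c2. f a c1 c2) (\<Delta> c)) R = tlift3 U f (leg13 k H R \<otimes>\<^bsub>tensor3 k H\<^esub> leg12 k H R)"
    using tlift3_comult_right[OF U f R_pairs] R_universal by (simp add: universal_R_matrix_def)
  also have "\<dots> = tlift U (\<lambda>a b. tlift3 U (\<lambda>a' b' c'. f (a \<cdot> a') (\<one>\<^bsub>H\<^esub> \<cdot> b') (b \<cdot> c')) (leg12 k H R)) R"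
    by (simp add: tlift3_mult[OF U f leg13_L[OF R_pairs] leg12_L[OF R_closed]]
      tlift3_leg13[OF U trilin_tlift3[OF f U leg12_L[OF R_closed]] R_pairs])
  also have "\<dots> = tlift U (\<lambda>a b. tlift U (\<lambda>a' b'. f (a \<cdot> a') b' b) R) R"
    by (rule tlift_cong[OF refl]) (simp add: tlift3_leg12[OF U trilin_shift[OF f] R_closed])
  finally show ?thesis .
qed

end

context
  fixes U :: "('k, 'u, 'z) module_scheme" and f :: "'h \<Rightarrow> 'h \<Rightarrow> 'h \<Rightarrow> 'u"
  assumes U: "module k U" and f: "trilin k H H H U f"
begin

text \<open>The factors \<open>R13 R23\<close> combine to \<open>(\<Delta> \<otimes> id)(R)\<close>,
  and \<open>R12\<close> passes through the coproduct by \<open>R_comm\<close>. The result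
  \<open>R12 R13 R23 = R23 R13 R12\<close> will give the coherence of \<open>f2\<close> with the
  associator.\<close>

lemma YBE:
  "tlift U (\<lambda>a1 b1. tlift U (\<lambda>a2 b2. tlift U (\<lambda>a3 b3. f (a1 \<cdot> a2) (b1 \<cdot> a3) (b2 \<cdot> b3)) R) R) R =
   tlift U (\<lambda>a1 b1. tlift U (\<lambda>a2 b2. tlift U (\<lambda>a3 b3. f (a2 \<cdot> a3) (a1 \<cdot> b3) (b1 \<cdot> b2)) R) R) R"
  (is "?l = ?r")
proof -
  note fl = klin_tri1[OF f] klin_tri2[OF f] klin_tri3[OF f] linH
  have "?l = tlift U (\<lambda>a1 b1. tlift U (\<lambda>a c. tlift U (\<lambda>x y. f (a1 \<cdot> x) (b1 \<cdot> y) c) (\<Delta> a)) R) R"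
    by (rule tlift_cong[OF refl], rule R_hex1[OF U, symmetric]) (intro trilinI fl; simp)
  also have "\<dots> = tlift U (\<lambda>a c. tlift U (\<lambda>a1 b1. tlift U (\<lambda>x y. f (a1 \<cdot> x) (b1 \<cdot> y) c) (\<Delta> a)) R) R"
    by (rule tlift_Fubini[OF U]) (intro tlift_closed[OF U] trilin_cl[OF f]; simp)
  also have "\<dots> = tlift U (\<lambda>a c. tlift U (\<lambda>x y. tlift U (\<lambda>a1 b1. f (y \<cdot> a1) (x \<cdot> b1) c) R) (\<Delta> a)) R"
    by (rule tlift_cong[OF refl], rule R_comm[OF U]) ((intro bilinI fl; simp), simp)
  also have "\<dots> = ?r"
    by (rule R_hex1[OF U]) (intro trilinI klin_tlift_fun[OF U] fl; simp)
  finally show ?thesis .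
qed

end

text \<open>The counit applied to the first leg of
  \<open>(\<Delta> \<otimes> id)(R) = R13 R23\<close> gives \<open>R = (1 \<otimes> r) R\<close>
  with \<open>r = (\<epsilon> \<otimes> id)(R)\<close>, and cancelling the invertible
  \<open>R\<close> leaves \<open>r = 1\<close>. The other side uses the second hexagon in the same
  way.\<close>

lemma R_counit:
  assumes U: "module k U" and g: "g \<in> klin k H U"
  shows "tlift U (\<lambda>a b. \<epsilon> a \<odot>\<^bsub>U\<^esub> g b) R = g \<one>\<^bsub>H\<^esub>" "tlift U (\<lambda>a b. \<epsilon> b \<odot>\<^bsub>U\<^esub> g a) R = g \<one>\<^bsub>H\<^esub>"
proof -
  note gl = klin_comp[OF g]
  have gc: "g x \<in> carrier U" if "x \<in> carrier H" for x using g that by (rule klin_cl)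
  note rls = klin_tlift_fun[OF U] klin_scal[OF U] klin_counit[OF U] gl linH
  note cl = mod_smult[OF U] gc
  \<comment> \<open>The pair \<open>R\<close>, \<open>R_inv\<close> is first inserted with
    \<open>x = 1\<close>, then split by the hexagon, and finally collapsed again with
    \<open>x\<close> an entry of the copy of \<open>R\<close> that remains.\<close>
  have one: "tlift U (\<lambda>a c. tlift U (\<lambda>p q. \<epsilon> (a \<cdot> p) \<odot>\<^bsub>U\<^esub> g (x \<cdot> (c \<cdot> q))) R_inv) R = g x"
    if x: "x \<in> carrier H" for x
    by (subst tlift_R_R_inv[OF U, of "\<lambda>a c. \<epsilon> a \<odot>\<^bsub>U\<^esub> g (x \<cdot> c)"])
      (use x U gc in \<open>auto intro!: bilinI rls cl\<close>)
  have two: "tlift U (\<lambda>a c. tlift U (\<lambda>p q. \<epsilon> (c \<cdot> q) \<odot>\<^bsub>U\<^esub> g (x \<cdot> (a \<cdot> p))) R_inv) R = g x"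
    if x: "x \<in> carrier H" for x
    by (subst tlift_R_R_inv[OF U, of "\<lambda>a c. \<epsilon> c \<odot>\<^bsub>U\<^esub> g (x \<cdot> a)"])
      (use x U gc in \<open>auto intro!: bilinI rls cl\<close>)
  have "g \<one>\<^bsub>H\<^esub> = tlift U (\<lambda>a c. tlift U (\<lambda>p q. \<epsilon> (a \<cdot> p) \<odot>\<^bsub>U\<^esub> g (c \<cdot> q)) R_inv) R"
    by (subst one[OF H_one, symmetric]) (intro tlift_cong refl; simp)
  also have "\<dots> = tlift U (\<lambda>a c. tlift U (\<lambda>x y. \<epsilon> x \<odot>\<^bsub>U\<^esub> tlift U (\<lambda>p q. \<epsilon> (y \<cdot> p) \<odot>\<^bsub>U\<^esub> g (c \<cdot> q)) R_inv) (\<Delta> a)) R"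
    by (rule tlift_cong[OF refl], rule counit_left[OF U, symmetric]) ((intro rls cl; simp add: cl), simp)
  also have "\<dots> = tlift U (\<lambda>a b. tlift U (\<lambda>a' b'. \<epsilon> a \<odot>\<^bsub>U\<^esub> tlift U (\<lambda>p q. \<epsilon> (a' \<cdot> p) \<odot>\<^bsub>U\<^esub> g (b \<cdot> b' \<cdot> q)) R_inv) R) R"
    by (rule R_hex1[OF U]) (intro trilinI rls tlift_closed[OF U] cl; simp)
  also have "\<dots> = tlift U (\<lambda>a b. \<epsilon> a \<odot>\<^bsub>U\<^esub> tlift U (\<lambda>a' b'. tlift U (\<lambda>p q. \<epsilon> (a' \<cdot> p) \<odot>\<^bsub>U\<^esub> g (b \<cdot> (b' \<cdot> q))) R_inv) R) R"
    by (intro tlift_cong refl) (simp add: tlift_smult[OF U] U cl H_assoc)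
  also have "\<dots> = tlift U (\<lambda>a b. \<epsilon> a \<odot>\<^bsub>U\<^esub> g b) R"
    by (intro tlift_cong refl) (simp add: one)
  finally show "tlift U (\<lambda>a b. \<epsilon> a \<odot>\<^bsub>U\<^esub> g b) R = g \<one>\<^bsub>H\<^esub>" by simp
  have "g \<one>\<^bsub>H\<^esub> = tlift U (\<lambda>a c. tlift U (\<lambda>p q. \<epsilon> (c \<cdot> q) \<odot>\<^bsub>U\<^esub> g (a \<cdot> p)) R_inv) R"
    by (subst two[OF H_one, symmetric]) (intro tlift_cong refl; simp)
  also have "\<dots> = tlift U (\<lambda>a c. tlift U (\<lambda>x y. \<epsilon> y \<odot>\<^bsub>U\<^esub> tlift U (\<lambda>p q. \<epsilon> (x \<cdot> q) \<odot>\<^bsub>U\<^esub> g (a \<cdot> p)) R_inv) (\<Delta> c)) R"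
    by (rule tlift_cong[OF refl], rule counit_right[OF U, symmetric]) ((intro rls cl; simp add: cl), simp)
  also have "\<dots> = tlift U (\<lambda>a b. tlift U (\<lambda>a' b'. \<epsilon> b \<odot>\<^bsub>U\<^esub> tlift U (\<lambda>p q. \<epsilon> (b' \<cdot> q) \<odot>\<^bsub>U\<^esub> g (a \<cdot> a' \<cdot> p)) R_inv) R) R"
    by (rule R_hex2[OF U]) (intro trilinI rls tlift_closed[OF U] cl; simp)
  also have "\<dots> = tlift U (\<lambda>a b. \<epsilon> b \<odot>\<^bsub>U\<^esub> tlift U (\<lambda>a' b'. tlift U (\<lambda>p q. \<epsilon> (b' \<cdot> q) \<odot>\<^bsub>U\<^esub> g (a \<cdot> (a' \<cdot> p))) R_inv) R) R"
    by (intro tlift_cong refl) (simp add: tlift_smult[OF U] U cl H_assoc)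
  also have "\<dots> = tlift U (\<lambda>a b. \<epsilon> b \<odot>\<^bsub>U\<^esub> g a) R"
    by (intro tlift_cong refl) (simp add: two)
  finally show "tlift U (\<lambda>a b. \<epsilon> b \<odot>\<^bsub>U\<^esub> g a) R = g \<one>\<^bsub>H\<^esub>" by simp
qed

end

section \<open>The Hopf algebra involution\<close>

locale inv_hopf = qt_hopf k H R for k :: "'k ring" and H :: "('k, 'h) hopf" and R +
  fixes \<phi> :: "'h \<Rightarrow> 'h"
  assumes phi_involution: "hopf_involution k H \<phi>" and R_phi: "tmap k H H \<phi> \<phi> R = R"
begin

lemma phi_klin: "\<phi> \<in> klin k H H" using phi_involution by (simp add: hopf_involution_def)

lemma phi_cl [simp]: "h \<in> carrier H \<Longrightarrow> \<phi> h \<in> carrier H"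
  using klin_cl[OF phi_klin] .

lemma phi_phi [simp]: "h \<in> carrier H \<Longrightarrow> \<phi> (\<phi> h) = h"
  and phi_eps [simp]: "h \<in> carrier H \<Longrightarrow> \<epsilon> (\<phi> h) = \<epsilon> h"
  using phi_involution by (simp_all add: hopf_involution_def)

lemma phi_mult: "x \<in> carrier H \<Longrightarrow> y \<in> carrier H \<Longrightarrow> \<phi> (x \<cdot> y) = \<phi> x \<cdot> \<phi> y"
  and phi_one [simp]: "\<phi> \<one>\<^bsub>H\<^esub> = \<one>\<^bsub>H\<^esub>"
  using phi_involution by (auto simp: hopf_involution_def ring_hom_def)

lemma phi_comult:
  assumes "module k U" "bilin k H H U f" "h \<in> carrier H"
  shows "tlift U f (\<Delta> (\<phi> h)) = tlift U (\<lambda>a b. f (\<phi> a) (\<phi> b)) (\<Delta> h)"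
proof -
  have "\<Delta> (\<phi> h) = tmap k H H \<phi> \<phi> (\<Delta> h)" using phi_involution assms(3) by (simp add: hopf_involution_def)
  then show ?thesis using assms(3) by (simp add: tlift_tmap[OF module_H module_H assms(1,2)])
qed

lemma phi_R:
  assumes "module k U" "bilin k H H U f"
  shows "tlift U (\<lambda>a b. f (\<phi> a) (\<phi> b)) R = tlift U f R"
  using tlift_tmap[OF module_H module_H assms, of R \<phi> \<phi>] R_phi by simp

lemma R_twist_cl: "R_twist k H \<phi> R \<in> carrier (tensor k H H)"
  unfolding R_twist_def by (rule tmap_cl[OF module_H module_H]) simp

lemma tlift_R_twist:
  assumes "module k U" "bilin k H H U f"
  shows "tlift U f (R_twist k H \<phi> R) = tlift U (\<lambda>a b. f (\<phi> a) b) R"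
  unfolding R_twist_def by (rule tlift_tmap[OF module_H module_H assms]) simp

lemma klin_phi: "g \<in> klin k X H \<Longrightarrow> (\<lambda>v. \<phi> (g v)) \<in> klin k X H"
  using klin_comp[OF phi_klin] .

end

section \<open>Coideal subalgebras and their coaction\<close>

locale coideal = hopf_alg k H for k :: "'k ring" and H :: "('k, 'h) hopf" +
  fixes B :: "'h set"
  assumes coideal: "coideal_subalgebra k H B"
begin

abbreviation A0 where "A0 \<equiv> sub_algebra H B"
abbreviation \<delta> where "\<delta> \<equiv> coaction k H B"

lemma B_ring: "B \<subseteq> carrier H" "\<one>\<^bsub>H\<^esub> \<in> B" "\<zero>\<^bsub>H\<^esub> \<in> B" "x \<in> B \<Longrightarrow> y \<in> B \<Longrightarrow> x \<cdot> y \<in> B"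
  "x \<in> B \<Longrightarrow> y \<in> B \<Longrightarrow> x \<oplus>\<^bsub>H\<^esub> y \<in> B"
proof -
  have S: "subring B H" using coideal by (simp add: coideal_subalgebra_def)
  note E = subringE[OF S]
  show "B \<subseteq> carrier H" "\<one>\<^bsub>H\<^esub> \<in> B" "\<zero>\<^bsub>H\<^esub> \<in> B" using E by auto
  show "x \<in> B \<Longrightarrow> y \<in> B \<Longrightarrow> x \<cdot> y \<in> B" "x \<in> B \<Longrightarrow> y \<in> B \<Longrightarrow> x \<oplus>\<^bsub>H\<^esub> y \<in> B" using E by auto
qed

lemma B_H [simp]: "b \<in> B \<Longrightarrow> b \<in> carrier H" using B_ring(1) by blast

lemma subspace_B: "subspace H B"
  unfolding subspace_def using B_ring coideal by (auto simp: coideal_subalgebra_def)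

lemma module_B: "module k A0" by (rule module_subspace[OF module_H subspace_B])

lemma algebra_B: "bilinear_algebra A0"
  unfolding bilinear_algebra_def
proof (intro conjI module_B)
  show "\<one>\<^bsub>A0\<^esub> \<in> carrier A0" using B_ring by simp
  have b: "bilin k H H H (mult H)" by (rule bilinear_algebra_bilin[OF algebra_H])
  show "bilin k A0 A0 A0 (mult A0)"
    using B_ring klin_add[OF bilinD1[OF b]] klin_add[OF bilinD2[OF b]]
      klin_smult[OF bilinD1[OF b]] klin_smult[OF bilinD2[OF b]]
    by (intro bilinI klinI) auto
qed

definition retract where "retract = (SOME retract. retract \<in> klin k H A0 \<and> (\<forall>b\<in>B. retract b = b))"

lemma retract: "retract \<in> klin k H A0" "b \<in> B \<Longrightarrow> retract b = b"
  unfolding retract_def using someI_ex[OF retraction_exists[OF module_H subspace_B]] by blast+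

lemma r_B [simp]: "h \<in> carrier H \<Longrightarrow> retract h \<in> B" using klin_cl[OF retract(1)] by simp

lemma klin_retract: "g \<in> klin k X H \<Longrightarrow> (\<lambda>v. retract (g v)) \<in> klin k X A0"
  using klin_comp[OF retract(1)] .

lemma AH_L: "t \<in> carrier (tensor k A0 H) \<Longrightarrow> (a, b) \<in> set t \<Longrightarrow> a \<in> B \<and> b \<in> carrier H"
  using pairsD[OF tens_L[OF module_B module_H]] by fastforce

text \<open>\<open>BH_restrict\<close> returns some preimage under \<open>BH_incl\<close>, and a
  bilinear map defined on all of \<open>H\<close> takes the same value on a tensor and on its
  preimage.\<close>

lemma restrict:
  assumes "t \<in> BH k H B"
  shows "BH_restrict k H B t \<in> carrier (tensor k A0 H)" (is ?A)
    and "module k U \<Longrightarrow> bilin k H H U f \<Longrightarrow> tlift U f (BH_restrict k H B t) = tlift U f t"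
proof -
  show A: ?A
    unfolding BH_restrict_def by (rule inv_into_into) (use assms in \<open>simp add: BH_def\<close>)
  assume U: "module k U" and f: "bilin k H H U f"
  have "BH_incl k H (BH_restrict k H B t) = t"
    unfolding BH_restrict_def by (rule f_inv_into_f) (use assms in \<open>simp add: BH_def\<close>)
  then have "tlift U f t = tlift U f (tmap k H H (\<lambda>x. x) (\<lambda>y. y) (BH_restrict k H B t))"
    by (simp add: BH_incl_def)
  also have "\<dots> = tlift U f (BH_restrict k H B t)"
    by (rule tlift_tmap[OF module_H module_H U f]) (use AH_L[OF A] in auto)
  finally show "tlift U f (BH_restrict k H B t) = tlift U f t" by simp
qed

lemma bilin_retract:
  assumes "bilin k A0 H U f"
  shows "bilin k H H U (\<lambda>a b. f (retract a) b)"
  by (intro bilinI klin_bil1[OF assms] klin_bil2[OF assms] klin_retract klin_id) auto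

text \<open>The left entries of the preimage lie in \<open>B\<close> and are fixed by
  \<open>retract\<close>; once it is inserted, the map is defined on all of \<open>H\<close> and
  \<open>restrict\<close> applies.\<close>

lemma restrict_retract:
  assumes "t \<in> BH k H B" "module k U" "bilin k A0 H U f"
  shows "tlift U f (BH_restrict k H B t) = tlift U (\<lambda>a b. f (retract a) b) t"
proof -
  have "tlift U f (BH_restrict k H B t) = tlift U (\<lambda>a b. f (retract a) b) (BH_restrict k H B t)"
    by (rule tlift_cong[OF refl]) (use AH_L[OF restrict(1)[OF assms(1)]] retract(2) in auto)
  also have "\<dots> = tlift U (\<lambda>a b. f (retract a) b) t"
    by (rule restrict(2)[OF assms(1,2) bilin_retract[OF assms(3)]])
  finally show ?thesis .
qed

lemma comult_BH: "b \<in> B \<Longrightarrow> \<Delta> b \<in> BH k H B"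
  using coideal by (simp add: coideal_subalgebra_def)

lemma coaction_closed: "b \<in> B \<Longrightarrow> \<delta> b \<in> carrier (tensor k A0 H)"
  unfolding coaction_def by (rule restrict(1)[OF comult_BH])

lemma coaction_set [simp]: "(x, y) \<in> set (\<delta> b) \<Longrightarrow> b \<in> B \<Longrightarrow> x \<in> B" "(x, y) \<in> set (\<delta> b) \<Longrightarrow> b \<in> B \<Longrightarrow> y \<in> carrier H"
  using AH_L[OF coaction_closed] by blast+

lemma coaction_comult:
  assumes "b \<in> B" "module k U" "bilin k H H U f"
  shows "tlift U f (\<delta> b) = tlift U f (\<Delta> b)"
  unfolding coaction_def by (rule restrict(2)[OF comult_BH[OF assms(1)] assms(2,3)])

lemma coaction_retract:
  assumes "b \<in> B" "module k U" "bilin k A0 H U f"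
  shows "tlift U f (\<delta> b) = tlift U (\<lambda>a b. f (retract a) b) (\<Delta> b)"
  unfolding coaction_def by (rule restrict_retract[OF comult_BH[OF assms(1)] assms(2,3)])

text \<open>The coaction is defined through \<open>inv_into\<close>, which hides its linearity. The
  retraction gives a second formula for it, as a sum over \<open>\<Delta> b\<close>, in which
  linearity is visible.\<close>

lemma coaction_klin: "\<delta> \<in> klin k A0 (tensor k A0 H)"
proof (rule klin_cong[OF module_B])
  note mT = module_tensor[OF module_B module_H]
  have "(\<lambda>h. h) \<in> klin k A0 H" by (rule klinI) auto
  then show "(\<lambda>b. tlift (tensor k A0 H) (\<lambda>a b. pure k A0 H (retract a) b) (\<Delta> b)) \<in> klin k A0 (tensor k A0 H)"
    by (rule klin_comult[OF mT bilin_retract[OF bilin_pure[OF module_B module_H]]])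
  show "\<delta> x = tlift (tensor k A0 H) (\<lambda>a b. pure k A0 H (retract a) b) (\<Delta> x)" if "x \<in> carrier A0" for x
    using coaction_retract[of x, OF _ mT bilin_pure[OF module_B module_H]] tens_tlift[OF module_B module_H coaction_closed, of x] that by simp
qed

lemma coaction_mult:
  assumes U: "module k U" and f: "bilin k A0 H U f" and xy: "x \<in> B" "y \<in> B"
  shows "tlift U f (\<delta> (x \<cdot> y)) = tlift U (\<lambda>a b. tlift U (\<lambda>c d. f (a \<cdot> c) (b \<cdot> d)) (\<delta> y)) (\<delta> x)"
proof -
  note fl = klin_tlift_fun[OF U] klin_bil1[OF f] klin_bil2[OF f] klin_retract linH
  have "tlift U f (\<delta> (x \<cdot> y)) = tlift U (\<lambda>a b. f (retract a) b) (\<Delta> (x \<cdot> y))"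
    using xy by (intro coaction_retract U f B_ring)
  also have "\<dots> = tlift U (\<lambda>a b. tlift U (\<lambda>c d. f (retract (a \<cdot> c)) (b \<cdot> d)) (\<Delta> y)) (\<Delta> x)"
    using xy by (intro tlift_comult_mult U bilin_retract f B_H)
  also have "\<dots> = tlift U (\<lambda>a b. tlift U (\<lambda>c d. f (retract (a \<cdot> c)) (b \<cdot> d)) (\<Delta> y)) (\<delta> x)"
    by (rule coaction_comult[symmetric]) (use xy in \<open>auto intro!: bilinI fl U\<close>)
  also have "\<dots> = tlift U (\<lambda>a b. tlift U (\<lambda>c d. f (retract (a \<cdot> c)) (b \<cdot> d)) (\<delta> y)) (\<delta> x)"
    by (rule tlift_cong[OF refl], rule coaction_comult[symmetric]) (use xy in \<open>auto intro!: bilinI fl U\<close>)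
  \<comment> \<open>Both sums now run over the coaction, so \<open>a\<close> and \<open>c\<close>
    lie in \<open>B\<close> and \<open>retract\<close> fixes their product.\<close>
  also have "\<dots> = tlift U (\<lambda>a b. tlift U (\<lambda>c d. f (a \<cdot> c) (b \<cdot> d)) (\<delta> y)) (\<delta> x)"
    using xy by (intro tlift_cong refl) (simp add: retract(2) B_ring)
  finally show ?thesis .
qed

lemma coaction_one:
  assumes U: "module k U" and f: "bilin k A0 H U f"
  shows "tlift U f (\<delta> \<one>\<^bsub>H\<^esub>) = f \<one>\<^bsub>H\<^esub> \<one>\<^bsub>H\<^esub>"
  using coaction_retract[OF B_ring(2) U f] tlift_comult_one[OF U bilin_retract[OF f]] retract(2) B_ring by simp

text \<open>The inner coaction is rewritten first: after \<open>retract\<close> has replaced it by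
  the coproduct of \<open>H\<close>, the outer summand is bilinear on \<open>H\<close> and
  coassociativity of \<open>H\<close> takes over.\<close>

lemma coaction_coassoc:
  assumes U: "module k U" and f: "trilin k A0 H H U f" and b: "b \<in> B"
  shows "tlift U (\<lambda>a c. tlift U (\<lambda>a1 a2. f a1 a2 c) (\<delta> a)) (\<delta> b)
    = tlift U (\<lambda>a c. tlift U (\<lambda>c1 c2. f a c1 c2) (\<Delta> c)) (\<delta> b)"
proof -
  note fl = klin_tlift_fun[OF U] klin_tri1[OF f] klin_tri2[OF f] klin_tri3[OF f] klin_retract linH
  have "tlift U (\<lambda>a c. tlift U (\<lambda>a1 a2. f a1 a2 c) (\<delta> a)) (\<delta> b)
    = tlift U (\<lambda>a c. tlift U (\<lambda>a1 a2. f (retract a1) a2 c) (\<Delta> a)) (\<delta> b)"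
    by (rule tlift_cong[OF refl], rule coaction_retract) (use b in \<open>auto intro!: bilinI fl U\<close>)
  also have "\<dots> = tlift U (\<lambda>a c. tlift U (\<lambda>a1 a2. f (retract a1) a2 c) (\<Delta> a)) (\<Delta> b)"
    by (rule coaction_comult[OF b U]) (intro bilinI fl klin_comult[OF U]; simp)
  also have "\<dots> = tlift U (\<lambda>a c. tlift U (\<lambda>c1 c2. f (retract a) c1 c2) (\<Delta> c)) (\<Delta> b)"
    by (rule coassoc[OF U]) (use b in \<open>auto intro!: trilinI fl\<close>)
  also have "\<dots> = tlift U (\<lambda>a c. tlift U (\<lambda>c1 c2. f a c1 c2) (\<Delta> c)) (\<delta> b)"
    by (rule coaction_retract[OF b U, symmetric]) (intro bilinI fl klin_comult[OF U]; simp)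
  finally show ?thesis .
qed

lemma coaction_counit:
  assumes U: "module k U" and g: "g \<in> klin k A0 U" and b: "b \<in> B"
  shows "tlift U (\<lambda>x y. \<epsilon> y \<odot>\<^bsub>U\<^esub> g x) (\<delta> b) = g b"
proof -
  have "tlift U (\<lambda>x y. \<epsilon> y \<odot>\<^bsub>U\<^esub> g x) (\<delta> b) = tlift U (\<lambda>x y. \<epsilon> y \<odot>\<^bsub>U\<^esub> g (retract x)) (\<Delta> b)"
    using klin_cl[OF g]
    by (intro coaction_retract[OF b U] bilinI klin_scal[OF U] klin_counit[OF U] klin_comp[OF g] linH) auto
  also have "\<dots> = g (retract b)"
    by (rule counit_right[OF U klin_comp[OF g retract(1)]]) (use b in simp)
  finally show ?thesis using retract(2)[OF b] by simp
qed

end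

section \<open>The universal K-matrix\<close>

locale kmat = inv_hopf k H R \<phi> + coideal k H B
  for k :: "'k ring" and H :: "('k, 'h) hopf" and R \<phi> B +
  fixes K :: "('h \<times> 'h) list"
  assumes K_universal: "universal_K_matrix k H R \<phi> B K"
begin

lemma K_BH: "K \<in> BH k H B" using K_universal by (simp add: universal_K_matrix_def)

definition K_inv where "K_inv = (SOME K'. K' \<in> BH k H B \<and> K \<otimes>\<^bsub>tensor2 k H\<^esub> K' = \<one>\<^bsub>tensor2 k H\<^esub> \<and>
  K' \<otimes>\<^bsub>tensor2 k H\<^esub> K = \<one>\<^bsub>tensor2 k H\<^esub>)"

lemma K_inv: "K_inv \<in> BH k H B" "K \<otimes>\<^bsub>tensor2 k H\<^esub> K_inv = \<one>\<^bsub>tensor2 k H\<^esub>" "K_inv \<otimes>\<^bsub>tensor2 k H\<^esub> K = \<one>\<^bsub>tensor2 k H\<^esub>"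
proof -
  have "\<exists>K'. K' \<in> BH k H B \<and> K \<otimes>\<^bsub>tensor2 k H\<^esub> K' = \<one>\<^bsub>tensor2 k H\<^esub> \<and> K' \<otimes>\<^bsub>tensor2 k H\<^esub> K = \<one>\<^bsub>tensor2 k H\<^esub>"
    using K_universal by (auto simp: universal_K_matrix_def)
  from someI_ex[OF this] show "K_inv \<in> BH k H B" "K \<otimes>\<^bsub>tensor2 k H\<^esub> K_inv = \<one>\<^bsub>tensor2 k H\<^esub>"
    "K_inv \<otimes>\<^bsub>tensor2 k H\<^esub> K = \<one>\<^bsub>tensor2 k H\<^esub>"
    unfolding K_inv_def by blast+
qed

abbreviation "K0 \<equiv> BH_restrict k H B K"
abbreviation "K_inv0 \<equiv> BH_restrict k H B K_inv"

lemma K0_set [simp]: "(a, b) \<in> set K0 \<Longrightarrow> a \<in> B" "(a, b) \<in> set K0 \<Longrightarrow> b \<in> carrier H"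
  and K_inv0_set [simp]: "(a, b) \<in> set K_inv0 \<Longrightarrow> a \<in> B" "(a, b) \<in> set K_inv0 \<Longrightarrow> b \<in> carrier H"
  using AH_L restrict(1)[OF K_BH] restrict(1)[OF K_inv(1)] by blast+

lemma BH_cl: "t \<in> BH k H B \<Longrightarrow> t \<in> carrier (tensor k H H)"
proof -
  assume "t \<in> BH k H B"
  then obtain s where s: "s \<in> carrier (tensor k A0 H)" "t = tmap k H H (\<lambda>x. x) (\<lambda>y. y) s"
    by (auto simp: BH_def BH_incl_def)
  show ?thesis unfolding s(2) by (rule tmap_cl[OF module_H module_H]) (use AH_L[OF s(1)] in auto)
qed

lemma K_cl: "K \<in> carrier (tensor k H H)" "K_inv \<in> carrier (tensor k H H)"
  using BH_cl K_BH K_inv(1) by auto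

lemma K_L: "K \<in> pairs H H" "K_inv \<in> pairs H H"
  using K_cl tens_L[OF module_H module_H] by auto

lemma K_set [simp]: "(a, b) \<in> set K \<Longrightarrow> a \<in> carrier H" "(a, b) \<in> set K \<Longrightarrow> b \<in> carrier H"
  "(a, b) \<in> set K_inv \<Longrightarrow> a \<in> carrier H" "(a, b) \<in> set K_inv \<Longrightarrow> b \<in> carrier H"
  using pairsD[OF K_L(1)] pairsD[OF K_L(2)] by auto

text \<open>Invertibility of \<open>K\<close> is an equation in \<open>H \<otimes> H\<close>, but
  \<open>K\<close> acts on modules through its preimage in \<open>B \<otimes> H\<close>. As both
  factors lie in the image of \<open>B \<otimes> H\<close>, the retraction carries the equation
  across.\<close>

lemma K_prod:
  assumes U: "module k U" and f: "bilin k A0 H U f" and s: "s \<in> BH k H B" and t: "t \<in> BH k H B"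
    and st: "s \<otimes>\<^bsub>tensor2 k H\<^esub> t = \<one>\<^bsub>tensor2 k H\<^esub>"
  shows "tlift U (\<lambda>a b. tlift U (\<lambda>c d. f (a \<cdot> c) (b \<cdot> d)) (BH_restrict k H B t)) (BH_restrict k H B s)
    = f \<one>\<^bsub>H\<^esub> \<one>\<^bsub>H\<^esub>"
proof -
  note fl = klin_tlift_fun[OF U] klin_bil1[OF f] klin_bil2[OF f] klin_retract linH
  have rs: "a \<in> B \<and> b \<in> carrier H" if "(a, b) \<in> set (BH_restrict k H B u)" "u = s \<or> u = t" for a b u
    using AH_L restrict(1) s t that by blast
  have rt: "a \<in> carrier H \<and> b \<in> carrier H" if "(a, b) \<in> set u" "u = s \<or> u = t" for a b u
    using pairsD[OF tens_L[OF module_H module_H BH_cl]] s t that by blast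
  let ?g = "\<lambda>a b c d. f (retract (a \<cdot> c)) (b \<cdot> d)"
  have "tlift U (\<lambda>a b. tlift U (\<lambda>c d. f (a \<cdot> c) (b \<cdot> d)) (BH_restrict k H B t)) (BH_restrict k H B s)
    = tlift U (\<lambda>a b. tlift U (?g a b) (BH_restrict k H B t)) (BH_restrict k H B s)"
    by (intro tlift_cong refl) (auto dest!: rs simp: retract(2) B_ring)
  also have "\<dots> = tlift U (\<lambda>a b. tlift U (?g a b) t) (BH_restrict k H B s)"
    by (rule tlift_cong[OF refl], rule restrict(2)[OF t U]) (auto dest!: rs intro!: bilinI fl)
  also have "\<dots> = tlift U (\<lambda>a b. tlift U (?g a b) t) s"
    by (rule restrict(2)[OF s U]) (auto dest!: rt intro!: bilinI fl)
  also have "\<dots> = tlift U (\<lambda>a b. f (retract a) b) (s \<otimes>\<^bsub>tensor2 k H\<^esub> t)"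
    by (rule tlift_mult[OF algebra_H algebra_H U bilin_retract[OF f] tens_L[OF module_H module_H BH_cl[OF s]] tens_L[OF module_H module_H BH_cl[OF t]], symmetric])
  also have "\<dots> = f \<one>\<^bsub>H\<^esub> \<one>\<^bsub>H\<^esub>"
    unfolding st tlift_one[OF algebra_H algebra_H U bilin_retract[OF f]] by (simp add: retract(2) B_ring)
  finally show ?thesis .
qed

lemma tlift_K_K_inv:
  assumes U: "module k U" and f: "bilin k A0 H U f"
  shows "tlift U (\<lambda>a b. tlift U (\<lambda>c d. f (a \<cdot> c) (b \<cdot> d)) K_inv0) K0 = f \<one>\<^bsub>H\<^esub> \<one>\<^bsub>H\<^esub>"
    "tlift U (\<lambda>a b. tlift U (\<lambda>c d. f (a \<cdot> c) (b \<cdot> d)) K0) K_inv0 = f \<one>\<^bsub>H\<^esub> \<one>\<^bsub>H\<^esub>"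
  by (rule K_prod[OF U f] K_BH K_inv)+

text \<open>With \<open>retract\<close> inserted, \<open>K0\<close> and the coaction can be replaced
  by \<open>K\<close> and the coproduct; the intertwining axiom is applied in
  \<open>H \<otimes> H\<close>, and the replacements are then undone.\<close>

lemma K_comm:
  assumes U: "module k U" and f: "bilin k A0 H U f" and b: "b \<in> B"
  shows "tlift U (\<lambda>a c. tlift U (\<lambda>x y. f (a \<cdot> x) (c \<cdot> y)) (\<delta> b)) K0 =
    tlift U (\<lambda>x y. tlift U (\<lambda>a c. f (x \<cdot> a) (\<phi> y \<cdot> c)) K0) (\<delta> b)"
proof -
  note fl = klin_tlift_fun[OF U] klin_bil1[OF f] klin_bil2[OF f] klin_retract linH klin_phi
  have pD: "tmap k H H (\<lambda>x. x) \<phi> (\<Delta> b) \<in> pairs H H"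
    by (intro tens_L[OF module_H module_H] tmap_cl[OF module_H module_H]) (use b in auto)
  let ?f = "\<lambda>a b. f (retract a) b"
  have "tlift U (\<lambda>a c. tlift U (\<lambda>x y. f (a \<cdot> x) (c \<cdot> y)) (\<delta> b)) K0 =
    tlift U (\<lambda>a c. tlift U (\<lambda>x y. ?f (a \<cdot> x) (c \<cdot> y)) (\<delta> b)) K0"
    using b by (intro tlift_cong refl) (simp add: retract(2) B_ring)
  also have "\<dots> = tlift U (\<lambda>a c. tlift U (\<lambda>x y. ?f (a \<cdot> x) (c \<cdot> y)) (\<Delta> b)) K0"
    by (rule tlift_cong[OF refl], rule coaction_comult[OF b U]) (auto intro!: bilinI fl)
  also have "\<dots> = tlift U (\<lambda>a c. tlift U (\<lambda>x y. ?f (a \<cdot> x) (c \<cdot> y)) (\<Delta> b)) K"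
    by (rule restrict(2)[OF K_BH U]) (use b in \<open>auto intro!: bilinI fl\<close>)
  also have "\<dots> = tlift U ?f (K \<otimes>\<^bsub>tensor2 k H\<^esub> \<Delta> b)"
    by (rule tlift_mult[OF algebra_H algebra_H U bilin_retract[OF f] K_L(1) comult_pairs, symmetric]) (use b in simp)
  also have "\<dots> = tlift U ?f (tmap k H H (\<lambda>x. x) \<phi> (\<Delta> b) \<otimes>\<^bsub>tensor2 k H\<^esub> K)"
    using K_universal b by (simp add: universal_K_matrix_def)
  also have "\<dots> = tlift U (\<lambda>x y. tlift U (\<lambda>a c. ?f (x \<cdot> a) (y \<cdot> c)) K) (tmap k H H (\<lambda>x. x) \<phi> (\<Delta> b))"
    by (rule tlift_mult[OF algebra_H algebra_H U bilin_retract[OF f] pD K_L(1)])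
  also have "\<dots> = tlift U (\<lambda>x y. tlift U (\<lambda>a c. ?f (x \<cdot> a) (\<phi> y \<cdot> c)) K) (\<Delta> b)"
    by (rule tlift_tmap[OF module_H module_H U]) (use b in \<open>auto intro!: bilinI fl\<close>)
  also have "\<dots> = tlift U (\<lambda>x y. tlift U (\<lambda>a c. ?f (x \<cdot> a) (\<phi> y \<cdot> c)) K) (\<delta> b)"
    by (rule coaction_comult[OF b U, symmetric]) (auto intro!: bilinI fl)
  also have "\<dots> = tlift U (\<lambda>x y. tlift U (\<lambda>a c. ?f (x \<cdot> a) (\<phi> y \<cdot> c)) K0) (\<delta> b)"
    by (rule tlift_cong[OF refl], rule restrict(2)[OF K_BH U, symmetric]) (use b in \<open>auto intro!: bilinI fl\<close>)
  also have "\<dots> = tlift U (\<lambda>x y. tlift U (\<lambda>a c. f (x \<cdot> a) (\<phi> y \<cdot> c)) K0) (\<delta> b)"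
    using b by (intro tlift_cong refl) (simp add: retract(2) B_ring)
  finally show ?thesis .
qed

end

context kmat
begin

lemma trilin_retract:
  assumes "trilin k A0 H H U f"
  shows "trilin k H H H U (\<lambda>a b c. f (retract a) b c)"
  by (intro trilinI klin_tri1[OF assms] klin_tri2[OF assms] klin_tri3[OF assms] klin_retract klin_id) auto

context
  fixes U :: "('k, 'u, 'z) module_scheme" and f :: "'h \<Rightarrow> 'h \<Rightarrow> 'h \<Rightarrow> 'u"
  assumes U: "module k U" and f: "trilin k A0 H H U f"
begin

text \<open>In \<open>(\<Delta> \<otimes> id)(K)\<close> the factor written \<open>R32\<close>
  carries the twist on the leg in the third position. Hence \<open>\<phi> p\<close> heads the third
  argument and \<open>q\<close> the second.\<close>

lemma K_hex1:
  "tlift U (\<lambda>a c. tlift U (\<lambda>a1 a2. f a1 a2 c) (\<delta> a)) K0 =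
   tlift U (\<lambda>p q. tlift U (\<lambda>x y. tlift U (\<lambda>s t. f x (q \<cdot> s) (\<phi> p \<cdot> y \<cdot> t)) R) K0) R"
proof -
  define g where "g = (\<lambda>a b c. f (retract a) b c)"
  have g: "trilin k H H H U g" unfolding g_def by (rule trilin_retract[OF f])
  note fl = klin_tlift_fun[OF U] klin_tri1[OF f] klin_tri2[OF f] klin_tri3[OF f] klin_retract linH klin_phi
  note gl = klin_tlift_fun[OF U] klin_tri1[OF g] klin_tri2[OF g] klin_tri3[OF g] linH klin_phi
  let ?T = "R_twist k H \<phi> R"
  have TL: "?T \<in> pairs H H" by (rule tens_L[OF module_H module_H R_twist_cl])
  note Ls = leg32_L[OF TL] leg13_L[OF K_L(1)] leg23_L[OF R_pairs] mult3_L
  \<comment> \<open>\<open>G\<close> has absorbed the last factor \<open>R23\<close>; the remaining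
    product is evaluated with \<open>G\<close> in place of \<open>g\<close>.\<close>
  define G where "G = (\<lambda>a b c. tlift3 U (\<lambda>a' b' c'. g (a \<cdot> a') (b \<cdot> b') (c \<cdot> c')) (leg23 k H R))"
  have G: "trilin k H H H U G" unfolding G_def by (rule trilin_tlift3[OF g U Ls(3)])
  have "tlift U (\<lambda>a c. tlift U (\<lambda>a1 a2. f a1 a2 c) (\<delta> a)) K0 = tlift U (\<lambda>a c. tlift U (\<lambda>a1 a2. g a1 a2 c) (\<Delta> a)) K0"
    unfolding g_def by (rule tlift_cong[OF refl], rule coaction_retract) (auto intro!: bilinI fl U)
  also have "\<dots> = tlift U (\<lambda>a c. tlift U (\<lambda>a1 a2. g a1 a2 c) (\<Delta> a)) K"
    by (rule restrict(2)[OF K_BH U]) (intro bilinI gl klin_comult[OF U]; simp)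
  also have "\<dots> = tlift3 U g (leg32 k H ?T \<otimes>\<^bsub>tensor3 k H\<^esub> leg13 k H K \<otimes>\<^bsub>tensor3 k H\<^esub> leg23 k H R)"
    using tlift3_comult_left[OF U g K_L(1)] K_universal by (simp add: universal_K_matrix_def)
  also have "\<dots> = tlift3 U G (leg32 k H ?T \<otimes>\<^bsub>tensor3 k H\<^esub> leg13 k H K)"
    unfolding G_def by (rule tlift3_mult[OF U g mult3_L[OF Ls(1,2)] Ls(3)])
  also have "\<dots> = tlift U (\<lambda>p q. tlift3 U (\<lambda>a' b' c'. G (\<one>\<^bsub>H\<^esub> \<cdot> a') (q \<cdot> b') (p \<cdot> c')) (leg13 k H K)) ?T"
    by (simp add: tlift3_mult[OF U G Ls(1,2)] tlift3_leg32[OF U trilin_tlift3[OF G U Ls(2)] TL])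
  also have "\<dots> = tlift U (\<lambda>p q. tlift U (\<lambda>x y. G x q (p \<cdot> y)) K) ?T"
    by (rule tlift_cong[OF refl]) (use pairsD[OF TL] in \<open>simp add: tlift3_leg13[OF U trilin_shift[OF G] K_L(1)]\<close>)
  also have "\<dots> = tlift U (\<lambda>p q. tlift U (\<lambda>x y. tlift U (\<lambda>s t. g x (q \<cdot> s) (p \<cdot> y \<cdot> t)) R) K) ?T"
    unfolding G_def
    by (intro tlift_cong refl) (use pairsD[OF TL] in \<open>simp add: tlift3_leg23[OF U trilin_shift[OF g] R_pairs]\<close>)
  also have "\<dots> = tlift U (\<lambda>p q. tlift U (\<lambda>x y. tlift U (\<lambda>s t. g x (q \<cdot> s) (\<phi> p \<cdot> y \<cdot> t)) R) K) R"
    by (rule tlift_R_twist[OF U]) (intro bilinI gl; simp)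
  also have "\<dots> = tlift U (\<lambda>p q. tlift U (\<lambda>x y. tlift U (\<lambda>s t. g x (q \<cdot> s) (\<phi> p \<cdot> y \<cdot> t)) R) K0) R"
    by (rule tlift_cong[OF refl], rule restrict(2)[OF K_BH U, symmetric]) (intro bilinI gl; simp)
  also have "\<dots> = tlift U (\<lambda>p q. tlift U (\<lambda>x y. tlift U (\<lambda>s t. f x (q \<cdot> s) (\<phi> p \<cdot> y \<cdot> t)) R) K0) R"
    unfolding g_def by (intro tlift_cong refl) (simp add: retract(2))
  finally show ?thesis .
qed

text \<open>Four factors are peeled off from the right: \<open>G\<close> absorbs \<open>K12\<close>,
  then \<open>J\<close> absorbs the twisted \<open>R23\<close>, and what remains is
  \<open>R32 K13\<close>. The two copies of \<open>K\<close> meet in the first argument, as a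
  product in \<open>B\<close>.\<close>

lemma K_hex2:
  "tlift U (\<lambda>a c. tlift U (\<lambda>c1 c2. f a c1 c2) (\<Delta> c)) K0 =
   tlift U (\<lambda>p q. tlift U (\<lambda>x y. tlift U (\<lambda>s t. tlift U (\<lambda>x' y'.
     f (x \<cdot> x') (q \<cdot> \<phi> s \<cdot> y') (p \<cdot> y \<cdot> t)) K0) R) K0) R"
proof -
  define g where "g = (\<lambda>a b c. f (retract a) b c)"
  have g: "trilin k H H H U g" unfolding g_def by (rule trilin_retract[OF f])
  note fl = klin_tlift_fun[OF U] klin_tri1[OF f] klin_tri2[OF f] klin_tri3[OF f] klin_retract linH klin_phi
  note gl = klin_tlift_fun[OF U] klin_tri1[OF g] klin_tri2[OF g] klin_tri3[OF g] linH klin_phi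
  let ?T = "R_twist k H \<phi> R"
  have TL: "?T \<in> pairs H H" by (rule tens_L[OF module_H module_H R_twist_cl])
  note Ls = leg32_L[OF R_pairs] leg13_L[OF K_L(1)] leg23_L[OF TL] leg12_L[OF K_cl(1)] mult3_L
  define G where "G = (\<lambda>a b c. tlift3 U (\<lambda>a' b' c'. g (a \<cdot> a') (b \<cdot> b') (c \<cdot> c')) (leg12 k H K))"
  have G: "trilin k H H H U G" unfolding G_def by (rule trilin_tlift3[OF g U Ls(4)])
  define J where "J = (\<lambda>a b c. tlift3 U (\<lambda>a' b' c'. G (a \<cdot> a') (b \<cdot> b') (c \<cdot> c')) (leg23 k H ?T))"
  have J: "trilin k H H H U J" unfolding J_def by (rule trilin_tlift3[OF G U Ls(3)])
  note Gl = klin_tlift_fun[OF U] klin_tri1[OF G] klin_tri2[OF G] klin_tri3[OF G] linH klin_phi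
  have "tlift U (\<lambda>a c. tlift U (\<lambda>c1 c2. f a c1 c2) (\<Delta> c)) K0 = tlift U (\<lambda>a c. tlift U (\<lambda>c1 c2. g a c1 c2) (\<Delta> c)) K0"
    unfolding g_def by (intro tlift_cong refl) (simp add: retract(2))
  also have "\<dots> = tlift U (\<lambda>a c. tlift U (\<lambda>c1 c2. g a c1 c2) (\<Delta> c)) K"
    by (rule restrict(2)[OF K_BH U]) (intro bilinI gl klin_comult[OF U]; simp)
  also have "\<dots> = tlift3 U g (leg32 k H R \<otimes>\<^bsub>tensor3 k H\<^esub> leg13 k H K \<otimes>\<^bsub>tensor3 k H\<^esub> leg23 k H ?T \<otimes>\<^bsub>tensor3 k H\<^esub> leg12 k H K)"
    using tlift3_comult_right[OF U g K_L(1)] K_universal by (simp add: universal_K_matrix_def)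
  also have "\<dots> = tlift3 U G (leg32 k H R \<otimes>\<^bsub>tensor3 k H\<^esub> leg13 k H K \<otimes>\<^bsub>tensor3 k H\<^esub> leg23 k H ?T)"
    unfolding G_def by (rule tlift3_mult[OF U g mult3_L[OF mult3_L[OF Ls(1,2)] Ls(3)] Ls(4)])
  also have "\<dots> = tlift3 U J (leg32 k H R \<otimes>\<^bsub>tensor3 k H\<^esub> leg13 k H K)"
    unfolding J_def by (rule tlift3_mult[OF U G mult3_L[OF Ls(1,2)] Ls(3)])
  also have "\<dots> = tlift U (\<lambda>p q. tlift3 U (\<lambda>a' b' c'. J (\<one>\<^bsub>H\<^esub> \<cdot> a') (q \<cdot> b') (p \<cdot> c')) (leg13 k H K)) R"
    by (simp add: tlift3_mult[OF U J Ls(1,2)] tlift3_leg32[OF U trilin_tlift3[OF J U Ls(2)] R_pairs])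
  also have "\<dots> = tlift U (\<lambda>p q. tlift U (\<lambda>x y. J x q (p \<cdot> y)) K) R"
    by (rule tlift_cong[OF refl]) (simp add: tlift3_leg13[OF U trilin_shift[OF J] K_L(1)])
  also have "\<dots> = tlift U (\<lambda>p q. tlift U (\<lambda>x y. tlift U (\<lambda>s t. G x (q \<cdot> s) (p \<cdot> y \<cdot> t)) ?T) K) R"
    unfolding J_def
    by (intro tlift_cong refl) (use pairsD[OF TL] in \<open>simp add: tlift3_leg23[OF U trilin_shift[OF G] TL]\<close>)
  also have "\<dots> = tlift U (\<lambda>p q. tlift U (\<lambda>x y. tlift U (\<lambda>s t. G x (q \<cdot> \<phi> s) (p \<cdot> y \<cdot> t)) R) K) R"
    by (rule tlift_cong[OF refl], rule tlift_cong[OF refl], rule tlift_R_twist[OF U]) (intro bilinI Gl; simp)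
  also have "\<dots> = tlift U (\<lambda>p q. tlift U (\<lambda>x y. tlift U (\<lambda>s t. tlift U (\<lambda>x' y'.
     g (x \<cdot> x') (q \<cdot> \<phi> s \<cdot> y') (p \<cdot> y \<cdot> t)) K) R) K) R"
    unfolding G_def
    by (intro tlift_cong refl) (simp add: tlift3_leg12[OF U trilin_shift[OF g] K_cl(1)])
  also have "\<dots> = tlift U (\<lambda>p q. tlift U (\<lambda>x y. tlift U (\<lambda>s t. tlift U (\<lambda>x' y'.
     g (x \<cdot> x') (q \<cdot> \<phi> s \<cdot> y') (p \<cdot> y \<cdot> t)) K0) R) K) R"
    by (rule tlift_cong[OF refl], rule tlift_cong[OF refl], rule tlift_cong[OF refl],
        rule restrict(2)[OF K_BH U, symmetric]) (intro bilinI gl; simp)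
  also have "\<dots> = tlift U (\<lambda>p q. tlift U (\<lambda>x y. tlift U (\<lambda>s t. tlift U (\<lambda>x' y'.
     g (x \<cdot> x') (q \<cdot> \<phi> s \<cdot> y') (p \<cdot> y \<cdot> t)) K0) R) K0) R"
    by (rule tlift_cong[OF refl], rule restrict(2)[OF K_BH U, symmetric]) (intro bilinI gl; simp)
  also have "\<dots> = tlift U (\<lambda>p q. tlift U (\<lambda>x y. tlift U (\<lambda>s t. tlift U (\<lambda>x' y'.
     f (x \<cdot> x') (q \<cdot> \<phi> s \<cdot> y') (p \<cdot> y \<cdot> t)) K0) R) K0) R"
    unfolding g_def by (intro tlift_cong refl) (simp add: retract(2) B_ring)
  finally show ?thesis .
qed

end

end

section \<open>Tensor products of modules\<close>

text \<open>
  Twisting by \<open>\<phi>\<close> and changing \<open>\<delta>\<close> alter only the action of a module; tensor products of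
  elements depend only on the linear structure.
\<close>

definition lineq :: "('k, 'a, 'x) module_scheme \<Rightarrow> ('k, 'a, 'y) module_scheme \<Rightarrow> bool" where
  "lineq V V' \<longleftrightarrow> carrier V = carrier V' \<and> add V = add V' \<and> zero V = zero V' \<and> smult V = smult V'"

lemma lineq_refl [simp]: "lineq V V" by (simp add: lineq_def)

lemma teq_lineq:
  assumes "teq k V W xs ys" "lineq V V'" "lineq W W'"
  shows "teq k V' W' xs ys"
  using assms(1)
proof induction
  case (teq_refl xs) then show ?case using assms(2,3) by (auto simp: lineq_def intro: teq.teq_refl)
next
  case (teq_sym xs ys) then show ?case by (rule_tac teq.teq_sym)
next
  case (teq_trans xs ys zs) then show ?case by (rule_tac teq.teq_trans)
next
  case (teq_append xs xs' ys ys') then show ?case by (simp add: teq.teq_append)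
next
  case (teq_commute xs ys) then show ?case using assms(2,3) by (auto simp: lineq_def intro: teq.teq_commute)
next
  case (teq_add_left x x' y)
  then show ?case using teq.teq_add_left[of x V' x' y W' k] assms(2,3) by (simp add: lineq_def)
next
  case (teq_add_right x y y')
  then show ?case using teq.teq_add_right[of x V' y W' y' k] assms(2,3) by (simp add: lineq_def)
next
  case (teq_smult c x y)
  then show ?case using teq.teq_smult[of c k x V' y W'] assms(2,3) by (simp add: lineq_def)
next
  case (teq_zero y)
  then show ?case using teq.teq_zero[of y W' k V'] assms(2,3) by (simp add: lineq_def)
qed

lemma lineq_sym: "lineq V V' \<Longrightarrow> lineq V' V" by (simp add: lineq_def)

text \<open>Since \<open>teq\<close> sees only the linear structure, the predicate under
  \<open>SOME\<close> is the same on both sides; so even the chosen representatives agree, and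
  tensor products of twisted modules have literally the same elements.\<close>

lemma tnf_lineq: "lineq V V' \<Longrightarrow> lineq W W' \<Longrightarrow> tnf k V W xs = tnf k V' W' xs"
proof -
  assume l: "lineq V V'" "lineq W W'"
  have "teq k V W xs = teq k V' W' xs"
    by (intro ext iffI) (erule teq_lineq[OF _ l] teq_lineq[OF _ lineq_sym[OF l(1)] lineq_sym[OF l(2)]])+
  then show ?thesis by (simp add: tnf_def)
qed

lemma pure_lineq: "lineq V V' \<Longrightarrow> lineq W W' \<Longrightarrow> pure k V W x y = pure k V' W' x y"
  by (simp add: pure_def tnf_lineq)

text \<open>The two coactions are unrelated because they enter only the action.\<close>

lemma lineq_mod_tensor: "lineq X X' \<Longrightarrow> lineq Y Y' \<Longrightarrow> lineq (mod_tensor k \<delta> X Y) (mod_tensor k \<delta>' X' Y')"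
  unfolding lineq_def mod_tensor_def tensor_def
  using tnf_lineq[of X X' Y Y'] by (simp add: lineq_def)

lemma klin_lineq: "lineq V V' \<Longrightarrow> lineq W W' \<Longrightarrow> klin k V W = klin k V' W'"
  by (simp add: klin_def lineq_def)

lemma tlift_lineq: "lineq U U' \<Longrightarrow> tlift U f t = tlift U' f t"
  by (simp add: tlift_def lineq_def)

lemma lineq_twist: "lineq (twist \<phi> X) X" "lineq X (twist \<phi> X)"
  by (simp_all add: lineq_def twist_def)

definition tp :: "'k ring \<Rightarrow> ('k, 'h, 'a) mob \<Rightarrow> ('k, 'h, 'a) mob \<Rightarrow> ('k, 'a) univ \<Rightarrow> ('k, 'a) univ \<Rightarrow> ('k, 'a) univ" where
  "tp k X Y x y = Tens (pure k X Y x y)"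

definition mlift :: "('u, 'z) ring_scheme \<Rightarrow> (('k, 'a) univ \<Rightarrow> ('k, 'a) univ \<Rightarrow> 'u) \<Rightarrow> ('k, 'a) univ \<Rightarrow> 'u" where
  "mlift U f u = tlift U f (untens u)"

lemma tp_lineq: "lineq X X' \<Longrightarrow> lineq Y Y' \<Longrightarrow> tp k X Y = tp k X' Y'"
  by (intro ext) (simp add: tp_def pure_lineq)

section \<open>Tensor products inside the type \<open>univ\<close>\<close>

context over_field
begin

context
  fixes X Y :: "('k, 'h, 'a) mob" and \<delta> :: "'h \<Rightarrow> ('h \<times> 'h) list"
  assumes X: "module k X" and Y: "module k Y"
begin

interpretation T: module k "tensor k X Y" by (rule module_tensor[OF X Y])

lemma Tens_iso: "Tens \<in> klin k (tensor k X Y) (mod_tensor k \<delta> X Y)"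
  by (rule klinI) (auto simp: mod_tensor_def)

lemma untens_iso: "untens \<in> klin k (mod_tensor k \<delta> X Y) (tensor k X Y)"
  by (rule klinI) (auto simp: mod_tensor_def)

lemma module_mod_tensor: "module k (mod_tensor k \<delta> X Y)"
proof (rule moduleI)
  show "abelian_group (mod_tensor k \<delta> X Y)"
  proof (rule abelian_groupI)
    fix x assume "x \<in> carrier (mod_tensor k \<delta> X Y)"
    then obtain t where t: "t \<in> carrier (tensor k X Y)" "x = Tens t" by (auto simp: mod_tensor_def)
    then show "\<exists>y\<in>carrier (mod_tensor k \<delta> X Y). y \<oplus>\<^bsub>mod_tensor k \<delta> X Y\<^esub> x = \<zero>\<^bsub>mod_tensor k \<delta> X Y\<^esub>"
      by (intro bexI[of _ "Tens (\<ominus>\<^bsub>tensor k X Y\<^esub> t)"]) (auto simp: mod_tensor_def T.M.l_neg)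
  qed (auto simp: mod_tensor_def T.M.a_ac)
qed (auto simp: mod_tensor_def cring_k T.smult_l_distr T.smult_r_distr T.smult_assoc1)

lemma bilin_tp: "bilin k X Y (mod_tensor k \<delta> X Y) (tp k X Y)"
  unfolding tp_def
  by (intro bilinI klin_comp[OF Tens_iso] klin_pure1[OF X Y] klin_pure2[OF X Y] klin_id)

lemma tp_cl [simp]: "x \<in> carrier X \<Longrightarrow> y \<in> carrier Y \<Longrightarrow> tp k X Y x y \<in> carrier (mod_tensor k \<delta> X Y)"
  using bilin_cl[OF bilin_tp] .

lemma klin_tp1: "y \<in> carrier Y \<Longrightarrow> g \<in> klin k Z X \<Longrightarrow> (\<lambda>v. tp k X Y (g v) y) \<in> klin k Z (mod_tensor k \<delta> X Y)"
  using klin_bil1[OF bilin_tp] .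

lemma klin_tp2: "x \<in> carrier X \<Longrightarrow> g \<in> klin k Z Y \<Longrightarrow> (\<lambda>v. tp k X Y x (g v)) \<in> klin k Z (mod_tensor k \<delta> X Y)"
  using klin_bil2[OF bilin_tp] .

text \<open>Most structure maps are defined as \<open>Tens\<close> of the normal form of an explicit
  list; as a sum of pure tensors such a value is accessible to linear maps.\<close>

lemma Tens_tnf:
  assumes "xs \<in> pairs X Y"
  shows "Tens (tnf k X Y xs) = tlift (mod_tensor k \<delta> X Y) (tp k X Y) xs"
proof -
  have "Tens (tnf k X Y xs) = Tens (tlift (tensor k X Y) (pure k X Y) xs)"
    by (simp add: tnf_tlift[OF X Y assms])
  also have "\<dots> = tlift (mod_tensor k \<delta> X Y) (\<lambda>a b. Tens (pure k X Y a b)) xs"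
    by (rule klin_tlift[OF Tens_iso module_tensor[OF X Y] module_mod_tensor]) (use assms in \<open>auto intro!: pure_cl[OF X Y]\<close>)
  finally show ?thesis unfolding tp_def .
qed

lemma mlift_klin:
  assumes "module k U" "bilin k X Y U f"
  shows "mlift U f \<in> klin k (mod_tensor k \<delta> X Y) U"
  unfolding mlift_def by (rule klin_comp[OF tlift_klin[OF X Y assms] untens_iso])

lemma mlift_tp:
  assumes "module k U" "bilin k X Y U f" "x \<in> carrier X" "y \<in> carrier Y"
  shows "mlift U f (tp k X Y x y) = f x y"
  unfolding mlift_def tp_def by (simp add: tlift_pure[OF X Y assms])

lemma mod_tensor_pairs: "u \<in> carrier (mod_tensor k \<delta> X Y) \<Longrightarrow> untens u \<in> pairs X Y"
  using tens_L[OF X Y] klin_cl[OF untens_iso] by blast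

lemma mod_tensor_ext:
  assumes "module k U" "f \<in> klin k (mod_tensor k \<delta> X Y) U" "g \<in> klin k (mod_tensor k \<delta> X Y) U"
    "\<And>x y. x \<in> carrier X \<Longrightarrow> y \<in> carrier Y \<Longrightarrow> f (tp k X Y x y) = g (tp k X Y x y)"
    "u \<in> carrier (mod_tensor k \<delta> X Y)"
  shows "f u = g u"
proof -
  obtain t where t: "t \<in> carrier (tensor k X Y)" "u = Tens t" using assms(5) by (auto simp: mod_tensor_def)
  have "f (Tens t) = g (Tens t)"
    by (rule tens_ext[OF X Y assms(1) klin_comp[OF assms(2) Tens_iso] klin_comp[OF assms(3) Tens_iso] _ t(1)])
      (use assms(4) in \<open>auto simp: tp_def\<close>)
  then show ?thesis using t by simp
qed

end

end

section \<open>Modules over an algebra\<close>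

context over_field
begin

lemma amodule_module: "amodule k A X \<Longrightarrow> module k X"
  by (simp add: amodule_def)

lemma act_bil: "amodule k A X \<Longrightarrow> bilin k A X X (act X)"
  unfolding amodule_def by (intro bilinI klinI) (auto intro: klin_cl klin_add klin_smult)

lemma act_cl: "amodule k A X \<Longrightarrow> a \<in> carrier A \<Longrightarrow> x \<in> carrier X \<Longrightarrow> act X a x \<in> carrier X"
  using bilin_cl[OF act_bil] .

lemma act_mult: "amodule k A X \<Longrightarrow> a \<in> carrier A \<Longrightarrow> b \<in> carrier A \<Longrightarrow> x \<in> carrier X \<Longrightarrow>
    act X (a \<otimes>\<^bsub>A\<^esub> b) x = act X a (act X b x)"
  and act_one: "amodule k A X \<Longrightarrow> x \<in> carrier X \<Longrightarrow> act X \<one>\<^bsub>A\<^esub> x = x"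
  by (auto simp: amodule_def)

lemma amoduleI:
  assumes "module k X" "bilin k A X X (act X)"
    and "\<And>a b x. a \<in> carrier A \<Longrightarrow> b \<in> carrier A \<Longrightarrow> x \<in> carrier X \<Longrightarrow> act X (a \<otimes>\<^bsub>A\<^esub> b) x = act X a (act X b x)"
    and "\<And>x. x \<in> carrier X \<Longrightarrow> act X \<one>\<^bsub>A\<^esub> x = x"
  shows "amodule k A X"
  using assms bilinD1[OF assms(2)] klin_add[OF bilinD2[OF assms(2)]] klin_smult[OF bilinD2[OF assms(2)]]
  by (simp add: amodule_def)

lemma klin_act1: "amodule k A X \<Longrightarrow> x \<in> carrier X \<Longrightarrow> g \<in> klin k Z A \<Longrightarrow> (\<lambda>v. act X (g v) x) \<in> klin k Z X"
  using klin_bil1[OF act_bil] .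

lemma klin_act2: "amodule k A X \<Longrightarrow> a \<in> carrier A \<Longrightarrow> g \<in> klin k Z X \<Longrightarrow> (\<lambda>v. act X a (g v)) \<in> klin k Z X"
  using klin_bil2[OF act_bil] .

section \<open>Finite dimension of tensor products\<close>

definition lin_span :: "('k, 'a, 'z) module_scheme \<Rightarrow> 'a set \<Rightarrow> 'a set" where
  "lin_span V S = {finsum V (\<lambda>s. c s \<odot>\<^bsub>V\<^esub> s) S | c. c \<in> S \<rightarrow> carrier k}"

lemma fin_dim_lin_span: "fin_dim k V \<longleftrightarrow> (\<exists>S. finite S \<and> S \<subseteq> carrier V \<and> carrier V \<subseteq> lin_span V S)"
  unfolding fin_dim_def lin_span_def by (intro iff_exI conj_cong refl) blast

context
  fixes V :: "('k, 'a, 'z) module_scheme" and S :: "'a set"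
  assumes V: "module k V" and S: "finite S" "S \<subseteq> carrier V"
begin

interpretation V: module k V by (rule V)

lemma lin_span_term: "c \<in> S \<rightarrow> carrier k \<Longrightarrow> (\<lambda>s. c s \<odot>\<^bsub>V\<^esub> s) \<in> S \<rightarrow> carrier V"
  using S by auto

lemma subspace_lin_span: "subspace V (lin_span V S)"
  unfolding subspace_def
proof (intro conjI ballI)
  show "lin_span V S \<subseteq> carrier V" unfolding lin_span_def using lin_span_term by auto
  have "finsum V (\<lambda>s. \<zero>\<^bsub>k\<^esub> \<odot>\<^bsub>V\<^esub> s) S = finsum V (\<lambda>s. \<zero>\<^bsub>V\<^esub>) S"
    using S by (intro V.M.finsum_cong') auto
  then show "\<zero>\<^bsub>V\<^esub> \<in> lin_span V S"
    unfolding lin_span_def by (auto intro!: exI[of _ "\<lambda>s. \<zero>\<^bsub>k\<^esub>"])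
  fix x assume "x \<in> lin_span V S"
  then obtain c where c: "c \<in> S \<rightarrow> carrier k" "x = finsum V (\<lambda>s. c s \<odot>\<^bsub>V\<^esub> s) S" by (auto simp: lin_span_def)
  show "a \<odot>\<^bsub>V\<^esub> x \<in> lin_span V S" if a: "a \<in> carrier k" for a
  proof -
    have "a \<odot>\<^bsub>V\<^esub> x = finsum V (\<lambda>s. a \<odot>\<^bsub>V\<^esub> (c s \<odot>\<^bsub>V\<^esub> s)) S"
      unfolding c(2) using V.finsum_smult_ldistr[OF S(1) a] lin_span_term[OF c(1)] by simp
    also have "\<dots> = finsum V (\<lambda>s. (a \<otimes>\<^bsub>k\<^esub> c s) \<odot>\<^bsub>V\<^esub> s) S"
      using S a c by (intro V.M.finsum_cong') (auto simp: V.smult_assoc1 Pi_iff subset_iff)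
    finally show ?thesis using a c(1) unfolding lin_span_def by (auto intro!: exI[of _ "\<lambda>s. a \<otimes>\<^bsub>k\<^esub> c s"])
  qed
  fix y assume "y \<in> lin_span V S"
  then obtain d where d: "d \<in> S \<rightarrow> carrier k" "y = finsum V (\<lambda>s. d s \<odot>\<^bsub>V\<^esub> s) S" by (auto simp: lin_span_def)
  have "x \<oplus>\<^bsub>V\<^esub> y = finsum V (\<lambda>s. c s \<odot>\<^bsub>V\<^esub> s \<oplus>\<^bsub>V\<^esub> d s \<odot>\<^bsub>V\<^esub> s) S"
    unfolding c(2) d(2) using V.M.finsum_addf[OF lin_span_term[OF c(1)] lin_span_term[OF d(1)]] by simp
  also have "\<dots> = finsum V (\<lambda>s. (c s \<oplus>\<^bsub>k\<^esub> d s) \<odot>\<^bsub>V\<^esub> s) S"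
    using S c d by (intro V.M.finsum_cong') (auto simp: V.smult_l_distr Pi_iff subset_iff)
  finally show "x \<oplus>\<^bsub>V\<^esub> y \<in> lin_span V S"
    using c(1) d(1) unfolding lin_span_def by (auto intro!: exI[of _ "\<lambda>s. c s \<oplus>\<^bsub>k\<^esub> d s"])
qed

lemma lin_span_superset: "s \<in> S \<Longrightarrow> s \<in> lin_span V S"
proof -
  assume s: "s \<in> S"
  have "finsum V (\<lambda>j. (if s = j then \<one>\<^bsub>k\<^esub> else \<zero>\<^bsub>k\<^esub>) \<odot>\<^bsub>V\<^esub> j) S = finsum V (\<lambda>j. if s = j then j else \<zero>\<^bsub>V\<^esub>) S"
    using S by (intro V.M.finsum_cong') auto
  also have "\<dots> = s" using V.M.finsum_singleton[OF s S(1), of "\<lambda>j. j"] S by auto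
  finally show ?thesis unfolding lin_span_def by (auto intro!: exI[of _ "\<lambda>j. if s = j then \<one>\<^bsub>k\<^esub> else \<zero>\<^bsub>k\<^esub>"])
qed

text \<open>Spanning is handled through subspaces, so that no double sums of coefficients have to be
  written out: it is enough to map the generators into \<open>P\<close>.\<close>

lemma klin_lin_span:
  assumes W: "module k W" and g: "g \<in> klin k V W" and P: "subspace W P" and gS: "\<And>s. s \<in> S \<Longrightarrow> g s \<in> P"
    and x: "x \<in> lin_span V S"
  shows "g x \<in> P"
proof -
  obtain c where c: "c \<in> S \<rightarrow> carrier k" "x = finsum V (\<lambda>s. c s \<odot>\<^bsub>V\<^esub> s) S" using x by (auto simp: lin_span_def)
  have "S' \<subseteq> S \<Longrightarrow> g (finsum V (\<lambda>s. c s \<odot>\<^bsub>V\<^esub> s) S') \<in> P" if "finite S'" for S'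
    using that
  proof (induction S' rule: finite_induct)
    case empty
    then show ?case using klin_zero[OF V W g] P by (simp add: subspace_def)
  next
    case (insert s S')
    have cs: "c s \<in> carrier k" "s \<in> carrier V" "g s \<in> P" using insert.prems c(1) S gS by auto
    have t: "(\<lambda>s. c s \<odot>\<^bsub>V\<^esub> s) \<in> S' \<rightarrow> carrier V" using lin_span_term[OF c(1)] insert.prems by auto
    then have "g (finsum V (\<lambda>s. c s \<odot>\<^bsub>V\<^esub> s) (insert s S')) = c s \<odot>\<^bsub>W\<^esub> g s \<oplus>\<^bsub>W\<^esub> g (finsum V (\<lambda>s. c s \<odot>\<^bsub>V\<^esub> s) S')"
      using insert.hyps cs by (simp add: klin_add[OF g] klin_smult[OF g])
    moreover have "g (finsum V (\<lambda>s. c s \<odot>\<^bsub>V\<^esub> s) S') \<in> P" using insert by auto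
    ultimately show ?case using P cs unfolding subspace_def by auto
  qed
  then show ?thesis using S c(2) by auto
qed

end

lemma tlift_subspace: "subspace U P \<Longrightarrow> (\<And>a b. (a, b) \<in> set t \<Longrightarrow> f a b \<in> P) \<Longrightarrow> tlift U f t \<in> P"
  by (induction t) (auto simp: tlift_Cons subspace_def)

text \<open>With \<open>y\<close> fixed, linearity in the first factor reduces \<open>x\<close> to a
  generator; with that generator fixed, linearity in the second factor reduces \<open>y\<close>. So
  the pure tensors of generators span.\<close>

lemma fin_dim_mod_tensor:
  fixes X Y :: "('k, 'h, 'a) mob"
  assumes X: "module k X" "fin_dim k X" and Y: "module k Y" "fin_dim k Y"
  shows "fin_dim k (mod_tensor k \<delta> X Y)"
proof -
  let ?T = "mod_tensor k \<delta> X Y"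
  note mT = module_mod_tensor[OF X(1) Y(1), of \<delta>]
  obtain S where S: "finite S" "S \<subseteq> carrier X" "carrier X \<subseteq> lin_span X S" using X(2) by (auto simp: fin_dim_lin_span)
  obtain S' where S': "finite S'" "S' \<subseteq> carrier Y" "carrier Y \<subseteq> lin_span Y S'" using Y(2) by (auto simp: fin_dim_lin_span)
  define Q where "Q = (\<lambda>(x, y). tp k X Y x y) ` (S \<times> S')"
  have Q: "finite Q" "Q \<subseteq> carrier ?T"
    using S S' by (auto simp: Q_def intro!: tp_cl[OF X(1) Y(1)])
  note sQ = subspace_lin_span[OF mT Q]
  have tpQ: "tp k X Y x y \<in> lin_span ?T Q" if x: "x \<in> carrier X" and y: "y \<in> carrier Y" for x y
  proof (rule klin_lin_span[OF X(1) S(1,2) mT klin_tp1[OF X(1) Y(1) y klin_id] sQ])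
    show "x \<in> lin_span X S" using S(3) x by blast
    fix s assume s: "s \<in> S"
    show "tp k X Y s y \<in> lin_span ?T Q"
    proof (rule klin_lin_span[OF Y(1) S'(1,2) mT klin_tp2[OF X(1) Y(1) _ klin_id] sQ])
      show "s \<in> carrier X" using s S by blast
      show "y \<in> lin_span Y S'" using S' y by blast
      show "tp k X Y s s' \<in> lin_span ?T Q" if "s' \<in> S'" for s'
        by (rule lin_span_superset[OF mT Q]) (use s that in \<open>auto simp: Q_def\<close>)
    qed
  qed
  have "carrier ?T \<subseteq> lin_span ?T Q"
  proof
    fix u assume "u \<in> carrier ?T"
    then obtain t where t: "t \<in> carrier (tensor k X Y)" "u = Tens t" by (auto simp: mod_tensor_def)
    have tL: "t \<in> pairs X Y" by (rule tens_L[OF X(1) Y(1) t(1)])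
    have "u = tlift ?T (tp k X Y) t"
      using Tens_tnf[OF X(1) Y(1) tL] tens_tnf[OF X(1) Y(1) t(1)] t(2) by simp
    then show "u \<in> lin_span ?T Q" using tlift_subspace[OF sQ] tpQ pairsD[OF tL] by metis
  qed
  then show ?thesis using Q fin_dim_lin_span by blast
qed

end

section \<open>The action of tensors of algebra elements, and the unit object\<close>

context hopf_alg
begin

text \<open>Fubini moves the sum over the module element outside the sum over \<open>t\<close>; in
  this order the action is the linear map induced by a bilinear one.\<close>

lemma tact_mlift:
  fixes A :: "('k, 'h) hopf" and M X :: "('k, 'h, 'a) mob"
  assumes M: "amodule k A M" and X: "amodule k H X" and t: "t \<in> pairs A H"
    and u: "u \<in> carrier (mod_tensor k \<delta> M X)"
  shows "tact k M X t u = mlift (mod_tensor k \<delta> M X)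
    (\<lambda>x y. tlift (mod_tensor k \<delta> M X) (\<lambda>h h'. tp k M X (act M h x) (act X h' y)) t) u"
proof -
  note mM = amodule_module[OF M] and mX = amodule_module[OF X]
  let ?T = "mod_tensor k \<delta> M X"
  note mT = module_mod_tensor[OF mM mX, of \<delta>]
  have uL: "untens u \<in> pairs M X" by (rule mod_tensor_pairs[OF mM mX u])
  let ?g = "\<lambda>p q. (act M (fst p) (fst q), act X (snd p) (snd q))"
  have cl: "act M h x \<in> carrier M \<and> act X h' y \<in> carrier X"
    if "(h, h') \<in> set t" "(x, y) \<in> set (untens u)" for h h' x y
    using pairsD[OF t that(1)] pairsD[OF uL that(2)] act_cl[OF M] act_cl[OF X] by blast
  have eq: "(\<lambda>((h, h'), (x, y)). (act M h x, act X h' y)) = (\<lambda>(p, q). ?g p q)"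
    by (auto simp: fun_eq_iff)
  have gL: "map (\<lambda>(p, q). ?g p q) (List.product t (untens u)) \<in> pairs M X"
    by (rule pairsI) (use cl in auto)
  have "tact k M X t u = tlift ?T (tp k M X) (map (\<lambda>(p, q). ?g p q) (List.product t (untens u)))"
    unfolding tact_def eq by (rule Tens_tnf[OF mM mX gL])
  also have "\<dots> = tlift ?T (\<lambda>h h'. tlift ?T (\<lambda>x y. tp k M X (act M h x) (act X h' y)) (untens u)) t"
    by (subst tlift_product[OF mT]) (use cl in \<open>auto intro!: tp_cl[OF mM mX]\<close>)
  also have "\<dots> = tlift ?T (\<lambda>x y. tlift ?T (\<lambda>h h'. tp k M X (act M h x) (act X h' y)) t) (untens u)"
    by (rule tlift_Fubini[OF mT]) (use cl in \<open>auto intro!: tp_cl[OF mM mX]\<close>)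
  finally show ?thesis by (simp add: mlift_def)
qed

context
  fixes A :: "('k, 'h) hopf" and M X :: "('k, 'h, 'a) mob" and t :: "('h \<times> 'h) list" and \<delta> :: "'h \<Rightarrow> ('h \<times> 'h) list"
  assumes M: "amodule k A M" and X: "amodule k H X" and t: "t \<in> pairs A H"
begin

lemma bilin_tact:
  "bilin k M X (mod_tensor k \<delta> M X) (\<lambda>x y. tlift (mod_tensor k \<delta> M X) (\<lambda>h h'. tp k M X (act M h x) (act X h' y)) t)"
  using pairsD[OF t]
  by (intro bilinI klin_tlift_fun module_mod_tensor amodule_module[OF M] amodule_module[OF X] klin_tp1 klin_tp2
      klin_act2[OF M] klin_act2[OF X] act_cl[OF M] act_cl[OF X] klin_id) blast+

lemma tact_klin: "tact k M X t \<in> klin k (mod_tensor k \<delta> M X) (mod_tensor k \<delta> M X)"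
  by (rule klin_cong[OF _ mlift_klin[OF _ _ _ bilin_tact]])
    (simp_all add: module_mod_tensor amodule_module[OF M] amodule_module[OF X] tact_mlift[OF M X t])

lemma tact_tp: "x \<in> carrier M \<Longrightarrow> y \<in> carrier X \<Longrightarrow> tact k M X t (tp k M X x y) =
    tlift (mod_tensor k \<delta> M X) (\<lambda>h h'. tp k M X (act M h x) (act X h' y)) t"
  using mlift_tp[OF amodule_module[OF M] amodule_module[OF X] module_mod_tensor[OF amodule_module[OF M] amodule_module[OF X]] bilin_tact]
    tact_mlift[OF M X t tp_cl[OF amodule_module[OF M] amodule_module[OF X]]] by simp

end

lemma mod_unit_module: "module k (mod_unit k H :: ('k, 'h, 'a) mob)"
proof -
  interpret K: cring k by (rule cring_k)
  show ?thesis
  proof (rule moduleI)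
  show "abelian_group (mod_unit k H :: ('k, 'h, 'a) mob)"
  proof (rule abelian_groupI)
    fix x :: "('k, 'a) univ" assume "x \<in> carrier (mod_unit k H :: ('k, 'h, 'a) mob)"
    then obtain c where "c \<in> carrier k" "x = Scal c" by (auto simp: mod_unit_def)
    then show "\<exists>y\<in>carrier (mod_unit k H :: ('k, 'h, 'a) mob). y \<oplus>\<^bsub>mod_unit k H :: ('k, 'h, 'a) mob\<^esub> x = \<zero>\<^bsub>mod_unit k H :: ('k, 'h, 'a) mob\<^esub>"
      by (intro bexI[of _ "Scal (\<ominus>\<^bsub>k\<^esub> c)"]) (auto simp: mod_unit_def K.l_neg)
  qed (auto simp: mod_unit_def K.a_ac)
  show "cring k" by (rule cring_k)
  qed (auto simp: mod_unit_def K.l_distr K.r_distr K.m_assoc)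
qed

text \<open>Formulated for any \<open>A\<close> that shares the operations of \<open>H\<close> on a
  smaller carrier, in order to cover both the tensor unit over \<open>H\<close> and the
  distinguished object over \<open>B\<close>.\<close>

lemma mod_unit_amodule:
  fixes A :: "('k, 'h) hopf"
  assumes "carrier A \<subseteq> carrier H" "mult A = mult H" "one A = one H" "add A = add H" "smult A = smult H"
  shows "amodule k A (mod_unit k H :: ('k, 'h, 'a) mob)"
proof (rule amoduleI[OF mod_unit_module])
  interpret K: cring k by (rule cring_k)
  have AH: "\<And>a. a \<in> carrier A \<Longrightarrow> a \<in> carrier H" using assms(1) by blast
  show "bilin k A (mod_unit k H) (mod_unit k H) (act (mod_unit k H :: ('k, 'h, 'a) mob))"
    by (intro bilinI klinI)
      (auto simp: mod_unit_def assms(2-) AH counit_add counit_smult K.r_distr K.l_distr K.m_ac)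
  fix a b and x :: "('k, 'a) univ" assume "a \<in> carrier A" "b \<in> carrier A" "x \<in> carrier (mod_unit k H :: ('k, 'h, 'a) mob)"
  then show "act (mod_unit k H :: ('k, 'h, 'a) mob) (a \<otimes>\<^bsub>A\<^esub> b) x = act (mod_unit k H :: ('k, 'h, 'a) mob) a (act (mod_unit k H :: ('k, 'h, 'a) mob) b x)"
    by (auto simp: mod_unit_def assms(2-) AH counit_mult K.m_assoc)
next
  interpret K: cring k by (rule cring_k)
  fix x :: "('k, 'a) univ" assume "x \<in> carrier (mod_unit k H :: ('k, 'h, 'a) mob)"
  then show "act (mod_unit k H :: ('k, 'h, 'a) mob) \<one>\<^bsub>A\<^esub> x = x" by (auto simp: mod_unit_def assms(2-))
qed

lemma mod_unit_fin_dim: "fin_dim k (mod_unit k H :: ('k, 'h, 'a) mob)"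
proof -
  let ?U = "mod_unit k H :: ('k, 'h, 'a) mob"
  have S: "finite {Scal \<one>\<^bsub>k\<^esub>}" "{Scal \<one>\<^bsub>k\<^esub>} \<subseteq> carrier ?U" by (auto simp: mod_unit_def)
  have "carrier ?U \<subseteq> lin_span ?U {Scal \<one>\<^bsub>k\<^esub>}"
  proof
    fix x assume "x \<in> carrier ?U"
    then obtain c where c: "c \<in> carrier k" "x = Scal c" by (auto simp: mod_unit_def)
    interpret K: cring k by (rule cring_k)
    have "x = c \<odot>\<^bsub>?U\<^esub> Scal \<one>\<^bsub>k\<^esub>" using c by (simp add: mod_unit_def)
    moreover have "c \<odot>\<^bsub>?U\<^esub> Scal \<one>\<^bsub>k\<^esub> \<in> lin_span ?U {Scal \<one>\<^bsub>k\<^esub>}"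
      using subspace_lin_span[OF mod_unit_module S] lin_span_superset[OF mod_unit_module S] c by (simp add: subspace_def)
    ultimately show "x \<in> lin_span ?U {Scal \<one>\<^bsub>k\<^esub>}" by simp
  qed
  then show ?thesis using S fin_dim_lin_span by blast
qed

end

text \<open>
  The comodule algebra \<open>(A, \<delta>)\<close> is either \<open>(H, \<Delta>)\<close> or \<open>B\<close> with its coaction, so that the
  monoidal structure of \<open>H\<close>-modules and the module category of \<open>B\<close>-modules are instances of
  one construction. The parameter \<open>ty\<close> only fixes the type over which the target modules range.
\<close>

locale comod = hopf_alg k H for k :: "'k ring" and H :: "('k, 'h) hopf" +
  fixes A :: "('k, 'h) hopf" and \<delta> :: "'h \<Rightarrow> ('h \<times> 'h) list" and ty :: "'a itself"
  assumes algebra_A: "bilinear_algebra A" and delta_klin: "\<delta> \<in> klin k A (tensor k A H)"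
    and delta_mult: "\<And>(U :: ('k, 'h, 'a) mob) f x y. \<lbrakk>module k U; bilin k A H U f; x \<in> carrier A; y \<in> carrier A\<rbrakk> \<Longrightarrow>
      tlift U f (\<delta> (x \<otimes>\<^bsub>A\<^esub> y)) = tlift U (\<lambda>a b. tlift U (\<lambda>c d. f (a \<otimes>\<^bsub>A\<^esub> c) (b \<cdot> d)) (\<delta> y)) (\<delta> x)"
    and delta_one: "\<And>(U :: ('k, 'h, 'a) mob) f. \<lbrakk>module k U; bilin k A H U f\<rbrakk> \<Longrightarrow> tlift U f (\<delta> \<one>\<^bsub>A\<^esub>) = f \<one>\<^bsub>A\<^esub> \<one>\<^bsub>H\<^esub>"
    and delta_coassoc: "\<And>(U :: ('k, 'h, 'a) mob) f a. \<lbrakk>module k U; trilin k A H H U f; a \<in> carrier A\<rbrakk> \<Longrightarrow>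
      tlift U (\<lambda>a c. tlift U (\<lambda>a1 a2. f a1 a2 c) (\<delta> a)) (\<delta> a)
        = tlift U (\<lambda>a c. tlift U (\<lambda>c1 c2. f a c1 c2) (\<Delta> c)) (\<delta> a)"
    and delta_counit: "\<And>(U :: ('k, 'h, 'a) mob) g a. \<lbrakk>module k U; g \<in> klin k A U; a \<in> carrier A\<rbrakk> \<Longrightarrow>
      tlift U (\<lambda>x y. \<epsilon> y \<odot>\<^bsub>U\<^esub> g x) (\<delta> a) = g a"
begin

lemma delta_closed: "a \<in> carrier A \<Longrightarrow> \<delta> a \<in> carrier (tensor k A H)"
  using klin_cl[OF delta_klin] .

lemma delta_pairs: "a \<in> carrier A \<Longrightarrow> \<delta> a \<in> pairs A H"
  by (rule tens_L[OF bilinear_algebra_module[OF algebra_A] module_H delta_closed])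

lemma delta_set [simp]: "(x, y) \<in> set (\<delta> a) \<Longrightarrow> a \<in> carrier A \<Longrightarrow> x \<in> carrier A"
  "(x, y) \<in> set (\<delta> a) \<Longrightarrow> a \<in> carrier A \<Longrightarrow> y \<in> carrier H"
  using delta_pairs by blast+

lemma amodule_mod_tensor:
  fixes M X :: "('k, 'h, 'a) mob"
  assumes M: "amodule k A M" and X: "amodule k H X"
  shows "amodule k A (mod_tensor k \<delta> M X)"
proof -
  let ?T = "mod_tensor k \<delta> M X"
  note mM = amodule_module[OF M] and mX = amodule_module[OF X]
  note mT = module_mod_tensor[OF mM mX, of \<delta>]
  have act: "act ?T a = tact k M X (\<delta> a)" for a by (simp add: mod_tensor_def)
  note ac = act_cl[OF M] act_cl[OF X]
  note rl = klin_tlift_fun[OF mT] klin_tp1[OF mM mX] klin_tp2[OF mM mX] klin_act1[OF M] klin_act2[OF M]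
    klin_act1[OF X] klin_act2[OF X] klin_id ac
  have bl: "bilin k A H ?T (\<lambda>h h'. tp k M X (act M h x) (act X h' y))" if "x \<in> carrier M" "y \<in> carrier X" for x y
    using that by (intro bilinI rl)
  note kl = tact_klin[OF M X delta_pairs, of _ \<delta>]
  note tpr = tact_tp[OF M X delta_pairs, of _ _ _ \<delta>]
  show ?thesis
  proof (rule amoduleI[OF mT], unfold act)
    show "bilin k A ?T ?T (\<lambda>a. tact k M X (\<delta> a))"
    proof (intro bilinI)
      show "(\<lambda>u. tact k M X (\<delta> a) u) \<in> klin k ?T ?T" if "a \<in> carrier A" for a using kl[OF that] .
      fix u assume u: "u \<in> carrier ?T"
      \<comment> \<open>With the sum over \<open>u\<close> outside, \<open>a\<close> occurs only in
        \<open>\<delta> a\<close>, which depends linearly on it.\<close>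
      have "(\<lambda>a. tlift ?T (\<lambda>x y. tlift ?T (\<lambda>h h'. tp k M X (act M h x) (act X h' y)) (\<delta> a)) (untens u)) \<in> klin k A ?T"
        using pairsD[OF mod_tensor_pairs[OF mM mX u]]
        by (intro klin_tlift_fun[OF mT] klin_tlift_arg[OF bilinear_algebra_module[OF algebra_A] module_H mT bl delta_klin]) blast+
      then show "(\<lambda>a. tact k M X (\<delta> a) u) \<in> klin k A ?T"
        by (rule klin_cong[OF bilinear_algebra_module[OF algebra_A]]) (simp add: tact_mlift[OF M X delta_pairs u] mlift_def)
    qed
  next
    fix a b u assume a: "a \<in> carrier A" and b: "b \<in> carrier A" and u: "u \<in> carrier ?T"
    note ab = bilinear_algebra_mult[OF algebra_A a b]
    show "tact k M X (\<delta> (a \<otimes>\<^bsub>A\<^esub> b)) u = tact k M X (\<delta> a) (tact k M X (\<delta> b) u)"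
    proof (rule mod_tensor_ext[OF mM mX mT kl[OF ab] klin_comp[OF kl[OF a] kl[OF b]] _ u])
      fix x y assume x: "x \<in> carrier M" and y: "y \<in> carrier X"
      have "tact k M X (\<delta> a) (tact k M X (\<delta> b) (tp k M X x y))
        = tlift ?T (\<lambda>c d. tact k M X (\<delta> a) (tp k M X (act M c x) (act X d y))) (\<delta> b)"
        unfolding tpr[OF b x y] using b x y
        by (intro klin_tlift[OF kl[OF a] mT mT]) (auto intro!: tp_cl[OF mM mX] ac)
      also have "\<dots> = tlift ?T (\<lambda>c d. tlift ?T (\<lambda>h h'. tp k M X (act M h (act M c x)) (act X h' (act X d y))) (\<delta> a)) (\<delta> b)"
        using a b x y by (intro tlift_cong refl) (simp add: tpr ac)
      \<comment> \<open>As \<open>b\<close> acts first, its sum came out outermost; multiplicativity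
        of the coaction has the sum over \<open>\<delta> a\<close> outside.\<close>
      also have "\<dots> = tlift ?T (\<lambda>h h'. tlift ?T (\<lambda>c d. tp k M X (act M h (act M c x)) (act X h' (act X d y))) (\<delta> b)) (\<delta> a)"
        by (rule tlift_Fubini[OF mT]) (use a b x y in \<open>auto intro!: tp_cl[OF mM mX] ac\<close>)
      also have "\<dots> = tlift ?T (\<lambda>h h'. tlift ?T (\<lambda>c d. tp k M X (act M (h \<otimes>\<^bsub>A\<^esub> c) x) (act X (h' \<cdot> d) y)) (\<delta> b)) (\<delta> a)"
        using a b x y by (intro tlift_cong refl) (simp add: act_mult[OF M] act_mult[OF X])
      also have "\<dots> = tact k M X (\<delta> (a \<otimes>\<^bsub>A\<^esub> b)) (tp k M X x y)"
        using delta_mult[OF mT bl[OF x y] a b] tpr[OF ab x y] by simp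
      finally show "tact k M X (\<delta> (a \<otimes>\<^bsub>A\<^esub> b)) (tp k M X x y) = tact k M X (\<delta> a) (tact k M X (\<delta> b) (tp k M X x y))" by simp
    qed
  next
    fix u assume u: "u \<in> carrier ?T"
    note one = bilinear_algebra_one[OF algebra_A]
    show "tact k M X (\<delta> \<one>\<^bsub>A\<^esub>) u = u"
      by (rule mod_tensor_ext[OF mM mX mT kl[OF one] klin_id _ u])
        (simp add: tpr[OF one] delta_one[OF mT bl] act_one[OF M] act_one[OF X])
  qed
qed

end

section \<open>Homomorphisms of modules\<close>

text \<open>An arrow stores its map restricted to the carrier. Here it is paired with an
  unrestricted map \<open>f\<close> inducing it, so that composites can be computed without
  \<open>restrict\<close>.\<close>

definition is_hom :: "'k ring \<Rightarrow> ('k, 'h) hopf \<Rightarrow> ('k, 'h, 'a) mar \<Rightarrow> ('k, 'h, 'a) mob \<Rightarrow>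
    (('k, 'a) univ \<Rightarrow> ('k, 'a) univ) \<Rightarrow> ('k, 'h, 'a) mob \<Rightarrow> bool" where
  "is_hom k A F X f Y \<longleftrightarrow> F = mk_arrow X f Y \<and> f \<in> klin k X Y \<and>
     (\<forall>a\<in>carrier A. \<forall>x\<in>carrier X. f (act X a x) = act Y a (f x))"

definition tensor_map :: "'k ring \<Rightarrow> ('k, 'h, 'a) mob \<Rightarrow> ('k, 'h, 'a) mob \<Rightarrow> (('k, 'a) univ \<Rightarrow> ('k, 'a) univ) \<Rightarrow>
    (('k, 'a) univ \<Rightarrow> ('k, 'a) univ) \<Rightarrow> ('k, 'a) univ \<Rightarrow> ('k, 'a) univ" where
  "tensor_map k X' Y' f g u = Tens (tmap k X' Y' f g (untens u))"

definition assoc_map :: "'k ring \<Rightarrow> ('k, 'h) hopf \<Rightarrow> ('k, 'h, 'a) mob \<Rightarrow> ('k, 'h, 'a) mob \<Rightarrow> ('k, 'h, 'a) mob \<Rightarrow>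
    ('k, 'a) univ \<Rightarrow> ('k, 'a) univ" where
  "assoc_map k H X Y Z u = Tens (tnf k X (mod_tensor k (comult H) Y Z)
        (concat (map (\<lambda>(s, z). map (\<lambda>(x, y). (x, Tens (pure k Y Z y z))) (untens s)) (untens u))))"

text \<open>The inverse of \<open>assoc_map\<close>, obtained from the universal property;
  \<open>assoc_inv\<close> identifies \<open>inv_mor\<close> of the associator with its
  arrow.\<close>

definition assoc_unmap :: "'k ring \<Rightarrow> ('h \<Rightarrow> ('h \<times> 'h) list) \<Rightarrow> ('k, 'h, 'a) mob \<Rightarrow> ('k, 'h, 'a) mob \<Rightarrow> ('k, 'h, 'a) mob \<Rightarrow>
    ('k, 'a) univ \<Rightarrow> ('k, 'a) univ" where
  "assoc_unmap k \<delta> X Y Z = (let S = mod_tensor k \<delta> (mod_tensor k \<delta> X Y) Z in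
     mlift S (\<lambda>x s. mlift S (\<lambda>y z. tp k (mod_tensor k \<delta> X Y) Z (tp k X Y x y) z) s))"

lemma is_hom_mor: "F \<in> amod_mor k A X Y \<longleftrightarrow> (\<exists>f. is_hom k A F X f Y)"
  unfolding amod_mor_def is_hom_def mem_Collect_eq by (rule refl)

lemma is_homD: "is_hom k A F X f Y \<Longrightarrow> f \<in> klin k X Y"
  "is_hom k A F X f Y \<Longrightarrow> F = mk_arrow X f Y"
  "is_hom k A F X f Y \<Longrightarrow> a \<in> carrier A \<Longrightarrow> x \<in> carrier X \<Longrightarrow> f (act X a x) = act Y a (f x)"
  unfolding is_hom_def by simp_all

lemma is_hom_morI: "is_hom k A F X f Y \<Longrightarrow> F \<in> amod_mor k A X Y"
  unfolding is_hom_mor by (rule exI)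

lemma mk_arrow_cong:
  assumes "\<And>x. x \<in> carrier X \<Longrightarrow> f x = g x"
  shows "mk_arrow X f Y = mk_arrow X g Y"
proof -
  have "restrict f (carrier X) = restrict g (carrier X)" by (rule restrict_ext) (rule assms)
  then show ?thesis by (simp add: mk_arrow_def)
qed

lemma hom_eqI:
  assumes "is_hom k A F X f Y" "is_hom k A' G X g Y" "\<And>x. x \<in> carrier X \<Longrightarrow> f x = g x"
  shows "F = G"
  unfolding is_homD(2)[OF assms(1)] is_homD(2)[OF assms(2)] by (rule mk_arrow_cong[OF assms(3)])

context over_field
begin

lemma is_hom_id: "is_hom k A (amod_id X) X (\<lambda>x. x) X"
  by (simp add: is_hom_def amod_id_def klin_id)

lemma is_hom_comp:
  assumes f: "is_hom k A F X f Y" and g: "is_hom k A G Y g Z"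
  shows "is_hom k A (amod_comp G F) X (\<lambda>x. g (f x)) Z"
proof -
  have c: "\<And>x. x \<in> carrier X \<Longrightarrow> f x \<in> carrier Y" using klin_cl[OF is_homD(1)[OF f]] .
  have "amod_comp G F = mk_arrow X (\<lambda>x. g (f x)) Z"
    using f g c by (auto simp: is_hom_def amod_comp_def mk_arrow_def restrict_def fun_eq_iff)
  then show ?thesis
    using klin_comp[OF is_homD(1)[OF g] is_homD(1)[OF f]] is_homD(3)[OF f] is_homD(3)[OF g] c
    by (simp add: is_hom_def)
qed

context
  fixes X Y X' Y' :: "('k, 'h, 'a) mob" and f g
  assumes m: "module k X" "module k Y" "module k X'" "module k Y'"
    and f: "f \<in> klin k X X'" and g: "g \<in> klin k Y Y'"
begin

lemma bilin_tensor_map: "bilin k X Y (mod_tensor k \<delta>' X' Y') (\<lambda>x y. tp k X' Y' (f x) (g y))"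
  using klin_cl[OF f] klin_cl[OF g]
  by (intro bilinI klin_tp1[OF m(3,4)] klin_tp2[OF m(3,4)] f g klin_comp[OF f klin_id] klin_comp[OF g klin_id])

lemma tensor_map_mlift:
  assumes "u \<in> carrier (mod_tensor k \<delta> X Y)"
  shows "tensor_map k X' Y' f g u = mlift (mod_tensor k \<delta>' X' Y') (\<lambda>x y. tp k X' Y' (f x) (g y)) u"
proof -
  note uL = mod_tensor_pairs[OF m(1,2) assms]
  have l: "map (\<lambda>(x, y). (f x, g y)) (untens u) \<in> pairs X' Y'"
    using pairsD[OF uL] klin_cl[OF f] klin_cl[OF g] by (intro pairsI) auto
  show ?thesis
    unfolding tensor_map_def tmap_def mlift_def by (simp add: Tens_tnf[OF m(3,4) l, of \<delta>'] tlift_map)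
qed

lemma tensor_map_klin: "tensor_map k X' Y' f g \<in> klin k (mod_tensor k \<delta> X Y) (mod_tensor k \<delta>' X' Y')"
  by (rule klin_cong[OF module_mod_tensor[OF m(1,2)] mlift_klin[OF m(1,2) module_mod_tensor[OF m(3,4)] bilin_tensor_map] tensor_map_mlift])

lemma tensor_map_tp: "x \<in> carrier X \<Longrightarrow> y \<in> carrier Y \<Longrightarrow> tensor_map k X' Y' f g (tp k X Y x y) = tp k X' Y' (f x) (g y)"
  using tensor_map_mlift[OF tp_cl[OF m(1,2)]] mlift_tp[OF m(1,2) module_mod_tensor[OF m(3,4)] bilin_tensor_map] by simp

end

text \<open>Freezing the outer factor leaves a linear map on the inner product, where
  \<open>mod_tensor_ext\<close> applies again. The suffixes \<open>l\<close> and \<open>r\<close>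
  tell on which side the inner product stands.\<close>

lemma ext3l:
  assumes m: "module k X" "module k Y" "module k Z" "module k U"
    and f: "f \<in> klin k (mod_tensor k \<delta> (mod_tensor k \<delta>' X Y) Z) U"
    and g: "g \<in> klin k (mod_tensor k \<delta> (mod_tensor k \<delta>' X Y) Z) U"
    and eq: "\<And>x y z. x \<in> carrier X \<Longrightarrow> y \<in> carrier Y \<Longrightarrow> z \<in> carrier Z \<Longrightarrow>
      f (tp k (mod_tensor k \<delta>' X Y) Z (tp k X Y x y) z) = g (tp k (mod_tensor k \<delta>' X Y) Z (tp k X Y x y) z)"
    and u: "u \<in> carrier (mod_tensor k \<delta> (mod_tensor k \<delta>' X Y) Z)"
  shows "f u = g u"
proof (rule mod_tensor_ext[OF module_mod_tensor[OF m(1,2)] m(3,4) f g _ u])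
  fix s z assume s: "s \<in> carrier (mod_tensor k \<delta>' X Y)" and z: "z \<in> carrier Z"
  note t = klin_tp1[OF module_mod_tensor[OF m(1,2)] m(3) z klin_id]
  show "f (tp k (mod_tensor k \<delta>' X Y) Z s z) = g (tp k (mod_tensor k \<delta>' X Y) Z s z)"
    by (rule mod_tensor_ext[OF m(1,2,4) klin_comp[OF f t] klin_comp[OF g t] _ s]) (rule eq[OF _ _ z])
qed

lemma ext3r:
  assumes m: "module k X" "module k Y" "module k Z" "module k U"
    and f: "f \<in> klin k (mod_tensor k \<delta> X (mod_tensor k \<delta>' Y Z)) U"
    and g: "g \<in> klin k (mod_tensor k \<delta> X (mod_tensor k \<delta>' Y Z)) U"
    and eq: "\<And>x y z. x \<in> carrier X \<Longrightarrow> y \<in> carrier Y \<Longrightarrow> z \<in> carrier Z \<Longrightarrow>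
      f (tp k X (mod_tensor k \<delta>' Y Z) x (tp k Y Z y z)) = g (tp k X (mod_tensor k \<delta>' Y Z) x (tp k Y Z y z))"
    and u: "u \<in> carrier (mod_tensor k \<delta> X (mod_tensor k \<delta>' Y Z))"
  shows "f u = g u"
proof (rule mod_tensor_ext[OF m(1) module_mod_tensor[OF m(2,3)] m(4) f g _ u])
  fix x s assume s: "s \<in> carrier (mod_tensor k \<delta>' Y Z)" and x: "x \<in> carrier X"
  note t = klin_tp2[OF m(1) module_mod_tensor[OF m(2,3)] x klin_id]
  show "f (tp k X (mod_tensor k \<delta>' Y Z) x s) = g (tp k X (mod_tensor k \<delta>' Y Z) x s)"
    by (rule mod_tensor_ext[OF m(2,3,4) klin_comp[OF f t] klin_comp[OF g t] _ s]) (rule eq[OF x])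
qed

lemma ext4l:
  assumes m: "module k W" "module k X" "module k Y" "module k Z" "module k U"
    and f: "f \<in> klin k (mod_tensor k \<delta> (mod_tensor k \<delta>' (mod_tensor k \<delta>'' W X) Y) Z) U"
    and g: "g \<in> klin k (mod_tensor k \<delta> (mod_tensor k \<delta>' (mod_tensor k \<delta>'' W X) Y) Z) U"
    and eq: "\<And>w x y z. w \<in> carrier W \<Longrightarrow> x \<in> carrier X \<Longrightarrow> y \<in> carrier Y \<Longrightarrow> z \<in> carrier Z \<Longrightarrow>
      f (tp k (mod_tensor k \<delta>' (mod_tensor k \<delta>'' W X) Y) Z (tp k (mod_tensor k \<delta>'' W X) Y (tp k W X w x) y) z) =
      g (tp k (mod_tensor k \<delta>' (mod_tensor k \<delta>'' W X) Y) Z (tp k (mod_tensor k \<delta>'' W X) Y (tp k W X w x) y) z)"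
    and u: "u \<in> carrier (mod_tensor k \<delta> (mod_tensor k \<delta>' (mod_tensor k \<delta>'' W X) Y) Z)"
  shows "f u = g u"
proof (rule ext3l[OF module_mod_tensor[OF m(1,2)] m(3,4,5) f g _ u])
  fix s y z assume s: "s \<in> carrier (mod_tensor k \<delta>'' W X)" and y: "y \<in> carrier Y" and z: "z \<in> carrier Z"
  let ?P = "mod_tensor k \<delta>'' W X"
  let ?Q = "mod_tensor k \<delta>' ?P Y"
  note mP = module_mod_tensor[OF m(1,2)]
  note t = klin_tp1[OF module_mod_tensor[OF mP m(3)] m(4) z klin_tp1[OF mP m(3) y klin_id]]
  show "f (tp k ?Q Z (tp k ?P Y s y) z) = g (tp k ?Q Z (tp k ?P Y s y) z)"
    by (rule mod_tensor_ext[OF m(1,2,5) klin_comp[OF f t] klin_comp[OF g t] _ s]) (rule eq[OF _ _ y z])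
qed

end

section \<open>Associators and unit maps as linear maps\<close>

context hopf_alg
begin

context
  fixes X Y Z :: "('k, 'h, 'a) mob" and \<delta> :: "'h \<Rightarrow> ('h \<times> 'h) list"
  assumes m: "module k X" "module k Y" "module k Z"
begin

abbreviation (input) "P1 \<equiv> mod_tensor k \<delta> X Y"
abbreviation (input) "P2 \<equiv> mod_tensor k \<Delta> Y Z"
abbreviation (input) "S1 \<equiv> mod_tensor k \<delta> P1 Z"
abbreviation (input) "S2 \<equiv> mod_tensor k \<delta> X P2"

lemmas mP1 = module_mod_tensor[OF m(1,2), of \<delta>]
lemmas mP2 = module_mod_tensor[OF m(2,3), of \<Delta>]
lemmas mS1 = module_mod_tensor[OF mP1 m(3), of \<delta>]
lemmas mS2 = module_mod_tensor[OF m(1) mP2, of \<delta>]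

lemma bilin_assoc_map: "bilin k P1 Z S2 (\<lambda>s z. mlift S2 (\<lambda>x y. tp k X P2 x (tp k Y Z y z)) s)"
proof (rule bilinI)
  note rl = klin_tp1[OF m(1) mP2] klin_tp2[OF m(1) mP2] klin_tp1[OF m(2,3)] klin_tp2[OF m(2,3)] klin_id tp_cl[OF m(2,3)]
  show "(\<lambda>s. mlift S2 (\<lambda>x y. tp k X P2 x (tp k Y Z y z)) s) \<in> klin k P1 S2" if "z \<in> carrier Z" for z
    by (intro mlift_klin m mS2 bilinI rl that)
  fix s assume "s \<in> carrier P1"
  then have "untens s \<in> pairs X Y" by (rule mod_tensor_pairs[OF m(1,2)])
  then show "(\<lambda>z. mlift S2 (\<lambda>x y. tp k X P2 x (tp k Y Z y z)) s) \<in> klin k Z S2"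
    unfolding mlift_def by (intro klin_tlift_fun mS2 rl) auto
qed

text \<open>The associator is defined by flattening a list of lists; it becomes visibly linear once
  it is written as an iterated lift of a multilinear map.\<close>

lemma assoc_map_mlift:
  assumes u: "u \<in> carrier S1"
  shows "assoc_map k H X Y Z u = mlift S2 (\<lambda>s z. mlift S2 (\<lambda>x y. tp k X P2 x (tp k Y Z y z)) s) u"
proof -
  note uL = mod_tensor_pairs[OF mP1 m(3) u]
  have p: "x \<in> carrier X \<and> y \<in> carrier Y \<and> z \<in> carrier Z" if "(s, z) \<in> set (untens u)" "(x, y) \<in> set (untens s)" for s z x y
    using pairsD[OF uL that(1)] pairsD[OF mod_tensor_pairs[OF m(1,2)] that(2)] by blast
  let ?h = "\<lambda>p. case p of (s, z) \<Rightarrow> map (\<lambda>(x, y). (x, Tens (pure k Y Z y z))) (untens s)"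
  have l: "concat (map ?h (untens u)) \<in> pairs X P2"
    by (rule pairsI) (use p tp_cl[OF m(2,3)] in \<open>fastforce simp: tp_def\<close>)
  have "assoc_map k H X Y Z u = tlift S2 (tp k X P2) (concat (map ?h (untens u)))"
    unfolding assoc_map_def by (rule Tens_tnf[OF m(1) mP2 l])
  also have "\<dots> = tlift S2 (\<lambda>s z. tlift S2 (tp k X P2) (?h (s, z))) (untens u)"
  proof (rule tlift_concat[OF mS2])
    fix q a b assume "q \<in> set (untens u)" "(a, b) \<in> set (?h q)"
    then have "(a, b) \<in> set (concat (map ?h (untens u)))" unfolding set_concat set_map by blast
    then show "tp k X P2 a b \<in> carrier S2" using pairsD[OF l] tp_cl[OF m(1) mP2] by blast
  qed
  also have "\<dots> = mlift S2 (\<lambda>s z. mlift S2 (\<lambda>x y. tp k X P2 x (tp k Y Z y z)) s) u"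
    unfolding mlift_def by (rule tlift_cong[OF refl]) (simp add: tlift_map tp_def)
  finally show ?thesis .
qed

lemma assoc_map_klin: "assoc_map k H X Y Z \<in> klin k S1 S2"
  by (rule klin_cong[OF mS1 mlift_klin[OF mP1 m(3) mS2 bilin_assoc_map] assoc_map_mlift])

lemma assoc_map_tp:
  assumes "x \<in> carrier X" "y \<in> carrier Y" "z \<in> carrier Z"
  shows "assoc_map k H X Y Z (tp k P1 Z (tp k X Y x y) z) = tp k X P2 x (tp k Y Z y z)"
proof -
  have "mlift S2 (\<lambda>x y. tp k X P2 x (tp k Y Z y z)) (tp k X Y x y) = tp k X P2 x (tp k Y Z y z)"
    by (rule mlift_tp[OF m(1,2) mS2 _ assms(1,2)])
      (intro bilinI klin_tp1[OF m(1) mP2] klin_tp2[OF m(1) mP2] klin_tp1[OF m(2,3)] klin_id tp_cl[OF m(2,3)] assms)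
  then show ?thesis
    using assms by (simp add: assoc_map_mlift tp_cl[OF mP1 m(3)] tp_cl[OF m(1,2)] mlift_tp[OF mP1 m(3) mS2 bilin_assoc_map])
qed

lemma bilin_assoc_unmap: "bilin k X P2 S1 (\<lambda>x s. mlift S1 (\<lambda>y z. tp k P1 Z (tp k X Y x y) z) s)"
proof (rule bilinI)
  note rl = klin_tp1[OF mP1 m(3)] klin_tp2[OF mP1 m(3)] klin_tp1[OF m(1,2)] klin_tp2[OF m(1,2)] klin_id tp_cl[OF m(1,2)]
  show "(\<lambda>s. mlift S1 (\<lambda>y z. tp k P1 Z (tp k X Y x y) z) s) \<in> klin k P2 S1" if "x \<in> carrier X" for x
    by (intro mlift_klin m mS1 bilinI rl that)
  fix s assume "s \<in> carrier P2"
  then have "untens s \<in> pairs Y Z" by (rule mod_tensor_pairs[OF m(2,3)])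
  then show "(\<lambda>x. mlift S1 (\<lambda>y z. tp k P1 Z (tp k X Y x y) z) s) \<in> klin k X S1"
    unfolding mlift_def by (intro klin_tlift_fun mS1 rl) auto
qed

lemma assoc_unmap_klin: "assoc_unmap k \<delta> X Y Z \<in> klin k S2 S1"
  unfolding assoc_unmap_def Let_def by (rule mlift_klin[OF m(1) mP2 mS1 bilin_assoc_unmap])

lemma assoc_unmap_tp:
  assumes "x \<in> carrier X" "y \<in> carrier Y" "z \<in> carrier Z"
  shows "assoc_unmap k \<delta> X Y Z (tp k X P2 x (tp k Y Z y z)) = tp k P1 Z (tp k X Y x y) z"
proof -
  have "mlift S1 (\<lambda>y z. tp k P1 Z (tp k X Y x y) z) (tp k Y Z y z) = tp k P1 Z (tp k X Y x y) z"
    by (rule mlift_tp[OF m(2,3) mS1 _ assms(2,3)])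
      (intro bilinI klin_tp1[OF mP1 m(3)] klin_tp2[OF mP1 m(3)] klin_tp2[OF m(1,2)] klin_id tp_cl[OF m(1,2)] assms)
  then show ?thesis
    unfolding assoc_unmap_def Let_def using assms mlift_tp[OF m(1) mP2 mS1 bilin_assoc_unmap] tp_cl[OF m(2,3)] by simp
qed

lemma assoc_unmap_map: "u \<in> carrier S1 \<Longrightarrow> assoc_unmap k \<delta> X Y Z (assoc_map k H X Y Z u) = u"
  by (rule ext3l[OF m mS1 klin_comp[OF assoc_unmap_klin assoc_map_klin] klin_id]) (simp_all add: assoc_map_tp assoc_unmap_tp)

lemma assoc_map_unmap: "u \<in> carrier S2 \<Longrightarrow> assoc_map k H X Y Z (assoc_unmap k \<delta> X Y Z u) = u"
  by (rule ext3r[OF m mS2 klin_comp[OF assoc_map_klin assoc_unmap_klin] klin_id]) (simp_all add: assoc_map_tp assoc_unmap_tp)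

end

lemma unit_carrier: "c \<in> carrier (mod_unit k H :: ('k, 'h, 'a) mob) \<Longrightarrow> \<exists>d\<in>carrier k. c = Scal d"
  and Scal_cl [simp]: "d \<in> carrier k \<Longrightarrow> Scal d \<in> carrier (mod_unit k H :: ('k, 'h, 'a) mob)"
  by (auto simp: mod_unit_def)

context
  fixes X :: "('k, 'h, 'a) mob"
  assumes m: "module k X"
begin

abbreviation (input) "I1 \<equiv> mod_unit k H :: ('k, 'h, 'a) mob"

lemma bilin_scal: "bilin k X I1 X (\<lambda>x c. unscal c \<odot>\<^bsub>X\<^esub> x)"
  using m by (intro bilinI klinI) (auto simp: mod_unit_def mod_sadd mod_adds mod_mults mod_scomm)

lemma bilin_scal': "bilin k I1 X X (\<lambda>c x. unscal c \<odot>\<^bsub>X\<^esub> x)"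
  using bilinD1[OF bilin_scal] bilinD2[OF bilin_scal] by (intro bilinI)

lemma klin_Scal: "(\<lambda>x. tp k X I1 x (Scal \<one>\<^bsub>k\<^esub>)) \<in> klin k X (mod_tensor k \<delta> X I1)"
  by (intro klin_tp1[OF m mod_unit_module] klin_id) simp

lemma klin_Scal': "(\<lambda>x. tp k I1 X (Scal \<one>\<^bsub>k\<^esub>) x) \<in> klin k X (mod_tensor k \<delta> I1 X)"
  by (intro klin_tp2[OF mod_unit_module m] klin_id) simp

abbreviation (input) "runit_map \<equiv> \<lambda>u. tlift X (\<lambda>x c. unscal c \<odot>\<^bsub>X\<^esub> x) (untens u)"
abbreviation (input) "lunit_map \<equiv> \<lambda>u. tlift X (\<lambda>c x. unscal c \<odot>\<^bsub>X\<^esub> x) (untens u)"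

lemma runit_map_klin: "runit_map \<in> klin k (mod_tensor k \<delta> X I1) X"
  using mlift_klin[OF m mod_unit_module m bilin_scal] by (simp add: mlift_def[abs_def])

lemma lunit_map_klin: "lunit_map \<in> klin k (mod_tensor k \<delta> I1 X) X"
  using mlift_klin[OF mod_unit_module m m bilin_scal'] by (simp add: mlift_def[abs_def])

lemma runit_map_tp: "x \<in> carrier X \<Longrightarrow> c \<in> carrier k \<Longrightarrow> runit_map (tp k X I1 x (Scal c)) = c \<odot>\<^bsub>X\<^esub> x"
  using mlift_tp[OF m mod_unit_module m bilin_scal, of x "Scal c"] by (simp add: mlift_def)

lemma lunit_map_tp: "x \<in> carrier X \<Longrightarrow> c \<in> carrier k \<Longrightarrow> lunit_map (tp k I1 X (Scal c) x) = c \<odot>\<^bsub>X\<^esub> x"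
  using mlift_tp[OF mod_unit_module m m bilin_scal', of "Scal c" x] by (simp add: mlift_def)

lemma Scal_smult: "c \<in> carrier k \<Longrightarrow> Scal c = c \<odot>\<^bsub>I1\<^esub> Scal \<one>\<^bsub>k\<^esub>"
proof -
  interpret K: cring k by (rule cring_k)
  show "c \<in> carrier k \<Longrightarrow> Scal c = c \<odot>\<^bsub>I1\<^esub> Scal \<one>\<^bsub>k\<^esub>" by (simp add: mod_unit_def)
qed

lemma tp_Scal:
  assumes "x \<in> carrier X" "c \<in> carrier k"
  shows "tp k X I1 (c \<odot>\<^bsub>X\<^esub> x) (Scal \<one>\<^bsub>k\<^esub>) = tp k X I1 x (Scal c)"
proof -
  \<comment> \<open>Bilinearity of \<open>tp\<close> is an equation in the linear structure of the
    target, so any coaction can be named there; the constant empty list is a placeholder.\<close>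
  note b = bilin_tp[OF m mod_unit_module, of "\<lambda>_. []"]
  have "tp k X I1 x (c \<odot>\<^bsub>I1\<^esub> Scal \<one>\<^bsub>k\<^esub>) = tp k X I1 (c \<odot>\<^bsub>X\<^esub> x) (Scal \<one>\<^bsub>k\<^esub>)"
    using klin_smult[OF bilinD1[OF b assms(1)] assms(2), of "Scal \<one>\<^bsub>k\<^esub>"]
      klin_smult[OF bilinD2[OF b, of "Scal \<one>\<^bsub>k\<^esub>"] assms(2,1)] by simp
  then show ?thesis by (simp add: Scal_smult[OF assms(2), symmetric])
qed

lemma tp_Scal':
  assumes "x \<in> carrier X" "c \<in> carrier k"
  shows "tp k I1 X (Scal \<one>\<^bsub>k\<^esub>) (c \<odot>\<^bsub>X\<^esub> x) = tp k I1 X (Scal c) x"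
proof -
  note b = bilin_tp[OF mod_unit_module m, of "\<lambda>_. []"]
  have "tp k I1 X (c \<odot>\<^bsub>I1\<^esub> Scal \<one>\<^bsub>k\<^esub>) x = tp k I1 X (Scal \<one>\<^bsub>k\<^esub>) (c \<odot>\<^bsub>X\<^esub> x)"
    using klin_smult[OF bilinD1[OF b, of "Scal \<one>\<^bsub>k\<^esub>"] assms(2,1)]
      klin_smult[OF bilinD2[OF b assms(1)] assms(2), of "Scal \<one>\<^bsub>k\<^esub>"] by simp
  then show ?thesis by (simp add: Scal_smult[OF assms(2), symmetric])
qed

lemma runit_map_inverse: "u \<in> carrier (mod_tensor k \<delta> X I1) \<Longrightarrow> tp k X I1 (runit_map u) (Scal \<one>\<^bsub>k\<^esub>) = u"
  by (rule mod_tensor_ext[OF m mod_unit_module module_mod_tensor[OF m mod_unit_module] klin_comp[OF klin_Scal runit_map_klin] klin_id])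
    (auto dest!: unit_carrier simp: runit_map_tp tp_Scal)

lemma lunit_map_inverse: "u \<in> carrier (mod_tensor k \<delta> I1 X) \<Longrightarrow> tp k I1 X (Scal \<one>\<^bsub>k\<^esub>) (lunit_map u) = u"
  by (rule mod_tensor_ext[OF mod_unit_module m module_mod_tensor[OF mod_unit_module m] klin_comp[OF klin_Scal' lunit_map_klin] klin_id])
    (auto dest!: unit_carrier simp: lunit_map_tp tp_Scal')

end

end

section \<open>Categories of modules and inverses in them\<close>

lemma (in hopf_alg) comod_H: "comod TYPE('a) k H H \<Delta>"
  by unfold_locales (simp_all add: algebra_H comult_klin tlift_comult_mult tlift_comult_one coassoc counit_right)

text \<open>The part shared by \<open>Hmod_fd\<close> and \<open>Bmod_fd\<close>, so that
  identities, composition and inverses are treated once for both.\<close>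

definition mod_cat :: "'k ring \<Rightarrow> ('k, 'h) hopf \<Rightarrow> (('k, 'h, 'a) mob, ('k, 'h, 'a) mar, 'z) cat_scheme \<Rightarrow> bool" where
  "mod_cat k A C \<longleftrightarrow> mor C = amod_mor k A \<and> idm C = amod_id \<and> cmp C = amod_comp \<and>
     (\<forall>X\<in>obj C. amodule k A X)"

context over_field
begin

lemma mod_cat_category:
  assumes "mod_cat k A C"
  shows "category C"
proof -
  have C: "mor C = amod_mor k A" "idm C = amod_id" "cmp C = amod_comp"
    using assms by (simp_all add: mod_cat_def)
  show ?thesis
  proof (unfold_locales, unfold C is_hom_mor)
    show "\<exists>f. is_hom k A (amod_id X) X f X" for X using is_hom_id by blast
    show "\<exists>h. is_hom k A (amod_comp g f) X h Z"
      if "\<exists>f'. is_hom k A f X f' Y" "\<exists>g'. is_hom k A g Y g' Z" for X Y Z f g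
      using that is_hom_comp by blast
    show "amod_comp f (amod_id X) = f" if "\<exists>f'. is_hom k A f X f' Y" for X Y f
      using that by (elim exE) (rule hom_eqI[OF is_hom_comp[OF is_hom_id]], auto)
    show "amod_comp (amod_id Y) f = f" if "\<exists>f'. is_hom k A f X f' Y" for X Y f
      using that by (elim exE) (rule hom_eqI[OF is_hom_comp[OF _ is_hom_id]], auto)
    show "amod_comp (amod_comp h g) f = amod_comp h (amod_comp g f)"
      if "\<exists>f'. is_hom k A f W f' X" "\<exists>f'. is_hom k A g X f' Y" "\<exists>f'. is_hom k A h Y f' Z" for W X Y Z f g h
    proof -
      obtain f' g' h' where *: "is_hom k A f W f' X" "is_hom k A g X g' Y" "is_hom k A h Y h' Z"
        using \<open>\<exists>f'. is_hom k A f W f' X\<close> \<open>\<exists>f'. is_hom k A g X f' Y\<close> \<open>\<exists>f'. is_hom k A h Y f' Z\<close> by blast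
      show ?thesis
        by (rule hom_eqI[OF is_hom_comp[OF *(1) is_hom_comp[OF *(2,3)]] is_hom_comp[OF is_hom_comp[OF *(1,2)] *(3)] refl])
    qed
  qed
qed

context
  fixes A :: "('k, 'h) hopf" and X Y :: "('k, 'h, 'a) mob" and F f g
  assumes F: "is_hom k A F X f Y" and g: "g \<in> klin k Y X"
    and gf: "\<And>x. x \<in> carrier X \<Longrightarrow> g (f x) = x" and fg: "\<And>y. y \<in> carrier Y \<Longrightarrow> f (g y) = y"
    and X: "amodule k A X"
begin

text \<open>Equivariance of \<open>g\<close> follows from that of \<open>f\<close> by cancelling
  \<open>f\<close>; for every isomorphism below it is thus enough to exhibit a linear
  inverse.\<close>

lemma inverse_hom: "is_hom k A (mk_arrow Y g X) Y g X"
proof -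
  have "g (act Y a y) = act X a (g y)" if "a \<in> carrier A" "y \<in> carrier Y" for a y
    using that is_homD(3)[OF F that(1) klin_cl[OF g that(2)]] gf[OF act_cl[OF X that(1) klin_cl[OF g that(2)]]]
    by (simp add: fg)
  then show ?thesis using g by (simp add: is_hom_def)
qed

lemma inverse_mors_hom:
  assumes "mod_cat k A C"
  shows "inverse_mors C X Y F (mk_arrow Y g X)"
proof -
  have C: "mor C = amod_mor k A" "idm C = amod_id" "cmp C = amod_comp"
    using assms by (simp_all add: mod_cat_def)
  have "amod_comp (mk_arrow Y g X) F = amod_id X"
    by (rule hom_eqI[OF is_hom_comp[OF F inverse_hom] is_hom_id gf])
  moreover have "amod_comp F (mk_arrow Y g X) = amod_id Y"
    by (rule hom_eqI[OF is_hom_comp[OF inverse_hom F] is_hom_id fg])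
  ultimately show ?thesis
    using is_hom_morI[OF F] is_hom_morI[OF inverse_hom] by (simp add: inverse_mors_def C)
qed

lemma iso_mor_hom: "mod_cat k A C \<Longrightarrow> iso_mor C X Y F"
  using inverse_mors_hom unfolding iso_mor_def by blast

text \<open>\<open>inv_mor\<close> is a definite description. Uniqueness of inverses turns it into
  an explicit arrow, which is what makes the second hexagon, (BP1) and (BP2) computable.\<close>

lemma inv_mor_hom:
  assumes C: "mod_cat k A C"
  shows "inv_mor C X Y F = mk_arrow Y g X"
  unfolding inv_mor_def
proof (rule the_equality)
  show "inverse_mors C X Y F (mk_arrow Y g X)" by (rule inverse_mors_hom[OF C])
  have C: "mor C = amod_mor k A" "idm C = amod_id" "cmp C = amod_comp"
    using C by (simp_all add: mod_cat_def)
  fix G assume G: "inverse_mors C X Y F G"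
  then obtain g' where g': "is_hom k A G Y g' X" by (auto simp: inverse_mors_def C is_hom_mor)
  have e: "amod_comp F G = amod_id Y" using G by (simp add: inverse_mors_def C)
  have "f (g' y) = y" if "y \<in> carrier Y" for y
    using e that unfolding is_homD(2)[OF is_hom_comp[OF g' F]] amod_id_def mk_arrow_def
    by (auto simp: restrict_def dest: fun_cong[of _ _ y])
  then have "g' y = g y" if "y \<in> carrier Y" for y
    using that gf[OF klin_cl[OF is_homD(1)[OF g'] that]] by simp
  then show "G = mk_arrow Y g X" using hom_eqI[OF g' inverse_hom] by blast
qed

end

end

section \<open>Equivariance of the structure maps\<close>

context comod
begin

lemma act_tp:
  fixes M X :: "('k, 'h, 'a) mob"
  assumes M: "amodule k A M" and X: "amodule k H X" and "a \<in> carrier A" "x \<in> carrier M" "y \<in> carrier X"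
  shows "act (mod_tensor k \<delta> M X) a (tp k M X x y) =
    tlift (mod_tensor k \<delta> M X) (\<lambda>h h'. tp k M X (act M h x) (act X h' y)) (\<delta> a)"
proof -
  have "act (mod_tensor k \<delta> M X) a = tact k M X (\<delta> a)" by (simp add: mod_tensor_def)
  then show ?thesis using tact_tp[OF M X delta_pairs[OF assms(3)] assms(4,5)] by simp
qed

lemma tens_hom:
  fixes M M' X X' :: "('k, 'h, 'a) mob"
  assumes F: "is_hom k A F M f M'" and G: "is_hom k H G X g X'"
    and M: "amodule k A M" "amodule k A M'" and X: "amodule k H X" "amodule k H X'"
  shows "is_hom k A (mod_tensor_mor k \<delta> F G) (mod_tensor k \<delta> M X) (tensor_map k M' X' f g) (mod_tensor k \<delta> M' X')"
proof -
  note f = is_homD(1)[OF F] and g = is_homD(1)[OF G]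
  note mM = amodule_module[OF M(1)] amodule_module[OF M(2)] and mX = amodule_module[OF X(1)] amodule_module[OF X(2)]
  note ms = mM(1) mX(1) mM(2) mX(2)
  let ?S = "mod_tensor k \<delta> M X" and ?T = "mod_tensor k \<delta> M' X'"
  note mS = module_mod_tensor[OF mM(1) mX(1), of \<delta>] and mT = module_mod_tensor[OF mM(2) mX(2), of \<delta>]
  note t = tensor_map_klin[OF ms f g, of \<delta> \<delta>]
  have "mod_tensor_mor k \<delta> F G = mk_arrow ?S (tensor_map k M' X' f g) ?T"
    unfolding is_homD(2)[OF F] is_homD(2)[OF G] mod_tensor_mor_def mk_arrow_def arrow.sel
  proof (rule arg_cong[of _ _ "\<lambda>h. Arrow _ h _"], rule restrict_ext)
    fix u assume "u \<in> carrier ?S"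
    then have "untens u \<in> pairs M X" by (rule mod_tensor_pairs[OF mM(1) mX(1)])
    \<comment> \<open>The maps stored in the arrows are restricted, but the entries of
      \<open>untens u\<close> lie in the carriers, where the restriction has no effect.\<close>
    then have l: "map (\<lambda>(x, y). (restrict f (carrier M) x, restrict g (carrier X) y)) (untens u) = map (\<lambda>(x, y). (f x, g y)) (untens u)"
      by (auto simp: restrict_def)
    show "Tens (tmap k M' X' (restrict f (carrier M)) (restrict g (carrier X)) (untens u)) = tensor_map k M' X' f g u"
      unfolding tensor_map_def tmap_def l by (rule refl)
  qed
  moreover have "tensor_map k M' X' f g (act ?S a u) = act ?T a (tensor_map k M' X' f g u)"
    if a: "a \<in> carrier A" and u: "u \<in> carrier ?S" for a u
  proof (rule mod_tensor_ext[OF mM(1) mX(1) mT _ _ _ u])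
    show "(\<lambda>u. tensor_map k M' X' f g (act ?S a u)) \<in> klin k ?S ?T"
      by (intro klin_comp[OF t] klin_act2[OF amodule_mod_tensor[OF M(1) X(1)] a] klin_id)
    show "(\<lambda>u. act ?T a (tensor_map k M' X' f g u)) \<in> klin k ?S ?T"
      by (rule klin_act2[OF amodule_mod_tensor[OF M(2) X(2)] a t])
    fix x y assume x: "x \<in> carrier M" and y: "y \<in> carrier X"
    have "tensor_map k M' X' f g (act ?S a (tp k M X x y)) = tlift ?T (\<lambda>h h'. tensor_map k M' X' f g (tp k M X (act M h x) (act X h' y))) (\<delta> a)"
      unfolding act_tp[OF M(1) X(1) a x y]
      by (rule klin_tlift[OF t mS mT]) (use a x y in \<open>auto intro!: tp_cl[OF mM(1) mX(1)] act_cl[OF M(1)] act_cl[OF X(1)]\<close>)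
    also have "\<dots> = tlift ?T (\<lambda>h h'. tp k M' X' (act M' h (f x)) (act X' h' (g y))) (\<delta> a)"
      using a x y by (intro tlift_cong refl)
        (simp add: tensor_map_tp[OF ms f g] act_cl[OF M(1)] act_cl[OF X(1)] is_homD(3)[OF F] is_homD(3)[OF G])
    also have "\<dots> = act ?T a (tensor_map k M' X' f g (tp k M X x y))"
      by (simp add: tensor_map_tp[OF ms f g x y] act_tp[OF M(2) X(2) a klin_cl[OF f x] klin_cl[OF g y]])
    finally show "tensor_map k M' X' f g (act ?S a (tp k M X x y)) = act ?T a (tensor_map k M' X' f g (tp k M X x y))" .
  qed
  ultimately show ?thesis using t by (simp add: is_hom_def)
qed

text \<open>In the two bracketings \<open>a\<close> acts through the two iterated coproducts, so
  equivariance on pure tensors is coassociativity of the coaction.\<close>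

lemma assoc_hom:
  fixes M X Y :: "('k, 'h, 'a) mob"
  assumes M: "amodule k A M" and X: "amodule k H X" and Y: "amodule k H Y"
  shows "is_hom k A (mod_assoc k H \<delta> M X Y) (mod_tensor k \<delta> (mod_tensor k \<delta> M X) Y) (assoc_map k H M X Y)
    (mod_tensor k \<delta> M (mod_tensor k \<Delta> X Y))"
proof -
  interpret HH: comod k H H \<Delta> "TYPE('a)" by (rule comod_H)
  note m = amodule_module[OF M] amodule_module[OF X] amodule_module[OF Y]
  let ?P = "mod_tensor k \<delta> M X" and ?Q = "mod_tensor k \<Delta> X Y"
  let ?S = "mod_tensor k \<delta> ?P Y" and ?T = "mod_tensor k \<delta> M ?Q"
  note P = amodule_mod_tensor[OF M X] and Q = HH.amodule_mod_tensor[OF X Y]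
  note mP = amodule_module[OF P] and mQ = amodule_module[OF Q]
  note S = amodule_mod_tensor[OF P Y] and T = amodule_mod_tensor[OF M Q]
  note mS = amodule_module[OF S] and mT = amodule_module[OF T]
  note t = assoc_map_klin[OF m, of \<delta>]
  note acts = act_cl[OF M] act_cl[OF X] act_cl[OF Y]
  note cls = acts tp_cl[OF m(1,2)] tp_cl[OF m(2,3)] tp_cl[OF mP m(3)] tp_cl[OF m(1) mQ]
  have "assoc_map k H M X Y (act ?S a u) = act ?T a (assoc_map k H M X Y u)"
    if a: "a \<in> carrier A" and u: "u \<in> carrier ?S" for a u
  proof (rule ext3l[OF m mT _ _ _ u])
    show "(\<lambda>u. assoc_map k H M X Y (act ?S a u)) \<in> klin k ?S ?T"
      by (intro klin_comp[OF t] klin_act2[OF S a] klin_id)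
    show "(\<lambda>u. act ?T a (assoc_map k H M X Y u)) \<in> klin k ?S ?T"
      by (rule klin_act2[OF T a t])
    fix x y z assume x: "x \<in> carrier M" and y: "y \<in> carrier X" and z: "z \<in> carrier Y"
    have "act ?S a (tp k ?P Y (tp k M X x y) z)
      = tlift ?S (\<lambda>h h'. tlift ?S (\<lambda>h1 h2. tp k ?P Y (tp k M X (act M h1 x) (act X h2 y)) (act Y h' z)) (\<delta> h)) (\<delta> a)"
      unfolding act_tp[OF P Y a tp_cl[OF m(1,2) x y] z]
    proof (rule tlift_cong[OF refl])
      fix h h' assume h: "(h, h') \<in> set (\<delta> a)"
      then have hh: "h \<in> carrier A" "h' \<in> carrier H" using a by auto
      show "tp k ?P Y (act ?P h (tp k M X x y)) (act Y h' z) =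
        tlift ?S (\<lambda>h1 h2. tp k ?P Y (tp k M X (act M h1 x) (act X h2 y)) (act Y h' z)) (\<delta> h)"
        unfolding act_tp[OF M X hh(1) x y]
        by (rule klin_tlift[OF klin_tp1[OF mP m(3) _ klin_id] mP mS]) (use hh x y z in \<open>auto intro!: cls\<close>)
    qed
    then have "assoc_map k H M X Y (act ?S a (tp k ?P Y (tp k M X x y) z))
      = assoc_map k H M X Y (tlift ?S (\<lambda>h h'. tlift ?S (\<lambda>h1 h2. tp k ?P Y (tp k M X (act M h1 x) (act X h2 y)) (act Y h' z)) (\<delta> h)) (\<delta> a))"
      by simp
    also have "\<dots> = tlift ?T (\<lambda>h h'. assoc_map k H M X Y (tlift ?S (\<lambda>h1 h2. tp k ?P Y (tp k M X (act M h1 x) (act X h2 y)) (act Y h' z)) (\<delta> h))) (\<delta> a)"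
      by (rule klin_tlift[OF t mS mT]) (use a x y z in \<open>auto intro!: tlift_closed[OF mS] cls\<close>)
    also have "\<dots> = tlift ?T (\<lambda>h h'. tlift ?T (\<lambda>h1 h2. assoc_map k H M X Y (tp k ?P Y (tp k M X (act M h1 x) (act X h2 y)) (act Y h' z))) (\<delta> h)) (\<delta> a)"
      by (rule tlift_cong[OF refl], rule klin_tlift[OF t mS mT]) (use a x y z in \<open>auto intro!: cls\<close>)
    also have "\<dots> = tlift ?T (\<lambda>h h'. tlift ?T (\<lambda>h1 h2. tp k M ?Q (act M h1 x) (tp k X Y (act X h2 y) (act Y h' z))) (\<delta> h)) (\<delta> a)"
      using a x y z by (intro tlift_cong refl) (simp add: assoc_map_tp[OF m] acts)
    also have "\<dots> = tlift ?T (\<lambda>h h'. tlift ?T (\<lambda>h1 h2. tp k M ?Q (act M h x) (tp k X Y (act X h1 y) (act Y h2 z))) (\<Delta> h')) (\<delta> a)"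
      by (rule delta_coassoc[OF mT _ a]) (intro trilinI klin_tp1[OF m(1) mQ] klin_tp2[OF m(1) mQ]
        klin_tp1[OF m(2,3)] klin_tp2[OF m(2,3)] klin_act1[OF M] klin_act1[OF X] klin_act1[OF Y] klin_id cls x y z)
    also have "\<dots> = tlift ?T (\<lambda>h h'. tp k M ?Q (act M h x) (act ?Q h' (tp k X Y y z))) (\<delta> a)"
    proof (rule tlift_cong[OF refl])
      fix h h' assume h: "(h, h') \<in> set (\<delta> a)"
      then have hh: "h \<in> carrier A" "h' \<in> carrier H" using a by auto
      show "tlift ?T (\<lambda>h1 h2. tp k M ?Q (act M h x) (tp k X Y (act X h1 y) (act Y h2 z))) (\<Delta> h') =
        tp k M ?Q (act M h x) (act ?Q h' (tp k X Y y z))"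
        unfolding HH.act_tp[OF X Y hh(2) y z]
        by (rule klin_tlift[OF klin_tp2[OF m(1) mQ _ klin_id] mQ mT, symmetric]) (use hh x y z in \<open>auto intro!: cls\<close>)
    qed
    also have "\<dots> = act ?T a (tp k M ?Q x (tp k X Y y z))"
      by (rule act_tp[OF M Q a x tp_cl[OF m(2,3) y z], symmetric])
    also have "\<dots> = act ?T a (assoc_map k H M X Y (tp k ?P Y (tp k M X x y) z))"
      by (simp add: assoc_map_tp[OF m x y z])
    finally show "assoc_map k H M X Y (act ?S a (tp k ?P Y (tp k M X x y) z)) = act ?T a (assoc_map k H M X Y (tp k ?P Y (tp k M X x y) z))" .
  qed
  then show ?thesis using t by (simp add: is_hom_def mod_assoc_def assoc_map_def[abs_def])
qed

end

context comod
begin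

lemma act_unit: "c \<in> carrier k \<Longrightarrow> act (mod_unit k H :: ('k, 'h, 'a) mob) h (Scal c) = Scal (\<epsilon> h \<otimes>\<^bsub>k\<^esub> c)"
  by (simp add: mod_unit_def)

lemma k_comm: "c \<in> carrier k \<Longrightarrow> d \<in> carrier k \<Longrightarrow> c \<otimes>\<^bsub>k\<^esub> d = d \<otimes>\<^bsub>k\<^esub> c"
  using cring.cring_simprules(14)[OF cring_k] .

lemma unit_amodule: "amodule k H (mod_unit k H :: ('k, 'h, 'a) mob)"
  by (rule mod_unit_amodule) auto

text \<open>On the unit object the second leg of \<open>\<delta> a\<close> acts by its counit, so
  equivariance is the counit axiom of the coaction.\<close>

lemma runit_hom:
  fixes M :: "('k, 'h, 'a) mob"
  assumes M: "amodule k A M"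
  shows "is_hom k A (mod_runit k H \<delta> M) (mod_tensor k \<delta> M (mod_unit k H))
    (\<lambda>u. tlift M (\<lambda>x c. unscal c \<odot>\<^bsub>M\<^esub> x) (untens u)) M"
proof -
  let ?I = "mod_unit k H :: ('k, 'h, 'a) mob"
  let ?S = "mod_tensor k \<delta> M ?I"
  let ?f = "\<lambda>u. tlift M (\<lambda>x c. unscal c \<odot>\<^bsub>M\<^esub> x) (untens u)"
  note m = amodule_module[OF M] mod_unit_module
  note S = amodule_mod_tensor[OF M unit_amodule]
  note mS = amodule_module[OF S]
  note t = runit_map_klin[OF m(1), of \<delta>]
  have "?f (act ?S a u) = act M a (?f u)" if a: "a \<in> carrier A" and u: "u \<in> carrier ?S" for a u
  proof (rule mod_tensor_ext[OF m m(1) klin_comp[OF t klin_act2[OF S a klin_id]] klin_act2[OF M a t] _ u])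
    fix x c assume x: "x \<in> carrier M" and "c \<in> carrier ?I"
    then obtain d where c: "d \<in> carrier k" "c = Scal d" by (auto simp: mod_unit_def)
    have "?f (act ?S a (tp k M ?I x c)) = tlift M (\<lambda>h h'. ?f (tp k M ?I (act M h x) (act ?I h' c))) (\<delta> a)"
      unfolding act_tp[OF M unit_amodule a x \<open>c \<in> carrier ?I\<close>]
      by (rule klin_tlift[OF t mS m(1)]) (use a x \<open>c \<in> carrier ?I\<close> in
        \<open>auto intro!: tp_cl[OF m(1,2)] act_cl[OF M] act_cl[OF unit_amodule]\<close>)
    also have "\<dots> = tlift M (\<lambda>h h'. d \<odot>\<^bsub>M\<^esub> (\<epsilon> h' \<odot>\<^bsub>M\<^esub> act M h x)) (\<delta> a)"
      using a x c m(1) by (intro tlift_cong refl)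
        (simp add: act_unit runit_map_tp[OF m(1)] act_cl[OF M] k_comm[of "\<epsilon> _" d] mod_mults)
    also have "\<dots> = d \<odot>\<^bsub>M\<^esub> tlift M (\<lambda>h h'. \<epsilon> h' \<odot>\<^bsub>M\<^esub> act M h x) (\<delta> a)"
      by (rule tlift_smult[OF m(1) c(1)]) (use a x m(1) in \<open>auto intro!: mod_smult act_cl[OF M]\<close>)
    also have "\<dots> = d \<odot>\<^bsub>M\<^esub> act M a x"
      using delta_counit[OF m(1) klin_act1[OF M x klin_id] a] by simp
    also have "\<dots> = act M a (?f (tp k M ?I x c))"
      unfolding c(2) runit_map_tp[OF m(1) x c(1)] using klin_smult[OF bilinD1[OF act_bil[OF M] a] c(1) x] by simp
    finally show "?f (act ?S a (tp k M ?I x c)) = act M a (?f (tp k M ?I x c))" .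
  qed
  then show ?thesis using t by (simp add: is_hom_def mod_runit_def)
qed

end

context hopf_alg
begin

lemma lunit_hom:
  fixes M :: "('k, 'h, 'a) mob"
  assumes M: "amodule k H M"
  shows "is_hom k H (mod_lunit k H M) (mod_tensor k \<Delta> (mod_unit k H) M)
    (\<lambda>u. tlift M (\<lambda>c x. unscal c \<odot>\<^bsub>M\<^esub> x) (untens u)) M"
proof -
  interpret comod k H H \<Delta> "TYPE('a)" by (rule comod_H)
  let ?I = "mod_unit k H :: ('k, 'h, 'a) mob"
  let ?S = "mod_tensor k \<Delta> ?I M"
  let ?f = "\<lambda>u. tlift M (\<lambda>c x. unscal c \<odot>\<^bsub>M\<^esub> x) (untens u)"
  note m = mod_unit_module amodule_module[OF M]
  note S = amodule_mod_tensor[OF unit_amodule M]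
  note mS = amodule_module[OF S]
  note t = lunit_map_klin[OF m(2), of \<Delta>]
  have "?f (act ?S a u) = act M a (?f u)" if a: "a \<in> carrier H" and u: "u \<in> carrier ?S" for a u
  proof (rule mod_tensor_ext[OF m m(2) klin_comp[OF t klin_act2[OF S a klin_id]] klin_act2[OF M a t] _ u])
    fix x c assume x: "x \<in> carrier M" and cI: "c \<in> carrier ?I"
    then obtain d where c: "d \<in> carrier k" "c = Scal d" by (auto simp: mod_unit_def)
    have "?f (act ?S a (tp k ?I M c x)) = tlift M (\<lambda>h h'. ?f (tp k ?I M (act ?I h c) (act M h' x))) (\<Delta> a)"
      unfolding act_tp[OF unit_amodule M a cI x]
      by (rule klin_tlift[OF t mS m(2)]) (use a x cI in
        \<open>auto intro!: tp_cl[OF m(1,2)] act_cl[OF M] act_cl[OF unit_amodule]\<close>)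
    also have "\<dots> = tlift M (\<lambda>h h'. d \<odot>\<^bsub>M\<^esub> (\<epsilon> h \<odot>\<^bsub>M\<^esub> act M h' x)) (\<Delta> a)"
      using a x c m(2) by (intro tlift_cong refl)
        (simp add: act_unit lunit_map_tp[OF m(2)] act_cl[OF M] k_comm[of "\<epsilon> _" d] mod_mults)
    also have "\<dots> = d \<odot>\<^bsub>M\<^esub> tlift M (\<lambda>h h'. \<epsilon> h \<odot>\<^bsub>M\<^esub> act M h' x) (\<Delta> a)"
      by (rule tlift_smult[OF m(2) c(1)]) (use a x m(2) in \<open>auto intro!: mod_smult act_cl[OF M]\<close>)
    also have "\<dots> = d \<odot>\<^bsub>M\<^esub> act M a x"
      using counit_left[OF m(2) klin_act1[OF M x klin_id] a] by simp
    also have "\<dots> = act M a (?f (tp k ?I M c x))"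
      unfolding c(2) lunit_map_tp[OF m(2) x c(1)] using klin_smult[OF bilinD1[OF act_bil[OF M] a] c(1) x] by simp
    finally show "?f (act ?S a (tp k ?I M c x)) = act M a (?f (tp k ?I M c x))" .
  qed
  then show ?thesis using t by (simp add: is_hom_def mod_lunit_def)
qed

end

section \<open>The braiding\<close>

context over_field
begin

text \<open>The flip alone is used only as a linear map and in general does not respect the action,
  hence the independent \<open>\<delta>\<close> and \<open>\<delta>'\<close>.\<close>

lemma flip_klin:
  fixes X Y :: "('k, 'h, 'a) mob"
  assumes m: "module k X" "module k Y"
  shows "(\<lambda>u. Tens (tflip k X Y (untens u))) \<in> klin k (mod_tensor k \<delta> X Y) (mod_tensor k \<delta>' Y X)"
    and "x \<in> carrier X \<Longrightarrow> y \<in> carrier Y \<Longrightarrow> Tens (tflip k X Y (untens (tp k X Y x y))) = tp k Y X y x"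
proof -
  have b: "bilin k X Y (mod_tensor k \<delta>' Y X) (\<lambda>x y. tp k Y X y x)" for \<delta>' :: "'h \<Rightarrow> ('h \<times> 'h) list"
    by (intro bilinI klin_tp1 klin_tp2 m klin_id)
  have e: "Tens (tflip k X Y (untens u)) = mlift (mod_tensor k \<delta>' Y X) (\<lambda>x y. tp k Y X y x) u"
    if "u \<in> carrier (mod_tensor k \<delta> X Y)" for u and \<delta> \<delta>' :: "'h \<Rightarrow> ('h \<times> 'h) list"
  proof -
    have "map prod.swap (untens u) \<in> pairs Y X" using mod_tensor_pairs[OF m that] by auto
    from Tens_tnf[OF m(2,1) this] show ?thesis unfolding tflip_def mlift_def by (simp add: tlift_swap_map)
  qed
  show "(\<lambda>u. Tens (tflip k X Y (untens u))) \<in> klin k (mod_tensor k \<delta> X Y) (mod_tensor k \<delta>' Y X)"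
    by (rule klin_cong[OF module_mod_tensor[OF m] mlift_klin[OF m module_mod_tensor[OF m(2,1)] b] e])
  show "Tens (tflip k X Y (untens (tp k X Y x y))) = tp k Y X y x" if "x \<in> carrier X" "y \<in> carrier Y"
    using e[OF tp_cl[OF m that]] mlift_tp[OF m module_mod_tensor[OF m(2,1)] b that] by simp
qed

end

context qt_hopf
begin

context
  fixes X Y :: "('k, 'h, 'a) mob"
  assumes X: "amodule k H X" and Y: "amodule k H Y"
begin

interpretation comod k H H \<Delta> "TYPE('a)" by (rule comod_H)

lemmas mXY = amodule_module[OF X] amodule_module[OF Y]

abbreviation (input) "XY \<equiv> mod_tensor k \<Delta> X Y"
abbreviation (input) "YX \<equiv> mod_tensor k \<Delta> Y X"

lemmas aXY = amodule_mod_tensor[OF X Y] amodule_mod_tensor[OF Y X]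
lemmas mT2 = amodule_module[OF aXY(1)] amodule_module[OF aXY(2)]
lemmas cls2 = act_cl[OF X] act_cl[OF Y] tp_cl[OF mXY] tp_cl[OF mXY(2,1)]
lemmas lin2 = klin_tp1[OF mXY] klin_tp2[OF mXY] klin_tp1[OF mXY(2,1)] klin_tp2[OF mXY(2,1)]
  klin_act1[OF X] klin_act2[OF X] klin_act1[OF Y] klin_act2[OF Y]

lemma braid_map_klin: "mod_flip_R k R X Y \<in> klin k XY YX"
  unfolding mod_flip_R_def[abs_def]
  by (rule klin_comp[OF flip_klin(1)[OF mXY] tact_klin[OF X Y R_pairs]])

lemma braid_map_tp:
  assumes "x \<in> carrier X" "y \<in> carrier Y"
  shows "mod_flip_R k R X Y (tp k X Y x y) = tlift YX (\<lambda>a b. tp k Y X (act Y b y) (act X a x)) R"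
proof -
  let ?f = "\<lambda>u. Tens (tflip k X Y (untens u))"
  have "mod_flip_R k R X Y (tp k X Y x y) = ?f (tlift XY (\<lambda>a b. tp k X Y (act X a x) (act Y b y)) R)"
    by (simp add: mod_flip_R_def tact_tp[OF X Y R_pairs assms, of \<Delta>])
  also have "\<dots> = tlift YX (\<lambda>a b. ?f (tp k X Y (act X a x) (act Y b y))) R"
    by (rule klin_tlift[OF flip_klin(1)[OF mXY] mT2]) (use assms in \<open>auto intro!: cls2\<close>)
  also have "\<dots> = tlift YX (\<lambda>a b. tp k Y X (act Y b y) (act X a x)) R"
    using assms by (intro tlift_cong refl) (simp add: flip_klin(2)[OF mXY] cls2)
  finally show ?thesis .
qed

text \<open>On pure tensors both sides are double sums over \<open>R\<close> and
  \<open>\<Delta> h\<close>, and \<open>R_comm\<close> exchanges the order in which the two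
  act.\<close>

lemma braid_hom: "is_hom k H (mod_braid k H R X Y) XY (mod_flip_R k R X Y) YX"
proof -
  let ?f = "mod_flip_R k R X Y"
  note t = braid_map_klin
  have "?f (act XY h u) = act YX h (?f u)" if h: "h \<in> carrier H" and u: "u \<in> carrier XY" for h u
  proof (rule mod_tensor_ext[OF mXY mT2(2) klin_comp[OF t klin_act2[OF aXY(1) h klin_id]] klin_act2[OF aXY(2) h t] _ u])
    fix x y assume x: "x \<in> carrier X" and y: "y \<in> carrier Y"
    have "?f (act XY h (tp k X Y x y)) = tlift YX (\<lambda>c d. ?f (tp k X Y (act X c x) (act Y d y))) (\<Delta> h)"
      unfolding act_tp[OF X Y h x y] by (rule klin_tlift[OF t mT2]) (use h x y in \<open>auto intro!: cls2\<close>)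
    also have "\<dots> = tlift YX (\<lambda>c d. tlift YX (\<lambda>a b. tp k Y X (act Y b (act Y d y)) (act X a (act X c x))) R) (\<Delta> h)"
      using h x y by (intro tlift_cong refl) (simp add: braid_map_tp cls2)
    \<comment> \<open>As \<open>h\<close> acts first, its sum is outermost; \<open>R_comm\<close>
      expects the left factor \<open>R\<close> of the product there.\<close>
    also have "\<dots> = tlift YX (\<lambda>a b. tlift YX (\<lambda>c d. tp k Y X (act Y b (act Y d y)) (act X a (act X c x))) (\<Delta> h)) R"
      by (rule tlift_Fubini[OF mT2(2)]) (use h x y in \<open>auto intro!: cls2\<close>)
    also have "\<dots> = tlift YX (\<lambda>a b. tlift YX (\<lambda>c d. tp k Y X (act Y (b \<cdot> d) y) (act X (a \<cdot> c) x)) (\<Delta> h)) R"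
      using h x y by (intro tlift_cong refl) (simp add: act_mult[OF X] act_mult[OF Y])
    also have "\<dots> = tlift YX (\<lambda>c d. tlift YX (\<lambda>a b. tp k Y X (act Y (c \<cdot> b) y) (act X (d \<cdot> a) x)) R) (\<Delta> h)"
      by (rule R_comm[OF mT2(2) _ h]) (intro bilinI lin2 klin_id cls2 x y)
    also have "\<dots> = tlift YX (\<lambda>a b. tlift YX (\<lambda>c d. tp k Y X (act Y (c \<cdot> b) y) (act X (d \<cdot> a) x)) (\<Delta> h)) R"
      by (rule tlift_Fubini[OF mT2(2)]) (use h x y in \<open>auto intro!: cls2\<close>)
    also have "\<dots> = tlift YX (\<lambda>a b. act YX h (tp k Y X (act Y b y) (act X a x))) R"
      using h x y by (intro tlift_cong refl) (simp add: act_tp[OF Y X h] act_mult[OF X] act_mult[OF Y] cls2)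
    also have "\<dots> = act YX h (?f (tp k X Y x y))"
      unfolding braid_map_tp[OF x y]
      by (rule klin_tlift[OF klin_act2[OF aXY(2) h klin_id] mT2(2,2), symmetric]) (use x y in \<open>auto intro!: cls2\<close>)
    finally show "?f (act XY h (tp k X Y x y)) = act YX h (?f (tp k X Y x y))" .
  qed
  then show ?thesis using t by (simp add: is_hom_def mod_braid_def)
qed

text \<open>The braiding acts by \<open>R\<close> and then flips; its inverse flips back and then
  acts by \<open>R_inv\<close>.\<close>

definition braid_inv where "braid_inv = mlift XY (\<lambda>y x. tlift XY (\<lambda>a b. tp k X Y (act X a x) (act Y b y)) R_inv)"

lemma bilin_braid_inv: "bilin k Y X XY (\<lambda>y x. tlift XY (\<lambda>a b. tp k X Y (act X a x) (act Y b y)) R_inv)"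
  by (intro bilinI klin_tlift_fun mT2 lin2 klin_id; auto intro!: cls2)

lemma braid_inv_klin: "braid_inv \<in> klin k YX XY"
  unfolding braid_inv_def by (rule mlift_klin[OF mXY(2,1) mT2(1) bilin_braid_inv])

lemma braid_inv_tp: "x \<in> carrier X \<Longrightarrow> y \<in> carrier Y \<Longrightarrow>
    braid_inv (tp k Y X y x) = tlift XY (\<lambda>a b. tp k X Y (act X a x) (act Y b y)) R_inv"
  unfolding braid_inv_def by (rule mlift_tp[OF mXY(2,1) mT2(1) bilin_braid_inv])

lemma braid_inv_map: "u \<in> carrier XY \<Longrightarrow> braid_inv (mod_flip_R k R X Y u) = u"
proof (rule mod_tensor_ext[OF mXY mT2(1) klin_comp[OF braid_inv_klin braid_map_klin] klin_id])
  fix x y assume x: "x \<in> carrier X" and y: "y \<in> carrier Y"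
  have "braid_inv (mod_flip_R k R X Y (tp k X Y x y)) = tlift XY (\<lambda>c d. braid_inv (tp k Y X (act Y d y) (act X c x))) R"
    unfolding braid_map_tp[OF x y] by (rule klin_tlift[OF braid_inv_klin mT2(2,1)]) (use x y in \<open>auto intro!: cls2\<close>)
  also have "\<dots> = tlift XY (\<lambda>c d. tlift XY (\<lambda>a b. tp k X Y (act X (a \<cdot> c) x) (act Y (b \<cdot> d) y)) R_inv) R"
    using x y by (intro tlift_cong refl) (simp add: braid_inv_tp cls2 act_mult[OF X] act_mult[OF Y])
  also have "\<dots> = tlift XY (\<lambda>a b. tlift XY (\<lambda>c d. tp k X Y (act X (a \<cdot> c) x) (act Y (b \<cdot> d) y)) R) R_inv"
    by (rule tlift_Fubini[OF mT2(1)]) (use x y in \<open>auto intro!: cls2\<close>)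
  also have "\<dots> = tp k X Y (act X \<one>\<^bsub>H\<^esub> x) (act Y \<one>\<^bsub>H\<^esub> y)"
    by (rule tlift_R_inv_R[OF mT2(1)]) (intro bilinI lin2 klin_id cls2 x y)
  finally show "braid_inv (mod_flip_R k R X Y (tp k X Y x y)) = tp k X Y x y"
    using x y by (simp add: act_one[OF X] act_one[OF Y])
qed

lemma braid_map_inv: "u \<in> carrier YX \<Longrightarrow> mod_flip_R k R X Y (braid_inv u) = u"
proof (rule mod_tensor_ext[OF mXY(2,1) mT2(2) klin_comp[OF braid_map_klin braid_inv_klin] klin_id])
  fix y x assume y: "y \<in> carrier Y" and x: "x \<in> carrier X"
  have "mod_flip_R k R X Y (braid_inv (tp k Y X y x)) = tlift YX (\<lambda>c d. mod_flip_R k R X Y (tp k X Y (act X c x) (act Y d y))) R_inv"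
    unfolding braid_inv_tp[OF x y] by (rule klin_tlift[OF braid_map_klin mT2]) (use x y in \<open>auto intro!: cls2\<close>)
  also have "\<dots> = tlift YX (\<lambda>c d. tlift YX (\<lambda>a b. tp k Y X (act Y (b \<cdot> d) y) (act X (a \<cdot> c) x)) R) R_inv"
    using x y by (intro tlift_cong refl) (simp add: braid_map_tp cls2 act_mult[OF X] act_mult[OF Y])
  also have "\<dots> = tlift YX (\<lambda>a b. tlift YX (\<lambda>c d. tp k Y X (act Y (b \<cdot> d) y) (act X (a \<cdot> c) x)) R_inv) R"
    by (rule tlift_Fubini[OF mT2(2)]) (use x y in \<open>auto intro!: cls2\<close>)
  also have "\<dots> = tp k Y X (act Y \<one>\<^bsub>H\<^esub> y) (act X \<one>\<^bsub>H\<^esub> x)"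
    by (rule tlift_R_R_inv[OF mT2(2)]) (intro bilinI lin2 klin_id cls2 x y)
  finally show "mod_flip_R k R X Y (braid_inv (tp k Y X y x)) = tp k Y X y x"
    using x y by (simp add: act_one[OF X] act_one[OF Y])
qed

end

end

section \<open>Twisted modules\<close>

context inv_hopf
begin

abbreviation tw where "tw \<equiv> twist \<phi>"

lemma tw_simps [simp]: "carrier (tw X) = carrier X" "act (tw X) h = act X (\<phi> h)"
  by (simp_all add: twist_def)

text \<open>Rewrite rules that strip \<open>tw\<close> from everything determined by the linear
  structure, so that in a coherence condition only the actions remain to be compared.\<close>

lemma tw_lin:
  "tp k (tw X) Y = tp k X Y" "tp k X (tw Y) = tp k X Y" "tlift (tw U) f t = tlift U f t"
  "tp k (mod_tensor k \<delta> (tw X) Y) Z = tp k (mod_tensor k \<delta> X Y) Z"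
  "tp k (mod_tensor k \<delta> X (tw Y)) Z = tp k (mod_tensor k \<delta> X Y) Z"
  "tp k Z (mod_tensor k \<delta> (tw X) Y) = tp k Z (mod_tensor k \<delta> X Y)"
  "tp k Z (mod_tensor k \<delta> X (tw Y)) = tp k Z (mod_tensor k \<delta> X Y)"
  "tlift (mod_tensor k \<delta> (tw X) Y) f t = tlift (mod_tensor k \<delta> X Y) f t"
  "tlift (mod_tensor k \<delta> X (tw Y)) f t = tlift (mod_tensor k \<delta> X Y) f t"
  by (intro tp_lineq tlift_lineq lineq_mod_tensor lineq_twist lineq_refl)+

lemma tw_klin1: "klin k (tw X) Y = klin k X Y"
  by (rule klin_lineq[OF lineq_twist(1) lineq_refl])

lemma tw_klin2: "klin k X (tw Y) = klin k X Y"
  by (rule klin_lineq[OF lineq_refl lineq_twist(1)])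

lemma tw_klin3: "klin k (mod_tensor k \<delta> (tw X) Y) Z = klin k (mod_tensor k \<delta> X Y) Z"
  "klin k (mod_tensor k \<delta> X (tw Y)) Z = klin k (mod_tensor k \<delta> X Y) Z"
  "klin k Z (mod_tensor k \<delta> (tw X) Y) = klin k Z (mod_tensor k \<delta> X Y)"
  "klin k Z (mod_tensor k \<delta> X (tw Y)) = klin k Z (mod_tensor k \<delta> X Y)"
  by (intro klin_lineq lineq_mod_tensor lineq_twist lineq_refl)+

lemmas tw_klin = tw_klin1 tw_klin2 tw_klin3

lemma tw_carrier: "carrier (mod_tensor k \<delta> (tw X) Y) = carrier (mod_tensor k \<delta> X Y)"
  "carrier (mod_tensor k \<delta> X (tw Y)) = carrier (mod_tensor k \<delta> X Y)"
  using lineq_mod_tensor[OF lineq_twist(1) lineq_refl] lineq_mod_tensor[OF lineq_refl lineq_twist(1)]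
  unfolding lineq_def by blast+

lemma tw_module: "module k X \<Longrightarrow> module k (tw X)"
proof -
  assume m: "module k X"
  interpret X: module k X by (rule m)
  show ?thesis
  proof (rule moduleI)
    show "abelian_group (tw X)"
    proof (rule abelian_groupI)
      show "\<exists>y\<in>carrier (tw X). y \<oplus>\<^bsub>tw X\<^esub> x = \<zero>\<^bsub>tw X\<^esub>" if "x \<in> carrier (tw X)" for x
        using that X.M.l_neg[of x] by (auto simp: twist_def intro!: bexI[of _ "\<ominus>\<^bsub>X\<^esub> x"])
    qed (auto simp: twist_def X.M.a_ac)
  qed (auto simp: twist_def cring_k X.smult_l_distr X.smult_r_distr X.smult_assoc1)
qed

lemma tw_amodule:
  assumes X: "amodule k H X"
  shows "amodule k H (tw X)"
proof (rule amoduleI[OF tw_module[OF amodule_module[OF X]]])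
  show "bilin k H (tw X) (tw X) (act (tw X))"
    unfolding bilin_def
    by (intro conjI ballI) (simp_all add: tw_klin bilinD1[OF act_bil[OF X]] klin_act1[OF X _ phi_klin])
qed (auto simp: act_mult[OF X] act_one[OF X] phi_mult)

lemma tw_mor: "is_hom k H F X f Y \<Longrightarrow> is_hom k H (Arrow (tw (src F)) (fnc F) (tw (tgt F))) (tw X) f (tw Y)"
  unfolding is_hom_def tw_klin by (auto simp: mk_arrow_def)

text \<open>Because \<open>\<phi>\<close> is compatible with the coproduct, twisting commutes with
  the tensor product. The carriers coincide, so this is an equality of actions rather than an
  isomorphism.\<close>

lemma tw_act:
  fixes X Y :: "('k, 'h, 'a) mob"
  assumes X: "amodule k H X" and Y: "amodule k H Y" and h: "h \<in> carrier H"
    and u: "u \<in> carrier (mod_tensor k \<Delta> X Y)"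
  shows "act (mod_tensor k \<Delta> (tw X) (tw Y)) h u = act (mod_tensor k \<Delta> X Y) (\<phi> h) u"
proof -
  interpret comod k H H \<Delta> "TYPE('a)" by (rule comod_H)
  let ?T = "mod_tensor k \<Delta> X Y"
  note m = amodule_module[OF X] amodule_module[OF Y]
  note T = amodule_mod_tensor[OF X Y] note T' = amodule_mod_tensor[OF tw_amodule[OF X] tw_amodule[OF Y]]
  have l: "(\<lambda>u. act (mod_tensor k \<Delta> (tw X) (tw Y)) h u) \<in> klin k ?T ?T"
    using klin_act2[OF T' h klin_id] by (simp add: tw_klin)
  show ?thesis
  proof (rule mod_tensor_ext[OF m amodule_module[OF T] l klin_act2[OF T phi_cl[OF h] klin_id] _ u])
    fix x y assume x: "x \<in> carrier X" and y: "y \<in> carrier Y"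
    have "act (mod_tensor k \<Delta> (tw X) (tw Y)) h (tp k X Y x y)
      = tlift ?T (\<lambda>a b. tp k X Y (act X (\<phi> a) x) (act Y (\<phi> b) y)) (\<Delta> h)"
      using act_tp[OF tw_amodule[OF X] tw_amodule[OF Y] h, of x y] x y by (simp add: tw_lin)
    also have "\<dots> = tlift ?T (\<lambda>a b. tp k X Y (act X a x) (act Y b y)) (\<Delta> (\<phi> h))"
      by (rule phi_comult[OF amodule_module[OF T] _ h, symmetric])
        (intro bilinI klin_tp1[OF m] klin_tp2[OF m] klin_act1[OF X] klin_act1[OF Y] klin_id act_cl[OF X] act_cl[OF Y] x y)
    also have "\<dots> = act ?T (\<phi> h) (tp k X Y x y)"
      using act_tp[OF X Y phi_cl[OF h] x y] by simp
    finally show "act (mod_tensor k \<Delta> (tw X) (tw Y)) h (tp k X Y x y) = act ?T (\<phi> h) (tp k X Y x y)" .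
  qed
qed

text \<open>Obtained from the braiding of the twisted modules by reading its target, via
  \<open>tw_act\<close>, as the twist of a tensor product.\<close>

lemma f2_hom_twisted:
  fixes X Y :: "('k, 'h, 'a) mob"
  assumes X: "amodule k H X" and Y: "amodule k H Y"
  shows "is_hom k H (f2 (twist_functor k H R \<phi>) X Y) (mod_tensor k \<Delta> (tw Y) (tw X))
    (mod_flip_R k R (tw Y) (tw X)) (tw (mod_tensor k \<Delta> X Y))"
proof -
  note b = braid_hom[OF tw_amodule[OF Y] tw_amodule[OF X]]
  have "act (mod_tensor k \<Delta> (tw X) (tw Y)) h (mod_flip_R k R (tw Y) (tw X) u)
    = act (tw (mod_tensor k \<Delta> X Y)) h (mod_flip_R k R (tw Y) (tw X) u)"
    if "h \<in> carrier H" "u \<in> carrier (mod_tensor k \<Delta> (tw Y) (tw X))" for h u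
    using tw_act[OF X Y that(1)] klin_cl[OF is_homD(1)[OF b] that(2)] by (simp add: tw_carrier)
  then show ?thesis using b by (simp add: is_hom_def twist_functor_def tw_klin)
qed

lemma f0_hom: "is_hom k H (f0 (twist_functor k H R \<phi>)) (mod_unit k H :: ('k, 'h, 'a) mob) (\<lambda>x. x) (tw (mod_unit k H))"
  by (simp add: is_hom_def twist_functor_def tw_klin klin_id) (simp add: mod_unit_def)

end

lemma (in coideal) comod_B: "comod TYPE('a) k H A0 \<delta>"
  by unfold_locales (simp_all add: algebra_B coaction_klin coaction_mult coaction_one coaction_coassoc coaction_counit)

section \<open>The action of the universal K-matrix as a morphism\<close>

context kmat
begin

context
  fixes M X :: "('k, 'h, 'a) mob"
  assumes M: "amodule k A0 M" and X: "amodule k H X"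
begin

interpretation comod k H A0 \<delta> "TYPE('a)" by (rule comod_B)

lemmas mMX = amodule_module[OF M] amodule_module[OF X]
abbreviation (input) "MX \<equiv> mod_tensor k \<delta> M X"
lemmas aMX = amodule_mod_tensor[OF M X]
lemmas mMXT = amodule_module[OF aMX]
lemmas clsK = act_cl[OF M] act_cl[OF X] tp_cl[OF mMX]
lemmas linK = klin_tp1[OF mMX] klin_tp2[OF mMX] klin_act1[OF M] klin_act2[OF M] klin_act1[OF X] klin_act2[OF X]

lemma K0_L: "K0 \<in> pairs A0 H" "K_inv0 \<in> pairs A0 H"
  using tens_L[OF module_B module_H] restrict(1)[OF K_BH] restrict(1)[OF K_inv(1)] by auto

lemmas K_map_klin = tact_klin[OF M X K0_L(1), of \<delta>] tact_klin[OF M X K0_L(2), of \<delta>]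
lemmas K_map_tp = tact_tp[OF M X K0_L(1), of _ _ \<delta>] tact_tp[OF M X K0_L(2), of _ _ \<delta>]

text \<open>\<open>B\<close>-linearity on pure tensors is \<open>K_comm\<close>; the
  \<open>\<phi>\<close> on its right-hand side is the twisted action on the target.\<close>

lemma K_hom: "is_hom k A0 (K_action k H \<phi> B K M X) MX (tact k M X K0) (mod_tensor k \<delta> M (tw X))"
proof -
  let ?f = "tact k M X K0"
  note aT = amodule_mod_tensor[OF M tw_amodule[OF X]]
  have l: "?f \<in> klin k MX (mod_tensor k \<delta> M (tw X))" using K_map_klin(1) by (simp add: tw_klin)
  have "?f (act MX b u) = act (mod_tensor k \<delta> M (tw X)) b (?f u)" if b: "b \<in> carrier A0" and u: "u \<in> carrier MX" for b u
  proof (rule mod_tensor_ext[OF mMX amodule_module[OF aT] klin_comp[OF l klin_act2[OF aMX b klin_id]] klin_act2[OF aT b l] _ u])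
    have b': "b \<in> B" using b by simp
    fix x y assume x: "x \<in> carrier M" and y: "y \<in> carrier X"
    have "?f (act MX b (tp k M X x y)) = tlift MX (\<lambda>c d. ?f (tp k M X (act M c x) (act X d y))) (\<delta> b)"
      unfolding act_tp[OF M X b x y] by (rule klin_tlift[OF K_map_klin(1) mMXT mMXT]) (use b' x y in \<open>auto intro!: clsK\<close>)
    also have "\<dots> = tlift MX (\<lambda>c d. tlift MX (\<lambda>a e. tp k M X (act M (a \<cdot> c) x) (act X (e \<cdot> d) y)) K0) (\<delta> b)"
      using b' x y act_mult[OF M] act_mult[OF X] by (intro tlift_cong refl) (simp add: K_map_tp clsK)
    also have "\<dots> = tlift MX (\<lambda>a e. tlift MX (\<lambda>c d. tp k M X (act M (a \<cdot> c) x) (act X (e \<cdot> d) y)) (\<delta> b)) K0"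
      by (rule tlift_Fubini[OF mMXT]) (use b' x y in \<open>auto intro!: clsK B_ring\<close>)
    also have "\<dots> = tlift MX (\<lambda>c d. tlift MX (\<lambda>a e. tp k M X (act M (c \<cdot> a) x) (act X (\<phi> d \<cdot> e) y)) K0) (\<delta> b)"
      by (rule K_comm[OF mMXT _ b']) (intro bilinI linK klin_id clsK x y)
    also have "\<dots> = tlift MX (\<lambda>a e. tlift MX (\<lambda>c d. tp k M X (act M (c \<cdot> a) x) (act X (\<phi> d \<cdot> e) y)) (\<delta> b)) K0"
      by (rule tlift_Fubini[OF mMXT]) (use b' x y in \<open>auto intro!: clsK B_ring\<close>)
    also have "\<dots> = tlift MX (\<lambda>a e. act (mod_tensor k \<delta> M (tw X)) b (tp k M X (act M a x) (act X e y))) K0"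
    proof (rule tlift_cong[OF refl])
      fix a e assume "(a, e) \<in> set K0"
      then have ae: "a \<in> B" "e \<in> carrier H" by auto
      show "tlift MX (\<lambda>c d. tp k M X (act M (c \<cdot> a) x) (act X (\<phi> d \<cdot> e) y)) (\<delta> b)
        = act (mod_tensor k \<delta> M (tw X)) b (tp k M X (act M a x) (act X e y))"
        using act_tp[OF M tw_amodule[OF X] b, of "act M a x" "act X e y"] ae x y b' act_mult[OF M] act_mult[OF X]
        by (simp add: tw_lin clsK)
    qed
    also have "\<dots> = act (mod_tensor k \<delta> M (tw X)) b (?f (tp k M X x y))"
    proof -
      have l': "(\<lambda>u. act (mod_tensor k \<delta> M (tw X)) b u) \<in> klin k MX MX"
        using klin_act2[OF aT b klin_id] by (simp add: tw_klin)
      show ?thesis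
        unfolding K_map_tp(1)[OF x y] by (rule klin_tlift[OF l' mMXT mMXT, symmetric]) (use x y in \<open>auto intro!: clsK\<close>)
    qed
    finally show "?f (act MX b (tp k M X x y)) = act (mod_tensor k \<delta> M (tw X)) b (?f (tp k M X x y))" .
  qed
  then show ?thesis using l by (simp add: is_hom_def K_action_def)
qed

lemma K_inverse:
  assumes "u \<in> carrier MX"
  shows "tact k M X K_inv0 (tact k M X K0 u) = u" "tact k M X K0 (tact k M X K_inv0 u) = u"
proof -
  note one = act_one[OF M] act_one[OF X]
  have b: "bilin k A0 H MX (\<lambda>a c. tp k M X (act M a x) (act X c y))" if "x \<in> carrier M" "y \<in> carrier X" for x y
    using that by (intro bilinI linK klin_id clsK)
  show "tact k M X K_inv0 (tact k M X K0 u) = u"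
  proof (rule mod_tensor_ext[OF mMX mMXT klin_comp[OF K_map_klin(2,1)] klin_id _ assms])
    fix x y assume x: "x \<in> carrier M" and y: "y \<in> carrier X"
    have "tact k M X K_inv0 (tact k M X K0 (tp k M X x y)) = tlift MX (\<lambda>c d. tact k M X K_inv0 (tp k M X (act M c x) (act X d y))) K0"
      unfolding K_map_tp(1)[OF x y] by (rule klin_tlift[OF K_map_klin(2) mMXT mMXT]) (use x y in \<open>auto intro!: clsK\<close>)
    also have "\<dots> = tlift MX (\<lambda>c d. tlift MX (\<lambda>a e. tp k M X (act M (a \<cdot> c) x) (act X (e \<cdot> d) y)) K_inv0) K0"
      using x y act_mult[OF M] act_mult[OF X] by (intro tlift_cong refl) (simp add: K_map_tp clsK)
    also have "\<dots> = tlift MX (\<lambda>a e. tlift MX (\<lambda>c d. tp k M X (act M (a \<cdot> c) x) (act X (e \<cdot> d) y)) K0) K_inv0"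
      by (rule tlift_Fubini[OF mMXT]) (use x y in \<open>auto intro!: clsK B_ring\<close>)
    also have "\<dots> = tp k M X x y" using tlift_K_K_inv(2)[OF mMXT b[OF x y]] one x y by simp
    finally show "tact k M X K_inv0 (tact k M X K0 (tp k M X x y)) = tp k M X x y" .
  qed
  show "tact k M X K0 (tact k M X K_inv0 u) = u"
  proof (rule mod_tensor_ext[OF mMX mMXT klin_comp[OF K_map_klin] klin_id _ assms])
    fix x y assume x: "x \<in> carrier M" and y: "y \<in> carrier X"
    have "tact k M X K0 (tact k M X K_inv0 (tp k M X x y)) = tlift MX (\<lambda>c d. tact k M X K0 (tp k M X (act M c x) (act X d y))) K_inv0"
      unfolding K_map_tp(2)[OF x y] by (rule klin_tlift[OF K_map_klin(1) mMXT mMXT]) (use x y in \<open>auto intro!: clsK\<close>)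
    also have "\<dots> = tlift MX (\<lambda>c d. tlift MX (\<lambda>a e. tp k M X (act M (a \<cdot> c) x) (act X (e \<cdot> d) y)) K0) K_inv0"
      using x y act_mult[OF M] act_mult[OF X] by (intro tlift_cong refl) (simp add: K_map_tp clsK)
    also have "\<dots> = tlift MX (\<lambda>a e. tlift MX (\<lambda>c d. tp k M X (act M (a \<cdot> c) x) (act X (e \<cdot> d) y)) K_inv0) K0"
      by (rule tlift_Fubini[OF mMXT]) (use x y in \<open>auto intro!: clsK B_ring\<close>)
    also have "\<dots> = tp k M X x y" using tlift_K_K_inv(1)[OF mMXT b[OF x y]] one x y by simp
    finally show "tact k M X K0 (tact k M X K_inv0 (tp k M X x y)) = tp k M X x y" .
  qed
qed

end

end

section \<open>The braided monoidal category and its module category\<close>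

context over_field
begin

lemma tensor_map_id:
  fixes X Y :: "('k, 'h, 'a) mob"
  assumes m: "module k X" "module k Y" and u: "u \<in> carrier (mod_tensor k \<delta> X Y)"
  shows "tensor_map k X Y (\<lambda>x. x) (\<lambda>x. x) u = u"
  by (rule mod_tensor_ext[OF m module_mod_tensor[OF m] tensor_map_klin[OF m m klin_id klin_id] klin_id _ u])
    (simp add: tensor_map_tp[OF m m klin_id klin_id])

text \<open>This and its companions move a structure map into a sum; used as rewrite rules they
  evaluate a whole composite on a pure tensor down to nested sums.\<close>

lemma push_tensor_map:
  fixes X Y X' Y' :: "('k, 'h, 'a) mob"
  assumes "module k X" "module k Y" "module k X'" "module k Y'" "f \<in> klin k X X'" "g \<in> klin k Y Y'"
    "\<And>a b. (a, b) \<in> set t \<Longrightarrow> h a b \<in> carrier (mod_tensor k \<delta> X Y)"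
  shows "tensor_map k X' Y' f g (tlift (mod_tensor k \<delta> X Y) h t)
    = tlift (mod_tensor k \<delta> X' Y') (\<lambda>a b. tensor_map k X' Y' f g (h a b)) t"
  by (rule klin_tlift[OF tensor_map_klin[OF assms(1-6)]]) (simp_all add: module_mod_tensor assms)

lemma push_tp1:
  fixes X Y :: "('k, 'h, 'a) mob"
  assumes "module k X" "module k Y" "y \<in> carrier Y" "\<And>a b. (a, b) \<in> set t \<Longrightarrow> h a b \<in> carrier X"
  shows "tp k X Y (tlift X h t) y = tlift (mod_tensor k \<delta> X Y) (\<lambda>a b. tp k X Y (h a b) y) t"
  by (rule klin_tlift[OF klin_tp1[OF assms(1-3) klin_id]]) (simp_all add: module_mod_tensor assms)

lemma push_tp2:
  fixes X Y :: "('k, 'h, 'a) mob"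
  assumes "module k X" "module k Y" "x \<in> carrier X" "\<And>a b. (a, b) \<in> set t \<Longrightarrow> h a b \<in> carrier Y"
  shows "tp k X Y x (tlift Y h t) = tlift (mod_tensor k \<delta> X Y) (\<lambda>a b. tp k X Y x (h a b)) t"
  by (rule klin_tlift[OF klin_tp2[OF assms(1-3) klin_id]]) (simp_all add: module_mod_tensor assms)

end

context hopf_alg
begin

lemma push_assoc_map:
  fixes X Y Z :: "('k, 'h, 'a) mob"
  assumes m: "module k X" "module k Y" "module k Z"
    and h: "\<And>a b. (a, b) \<in> set t \<Longrightarrow> h a b \<in> carrier (mod_tensor k \<delta> (mod_tensor k \<delta> X Y) Z)"
  shows "assoc_map k H X Y Z (tlift (mod_tensor k \<delta> (mod_tensor k \<delta> X Y) Z) h t)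
    = tlift (mod_tensor k \<delta> X (mod_tensor k \<Delta> Y Z)) (\<lambda>a b. assoc_map k H X Y Z (h a b)) t"
  by (rule klin_tlift[OF assoc_map_klin[OF m]]) (simp_all add: module_mod_tensor m h)

lemma push_assoc_unmap:
  fixes X Y Z :: "('k, 'h, 'a) mob"
  assumes m: "module k X" "module k Y" "module k Z"
    and h: "\<And>a b. (a, b) \<in> set t \<Longrightarrow> h a b \<in> carrier (mod_tensor k \<delta> X (mod_tensor k \<Delta> Y Z))"
  shows "assoc_unmap k \<delta> X Y Z (tlift (mod_tensor k \<delta> X (mod_tensor k \<Delta> Y Z)) h t)
    = tlift (mod_tensor k \<delta> (mod_tensor k \<delta> X Y) Z) (\<lambda>a b. assoc_unmap k \<delta> X Y Z (h a b)) t"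
  by (rule klin_tlift[OF assoc_unmap_klin[OF m]]) (simp_all add: module_mod_tensor m h)

lemmas tensor_eval = tensor_map_tp tensor_map_klin assoc_map_tp assoc_map_klin assoc_unmap_tp assoc_unmap_klin klin_id module_mod_tensor

end

context comod
begin

lemma hom_tmo_idm:
  fixes M X :: "('k, 'h, 'a) mob"
  assumes M: "amodule k A M" and X: "amodule k H X"
  shows "mod_tensor_mor k \<delta> (amod_id M) (amod_id X) = amod_id (mod_tensor k \<delta> M X)"
  by (rule hom_eqI[OF tens_hom[OF is_hom_id is_hom_id M M X X] is_hom_id tensor_map_id[OF amodule_module[OF M] amodule_module[OF X]]])

text \<open>The pattern for the coherence conditions: \<open>P\<close> and \<open>Q\<close> record
  the two sides together with their inducing maps, and \<open>hom_eqI\<close> followed by an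
  extensionality rule leaves an equation on pure tensors.\<close>

lemma hom_tmo_cmp:
  fixes M M' M'' X X' X'' :: "('k, 'h, 'a) mob"
  assumes M: "amodule k A M" "amodule k A M'" "amodule k A M''" and X: "amodule k H X" "amodule k H X'" "amodule k H X''"
    and F: "is_hom k A F M f M'" "is_hom k A F' M' f' M''" and G: "is_hom k H G X g X'" "is_hom k H G' X' g' X''"
  shows "mod_tensor_mor k \<delta> (amod_comp F' F) (amod_comp G' G) = amod_comp (mod_tensor_mor k \<delta> F' G') (mod_tensor_mor k \<delta> F G)"
proof -
  note m = M[THEN amodule_module] X[THEN amodule_module]
  note kl = F[THEN is_homD(1)] G[THEN is_homD(1)]
  note P = tens_hom[OF is_hom_comp[OF F] is_hom_comp[OF G] M(1,3) X(1,3)]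
  note Q = is_hom_comp[OF tens_hom[OF F(1) G(1) M(1,2) X(1,2)] tens_hom[OF F(2) G(2) M(2,3) X(2,3)]]
  show ?thesis
    by (rule hom_eqI[OF P Q], rule mod_tensor_ext[OF m(1,4) module_mod_tensor[OF m(3,6)] is_homD(1)[OF P] is_homD(1)[OF Q]])
      (simp_all add: tensor_eval m kl klin_comp[OF kl(2,1)] klin_comp[OF kl(4,3)] klin_cl[OF kl(1)] klin_cl[OF kl(3)])
qed

lemma hom_asc_nat:
  fixes M M' X X' Y Y' :: "('k, 'h, 'a) mob"
  assumes M: "amodule k A M" "amodule k A M'" and X: "amodule k H X" "amodule k H X'" and Y: "amodule k H Y" "amodule k H Y'"
    and F: "is_hom k A F M f M'" and G: "is_hom k H G X g X'" and E: "is_hom k H E Y e Y'"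
  shows "amod_comp (mod_assoc k H \<delta> M' X' Y') (mod_tensor_mor k \<delta> (mod_tensor_mor k \<delta> F G) E)
    = amod_comp (mod_tensor_mor k \<delta> F (mod_tensor_mor k \<Delta> G E)) (mod_assoc k H \<delta> M X Y)"
proof -
  interpret HH: comod k H H \<Delta> "TYPE('a)" by (rule comod_H)
  note m = M[THEN amodule_module] X[THEN amodule_module] Y[THEN amodule_module]
  note kl = F[THEN is_homD(1)] G[THEN is_homD(1)] E[THEN is_homD(1)]
  note cl = klin_cl[OF kl(1)] klin_cl[OF kl(2)] klin_cl[OF kl(3)]
  note P = is_hom_comp[OF tens_hom[OF tens_hom[OF F G M X] E amodule_mod_tensor[OF M(1) X(1)] amodule_mod_tensor[OF M(2) X(2)] Y]
    assoc_hom[OF M(2) X(2) Y(2)]]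
  note Q = is_hom_comp[OF assoc_hom[OF M(1) X(1) Y(1)] tens_hom[OF F HH.tens_hom[OF G E X Y] M
    HH.amodule_mod_tensor[OF X(1) Y(1)] HH.amodule_mod_tensor[OF X(2) Y(2)]]]
  show ?thesis
    by (rule hom_eqI[OF P Q], rule ext3l[OF m(1,3,5) module_mod_tensor[OF m(2) module_mod_tensor[OF m(4,6)]] is_homD(1)[OF P] is_homD(1)[OF Q]])
      (simp_all add: tensor_eval m kl cl)
qed

lemma hom_pentagon:
  fixes M X Y Z :: "('k, 'h, 'a) mob"
  assumes M: "amodule k A M" and X: "amodule k H X" and Y: "amodule k H Y" and Z: "amodule k H Z"
  shows "amod_comp (mod_assoc k H \<delta> M X (mod_tensor k \<Delta> Y Z)) (mod_assoc k H \<delta> (mod_tensor k \<delta> M X) Y Z)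
    = amod_comp (mod_tensor_mor k \<delta> (amod_id M) (mod_assoc k H \<Delta> X Y Z))
        (amod_comp (mod_assoc k H \<delta> M (mod_tensor k \<Delta> X Y) Z) (mod_tensor_mor k \<delta> (mod_assoc k H \<delta> M X Y) (amod_id Z)))"
proof -
  interpret HH: comod k H H \<Delta> "TYPE('a)" by (rule comod_H)
  note m = M[THEN amodule_module] X[THEN amodule_module] Y[THEN amodule_module] Z[THEN amodule_module]
  note MX = amodule_mod_tensor[OF M X] and XY = HH.amodule_mod_tensor[OF X Y] and YZ = HH.amodule_mod_tensor[OF Y Z]
  note P = is_hom_comp[OF assoc_hom[OF MX Y Z] assoc_hom[OF M X YZ]]
  note Q = is_hom_comp[OF is_hom_comp[OF tens_hom[OF assoc_hom[OF M X Y] is_hom_id amodule_mod_tensor[OF MX Y] amodule_mod_tensor[OF M XY] Z Z]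
     assoc_hom[OF M XY Z]]
     tens_hom[OF is_hom_id HH.assoc_hom[OF X Y Z] M M HH.amodule_mod_tensor[OF XY Z] HH.amodule_mod_tensor[OF X YZ]]]
  show ?thesis
    by (rule hom_eqI[OF P Q], rule ext4l[OF m module_mod_tensor[OF m(1) module_mod_tensor[OF m(2) module_mod_tensor[OF m(3,4)]]] is_homD(1)[OF P] is_homD(1)[OF Q]])
      (simp_all add: tensor_eval m)
qed

lemma hom_run_nat:
  fixes M M' :: "('k, 'h, 'a) mob"
  assumes M: "amodule k A M" "amodule k A M'" and F: "is_hom k A F M f M'"
  shows "amod_comp (mod_runit k H \<delta> M') (mod_tensor_mor k \<delta> F (amod_id (mod_unit k H))) = amod_comp F (mod_runit k H \<delta> M)"
proof -
  note m = M[THEN amodule_module] mod_unit_module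
  note kl = F[THEN is_homD(1)]
  note P = is_hom_comp[OF tens_hom[OF F is_hom_id M unit_amodule unit_amodule] runit_hom[OF M(2)]]
  note Q = is_hom_comp[OF runit_hom[OF M(1)] F]
  show ?thesis
    by (rule hom_eqI[OF P Q], rule mod_tensor_ext[OF m(1,3,2) is_homD(1)[OF P] is_homD(1)[OF Q]])
      (auto dest!: unit_carrier simp: tensor_eval m kl runit_map_tp klin_cl[OF kl] klin_smult[OF kl])
qed

lemma hom_triangle:
  fixes M X :: "('k, 'h, 'a) mob"
  assumes M: "amodule k A M" and X: "amodule k H X"
  shows "amod_comp (mod_tensor_mor k \<delta> (amod_id M) (mod_lunit k H X)) (mod_assoc k H \<delta> M (mod_unit k H) X)
    = mod_tensor_mor k \<delta> (mod_runit k H \<delta> M) (amod_id X)"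
proof -
  interpret HH: comod k H H \<Delta> "TYPE('a)" by (rule comod_H)
  note m = M[THEN amodule_module] X[THEN amodule_module] mod_unit_module
  note P = is_hom_comp[OF assoc_hom[OF M unit_amodule X] tens_hom[OF is_hom_id lunit_hom[OF X] M M HH.amodule_mod_tensor[OF unit_amodule X] X]]
  note Q = tens_hom[OF runit_hom[OF M] is_hom_id amodule_mod_tensor[OF M unit_amodule] M X X]
  note b = bilin_tp[OF m(1,2), of \<delta>]
  \<comment> \<open>A scalar from the middle unit object may be absorbed on either side of the
    tensor sign; the triangle identity says no more than this.\<close>
  have t: "tp k M X (c \<odot>\<^bsub>M\<^esub> x) y = tp k M X x (c \<odot>\<^bsub>X\<^esub> y)" if "c \<in> carrier k" "x \<in> carrier M" "y \<in> carrier X" for c x y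
    using klin_smult[OF bilinD1[OF b that(2)] that(1,3)] klin_smult[OF bilinD2[OF b that(3)] that(1,2)] by simp
  show ?thesis
    by (rule hom_eqI[OF P Q], rule ext3l[OF m(1,3,2) module_mod_tensor[OF m(1,2)] is_homD(1)[OF P] is_homD(1)[OF Q]])
      (auto dest!: unit_carrier simp: tensor_eval m runit_map_tp lunit_map_tp runit_map_klin lunit_map_klin t)
qed

end

context hopf_alg
begin

lemma hom_lun_nat:
  fixes M M' :: "('k, 'h, 'a) mob"
  assumes M: "amodule k H M" "amodule k H M'" and F: "is_hom k H F M f M'"
  shows "amod_comp (mod_lunit k H M') (mod_tensor_mor k \<Delta> (amod_id (mod_unit k H)) F) = amod_comp F (mod_lunit k H M)"
proof -
  interpret comod k H H \<Delta> "TYPE('a)" by (rule comod_H)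
  note m = M[THEN amodule_module] mod_unit_module
  note kl = F[THEN is_homD(1)]
  note P = is_hom_comp[OF tens_hom[OF is_hom_id F unit_amodule unit_amodule M] lunit_hom[OF M(2)]]
  note Q = is_hom_comp[OF lunit_hom[OF M(1)] F]
  show ?thesis
    by (rule hom_eqI[OF P Q], rule mod_tensor_ext[OF m(3,1,2) is_homD(1)[OF P] is_homD(1)[OF Q]])
      (auto dest!: unit_carrier simp: tensor_eval m kl lunit_map_tp klin_cl[OF kl] klin_smult[OF kl])
qed

end

context qt_hopf
begin

lemma push_braid_map:
  fixes X Y :: "('k, 'h, 'a) mob"
  assumes X: "amodule k H X" and Y: "amodule k H Y"
    and h: "\<And>a b. (a, b) \<in> set t \<Longrightarrow> h a b \<in> carrier (mod_tensor k \<Delta> X Y)"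
  shows "mod_flip_R k R X Y (tlift (mod_tensor k \<Delta> X Y) h t)
    = tlift (mod_tensor k \<Delta> Y X) (\<lambda>a b. mod_flip_R k R X Y (h a b)) t"
  by (rule klin_tlift[OF braid_map_klin[OF X Y]]) (simp_all add: module_mod_tensor amodule_module[OF X] amodule_module[OF Y] h)

lemma hom_brd_nat:
  fixes X X' Y Y' :: "('k, 'h, 'a) mob"
  assumes X: "amodule k H X" "amodule k H X'" and Y: "amodule k H Y" "amodule k H Y'"
    and F: "is_hom k H F X f X'" and G: "is_hom k H G Y g Y'"
  shows "amod_comp (mod_braid k H R X' Y') (mod_tensor_mor k \<Delta> F G) = amod_comp (mod_tensor_mor k \<Delta> G F) (mod_braid k H R X Y)"
proof -
  interpret comod k H H \<Delta> "TYPE('a)" by (rule comod_H)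
  note m = X[THEN amodule_module] Y[THEN amodule_module]
  note kl = F[THEN is_homD(1)] G[THEN is_homD(1)]
  note P = is_hom_comp[OF tens_hom[OF F G X Y] braid_hom[OF X(2) Y(2)]]
  note Q = is_hom_comp[OF braid_hom[OF X(1) Y(1)] tens_hom[OF G F Y X]]
  note acl = act_cl[OF X(1)] act_cl[OF Y(1)]
  show ?thesis
    by (rule hom_eqI[OF P Q], rule mod_tensor_ext[OF m(1,3) module_mod_tensor[OF m(4,2)] is_homD(1)[OF P] is_homD(1)[OF Q]])
      (simp_all add: tensor_eval m kl klin_cl[OF kl(1)] klin_cl[OF kl(2)] braid_map_tp X Y push_tensor_map acl tp_cl
        is_homD(3)[OF F] is_homD(3)[OF G])
qed

text \<open>Braiding \<open>X\<close> past \<open>Y \<otimes> Z\<close> lets the second leg of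
  \<open>R\<close> act through its coproduct, so the condition on pure tensors is
  \<open>R_hex2\<close>.\<close>

lemma hom_hexagon1:
  fixes X Y Z :: "('k, 'h, 'a) mob"
  assumes X: "amodule k H X" and Y: "amodule k H Y" and Z: "amodule k H Z"
  shows "amod_comp (mod_assoc k H \<Delta> Y Z X) (amod_comp (mod_braid k H R X (mod_tensor k \<Delta> Y Z)) (mod_assoc k H \<Delta> X Y Z))
    = amod_comp (mod_tensor_mor k \<Delta> (amod_id Y) (mod_braid k H R X Z))
        (amod_comp (mod_assoc k H \<Delta> Y X Z) (mod_tensor_mor k \<Delta> (mod_braid k H R X Y) (amod_id Z)))"
proof -
  interpret comod k H H \<Delta> "TYPE('a)" by (rule comod_H)
  note m = X[THEN amodule_module] Y[THEN amodule_module] Z[THEN amodule_module]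
  note YZ = amodule_mod_tensor[OF Y Z] and XZ = amodule_mod_tensor[OF X Z] and ZX = amodule_mod_tensor[OF Z X]
    and XY = amodule_mod_tensor[OF X Y] and YX = amodule_mod_tensor[OF Y X]
  note P = is_hom_comp[OF is_hom_comp[OF assoc_hom[OF X Y Z] braid_hom[OF X YZ]] assoc_hom[OF Y Z X]]
  note Q = is_hom_comp[OF is_hom_comp[OF tens_hom[OF braid_hom[OF X Y] is_hom_id XY YX Z Z] assoc_hom[OF Y X Z]]
    tens_hom[OF is_hom_id braid_hom[OF X Z] Y Y XZ ZX]]
  let ?T = "mod_tensor k \<Delta> Y (mod_tensor k \<Delta> Z X)"
  note mT = module_mod_tensor[OF m(2) amodule_module[OF ZX], of \<Delta>]
  note acl = act_cl[OF X] act_cl[OF Y] act_cl[OF Z]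
  \<comment> \<open>The rule \<open>act_mult\<close> is used backwards: successive actions on one
    factor are collected into a product, the form in which the identities for \<open>R\<close> are
    stated.\<close>
  note s = tensor_eval m acl tp_cl X Y Z braid_map_tp braid_map_klin act_tp YZ XZ ZX XY YX push_tp1[where \<delta>=\<Delta>] push_tp2[where \<delta>=\<Delta>] push_assoc_map push_tensor_map mT
    act_mult[OF X, symmetric] act_mult[OF Y, symmetric] act_mult[OF Z, symmetric]
  show ?thesis
  proof (rule hom_eqI[OF P Q], rule ext3l[OF m mT is_homD(1)[OF P] is_homD(1)[OF Q]])
    fix x y z assume x: "x \<in> carrier X" and y: "y \<in> carrier Y" and z: "z \<in> carrier Z"
    let ?f = "\<lambda>a c1 c2. tp k Y (mod_tensor k \<Delta> Z X) (act Y c1 y) (tp k Z X (act Z c2 z) (act X a x))"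
    let ?u = "tp k (mod_tensor k \<Delta> X Y) Z (tp k X Y x y) z"
    have "assoc_map k H Y Z X (mod_flip_R k R X (mod_tensor k \<Delta> Y Z) (assoc_map k H X Y Z ?u))
      = tlift ?T (\<lambda>a c. tlift ?T (\<lambda>c1 c2. ?f a c1 c2) (\<Delta> c)) R"
      using x y z by (simp add: s)
    also have "\<dots> = tlift ?T (\<lambda>a b. tlift ?T (\<lambda>a' b'. ?f (a \<cdot> a') b' b) R) R"
      by (rule R_hex2[OF mT]) (intro trilinI klin_tp1 klin_tp2 m amodule_module[OF ZX] tp_cl acl klin_act1[OF X] klin_act1[OF Y] klin_act1[OF Z] klin_id x y z)
    \<comment> \<open>The braiding of \<open>X\<close> with \<open>Y\<close> is applied first, so
      its copy of \<open>R\<close> has to be the outer sum.\<close>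
    also have "\<dots> = tlift ?T (\<lambda>a' b'. tlift ?T (\<lambda>a b. ?f (a \<cdot> a') b' b) R) R"
      by (rule tlift_Fubini[OF mT]) (use x y z in \<open>simp add: s\<close>)
    also have "\<dots> = tensor_map k Y (mod_tensor k \<Delta> Z X) (\<lambda>x. x) (mod_flip_R k R X Z)
      (assoc_map k H Y X Z (tensor_map k (mod_tensor k \<Delta> Y X) Z (mod_flip_R k R X Y) (\<lambda>x. x) ?u))"
      using x y z by (simp add: s)
    finally show "assoc_map k H Y Z X (mod_flip_R k R X (mod_tensor k \<Delta> Y Z) (assoc_map k H X Y Z ?u))
      = tensor_map k Y (mod_tensor k \<Delta> Z X) (\<lambda>x. x) (mod_flip_R k R X Z)
      (assoc_map k H Y X Z (tensor_map k (mod_tensor k \<Delta> Y X) Z (mod_flip_R k R X Y) (\<lambda>x. x) ?u))" .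
  qed
qed

end

context over_field
begin

text \<open>Reversing all sums translates between a product, read from its leftmost factor, and the
  composite of the corresponding operators, read from the one applied first. It is needed for (BP1),
  and the version with four sums for (BP2).\<close>

lemma tlift_Fubini3:
  assumes U: "module k U"
    and f: "\<And>a a' b b' c c'. (a, a') \<in> set r \<Longrightarrow> (b, b') \<in> set s \<Longrightarrow> (c, c') \<in> set t \<Longrightarrow> f a a' b b' c c' \<in> carrier U"
  shows "tlift U (\<lambda>a a'. tlift U (\<lambda>b b'. tlift U (\<lambda>c c'. f a a' b b' c c') t) s) r
    = tlift U (\<lambda>c c'. tlift U (\<lambda>b b'. tlift U (\<lambda>a a'. f a a' b b' c c') r) s) t"
proof -
  have "tlift U (\<lambda>a a'. tlift U (\<lambda>b b'. tlift U (\<lambda>c c'. f a a' b b' c c') t) s) r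
    = tlift U (\<lambda>a a'. tlift U (\<lambda>c c'. tlift U (\<lambda>b b'. f a a' b b' c c') s) t) r"
    by (rule tlift_cong[OF refl], rule tlift_Fubini[OF U]) (rule f)
  also have "\<dots> = tlift U (\<lambda>c c'. tlift U (\<lambda>a a'. tlift U (\<lambda>b b'. f a a' b b' c c') s) r) t"
    by (rule tlift_Fubini[OF U]) (intro tlift_closed[OF U] f)
  also have "\<dots> = tlift U (\<lambda>c c'. tlift U (\<lambda>b b'. tlift U (\<lambda>a a'. f a a' b b' c c') r) s) t"
    by (rule tlift_cong[OF refl], rule tlift_Fubini[OF U]) (rule f)
  finally show ?thesis .
qed

lemma tlift_Fubini4:
  assumes U: "module k U"
    and f: "\<And>a a' b b' c c' d d'. (a, a') \<in> set r \<Longrightarrow> (b, b') \<in> set s \<Longrightarrow> (c, c') \<in> set t \<Longrightarrow> (d, d') \<in> set v \<Longrightarrow>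
      f a a' b b' c c' d d' \<in> carrier U"
  shows "tlift U (\<lambda>a a'. tlift U (\<lambda>b b'. tlift U (\<lambda>c c'. tlift U (\<lambda>d d'. f a a' b b' c c' d d') v) t) s) r
    = tlift U (\<lambda>d d'. tlift U (\<lambda>c c'. tlift U (\<lambda>b b'. tlift U (\<lambda>a a'. f a a' b b' c c' d d') r) s) t) v"
proof -
  have "tlift U (\<lambda>a a'. tlift U (\<lambda>b b'. tlift U (\<lambda>c c'. tlift U (\<lambda>d d'. f a a' b b' c c' d d') v) t) s) r
    = tlift U (\<lambda>a a'. tlift U (\<lambda>d d'. tlift U (\<lambda>c c'. tlift U (\<lambda>b b'. f a a' b b' c c' d d') s) t) v) r"
    by (rule tlift_cong[OF refl], rule tlift_Fubini3[OF U]) (rule f)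
  also have "\<dots> = tlift U (\<lambda>d d'. tlift U (\<lambda>a a'. tlift U (\<lambda>c c'. tlift U (\<lambda>b b'. f a a' b b' c c' d d') s) t) r) v"
    by (rule tlift_Fubini[OF U]) (intro tlift_closed[OF U] f)
  also have "\<dots> = tlift U (\<lambda>d d'. tlift U (\<lambda>c c'. tlift U (\<lambda>a a'. tlift U (\<lambda>b b'. f a a' b b' c c' d d') s) r) t) v"
    by (rule tlift_cong[OF refl], rule tlift_Fubini[OF U]) (intro tlift_closed[OF U] f)
  also have "\<dots> = tlift U (\<lambda>d d'. tlift U (\<lambda>c c'. tlift U (\<lambda>b b'. tlift U (\<lambda>a a'. f a a' b b' c c' d d') r) s) t) v"
    by (rule tlift_cong[OF refl], rule tlift_cong[OF refl], rule tlift_Fubini[OF U]) (rule f)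
  finally show ?thesis .
qed

end

context comod
begin

context
  fixes M X Y :: "('k, 'h, 'a) mob"
  assumes M: "amodule k A M" and X: "amodule k H X" and Y: "amodule k H Y"
begin

lemmas m3 = amodule_module[OF M] amodule_module[OF X] amodule_module[OF Y]

lemmas assoc_inverse_prems = assoc_hom[OF M X Y] assoc_unmap_klin[OF m3, of \<delta>] assoc_unmap_map[OF m3, of _ \<delta>] assoc_map_unmap[OF m3, of _ \<delta>]
  amodule_mod_tensor[OF amodule_mod_tensor[OF M X] Y]

lemma assoc_inv_hom:
  "is_hom k A (mk_arrow (mod_tensor k \<delta> M (mod_tensor k \<Delta> X Y)) (assoc_unmap k \<delta> M X Y) (mod_tensor k \<delta> (mod_tensor k \<delta> M X) Y))
    (mod_tensor k \<delta> M (mod_tensor k \<Delta> X Y)) (assoc_unmap k \<delta> M X Y) (mod_tensor k \<delta> (mod_tensor k \<delta> M X) Y)"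
  by (rule inverse_hom[OF assoc_inverse_prems])

lemma assoc_iso: "mod_cat k A C \<Longrightarrow>
    iso_mor C (mod_tensor k \<delta> (mod_tensor k \<delta> M X) Y) (mod_tensor k \<delta> M (mod_tensor k \<Delta> X Y)) (mod_assoc k H \<delta> M X Y)"
  by (rule iso_mor_hom[OF assoc_inverse_prems])

lemma assoc_inv: "mod_cat k A C \<Longrightarrow>
    inv_mor C (mod_tensor k \<delta> (mod_tensor k \<delta> M X) Y) (mod_tensor k \<delta> M (mod_tensor k \<Delta> X Y)) (mod_assoc k H \<delta> M X Y)
     = mk_arrow (mod_tensor k \<delta> M (mod_tensor k \<Delta> X Y)) (assoc_unmap k \<delta> M X Y) (mod_tensor k \<delta> (mod_tensor k \<delta> M X) Y)"
  by (rule inv_mor_hom[OF assoc_inverse_prems])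

end

lemma runit_iso:
  fixes M :: "('k, 'h, 'a) mob"
  assumes M: "amodule k A M" and C: "mod_cat k A C"
  shows "iso_mor C (mod_tensor k \<delta> M (mod_unit k H)) M (mod_runit k H \<delta> M)"
proof -
  note m = amodule_module[OF M]
  show ?thesis
    by (rule iso_mor_hom[OF runit_hom[OF M] klin_Scal[OF m] runit_map_inverse[OF m] _ amodule_mod_tensor[OF M unit_amodule] C])
      (simp_all add: runit_map_tp[OF m] m)
qed

end

context hopf_alg
begin

lemma lunit_iso:
  fixes M :: "('k, 'h, 'a) mob"
  assumes M: "amodule k H M" and C: "mod_cat k H C"
  shows "iso_mor C (mod_tensor k \<Delta> (mod_unit k H) M) M (mod_lunit k H M)"
proof -
  interpret comod k H H \<Delta> "TYPE('a)" by (rule comod_H)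
  note m = amodule_module[OF M]
  show ?thesis
    by (rule iso_mor_hom[OF lunit_hom[OF M] klin_Scal'[OF m] lunit_map_inverse[OF m] _ amodule_mod_tensor[OF unit_amodule M] C])
      (simp_all add: lunit_map_tp[OF m] m)
qed

end

context qt_hopf
begin

lemma braid_iso:
  fixes X Y :: "('k, 'h, 'a) mob"
  assumes X: "amodule k H X" and Y: "amodule k H Y" and C: "mod_cat k H C"
  shows "iso_mor C (mod_tensor k \<Delta> X Y) (mod_tensor k \<Delta> Y X) (mod_braid k H R X Y)"
proof -
  interpret comod k H H \<Delta> "TYPE('a)" by (rule comod_H)
  show ?thesis
    by (rule iso_mor_hom[OF braid_hom[OF X Y] braid_inv_klin[OF X Y] braid_inv_map[OF X Y] braid_map_inv[OF X Y] amodule_mod_tensor[OF X Y] C])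
qed

text \<open>\<open>C\<close> is the category in which the inverse associators are taken. Braiding
  \<open>X \<otimes> Y\<close> past \<open>Z\<close> lets the first leg of \<open>R\<close> act
  through its coproduct, which is \<open>R_hex1\<close>.\<close>

lemma hom_hexagon2:
  fixes X Y Z :: "('k, 'h, 'a) mob"
  assumes X: "amodule k H X" and Y: "amodule k H Y" and Z: "amodule k H Z" and C: "mod_cat k H C"
  shows "amod_comp (inv_mor C (mod_tensor k \<Delta> (mod_tensor k \<Delta> Z X) Y) (mod_tensor k \<Delta> Z (mod_tensor k \<Delta> X Y)) (mod_assoc k H \<Delta> Z X Y))
      (amod_comp (mod_braid k H R (mod_tensor k \<Delta> X Y) Z)
        (inv_mor C (mod_tensor k \<Delta> (mod_tensor k \<Delta> X Y) Z) (mod_tensor k \<Delta> X (mod_tensor k \<Delta> Y Z)) (mod_assoc k H \<Delta> X Y Z)))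
    = amod_comp (mod_tensor_mor k \<Delta> (mod_braid k H R X Z) (amod_id Y))
        (amod_comp (inv_mor C (mod_tensor k \<Delta> (mod_tensor k \<Delta> X Z) Y) (mod_tensor k \<Delta> X (mod_tensor k \<Delta> Z Y)) (mod_assoc k H \<Delta> X Z Y))
          (mod_tensor_mor k \<Delta> (amod_id X) (mod_braid k H R Y Z)))"
proof -
  interpret comod k H H \<Delta> "TYPE('a)" by (rule comod_H)
  note m = X[THEN amodule_module] Y[THEN amodule_module] Z[THEN amodule_module]
  note YZ = amodule_mod_tensor[OF Y Z] and ZY = amodule_mod_tensor[OF Z Y] and XZ = amodule_mod_tensor[OF X Z] and ZX = amodule_mod_tensor[OF Z X]
    and XY = amodule_mod_tensor[OF X Y]
  note P = is_hom_comp[OF is_hom_comp[OF assoc_inv_hom[OF X Y Z] braid_hom[OF XY Z]] assoc_inv_hom[OF Z X Y]]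
  note Q = is_hom_comp[OF is_hom_comp[OF tens_hom[OF is_hom_id braid_hom[OF Y Z] X X YZ ZY] assoc_inv_hom[OF X Z Y]]
    tens_hom[OF braid_hom[OF X Z] is_hom_id XZ ZX Y Y]]
  let ?T = "mod_tensor k \<Delta> (mod_tensor k \<Delta> Z X) Y"
  note mT = module_mod_tensor[OF amodule_module[OF ZX] m(2), of \<Delta>]
  note acl = act_cl[OF X] act_cl[OF Y] act_cl[OF Z]
  note s = tensor_eval m acl tp_cl X Y Z braid_map_tp braid_map_klin act_tp YZ ZY XZ ZX XY push_tp1[where \<delta>=\<Delta>] push_tp2[where \<delta>=\<Delta>] push_assoc_unmap push_tensor_map mT
    act_mult[OF X, symmetric] act_mult[OF Y, symmetric] act_mult[OF Z, symmetric]
  show ?thesis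
    unfolding assoc_inv[OF Z X Y C] assoc_inv[OF X Y Z C] assoc_inv[OF X Z Y C]
  proof (rule hom_eqI[OF P Q], rule ext3r[OF m mT is_homD(1)[OF P] is_homD(1)[OF Q]])
    fix x y z assume x: "x \<in> carrier X" and y: "y \<in> carrier Y" and z: "z \<in> carrier Z"
    let ?f = "\<lambda>a1 a2 c. tp k (mod_tensor k \<Delta> Z X) Y (tp k Z X (act Z c z) (act X a1 x)) (act Y a2 y)"
    let ?u = "tp k X (mod_tensor k \<Delta> Y Z) x (tp k Y Z y z)"
    have "assoc_unmap k \<Delta> Z X Y (mod_flip_R k R (mod_tensor k \<Delta> X Y) Z (assoc_unmap k \<Delta> X Y Z ?u))
      = tlift ?T (\<lambda>a c. tlift ?T (\<lambda>a1 a2. ?f a1 a2 c) (\<Delta> a)) R"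
      using x y z by (simp add: s)
    also have "\<dots> = tlift ?T (\<lambda>a b. tlift ?T (\<lambda>a' b'. ?f a a' (b \<cdot> b')) R) R"
      by (rule R_hex1[OF mT]) (intro trilinI klin_tp1 klin_tp2 m amodule_module[OF ZX] tp_cl acl klin_act1[OF X] klin_act1[OF Y] klin_act1[OF Z] klin_id x y z)
    also have "\<dots> = tlift ?T (\<lambda>a' b'. tlift ?T (\<lambda>a b. ?f a a' (b \<cdot> b')) R) R"
      by (rule tlift_Fubini[OF mT]) (use x y z in \<open>simp add: s\<close>)
    also have "\<dots> = tensor_map k (mod_tensor k \<Delta> Z X) Y (mod_flip_R k R X Z) (\<lambda>x. x)
      (assoc_unmap k \<Delta> X Z Y (tensor_map k X (mod_tensor k \<Delta> Z Y) (\<lambda>x. x) (mod_flip_R k R Y Z) ?u))"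
      using x y z by (simp add: s)
    finally show "assoc_unmap k \<Delta> Z X Y (mod_flip_R k R (mod_tensor k \<Delta> X Y) Z (assoc_unmap k \<Delta> X Y Z ?u))
      = tensor_map k (mod_tensor k \<Delta> Z X) Y (mod_flip_R k R X Z) (\<lambda>x. x)
      (assoc_unmap k \<Delta> X Z Y (tensor_map k X (mod_tensor k \<Delta> Z Y) (\<lambda>x. x) (mod_flip_R k R Y Z) ?u))" .
  qed
qed

end

section \<open>The two categories of finite dimensional modules\<close>

definition fd_amod :: "'k ring \<Rightarrow> ('k, 'h) hopf \<Rightarrow> ('k, 'h, 'a) mob \<Rightarrow> bool" where
  "fd_amod k A X \<longleftrightarrow> amodule k A X \<and> fin_dim k X"

lemma Hmod_fd_sel [simp]:
  "obj (Hmod_fd k H R) = {X. fd_amod k H X}" "mor (Hmod_fd k H R) = amod_mor k H"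
  "idm (Hmod_fd k H R) = amod_id" "cmp (Hmod_fd k H R) = amod_comp"
  "tob (Hmod_fd k H R) = mod_tensor k (comult H)" "tmo (Hmod_fd k H R) = mod_tensor_mor k (comult H)"
  "unt (Hmod_fd k H R) = mod_unit k H" "asc (Hmod_fd k H R) = mod_assoc k H (comult H)"
  "lun (Hmod_fd k H R) = mod_lunit k H" "run (Hmod_fd k H R) = mod_runit k H (comult H)"
  "brd (Hmod_fd k H R) = mod_braid k H R"
  by (simp_all add: Hmod_fd_def Hmod_def fd_amod_def)

lemma Bmod_fd_sel [simp]:
  "obj (Bmod_fd k H B) = {X. fd_amod k (sub_algebra H B) X}" "mor (Bmod_fd k H B) = amod_mor k (sub_algebra H B)"
  "idm (Bmod_fd k H B) = amod_id" "cmp (Bmod_fd k H B) = amod_comp"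
  "aob (Bmod_fd k H B) = mod_tensor k (coaction k H B)" "amo (Bmod_fd k H B) = mod_tensor_mor k (coaction k H B)"
  "masc (Bmod_fd k H B) = mod_assoc k H (coaction k H B)" "mun (Bmod_fd k H B) = mod_runit k H (coaction k H B)"
  "dob (Bmod_fd k H B) = mod_unit k H"
  by (simp_all add: Bmod_fd_def fd_amod_def)

lemma fd_amodD: "fd_amod k A X \<Longrightarrow> amodule k A X"
  by (simp add: fd_amod_def)

lemma mod_cat_H: "mod_cat k H (Hmod_fd k H R)"
  and mod_cat_B: "mod_cat k (sub_algebra H B) (Bmod_fd k H B)"
  by (auto simp: mod_cat_def fd_amod_def)

lemma (in comod) fd_mod_tensor: "fd_amod k A (M :: ('k, 'h, 'a) mob) \<Longrightarrow> fd_amod k H X \<Longrightarrow> fd_amod k A (mod_tensor k \<delta> M X)"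
  unfolding fd_amod_def by (blast intro: amodule_mod_tensor fin_dim_mod_tensor amodule_module)

lemma (in comod) fd_unit: "fd_amod k H (mod_unit k H :: ('k, 'h, 'a) mob)"
  by (simp add: fd_amod_def unit_amodule mod_unit_fin_dim)

lemma (in qt_hopf) braided_Hmod_fd:
  "braided_monoidal_category (Hmod_fd k H R :: (('k, 'h, 'a) mob, ('k, 'h, 'a) mar) brcat)"
proof -
  interpret comod k H H \<Delta> "TYPE('a)" by (rule comod_H)
  let ?C = "Hmod_fd k H R :: (('k, 'h, 'a) mob, ('k, 'h, 'a) mar) brcat"
  interpret category ?C by (rule mod_cat_category[OF mod_cat_H])
  note C = mod_cat_H[of k H R]
  show ?thesis
  \<comment> \<open>Unfolding \<open>is_hom_mor\<close> replaces each morphism hypothesis by an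
    inducing map, so the remaining axioms match the lemmas proved above.\<close>
  proof (unfold_locales, unfold Hmod_fd_sel mem_Collect_eq is_hom_mor; (elim exE)?)
    show "fd_amod k H (mod_tensor k \<Delta> X Y)" if "fd_amod k H X" "fd_amod k H Y" for X Y :: "('k, 'h, 'a) mob"
      using that by (rule fd_mod_tensor)
    show "fd_amod k H (mod_unit k H :: ('k, 'h, 'a) mob)" by (rule fd_unit)
  qed (blast intro: tens_hom hom_tmo_idm hom_tmo_cmp assoc_iso[OF _ _ _ C] hom_asc_nat lunit_iso[OF _ C] runit_iso[OF _ C]
      hom_lun_nat hom_run_nat hom_pentagon hom_triangle braid_iso[OF _ _ C] hom_brd_nat hom_hexagon1 hom_hexagon2[OF _ _ _ C]
      dest: fd_amodD)+
qed

lemma (in coideal) module_category_Bmod_fd: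
  assumes "monoidal_category (Hmod_fd k H R :: (('k, 'h, 'a) mob, ('k, 'h, 'a) mar) brcat)"
  shows "pointed_module_category (Hmod_fd k H R :: (('k, 'h, 'a) mob, ('k, 'h, 'a) mar) brcat)
    (Bmod_fd k H B :: (('k, 'h, 'a) mob, ('k, 'h, 'a) mar, ('k, 'h, 'a) mob, ('k, 'h, 'a) mar) modcat)"
proof -
  interpret comod k H A0 \<delta> "TYPE('a)" by (rule comod_B)
  let ?C = "Hmod_fd k H R :: (('k, 'h, 'a) mob, ('k, 'h, 'a) mar) brcat"
  let ?D = "Bmod_fd k H B :: (('k, 'h, 'a) mob, ('k, 'h, 'a) mar, ('k, 'h, 'a) mob, ('k, 'h, 'a) mar) modcat"
  interpret C: monoidal_category ?C by (rule assms)
  interpret D: category ?D by (rule mod_cat_category[OF mod_cat_B])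
  note D = mod_cat_B[where k = k and H = H and B = B]
  show ?thesis
  proof (unfold_locales, unfold Hmod_fd_sel Bmod_fd_sel mem_Collect_eq is_hom_mor; (elim exE)?)
    show "fd_amod k A0 (mod_tensor k \<delta> M X)" if "fd_amod k A0 M" "fd_amod k H X" for M X :: "('k, 'h, 'a) mob"
      using that by (rule fd_mod_tensor)
    show "fd_amod k A0 (mod_unit k H :: ('k, 'h, 'a) mob)"
      unfolding fd_amod_def by (intro conjI mod_unit_amodule mod_unit_fin_dim) auto
  qed (blast intro: tens_hom hom_tmo_idm hom_tmo_cmp assoc_iso[OF _ _ _ D] hom_asc_nat runit_iso[OF _ D]
      hom_run_nat hom_pentagon hom_triangle dest: fd_amodD)+
qed

section \<open>The anti-involution\<close>

lemma tensor_map_lineq: "lineq X X' \<Longrightarrow> lineq Y Y' \<Longrightarrow> tensor_map k X Y = tensor_map k X' Y'"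
  by (intro ext) (simp add: tensor_map_def tmap_def tnf_lineq)

lemma mlift_lineq: "lineq U U' \<Longrightarrow> mlift U f = mlift U' f"
  unfolding mlift_def by (intro ext tlift_lineq)

lemma assoc_map_lineq:
  assumes "lineq X X'" "lineq Y Y'" "lineq Z Z'"
  shows "assoc_map k H X Y Z = assoc_map k H X' Y' Z'"
  unfolding assoc_map_def[abs_def] pure_lineq[OF assms(2,3)]
    tnf_lineq[OF assms(1) lineq_mod_tensor[where \<delta>' = "comult H", OF assms(2,3)]] by (rule refl)

lemma assoc_unmap_lineq:
  assumes "lineq X X'" "lineq Y Y'" "lineq Z Z'"
  shows "assoc_unmap k \<delta> X Y Z = assoc_unmap k \<delta> X' Y' Z'"
  unfolding assoc_unmap_def Let_def tp_lineq[OF assms(1,2)] tp_lineq[OF lineq_mod_tensor[where \<delta>' = \<delta>, OF assms(1,2)] assms(3)]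
    mlift_lineq[OF lineq_mod_tensor[where \<delta>' = \<delta>, OF lineq_mod_tensor[where \<delta>' = \<delta>, OF assms(1,2)] assms(3)]] by (rule refl)

context over_field
begin

lemma is_hom_cong:
  assumes "is_hom k A F X f Y" "amodule k A X" "\<And>x. x \<in> carrier X \<Longrightarrow> g x = f x"
  shows "is_hom k A F X g Y"
proof -
  have "mk_arrow X f Y = mk_arrow X g Y" by (rule mk_arrow_cong) (simp add: assms(3))
  moreover have "g \<in> klin k X Y"
    by (rule klin_cong[OF amodule_module[OF assms(2)] is_homD(1)[OF assms(1)] assms(3)])
  ultimately show ?thesis
    using assms(1) act_cl[OF assms(2)] by (simp add: is_hom_def assms(3))
qed

lemma tlift_rot:
  assumes U: "module k U"
    and f: "\<And>a a' b b' c c'. (a, a') \<in> set r \<Longrightarrow> (b, b') \<in> set s \<Longrightarrow> (c, c') \<in> set t \<Longrightarrow> f a a' b b' c c' \<in> carrier U"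
  shows "tlift U (\<lambda>c c'. tlift U (\<lambda>a a'. tlift U (\<lambda>b b'. f a a' b b' c c') s) r) t
    = tlift U (\<lambda>a a'. tlift U (\<lambda>b b'. tlift U (\<lambda>c c'. f a a' b b' c c') t) s) r"
proof -
  have "tlift U (\<lambda>c c'. tlift U (\<lambda>a a'. tlift U (\<lambda>b b'. f a a' b b' c c') s) r) t
    = tlift U (\<lambda>a a'. tlift U (\<lambda>c c'. tlift U (\<lambda>b b'. f a a' b b' c c') s) t) r"
    by (rule tlift_Fubini[OF U]) (intro tlift_closed[OF U] f)
  also have "\<dots> = tlift U (\<lambda>a a'. tlift U (\<lambda>b b'. tlift U (\<lambda>c c'. f a a' b b' c c') t) s) r"
    by (rule tlift_cong[OF refl], rule tlift_Fubini[OF U]) (rule f)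
  finally show ?thesis .
qed

end

context inv_hopf
begin

abbreviation \<Phi> :: "(('k, 'h, 'a) mob, ('k, 'h, 'a) mar, ('k, 'h, 'a) mob, ('k, 'h, 'a) mar) mfun" where
  "\<Phi> \<equiv> twist_functor k H R \<phi>"

lemma tw_fun:
  "tensor_map k (tw X) Y = tensor_map k X Y" "tensor_map k X (tw Y) = tensor_map k X Y"
  "tensor_map k (mod_tensor k \<delta> (tw X) Y) Z = tensor_map k (mod_tensor k \<delta> X Y) Z"
  "tensor_map k (mod_tensor k \<delta> X (tw Y)) Z = tensor_map k (mod_tensor k \<delta> X Y) Z"
  "tensor_map k Z (mod_tensor k \<delta> (tw X) Y) = tensor_map k Z (mod_tensor k \<delta> X Y)"
  "tensor_map k Z (mod_tensor k \<delta> X (tw Y)) = tensor_map k Z (mod_tensor k \<delta> X Y)"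
  "assoc_map k H (tw X) Y Z = assoc_map k H X Y Z" "assoc_map k H X (tw Y) Z = assoc_map k H X Y Z" "assoc_map k H X Y (tw Z) = assoc_map k H X Y Z"
  "assoc_unmap k \<delta> (tw X) Y Z = assoc_unmap k \<delta> X Y Z" "assoc_unmap k \<delta> X (tw Y) Z = assoc_unmap k \<delta> X Y Z" "assoc_unmap k \<delta> X Y (tw Z) = assoc_unmap k \<delta> X Y Z"
  by (intro tensor_map_lineq assoc_map_lineq assoc_unmap_lineq lineq_mod_tensor lineq_twist lineq_refl)+

lemma tw_smult [simp]: "smult (tw X) = smult X"
  by (simp add: twist_def)

lemmas twist_simps = tw_lin tw_fun tw_klin tw_carrier

text \<open>Twisting both factors applies \<open>\<phi>\<close> to both legs of \<open>R\<close>,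
  and \<open>R\<close> is invariant under this. So \<open>f2\<close> can be computed with the
  untwisted actions.\<close>

lemma braid_map_twist:
  fixes X Y :: "('k, 'h, 'a) mob"
  assumes X: "amodule k H X" and Y: "amodule k H Y" and u: "u \<in> carrier (mod_tensor k \<Delta> Y X)"
  shows "mod_flip_R k R (tw Y) (tw X) u = mod_flip_R k R Y X u"
proof -
  note m = amodule_module[OF Y] amodule_module[OF X]
  note mT = module_mod_tensor[OF m(2,1), of \<Delta>]
  have l: "mod_flip_R k R (tw Y) (tw X) \<in> klin k (mod_tensor k \<Delta> Y X) (mod_tensor k \<Delta> X Y)"
    using braid_map_klin[OF tw_amodule[OF Y] tw_amodule[OF X]] by (simp add: twist_simps)
  show ?thesis
  proof (rule mod_tensor_ext[OF m mT l braid_map_klin[OF Y X] _ u])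
    fix y x assume y: "y \<in> carrier Y" and x: "x \<in> carrier X"
    have "mod_flip_R k R (tw Y) (tw X) (tp k Y X y x)
      = tlift (mod_tensor k \<Delta> X Y) (\<lambda>a b. tp k X Y (act X (\<phi> b) x) (act Y (\<phi> a) y)) R"
      using braid_map_tp[OF tw_amodule[OF Y] tw_amodule[OF X], of y x] x y by (simp add: twist_simps)
    also have "\<dots> = tlift (mod_tensor k \<Delta> X Y) (\<lambda>a b. tp k X Y (act X b x) (act Y a y)) R"
      by (rule phi_R[OF mT]) (intro bilinI klin_tp1 klin_tp2 m klin_act1[OF X] klin_act1[OF Y] klin_id act_cl[OF X] act_cl[OF Y] x y)
    also have "\<dots> = mod_flip_R k R Y X (tp k Y X y x)"
      by (rule braid_map_tp[OF Y X y x, symmetric])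
    finally show "mod_flip_R k R (tw Y) (tw X) (tp k Y X y x) = mod_flip_R k R Y X (tp k Y X y x)" .
  qed
qed

lemma f2_hom:
  fixes X Y :: "('k, 'h, 'a) mob"
  assumes X: "amodule k H X" and Y: "amodule k H Y"
  shows "is_hom k H (f2 \<Phi> X Y) (mod_tensor k \<Delta> (tw Y) (tw X)) (mod_flip_R k R Y X) (tw (mod_tensor k \<Delta> X Y))"
proof -
  interpret comod k H H \<Delta> "TYPE('a)" by (rule comod_H)
  show ?thesis
    by (rule is_hom_cong[OF f2_hom_twisted[OF X Y] amodule_mod_tensor[OF tw_amodule[OF Y] tw_amodule[OF X]]])
      (simp add: twist_simps braid_map_twist[OF X Y])
qed

lemma fmo_hom: "is_hom k H F X f Y \<Longrightarrow> is_hom k H (fmo \<Phi> F) (tw X) f (tw Y)"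
  using tw_mor by (simp add: twist_functor_def)

lemma fob_tw [simp]: "fob \<Phi> = tw"
  by (simp add: twist_functor_def)

lemma f2_iso:
  fixes X Y :: "('k, 'h, 'a) mob"
  assumes X: "amodule k H X" and Y: "amodule k H Y" and C: "mod_cat k H C"
  shows "iso_mor C (mod_tensor k \<Delta> (tw Y) (tw X)) (tw (mod_tensor k \<Delta> X Y)) (f2 \<Phi> X Y)"
proof -
  interpret comod k H H \<Delta> "TYPE('a)" by (rule comod_H)
  show ?thesis
    by (rule iso_mor_hom[OF f2_hom[OF X Y] _ _ _ amodule_mod_tensor[OF tw_amodule[OF Y] tw_amodule[OF X]] C, of "braid_inv Y X"])
      (simp_all add: twist_simps braid_inv_klin[OF Y X] braid_inv_map[OF Y X] braid_map_inv[OF Y X])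
qed

lemma f0_iso:
  assumes C: "mod_cat k H C"
  shows "iso_mor C (mod_unit k H) (tw (mod_unit k H :: ('k, 'h, 'a) mob)) (f0 \<Phi>)"
proof -
  interpret comod k H H \<Delta> "TYPE('a)" by (rule comod_H)
  show ?thesis
    by (rule iso_mor_hom[OF f0_hom _ _ _ unit_amodule C, of "\<lambda>x. x"]) (simp_all add: twist_simps klin_id)
qed

lemma hom_f2_nat:
  fixes X X' Y Y' :: "('k, 'h, 'a) mob"
  assumes X: "amodule k H X" "amodule k H X'" and Y: "amodule k H Y" "amodule k H Y'"
    and F: "is_hom k H F X f X'" and G: "is_hom k H G Y g Y'"
  shows "amod_comp (f2 \<Phi> X' Y') (mod_tensor_mor k \<Delta> (fmo \<Phi> G) (fmo \<Phi> F)) = amod_comp (fmo \<Phi> (mod_tensor_mor k \<Delta> F G)) (f2 \<Phi> X Y)"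
proof -
  interpret comod k H H \<Delta> "TYPE('a)" by (rule comod_H)
  note m = X[THEN amodule_module] Y[THEN amodule_module]
  note kl = F[THEN is_homD(1)] G[THEN is_homD(1)]
  note tX = X[THEN tw_amodule] and tY = Y[THEN tw_amodule]
  note P = is_hom_comp[OF tens_hom[OF fmo_hom[OF G] fmo_hom[OF F] tY tX] f2_hom[OF X(2) Y(2)]]
  note Q = is_hom_comp[OF f2_hom[OF X(1) Y(1)] fmo_hom[OF tens_hom[OF F G X Y]]]
  note acl = act_cl[OF X(1)] act_cl[OF Y(1)]
  show ?thesis
    by (rule hom_eqI[OF P Q], rule mod_tensor_ext[OF tw_module[OF m(3)] tw_module[OF m(1)]
        tw_module[OF module_mod_tensor[OF m(2,4)]] is_homD(1)[OF P] is_homD(1)[OF Q]])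
      (simp_all add: twist_simps tensor_eval m kl klin_cl[OF kl(1)] klin_cl[OF kl(2)] braid_map_tp X Y push_tensor_map acl tp_cl
        is_homD(3)[OF F] is_homD(3)[OF G])
qed

text \<open>One side braids with a tensor product on the left and is expanded by
  \<open>R_hex1\<close>, the other with one on the right and is expanded by \<open>R_hex2\<close>;
  the resulting triple sums over \<open>R\<close> are the two sides of the Yang-Baxter
  equation.\<close>

lemma hom_f2_assoc:
  fixes X Y Z :: "('k, 'h, 'a) mob"
  assumes X: "amodule k H X" and Y: "amodule k H Y" and Z: "amodule k H Z" and C: "mod_cat k H C"
  shows "amod_comp (fmo \<Phi> (mod_assoc k H \<Delta> X Y Z)) (amod_comp (f2 \<Phi> (mod_tensor k \<Delta> X Y) Z)
      (mod_tensor_mor k \<Delta> (amod_id (tw Z)) (f2 \<Phi> X Y)))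
    = amod_comp (f2 \<Phi> X (mod_tensor k \<Delta> Y Z)) (amod_comp (mod_tensor_mor k \<Delta> (f2 \<Phi> Y Z) (amod_id (tw X)))
      (inv_mor C (mod_tensor k \<Delta> (mod_tensor k \<Delta> (tw Z) (tw Y)) (tw X)) (mod_tensor k \<Delta> (tw Z) (mod_tensor k \<Delta> (tw Y) (tw X)))
        (mod_assoc k H \<Delta> (tw Z) (tw Y) (tw X))))"
proof -
  interpret comod k H H \<Delta> "TYPE('a)" by (rule comod_H)
  note m = X[THEN amodule_module] Y[THEN amodule_module] Z[THEN amodule_module]
  note tm = m[THEN tw_module]
  note tX = tw_amodule[OF X] and tY = tw_amodule[OF Y] and tZ = tw_amodule[OF Z]
  note XY = amodule_mod_tensor[OF X Y] and YZ = amodule_mod_tensor[OF Y Z] and YX = amodule_mod_tensor[OF Y X] and ZY = amodule_mod_tensor[OF Z Y]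
  note P = is_hom_comp[OF is_hom_comp[OF tens_hom[OF is_hom_id f2_hom[OF X Y] tZ tZ amodule_mod_tensor[OF tY tX] tw_amodule[OF XY]]
    f2_hom[OF XY Z]] fmo_hom[OF assoc_hom[OF X Y Z]]]
  note Q = is_hom_comp[OF is_hom_comp[OF assoc_inv_hom[OF tZ tY tX] tens_hom[OF f2_hom[OF Y Z] is_hom_id amodule_mod_tensor[OF tZ tY]
    tw_amodule[OF YZ] tX tX]] f2_hom[OF X YZ]]
  let ?T = "mod_tensor k \<Delta> X (mod_tensor k \<Delta> Y Z)"
  note mT = module_mod_tensor[OF m(1) amodule_module[OF YZ], of \<Delta>]
  note acl = act_cl[OF X] act_cl[OF Y] act_cl[OF Z]
  note s = twist_simps tensor_eval m acl tp_cl X Y Z braid_map_tp braid_map_klin act_tp XY YZ YX ZY push_tp1[where \<delta>=\<Delta>] push_tp2[where \<delta>=\<Delta>]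
    push_assoc_unmap push_assoc_map push_tensor_map push_braid_map mT act_mult[OF X, symmetric] act_mult[OF Y, symmetric] act_mult[OF Z, symmetric]
  show ?thesis
    unfolding assoc_inv[OF tZ tY tX C]
  proof (rule hom_eqI[OF P Q], rule ext3r[OF tm(3,2,1) tw_module[OF mT] is_homD(1)[OF P] is_homD(1)[OF Q]])
    fix z y x assume "z \<in> carrier (tw Z)" "y \<in> carrier (tw Y)" "x \<in> carrier (tw X)"
    then have x: "x \<in> carrier X" and y: "y \<in> carrier Y" and z: "z \<in> carrier Z" by simp_all
    let ?f = "\<lambda>p q r. tp k X (mod_tensor k \<Delta> Y Z) (act X r x) (tp k Y Z (act Y q y) (act Z p z))"
    note tri = klin_tp1 klin_tp2 m amodule_module[OF YZ] tp_cl acl klin_act1[OF X] klin_act1[OF Y] klin_act1[OF Z] klin_id x y z linH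
    let ?u = "tp k (tw Z) (mod_tensor k \<Delta> (tw Y) (tw X)) z (tp k (tw Y) (tw X) y x)"
    let ?l = "assoc_map k H X Y Z (mod_flip_R k R Z (mod_tensor k \<Delta> X Y) (tensor_map k (tw Z) (tw (mod_tensor k \<Delta> X Y)) (\<lambda>x. x) (mod_flip_R k R Y X) ?u))"
    let ?r = "mod_flip_R k R (mod_tensor k \<Delta> Y Z) X (tensor_map k (tw (mod_tensor k \<Delta> Y Z)) (tw X) (mod_flip_R k R Z Y) (\<lambda>x. x)
        (assoc_unmap k \<Delta> (tw Z) (tw Y) (tw X) ?u))"
    have "?l = tlift ?T (\<lambda>a b. tlift ?T (\<lambda>a' c. tlift ?T (\<lambda>c1 c2. ?f a' (c2 \<cdot> a) (c1 \<cdot> b)) (\<Delta> c)) R) R"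
      using x y z by (simp add: s)
    also have "\<dots> = tlift ?T (\<lambda>a b. tlift ?T (\<lambda>a2 b2. tlift ?T (\<lambda>a3 b3. ?f (a2 \<cdot> a3) (b2 \<cdot> a) (b3 \<cdot> b)) R) R) R"
      by (rule tlift_cong[OF refl], rule R_hex2[OF mT]) (intro trilinI tri H_mult; simp)
    \<comment> \<open>The copy of \<open>R\<close> that acts first is the rightmost factor in
      \<open>YBE\<close>, so its sum is rotated from the outermost to the innermost place.\<close>
    also have "\<dots> = tlift ?T (\<lambda>a2 b2. tlift ?T (\<lambda>a3 b3. tlift ?T (\<lambda>a b. ?f (a2 \<cdot> a3) (b2 \<cdot> a) (b3 \<cdot> b)) R) R) R"
      by (rule tlift_rot[OF mT]) (intro tri H_mult; simp)
    also have "\<dots> = tlift ?T (\<lambda>a2 b2. tlift ?T (\<lambda>a3 b3. tlift ?T (\<lambda>a b. ?f (a3 \<cdot> a) (a2 \<cdot> b) (b2 \<cdot> b3)) R) R) R"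
      by (rule YBE[OF mT]) (intro trilinI tri)
    also have "\<dots> = tlift ?T (\<lambda>a b. tlift ?T (\<lambda>a2 b2. tlift ?T (\<lambda>a3 b3. ?f (a3 \<cdot> a) (a2 \<cdot> b) (b2 \<cdot> b3)) R) R) R"
      by (rule tlift_rot[OF mT, symmetric]) (intro tri H_mult; simp)
    also have "\<dots> = tlift ?T (\<lambda>a b. tlift ?T (\<lambda>a' b'. tlift ?T (\<lambda>a1 a2. ?f (a2 \<cdot> a) (a1 \<cdot> b) b') (\<Delta> a')) R) R"
      by (rule tlift_cong[OF refl], rule R_hex1[OF mT, symmetric]) (intro trilinI tri H_mult; simp)
    also have "\<dots> = ?r"
      using x y z by (simp add: s)
    finally show "?l = ?r" .
  qed
qed

text \<open>When \<open>X\<close> is braided with the unit object, the second leg of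
  \<open>R\<close> acts by its counit; by \<open>R_counit\<close> only the flip remains.\<close>

lemma hom_f2_lun:
  fixes X :: "('k, 'h, 'a) mob"
  assumes X: "amodule k H X"
  shows "amod_comp (fmo \<Phi> (mod_lunit k H X)) (amod_comp (f2 \<Phi> (mod_unit k H) X) (mod_tensor_mor k \<Delta> (amod_id (tw X)) (f0 \<Phi>)))
    = mod_runit k H \<Delta> (tw X)"
proof -
  interpret comod k H H \<Delta> "TYPE('a)" by (rule comod_H)
  let ?I = "mod_unit k H :: ('k, 'h, 'a) mob"
  note tX = tw_amodule[OF X] and m = amodule_module[OF X] mod_unit_module and I = unit_amodule
  note P = is_hom_comp[OF is_hom_comp[OF tens_hom[OF is_hom_id f0_hom tX tX I tw_amodule[OF I]] f2_hom[OF I X]] fmo_hom[OF lunit_hom[OF X]]]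
  note Q = runit_hom[OF tX]
  show ?thesis
  proof (rule hom_eqI[OF P Q], rule mod_tensor_ext[OF tw_module[OF m(1)] m(2) tw_module[OF m(1)] is_homD(1)[OF P] is_homD(1)[OF Q]])
    fix x c assume "x \<in> carrier (tw X)" "c \<in> carrier ?I"
    then obtain d where x: "x \<in> carrier X" and c: "d \<in> carrier k" "c = Scal d" by (auto simp: mod_unit_def)
    note e = R_counit(2)[OF m(1) klin_act1[OF X x klin_id]]
    have "tlift X (\<lambda>c x. unscal c \<odot>\<^bsub>X\<^esub> x) (untens (mod_flip_R k R X ?I (tp k X ?I x c)))
      = tlift X (\<lambda>a b. tlift X (\<lambda>c x. unscal c \<odot>\<^bsub>X\<^esub> x) (untens (tp k ?I X (act ?I b c) (act X a x)))) R"
      unfolding braid_map_tp[OF X I x \<open>c \<in> carrier ?I\<close>]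
      by (rule klin_tlift[OF lunit_map_klin[OF m(1)] module_mod_tensor[OF m(2,1)] m(1)])
        (use x \<open>c \<in> carrier ?I\<close> in \<open>auto intro!: tp_cl m act_cl[OF X] act_cl[OF I]\<close>)
    also have "\<dots> = tlift X (\<lambda>a b. d \<odot>\<^bsub>X\<^esub> (\<epsilon> b \<odot>\<^bsub>X\<^esub> act X a x)) R"
      using x c m(1) by (intro tlift_cong refl)
        (simp add: act_unit lunit_map_tp[OF m(1)] act_cl[OF X] k_comm[of "\<epsilon> _" d] mod_mults)
    also have "\<dots> = d \<odot>\<^bsub>X\<^esub> x"
      using e x by (subst tlift_smult[OF m(1) c(1)]) (auto simp: act_one[OF X] intro!: mod_smult m act_cl[OF X])
    finally have "tlift X (\<lambda>c x. unscal c \<odot>\<^bsub>X\<^esub> x) (untens (mod_flip_R k R X ?I (tp k X ?I x c))) = d \<odot>\<^bsub>X\<^esub> x" .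
    then show "tlift X (\<lambda>c x. unscal c \<odot>\<^bsub>X\<^esub> x) (untens (mod_flip_R k R X ?I
        (tensor_map k (tw X) (tw ?I) (\<lambda>x. x) (\<lambda>x. x) (tp k (tw X) ?I x c))))
      = tlift (tw X) (\<lambda>x c. unscal c \<odot>\<^bsub>tw X\<^esub> x) (untens (tp k (tw X) ?I x c))"
      using x c \<open>c \<in> carrier ?I\<close> by (simp add: twist_simps tensor_eval m runit_map_tp[OF m(1)])
  qed
qed

lemma hom_f2_run:
  fixes X :: "('k, 'h, 'a) mob"
  assumes X: "amodule k H X"
  shows "amod_comp (fmo \<Phi> (mod_runit k H \<Delta> X)) (amod_comp (f2 \<Phi> X (mod_unit k H)) (mod_tensor_mor k \<Delta> (f0 \<Phi>) (amod_id (tw X))))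
    = mod_lunit k H (tw X)"
proof -
  interpret comod k H H \<Delta> "TYPE('a)" by (rule comod_H)
  let ?I = "mod_unit k H :: ('k, 'h, 'a) mob"
  note tX = tw_amodule[OF X] and m = amodule_module[OF X] mod_unit_module and I = unit_amodule
  note P = is_hom_comp[OF is_hom_comp[OF tens_hom[OF f0_hom is_hom_id I tw_amodule[OF I] tX tX] f2_hom[OF X I]] fmo_hom[OF runit_hom[OF X]]]
  note Q = lunit_hom[OF tX]
  show ?thesis
  proof (rule hom_eqI[OF P Q], rule mod_tensor_ext[OF m(2) tw_module[OF m(1)] tw_module[OF m(1)] is_homD(1)[OF P] is_homD(1)[OF Q]])
    fix c x assume "x \<in> carrier (tw X)" "c \<in> carrier ?I"
    then obtain d where x: "x \<in> carrier X" and c: "d \<in> carrier k" "c = Scal d" by (auto simp: mod_unit_def)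
    note e = R_counit(1)[OF m(1) klin_act1[OF X x klin_id]]
    have "tlift X (\<lambda>x c. unscal c \<odot>\<^bsub>X\<^esub> x) (untens (mod_flip_R k R ?I X (tp k ?I X c x)))
      = tlift X (\<lambda>a b. tlift X (\<lambda>x c. unscal c \<odot>\<^bsub>X\<^esub> x) (untens (tp k X ?I (act X b x) (act ?I a c)))) R"
      unfolding braid_map_tp[OF I X \<open>c \<in> carrier ?I\<close> x]
      by (rule klin_tlift[OF runit_map_klin[OF m(1)] module_mod_tensor[OF m] m(1)])
        (use x \<open>c \<in> carrier ?I\<close> in \<open>auto intro!: tp_cl m act_cl[OF X] act_cl[OF I]\<close>)
    also have "\<dots> = tlift X (\<lambda>a b. d \<odot>\<^bsub>X\<^esub> (\<epsilon> a \<odot>\<^bsub>X\<^esub> act X b x)) R"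
      using x c m(1) by (intro tlift_cong refl)
        (simp add: act_unit runit_map_tp[OF m(1)] act_cl[OF X] k_comm[of "\<epsilon> _" d] mod_mults)
    also have "\<dots> = d \<odot>\<^bsub>X\<^esub> x"
      using e x by (subst tlift_smult[OF m(1) c(1)]) (auto simp: act_one[OF X] intro!: mod_smult m act_cl[OF X])
    finally have "tlift X (\<lambda>x c. unscal c \<odot>\<^bsub>X\<^esub> x) (untens (mod_flip_R k R ?I X (tp k ?I X c x))) = d \<odot>\<^bsub>X\<^esub> x" .
    then show "tlift X (\<lambda>x c. unscal c \<odot>\<^bsub>X\<^esub> x) (untens (mod_flip_R k R ?I X
        (tensor_map k (tw ?I) (tw X) (\<lambda>x. x) (\<lambda>x. x) (tp k ?I (tw X) c x))))
      = tlift (tw X) (\<lambda>c x. unscal c \<odot>\<^bsub>tw X\<^esub> x) (untens (tp k ?I (tw X) c x))"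
      using x c \<open>c \<in> carrier ?I\<close> by (simp add: twist_simps tensor_eval m lunit_map_tp[OF m(1)])
  qed
qed

text \<open>By \<open>braid_map_twist\<close> both sides are the double braiding of \<open>Y\<close>
  and \<open>X\<close> formed without any twist.\<close>

lemma hom_f2_braid:
  fixes X Y :: "('k, 'h, 'a) mob"
  assumes X: "amodule k H X" and Y: "amodule k H Y"
  shows "amod_comp (fmo \<Phi> (mod_braid k H R X Y)) (f2 \<Phi> X Y) = amod_comp (f2 \<Phi> Y X) (mod_braid k H R (tw Y) (tw X))"
proof -
  interpret comod k H H \<Delta> "TYPE('a)" by (rule comod_H)
  note P = is_hom_comp[OF f2_hom[OF X Y] fmo_hom[OF braid_hom[OF X Y]]]
  note Q = is_hom_comp[OF braid_hom[OF tw_amodule[OF Y] tw_amodule[OF X]] f2_hom[OF Y X]]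
  show ?thesis
    by (rule hom_eqI[OF P Q]) (simp add: twist_simps braid_map_twist[OF X Y])
qed

end

section \<open>The action of the universal K-matrix\<close>

context kmat
begin

lemma K_iso:
  fixes M X :: "('k, 'h, 'a) mob"
  assumes M: "amodule k A0 M" and X: "amodule k H X" and D: "mod_cat k A0 D"
  shows "iso_mor D (mod_tensor k \<delta> M X) (mod_tensor k \<delta> M (tw X)) (K_action k H \<phi> B K M X)"
  by (rule iso_mor_hom[OF K_hom[OF M X] _ _ _ aMX[OF M X] D, of "tact k M X K_inv0"])
    (simp_all add: twist_simps K_map_klin[OF M X] K_inverse[OF M X])

lemma hom_K_nat:
  fixes M M' X X' :: "('k, 'h, 'a) mob"
  assumes M: "amodule k A0 M" "amodule k A0 M'" and X: "amodule k H X" "amodule k H X'"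
    and F: "is_hom k A0 F M f M'" and G: "is_hom k H G X g X'"
  shows "amod_comp (K_action k H \<phi> B K M' X') (mod_tensor_mor k \<delta> F G)
    = amod_comp (mod_tensor_mor k \<delta> F (fmo \<Phi> G)) (K_action k H \<phi> B K M X)"
proof -
  interpret comod k H A0 \<delta> "TYPE('a)" by (rule comod_B)
  note m = M[THEN amodule_module] X[THEN amodule_module]
  note kl = F[THEN is_homD(1)] G[THEN is_homD(1)]
  note P = is_hom_comp[OF tens_hom[OF F G M X] K_hom[OF M(2) X(2)]]
  note Q = is_hom_comp[OF K_hom[OF M(1) X(1)] tens_hom[OF F fmo_hom[OF G] M tw_amodule[OF X(1)] tw_amodule[OF X(2)]]]
  note acl = act_cl[OF M(1)] act_cl[OF X(1)]
  show ?thesis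
    by (rule hom_eqI[OF P Q], rule mod_tensor_ext[OF m(1,3) module_mod_tensor[OF m(2) tw_module[OF m(4)]] is_homD(1)[OF P] is_homD(1)[OF Q]])
      (simp_all add: twist_simps tensor_eval m kl klin_cl[OF kl(1)] klin_cl[OF kl(2)] K_map_tp M X push_tensor_map acl tp_cl
        is_homD(3)[OF F] is_homD(3)[OF G])
qed

end

context kmat
begin

text \<open>With a single twisted factor \<open>\<phi>\<close> does not cancel: this braiding is the
  flip after the action of \<open>(\<phi> \<otimes> id)(R)\<close>, the twisted R-matrix in the
  axioms of \<open>K\<close>.\<close>

lemma braid_map_twist_left:
  fixes X Y :: "('k, 'h, 'a) mob"
  assumes X: "amodule k H X" and Y: "amodule k H Y"
  shows "mod_flip_R k R (tw Y) X \<in> klin k (mod_tensor k \<Delta> Y X) (mod_tensor k \<Delta> X Y)"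
    and "x \<in> carrier X \<Longrightarrow> y \<in> carrier Y \<Longrightarrow> mod_flip_R k R (tw Y) X (tp k Y X y x)
      = tlift (mod_tensor k \<Delta> X Y) (\<lambda>a b. tp k X Y (act X b x) (act Y (\<phi> a) y)) R"
  using braid_map_klin[OF tw_amodule[OF Y] X] braid_map_tp[OF tw_amodule[OF Y] X, of y x] by (simp_all add: twist_simps)

text \<open>Read from right to left, the factors in \<open>K_hex1\<close> are the braiding of
  \<open>X\<close> and \<open>Y\<close>, the action of \<open>K\<close> on
  \<open>M \<otimes> Y\<close>, and the braiding of the twisted \<open>Y\<close> with
  \<open>X\<close>. The associators merely move brackets.\<close>

lemma hom_BP1:
  fixes M X Y :: "('k, 'h, 'a) mob"
  assumes M: "amodule k A0 M" and X: "amodule k H X" and Y: "amodule k H Y" and D: "mod_cat k A0 D"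
  shows "K_action k H \<phi> B K (mod_tensor k \<delta> M X) Y =
    amod_comp (inv_mor D (mod_tensor k \<delta> (mod_tensor k \<delta> M X) (tw Y)) (mod_tensor k \<delta> M (mod_tensor k \<Delta> X (tw Y)))
      (mod_assoc k H \<delta> M X (tw Y)))
    (amod_comp (mod_tensor_mor k \<delta> (amod_id M) (mod_braid k H R (tw Y) X))
    (amod_comp (mod_assoc k H \<delta> M (tw Y) X)
    (amod_comp (mod_tensor_mor k \<delta> (K_action k H \<phi> B K M Y) (amod_id X))
    (amod_comp (inv_mor D (mod_tensor k \<delta> (mod_tensor k \<delta> M Y) X) (mod_tensor k \<delta> M (mod_tensor k \<Delta> Y X)) (mod_assoc k H \<delta> M Y X))
    (amod_comp (mod_tensor_mor k \<delta> (amod_id M) (mod_braid k H R X Y)) (mod_assoc k H \<delta> M X Y))))))"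
proof -
  interpret comod k H A0 \<delta> "TYPE('a)" by (rule comod_B)
  interpret HH: comod k H H \<Delta> "TYPE('a)" by (rule comod_H)
  note m = M[THEN amodule_module] X[THEN amodule_module] Y[THEN amodule_module]
  note tY = tw_amodule[OF Y]
  note MX = amodule_mod_tensor[OF M X] and MY = amodule_mod_tensor[OF M Y] and XY = HH.amodule_mod_tensor[OF X Y] and YX = HH.amodule_mod_tensor[OF Y X]
  note P = K_hom[OF MX Y]
  note Q = is_hom_comp[OF is_hom_comp[OF is_hom_comp[OF is_hom_comp[OF is_hom_comp[OF is_hom_comp[OF
    assoc_hom[OF M X Y]
    tens_hom[OF is_hom_id braid_hom[OF X Y] M M XY YX]]
    assoc_inv_hom[OF M Y X]]
    tens_hom[OF K_hom[OF M Y] is_hom_id MY amodule_mod_tensor[OF M tY] X X]]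
    assoc_hom[OF M tY X]]
    tens_hom[OF is_hom_id braid_hom[OF tY X] M M HH.amodule_mod_tensor[OF tY X] HH.amodule_mod_tensor[OF X tY]]]
    assoc_inv_hom[OF M X tY]]
  let ?T = "mod_tensor k \<delta> (mod_tensor k \<delta> M X) Y"
  note mT = amodule_module[OF amodule_mod_tensor[OF MX Y]]
  note acl = act_cl[OF M] act_cl[OF X] act_cl[OF Y]
  note s = twist_simps tensor_eval m acl tp_cl M X Y braid_map_tp braid_map_klin braid_map_twist_left act_tp MX MY XY YX push_tp1[where \<delta>=\<delta>] push_tp2[where \<delta>=\<delta>]
    push_assoc_unmap push_assoc_map push_tensor_map mT act_mult[OF M, simplified, symmetric] act_mult[OF X, symmetric] act_mult[OF Y, symmetric] K_map_tp K_map_klin H_assoc B_ring(4)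
  show ?thesis
    unfolding assoc_inv[OF M X tY D] assoc_inv[OF M Y X D]
  proof (rule hom_eqI[OF P Q], rule ext3l[OF m amodule_module[OF amodule_mod_tensor[OF MX tY]] is_homD(1)[OF P] is_homD(1)[OF Q]])
    fix w x y assume w: "w \<in> carrier M" and x: "x \<in> carrier X" and y: "y \<in> carrier Y"
    let ?f = "\<lambda>a b c. tp k (mod_tensor k \<delta> M X) Y (tp k M X (act M a w) (act X b x)) (act Y c y)"
    let ?u = "tp k (mod_tensor k \<delta> M X) Y (tp k M X w x) y"
    let ?r = "assoc_unmap k \<delta> M X (tw Y) (tensor_map k M (mod_tensor k \<Delta> X (tw Y)) (\<lambda>x. x) (mod_flip_R k R (tw Y) X)
      (assoc_map k H M (tw Y) X (tensor_map k (mod_tensor k \<delta> M (tw Y)) X (tact k M Y K0) (\<lambda>x. x)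
      (assoc_unmap k \<delta> M Y X (tensor_map k M (mod_tensor k \<Delta> Y X) (\<lambda>x. x) (mod_flip_R k R X Y) (assoc_map k H M X Y ?u))))))"
    have "tact k (mod_tensor k \<delta> M X) Y K0 ?u = tlift ?T (\<lambda>a c. tlift ?T (\<lambda>a1 a2. ?f a1 a2 c) (\<delta> a)) K0"
      using w x y by (simp add: s)
    also have "\<dots> = tlift ?T (\<lambda>p q. tlift ?T (\<lambda>g h. tlift ?T (\<lambda>s t. ?f g (q \<cdot> s) (\<phi> p \<cdot> h \<cdot> t)) R) K0) R"
      by (rule K_hex1[OF mT]) (intro trilinI klin_tp1 klin_tp2 m amodule_module[OF MX] tp_cl acl klin_act1[OF M] klin_act1[OF X] klin_act1[OF Y] klin_id w x y)
    \<comment> \<open>The sums are put in the order in which the operators act.\<close>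
    also have "\<dots> = tlift ?T (\<lambda>s t. tlift ?T (\<lambda>g h. tlift ?T (\<lambda>p q. ?f g (q \<cdot> s) (\<phi> p \<cdot> h \<cdot> t)) R) K0) R"
      by (rule tlift_Fubini3[OF mT]) (intro tp_cl m amodule_module[OF MX] acl w x y; simp)
    also have "\<dots> = ?r"
      using w x y by (simp add: s)
    finally show "tact k (mod_tensor k \<delta> M X) Y K0 ?u = ?r" .
  qed
qed

text \<open>Read from right to left, the factors in \<open>K_hex2\<close> are \<open>K\<close> on
  \<open>M \<otimes> X\<close>, the braiding of the twisted \<open>X\<close> with \<open>Y\<close>,
  \<open>K\<close> on \<open>M \<otimes> Y\<close>, and \<open>f2\<close>. Only the second keeps a
  \<open>\<phi>\<close>: in \<open>f2\<close> both factors are twisted, and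
  \<open>braid_map_twist\<close> removes the twists.\<close>

lemma hom_BP2:
  fixes M X Y :: "('k, 'h, 'a) mob"
  assumes M: "amodule k A0 M" and X: "amodule k H X" and Y: "amodule k H Y" and D: "mod_cat k A0 D"
  shows "K_action k H \<phi> B K M (mod_tensor k \<Delta> X Y) =
    amod_comp (mod_tensor_mor k \<delta> (amod_id M) (f2 \<Phi> X Y))
    (amod_comp (mod_assoc k H \<delta> M (tw Y) (tw X))
    (amod_comp (mod_tensor_mor k \<delta> (K_action k H \<phi> B K M Y) (amod_id (tw X)))
    (amod_comp (inv_mor D (mod_tensor k \<delta> (mod_tensor k \<delta> M Y) (tw X)) (mod_tensor k \<delta> M (mod_tensor k \<Delta> Y (tw X)))
      (mod_assoc k H \<delta> M Y (tw X)))
    (amod_comp (mod_tensor_mor k \<delta> (amod_id M) (mod_braid k H R (tw X) Y))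
    (amod_comp (mod_assoc k H \<delta> M (tw X) Y)
    (amod_comp (mod_tensor_mor k \<delta> (K_action k H \<phi> B K M X) (amod_id Y))
    (inv_mor D (mod_tensor k \<delta> (mod_tensor k \<delta> M X) Y) (mod_tensor k \<delta> M (mod_tensor k \<Delta> X Y)) (mod_assoc k H \<delta> M X Y))))))))"
proof -
  interpret comod k H A0 \<delta> "TYPE('a)" by (rule comod_B)
  interpret HH: comod k H H \<Delta> "TYPE('a)" by (rule comod_H)
  note m = M[THEN amodule_module] X[THEN amodule_module] Y[THEN amodule_module]
  note tX = tw_amodule[OF X] and tY = tw_amodule[OF Y]
  note MX = amodule_mod_tensor[OF M X] and MY = amodule_mod_tensor[OF M Y] and XY = HH.amodule_mod_tensor[OF X Y] and YX = HH.amodule_mod_tensor[OF Y X]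
  note P = K_hom[OF M XY]
  note Q = is_hom_comp[OF is_hom_comp[OF is_hom_comp[OF is_hom_comp[OF is_hom_comp[OF is_hom_comp[OF is_hom_comp[OF
    assoc_inv_hom[OF M X Y]
    tens_hom[OF K_hom[OF M X] is_hom_id MX amodule_mod_tensor[OF M tX] Y Y]]
    assoc_hom[OF M tX Y]]
    tens_hom[OF is_hom_id braid_hom[OF tX Y] M M HH.amodule_mod_tensor[OF tX Y] HH.amodule_mod_tensor[OF Y tX]]]
    assoc_inv_hom[OF M Y tX]]
    tens_hom[OF K_hom[OF M Y] is_hom_id MY amodule_mod_tensor[OF M tY] tX tX]]
    assoc_hom[OF M tY tX]]
    tens_hom[OF is_hom_id f2_hom[OF X Y] M M HH.amodule_mod_tensor[OF tY tX] tw_amodule[OF XY]]]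
  let ?T = "mod_tensor k \<delta> M (mod_tensor k \<Delta> X Y)"
  note mT = amodule_module[OF amodule_mod_tensor[OF M XY]]
  note acl = act_cl[OF M] act_cl[OF X] act_cl[OF Y]
  note s = twist_simps tensor_eval m acl tp_cl M X Y braid_map_tp braid_map_klin braid_map_twist_left HH.act_tp MX MY XY YX push_tp1[where \<delta>=\<delta>] push_tp2[where \<delta>=\<delta>]
    push_assoc_unmap push_assoc_map push_tensor_map mT act_mult[OF M, simplified, symmetric] act_mult[OF X, symmetric] act_mult[OF Y, symmetric] K_map_tp K_map_klin H_assoc B_ring(4)
  show ?thesis
    unfolding assoc_inv[OF M Y tX D] assoc_inv[OF M X Y D]
  proof (rule hom_eqI[OF P Q], rule ext3r[OF m amodule_module[OF amodule_mod_tensor[OF M tw_amodule[OF XY]]] is_homD(1)[OF P] is_homD(1)[OF Q]])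
    fix w x y assume w: "w \<in> carrier M" and x: "x \<in> carrier X" and y: "y \<in> carrier Y"
    let ?f = "\<lambda>a b c. tp k M (mod_tensor k \<Delta> X Y) (act M a w) (tp k X Y (act X b x) (act Y c y))"
    let ?u = "tp k M (mod_tensor k \<Delta> X Y) w (tp k X Y x y)"
    let ?r = "tensor_map k M (tw (mod_tensor k \<Delta> X Y)) (\<lambda>x. x) (mod_flip_R k R Y X)
      (assoc_map k H M (tw Y) (tw X) (tensor_map k (mod_tensor k \<delta> M (tw Y)) (tw X) (tact k M Y K0) (\<lambda>x. x)
      (assoc_unmap k \<delta> M Y (tw X) (tensor_map k M (mod_tensor k \<Delta> Y (tw X)) (\<lambda>x. x) (mod_flip_R k R (tw X) Y)
      (assoc_map k H M (tw X) Y (tensor_map k (mod_tensor k \<delta> M (tw X)) Y (tact k M X K0) (\<lambda>x. x) (assoc_unmap k \<delta> M X Y ?u)))))))"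
    have "tact k M (mod_tensor k \<Delta> X Y) K0 ?u = tlift ?T (\<lambda>a c. tlift ?T (\<lambda>c1 c2. ?f a c1 c2) (\<Delta> c)) K0"
      using w x y by (simp add: s)
    also have "\<dots> = tlift ?T (\<lambda>p q. tlift ?T (\<lambda>g h. tlift ?T (\<lambda>s t. tlift ?T (\<lambda>g' h'.
        ?f (g \<cdot> g') (q \<cdot> \<phi> s \<cdot> h') (p \<cdot> h \<cdot> t)) K0) R) K0) R"
      by (rule K_hex2[OF mT]) (intro trilinI klin_tp1 klin_tp2 m amodule_module[OF XY] tp_cl acl klin_act1[OF M] klin_act1[OF X] klin_act1[OF Y] klin_id w x y)
    also have "\<dots> = tlift ?T (\<lambda>g' h'. tlift ?T (\<lambda>s t. tlift ?T (\<lambda>g h. tlift ?T (\<lambda>p q.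
        ?f (g \<cdot> g') (q \<cdot> \<phi> s \<cdot> h') (p \<cdot> h \<cdot> t)) R) K0) R) K0"
      by (rule tlift_Fubini4[OF mT]) (intro tp_cl m amodule_module[OF XY] acl w x y; simp add: B_ring)
    also have "\<dots> = ?r"
      using w x y by (simp add: s)
    finally show "tact k M (mod_tensor k \<Delta> X Y) K0 ?u = ?r" .
  qed
qed

end

section \<open>The ribbon element\<close>

definition un_Elem :: "('k, 'h) univ \<Rightarrow> 'h" where
  "un_Elem u = (case u of Elem x \<Rightarrow> x)"

lemma un_Elem [simp]: "un_Elem (Elem x) = x"
  by (simp add: un_Elem_def)

text \<open>The module \<open>H\<close> over itself as an object inside \<open>univ\<close>. The
  action on \<open>Elem\<close> of 1 recovers the acting element, so equations of actions can be
  read as equations in \<open>H\<close>.\<close>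

definition regular :: "('k, 'h) hopf \<Rightarrow> ('k, 'h, 'h) mob" where
  "regular H = \<lparr>carrier = Elem ` carrier H, mult = undefined, one = undefined, zero = Elem \<zero>\<^bsub>H\<^esub>,
     add = \<lambda>u v. Elem (un_Elem u \<oplus>\<^bsub>H\<^esub> un_Elem v), smult = \<lambda>c u. Elem (c \<odot>\<^bsub>H\<^esub> un_Elem u),
     act = \<lambda>a u. Elem (a \<otimes>\<^bsub>H\<^esub> un_Elem u)\<rparr>"

lemma mk_arrow_eqD: "mk_arrow X f Y = mk_arrow X g Y' \<Longrightarrow> x \<in> carrier X \<Longrightarrow> f x = g x"
  unfolding mk_arrow_def arrow.inject by (metis restrict_apply')

context hopf_alg
begin

lemma regular_module: "module k (regular H)"
proof -
  interpret H: module k H by (rule module_H)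
  show ?thesis
  proof (rule moduleI)
    show "abelian_group (regular H)"
    proof (rule abelian_groupI)
      show "\<exists>y\<in>carrier (regular H). y \<oplus>\<^bsub>regular H\<^esub> x = \<zero>\<^bsub>regular H\<^esub>" if "x \<in> carrier (regular H)" for x
        using that by (intro bexI[of _ "Elem (\<ominus>\<^bsub>H\<^esub> un_Elem x)"]) (auto simp: regular_def H.M.l_neg)
    qed (auto simp: regular_def H.M.a_ac)
  qed (auto simp: regular_def cring_k H.smult_l_distr H.smult_r_distr H.smult_assoc1)
qed

lemma regular_amodule: "amodule k H (regular H)"
proof (rule amoduleI[OF regular_module])
  note b = bilinear_algebra_bilin[OF algebra_H]
  show "bilin k H (regular H) (regular H) (act (regular H))"
    using klin_add[OF bilinD1[OF b]] klin_add[OF bilinD2[OF b]] klin_smult[OF bilinD1[OF b]] klin_smult[OF bilinD2[OF b]]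
    by (intro bilinI klinI) (auto simp: regular_def)
qed (auto simp: regular_def H_assoc)

lemma un_Elem_klin: "un_Elem \<in> klin k (regular H) H"
  by (rule klinI) (auto simp: regular_def)

end

locale ribbon_inv = inv_hopf k H R \<phi> for k :: "'k ring" and H :: "('k, 'h) hopf" and R \<phi> +
  fixes \<nu> :: 'h
  assumes ribbon_nu: "ribbon_element k H R \<nu>" and phi_nu: "\<phi> \<nu> = \<nu>"
begin

abbreviation \<nu>' where "\<nu>' \<equiv> inv\<^bsub>H\<^esub> \<nu>"

lemma nu_cl [simp]: "\<nu> \<in> carrier H" "\<nu>' \<in> carrier H"
  and nu_inv: "\<nu> \<cdot> \<nu>' = \<one>\<^bsub>H\<^esub>" "\<nu>' \<cdot> \<nu> = \<one>\<^bsub>H\<^esub>"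
  and nu_central: "h \<in> carrier H \<Longrightarrow> \<nu> \<cdot> h = h \<cdot> \<nu>"
proof -
  interpret H: ring H by (rule ring_H)
  have "\<nu> \<in> Units H" using ribbon_nu by (simp add: ribbon_element_def)
  then show "\<nu> \<in> carrier H" "\<nu>' \<in> carrier H" "\<nu> \<cdot> \<nu>' = \<one>\<^bsub>H\<^esub>" "\<nu>' \<cdot> \<nu> = \<one>\<^bsub>H\<^esub>" by auto
  show "h \<in> carrier H \<Longrightarrow> \<nu> \<cdot> h = h \<cdot> \<nu>" using ribbon_nu by (simp add: ribbon_element_def)
qed

lemma nu'_central: "h \<in> carrier H \<Longrightarrow> \<nu>' \<cdot> h = h \<cdot> \<nu>'"
proof -
  assume h: "h \<in> carrier H"
  have "\<nu>' \<cdot> h = \<nu>' \<cdot> (h \<cdot> \<nu>) \<cdot> \<nu>'" using h by (simp add: H_assoc nu_inv)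
  also have "\<dots> = (\<nu>' \<cdot> \<nu>) \<cdot> h \<cdot> \<nu>'" using h by (simp only: nu_central[OF h, symmetric]) (simp add: H_assoc)
  finally show ?thesis using h by (simp add: nu_inv)
qed

lemma phi_nu' [simp]: "\<phi> \<nu>' = \<nu>'"
proof -
  have "\<phi> \<nu>' = \<phi> \<nu>' \<cdot> (\<phi> \<nu> \<cdot> \<nu>')" by (simp add: phi_nu nu_inv)
  also have "\<dots> = \<phi> (\<nu>' \<cdot> \<nu>) \<cdot> \<nu>'" by (simp add: phi_mult H_assoc)
  finally show ?thesis by (simp add: nu_inv)
qed

lemma theta_hom:
  assumes "amodule k H X"
  shows "is_hom k H (mk_arrow X (act X \<nu>) X) X (act X \<nu>) X"
  using act_mult[OF assms, symmetric] klin_act2[OF assms nu_cl(1) klin_id]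
  by (simp add: is_hom_def nu_central)

text \<open>The balancing speaks of modules whose elements come from \<open>H\<close>. On the
  regular module it turns into an identity of sums with arbitrary bilinear \<open>f\<close> and
  target \<open>U\<close>, and in this form it applies to modules over any other type.\<close>

lemma comult_nu:
  assumes U: "module k U" and f: "bilin k H H U f"
  shows "tlift U f (\<Delta> \<nu>) = tlift U (\<lambda>a b. tlift U (\<lambda>a' b'.
    f (b' \<cdot> (\<nu> \<cdot> a)) (a' \<cdot> (\<nu> \<cdot> b))) R) R"
proof -
  interpret comod k H H \<Delta> "TYPE('h)" by (rule comod_H)
  let ?X = "regular H" let ?T = "mod_tensor k \<Delta> ?X ?X" let ?t = "mk_arrow ?X (act ?X \<nu>) ?X"
  note X = regular_amodule and m = regular_module
  note T = amodule_mod_tensor[OF X X] note mT = amodule_module[OF T]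
  note th = theta_hom[OF X]
  let ?E = "\<lambda>a b. tp k ?X ?X (Elem a) (Elem b)"
  let ?e = "?E \<one>\<^bsub>H\<^esub> \<one>\<^bsub>H\<^esub>"
  have El [simp]: "a \<in> carrier H \<Longrightarrow> Elem a \<in> carrier ?X" for a by (simp add: regular_def)
  have ac [simp]: "act ?X a (Elem b) = Elem (a \<cdot> b)" for a b by (simp add: regular_def)
  have eT: "?e \<in> carrier ?T" by (simp add: tp_cl m)
  have "mk_arrow ?T (act ?T \<nu>) ?T
    = amod_comp (mod_braid k H R ?X ?X) (amod_comp (mod_tensor_mor k \<Delta> ?t ?t) (mod_braid k H R ?X ?X))"
    using ribbon_nu X by (simp add: ribbon_element_def balancing_def Hmod_def)
  moreover have "is_hom k H (amod_comp (mod_braid k H R ?X ?X) (amod_comp (mod_tensor_mor k \<Delta> ?t ?t) (mod_braid k H R ?X ?X))) ?T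
      (\<lambda>u. mod_flip_R k R ?X ?X (tensor_map k ?X ?X (act ?X \<nu>) (act ?X \<nu>) (mod_flip_R k R ?X ?X u))) ?T"
    by (rule is_hom_comp[OF is_hom_comp[OF braid_hom[OF X X] tens_hom[OF th th X X X X]] braid_hom[OF X X]])
  ultimately have "mk_arrow ?T (act ?T \<nu>) ?T = mk_arrow ?T
      (\<lambda>u. mod_flip_R k R ?X ?X (tensor_map k ?X ?X (act ?X \<nu>) (act ?X \<nu>) (mod_flip_R k R ?X ?X u))) ?T"
    by (simp add: is_hom_def)
  from mk_arrow_eqD[OF this eT]
  have 1: "act ?T \<nu> ?e = mod_flip_R k R ?X ?X (tensor_map k ?X ?X (act ?X \<nu>) (act ?X \<nu>) (mod_flip_R k R ?X ?X ?e))" .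
  have 2: "act ?T \<nu> ?e = tlift ?T ?E (\<Delta> \<nu>)"
    by (simp add: act_tp X)
  have 3: "mod_flip_R k R ?X ?X (tensor_map k ?X ?X (act ?X \<nu>) (act ?X \<nu>) (mod_flip_R k R ?X ?X ?e))
    = tlift ?T (\<lambda>a b. tlift ?T (\<lambda>a' b'. ?E (b' \<cdot> (\<nu> \<cdot> a)) (a' \<cdot> (\<nu> \<cdot> b))) R) R"
    by (simp add: braid_map_tp X push_tensor_map push_braid_map tensor_map_tp is_homD(1)[OF th] m tp_cl)
  \<comment> \<open>The linear map induced by \<open>f\<close> on the square of the regular module;
    it carries the equation found there to \<open>U\<close>.\<close>
  let ?g = "mlift U (\<lambda>x y. f (un_Elem x) (un_Elem y))"
  have b: "bilin k ?X ?X U (\<lambda>x y. f (un_Elem x) (un_Elem y))"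
    using klin_cl[OF un_Elem_klin] by (intro bilinI klin_bil1[OF f] klin_bil2[OF f] un_Elem_klin)
  note g = mlift_klin[OF m m U b, of \<Delta>]
  have gE: "?g (?E a b) = f a b" if "a \<in> carrier H" "b \<in> carrier H" for a b
    using mlift_tp[OF m m U b] that by simp
  have "tlift U f (\<Delta> \<nu>) = ?g (tlift ?T ?E (\<Delta> \<nu>))"
    by (subst klin_tlift[OF g mT U]) (auto simp: gE tp_cl m intro!: tlift_cong)
  also have "\<dots> = ?g (tlift ?T (\<lambda>a b. tlift ?T (\<lambda>a' b'. ?E (b' \<cdot> (\<nu> \<cdot> a)) (a' \<cdot> (\<nu> \<cdot> b))) R) R)"
    using 1 2 3 by simp
  also have "\<dots> = tlift U (\<lambda>a b. ?g (tlift ?T (\<lambda>a' b'. ?E (b' \<cdot> (\<nu> \<cdot> a)) (a' \<cdot> (\<nu> \<cdot> b))) R)) R"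
    by (rule klin_tlift[OF g mT U]) (simp add: tlift_closed[OF mT] tp_cl m)
  also have "\<dots> = tlift U (\<lambda>a b. tlift U (\<lambda>a' b'. ?g (?E (b' \<cdot> (\<nu> \<cdot> a)) (a' \<cdot> (\<nu> \<cdot> b)))) R) R"
    by (rule tlift_cong[OF refl], rule klin_tlift[OF g mT U]) (simp add: tp_cl m)
  also have "\<dots> = tlift U (\<lambda>a b. tlift U (\<lambda>a' b'.
    f (b' \<cdot> (\<nu> \<cdot> a)) (a' \<cdot> (\<nu> \<cdot> b))) R) R"
    by (intro tlift_cong refl) (simp add: gE)
  finally show ?thesis .
qed

text \<open>Applying the counit to the first leg of \<open>comult_nu\<close> makes both copies of
  \<open>R\<close> disappear by \<open>R_counit\<close> and leaves
  \<open>\<nu> = \<epsilon> \<nu> \<odot> \<nu>\<close>. So \<open>\<epsilon> \<nu>\<close> is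
  idempotent, and being invertible it is 1.\<close>

lemma counit_nu: "\<epsilon> \<nu> = \<one>\<^bsub>k\<^esub>" "\<epsilon> \<nu>' = \<one>\<^bsub>k\<^esub>"
proof -
  interpret K: cring k by (rule cring_k)
  have "\<nu> = tlift H (\<lambda>a b. \<epsilon> a \<odot>\<^bsub>H\<^esub> b) (\<Delta> \<nu>)"
    by (rule counit_left[OF module_H klin_id, symmetric]) simp
  also have "\<dots> = tlift H (\<lambda>a b. tlift H (\<lambda>a' b'. \<epsilon> (b' \<cdot> (\<nu> \<cdot> a)) \<odot>\<^bsub>H\<^esub> (a' \<cdot> (\<nu> \<cdot> b))) R) R"
    by (rule comult_nu[OF module_H]) (intro bilinI klin_scal[OF module_H] klin_counit[OF module_H] klin_id; simp)
  also have "\<dots> = tlift H (\<lambda>a b. (\<epsilon> \<nu> \<otimes>\<^bsub>k\<^esub> \<epsilon> a) \<odot>\<^bsub>H\<^esub> tlift H (\<lambda>a' b'. \<epsilon> b' \<odot>\<^bsub>H\<^esub> (a' \<cdot> (\<nu> \<cdot> b))) R) R"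
  proof (rule tlift_cong[OF refl])
    fix a b assume "(a, b) \<in> set R"
    then have ab: "a \<in> carrier H" "b \<in> carrier H" by auto
    have "tlift H (\<lambda>a' b'. \<epsilon> (b' \<cdot> (\<nu> \<cdot> a)) \<odot>\<^bsub>H\<^esub> (a' \<cdot> (\<nu> \<cdot> b))) R
      = tlift H (\<lambda>a' b'. (\<epsilon> \<nu> \<otimes>\<^bsub>k\<^esub> \<epsilon> a) \<odot>\<^bsub>H\<^esub> (\<epsilon> b' \<odot>\<^bsub>H\<^esub> (a' \<cdot> (\<nu> \<cdot> b)))) R"
      using ab by (intro tlift_cong refl) (simp add: counit_mult mod_mults[OF module_H, symmetric] K.m_ac)
    also have "\<dots> = (\<epsilon> \<nu> \<otimes>\<^bsub>k\<^esub> \<epsilon> a) \<odot>\<^bsub>H\<^esub> tlift H (\<lambda>a' b'. \<epsilon> b' \<odot>\<^bsub>H\<^esub> (a' \<cdot> (\<nu> \<cdot> b))) R"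
      by (rule tlift_smult[OF module_H]) (use ab module_H in simp_all)
    finally show "tlift H (\<lambda>a' b'. \<epsilon> (b' \<cdot> (\<nu> \<cdot> a)) \<odot>\<^bsub>H\<^esub> (a' \<cdot> (\<nu> \<cdot> b))) R
      = (\<epsilon> \<nu> \<otimes>\<^bsub>k\<^esub> \<epsilon> a) \<odot>\<^bsub>H\<^esub> tlift H (\<lambda>a' b'. \<epsilon> b' \<odot>\<^bsub>H\<^esub> (a' \<cdot> (\<nu> \<cdot> b))) R" .
  qed
  also have "\<dots> = tlift H (\<lambda>a b. \<epsilon> \<nu> \<odot>\<^bsub>H\<^esub> (\<epsilon> a \<odot>\<^bsub>H\<^esub> (\<nu> \<cdot> b))) R"
    using module_H by (intro tlift_cong refl) (simp add: R_counit(2)[OF module_H klin_mult1[OF algebra_H _ klin_id]] mod_mults)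
  also have "\<dots> = \<epsilon> \<nu> \<odot>\<^bsub>H\<^esub> tlift H (\<lambda>a b. \<epsilon> a \<odot>\<^bsub>H\<^esub> (\<nu> \<cdot> b)) R"
    by (rule tlift_smult[OF module_H]) (use module_H in simp_all)
  also have "\<dots> = \<epsilon> \<nu> \<odot>\<^bsub>H\<^esub> \<nu>"
    by (simp add: R_counit(1)[OF module_H klin_mult2[OF algebra_H _ klin_id]])
  finally have "\<epsilon> \<nu> = \<epsilon> (\<epsilon> \<nu> \<odot>\<^bsub>H\<^esub> \<nu>)" by (rule arg_cong)
  then have e: "\<epsilon> \<nu> = \<epsilon> \<nu> \<otimes>\<^bsub>k\<^esub> \<epsilon> \<nu>" by (simp add: counit_smult)
  have i: "\<epsilon> \<nu> \<otimes>\<^bsub>k\<^esub> \<epsilon> \<nu>' = \<one>\<^bsub>k\<^esub>" using counit_mult[of \<nu> \<nu>'] by (simp add: nu_inv)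
  have "\<epsilon> \<nu> = \<epsilon> \<nu> \<otimes>\<^bsub>k\<^esub> (\<epsilon> \<nu> \<otimes>\<^bsub>k\<^esub> \<epsilon> \<nu>')" by (simp add: i)
  also have "\<dots> = (\<epsilon> \<nu> \<otimes>\<^bsub>k\<^esub> \<epsilon> \<nu>) \<otimes>\<^bsub>k\<^esub> \<epsilon> \<nu>'" by (simp add: K.m_assoc)
  also have "\<dots> = \<one>\<^bsub>k\<^esub>" unfolding e[symmetric] by (rule i)
  finally show 1: "\<epsilon> \<nu> = \<one>\<^bsub>k\<^esub>" .
  show "\<epsilon> \<nu>' = \<one>\<^bsub>k\<^esub>" using i 1 by simp
qed

abbreviation sq_iso :: "('k, 'h, 'a) mob \<Rightarrow> ('k, 'h, 'a) mar" where "sq_iso \<equiv> twist_square_iso H \<phi> \<nu>"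

text \<open>The second twist undoes the first because \<open>\<phi>\<close> is an involution, and
  \<open>\<nu>'\<close> is central.\<close>

lemma sq_iso_hom:
  fixes X :: "('k, 'h, 'a) mob"
  assumes X: "amodule k H X"
  shows "is_hom k H (sq_iso X) (tw (tw X)) (act X \<nu>') X"
  using act_mult[OF X, symmetric] klin_act2[OF X nu_cl(2) klin_id]
  by (simp add: is_hom_def twist_square_iso_def twist_simps nu'_central)

lemma act_nu:
  assumes X: "amodule k H X" and x: "x \<in> carrier X"
  shows "act X \<nu> (act X \<nu>' x) = x" "act X \<nu>' (act X \<nu> x) = x"
  using act_mult[OF X _ _ x, symmetric] by (simp_all add: nu_inv act_one[OF X x])

lemma sq_iso_iso:
  fixes X :: "('k, 'h, 'a) mob"
  assumes X: "amodule k H X" and C: "mod_cat k H C"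
  shows "iso_mor C (tw (tw X)) X (sq_iso X)"
  by (rule iso_mor_hom[OF sq_iso_hom[OF X] _ _ _ tw_amodule[OF tw_amodule[OF X]] C, of "act X \<nu>"])
    (simp_all add: twist_simps klin_act2[OF X nu_cl(1) klin_id] act_nu[OF X])

lemma hom_sq_iso_nat:
  fixes X Y :: "('k, 'h, 'a) mob"
  assumes X: "amodule k H X" and Y: "amodule k H Y" and F: "is_hom k H F X f Y"
  shows "amod_comp (sq_iso Y) (fmo \<Phi> (fmo \<Phi> F)) = amod_comp F (sq_iso X)"
  by (rule hom_eqI[OF is_hom_comp[OF fmo_hom[OF fmo_hom[OF F]] sq_iso_hom[OF Y]] is_hom_comp[OF sq_iso_hom[OF X] F]])
    (simp add: is_homD(3)[OF F])

text \<open>Two applications of \<open>f2\<close> make up the double braiding, which by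
  \<open>comult_nu\<close> is the action of \<open>\<nu>\<close> on \<open>X \<otimes> Y\<close> up
  to one factor \<open>\<nu>'\<close> on each of \<open>X\<close> and \<open>Y\<close>. Monoidality
  therefore requires the inverse of the balancing.\<close>

lemma hom_sq_iso_mult:
  fixes X Y :: "('k, 'h, 'a) mob"
  assumes X: "amodule k H X" and Y: "amodule k H Y"
  shows "amod_comp (sq_iso (mod_tensor k \<Delta> X Y)) (amod_comp (fmo \<Phi> (f2 \<Phi> X Y)) (f2 \<Phi> (tw Y) (tw X)))
    = amod_comp (amod_id (mod_tensor k \<Delta> X Y)) (mod_tensor_mor k \<Delta> (sq_iso X) (sq_iso Y))"
proof -
  interpret comod k H H \<Delta> "TYPE('a)" by (rule comod_H)
  note tX = tw_amodule[OF X] and tY = tw_amodule[OF Y]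
  note ttX = tw_amodule[OF tX] and ttY = tw_amodule[OF tY]
  note XY = amodule_mod_tensor[OF X Y] and m = amodule_module[OF X] amodule_module[OF Y]
  note P = is_hom_comp[OF is_hom_comp[OF f2_hom[OF tY tX] fmo_hom[OF f2_hom[OF X Y]]] sq_iso_hom[OF XY]]
  note Q = is_hom_comp[OF tens_hom[OF sq_iso_hom[OF X] sq_iso_hom[OF Y] ttX X ttY Y] is_hom_id]
  let ?T = "mod_tensor k \<Delta> X Y"
  note mT = amodule_module[OF XY]
  note acl = act_cl[OF X] act_cl[OF Y]
  show ?thesis
  proof (rule hom_eqI[OF P Q], rule mod_tensor_ext[OF amodule_module[OF ttX] amodule_module[OF ttY] mT is_homD(1)[OF P] is_homD(1)[OF Q]])
    fix x y assume "x \<in> carrier (tw (tw X))" "y \<in> carrier (tw (tw Y))"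
    then have x: "x \<in> carrier X" and y: "y \<in> carrier Y" by simp_all
    let ?u = "tp k X Y x y" let ?v = "tp k X Y (act X \<nu>' x) (act Y \<nu>' y)"
    have v: "?v \<in> carrier ?T" using x y by (simp add: tp_cl m acl)
    \<comment> \<open>The element \<open>\<nu>\<close> is applied to the right-hand side, since
      \<open>comult_nu\<close> describes the coproduct of \<open>\<nu>\<close>; the action of
      \<open>\<nu>'\<close> is then moved to the other side by \<open>act_nu\<close>.\<close>
    have "act ?T \<nu> ?v = tlift ?T (\<lambda>a b. tp k X Y (act X a (act X \<nu>' x)) (act Y b (act Y \<nu>' y))) (\<Delta> \<nu>)"
      using x y by (simp add: act_tp[OF X Y] acl)
    also have "\<dots> = tlift ?T (\<lambda>a b. tlift ?T (\<lambda>a' b'.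
      tp k X Y (act X (b' \<cdot> (\<nu> \<cdot> a)) (act X \<nu>' x)) (act Y (a' \<cdot> (\<nu> \<cdot> b)) (act Y \<nu>' y))) R) R"
      by (rule comult_nu[OF mT]) (intro bilinI klin_tp1 klin_tp2 m klin_act1[OF X] klin_act1[OF Y] klin_id acl nu_cl x y)
    also have "\<dots> = tlift ?T (\<lambda>a b. tlift ?T (\<lambda>a' b'. tp k X Y (act X b' (act X a x)) (act Y a' (act Y b y))) R) R"
      using x y by (intro tlift_cong refl) (simp add: nu_central act_mult[OF X] act_mult[OF Y] act_nu[OF X] act_nu[OF Y] acl)
    also have "\<dots> = mod_flip_R k R Y X (mod_flip_R k R X Y ?u)"
      using x y by (simp add: braid_map_tp X Y push_braid_map tp_cl m acl)
    also have "\<dots> = mod_flip_R k R Y X (mod_flip_R k R (tw X) (tw Y) ?u)"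
      using x y by (simp add: braid_map_twist[OF Y X] tp_cl m)
    finally have "act ?T \<nu>' (mod_flip_R k R Y X (mod_flip_R k R (tw X) (tw Y) ?u)) = ?v"
      using act_nu(2)[OF XY v] by simp
    then show "act ?T \<nu>' (mod_flip_R k R Y X (mod_flip_R k R (tw X) (tw Y) (tp k (tw (tw X)) (tw (tw Y)) x y)))
      = tensor_map k X Y (act X \<nu>') (act Y \<nu>') (tp k (tw (tw X)) (tw (tw Y)) x y)"
      using x y klin_act2[OF X nu_cl(2) klin_id] klin_act2[OF Y nu_cl(2) klin_id] by (simp add: twist_simps tensor_eval m)
  qed
qed

lemma hom_sq_iso_unit:
  "amod_comp (sq_iso (mod_unit k H :: ('k, 'h, 'a) mob)) (amod_comp (fmo \<Phi> (f0 \<Phi>)) (f0 \<Phi>)) = amod_id (mod_unit k H)"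
proof -
  interpret comod k H H \<Delta> "TYPE('a)" by (rule comod_H)
  interpret K: cring k by (rule cring_k)
  show ?thesis
    by (rule hom_eqI[OF is_hom_comp[OF is_hom_comp[OF f0_hom fmo_hom[OF f0_hom]] sq_iso_hom[OF unit_amodule]] is_hom_id])
      (auto dest!: unit_carrier simp: act_unit counit_nu)
qed

text \<open>Both arrows are the action of \<open>\<nu>'\<close>, which \<open>\<phi>\<close>
  fixes.\<close>

lemma sq_iso_twist: "fmo \<Phi> (sq_iso X) = sq_iso (tw X)"
  by (simp add: twist_functor_def twist_square_iso_def mk_arrow_def)

lemma mon_op_sel:
  "obj (mon_op C) = obj C" "mor (mon_op C) = mor C" "idm (mon_op C) = idm C" "cmp (mon_op C) = cmp C"
  "tob (mon_op C) = (\<lambda>X Y. tob C Y X)" "tmo (mon_op C) = (\<lambda>f g. tmo C g f)" "unt (mon_op C) = unt C"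
  "asc (mon_op C) = (\<lambda>X Y Z. inv_mor C (tob C (tob C Z Y) X) (tob C Z (tob C Y X)) (asc C Z Y X))"
  "lun (mon_op C) = run C" "run (mon_op C) = lun C"
  by (simp_all add: mon_op_def)

lemma iso_mor_mon_op: "iso_mor (mon_op C) = iso_mor C"
  by (intro ext) (simp add: iso_mor_def inverse_mors_def mon_op_def)

lemma fd_tw: "fd_amod k H (X :: ('k, 'h, 'a) mob) \<Longrightarrow> fd_amod k H (tw X)"
proof -
  assume X: "fd_amod k H X"
  \<comment> \<open>The sum \<open>finsum\<close> is determined by the carrier, addition and zero,
    which twisting leaves alone.\<close>
  have "fin_dim k (tw X) = fin_dim k X"
    by (simp add: fin_dim_def twist_def finsum_def finprod_def)
  then show ?thesis using X by (auto simp: fd_amod_def intro: tw_amodule)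
qed

end

section \<open>The braided pair\<close>

context ribbon_inv
begin

lemma fmo_id: "fmo \<Phi> (amod_id X) = amod_id (tw X)"
  by (rule hom_eqI[OF fmo_hom[OF is_hom_id] is_hom_id refl])

lemma fmo_comp:
  assumes "is_hom k H F X f Y" "is_hom k H G Y g Z"
  shows "fmo \<Phi> (amod_comp G F) = amod_comp (fmo \<Phi> G) (fmo \<Phi> F)"
  by (rule hom_eqI[OF fmo_hom[OF is_hom_comp[OF assms]] is_hom_comp[OF fmo_hom[OF assms(1)] fmo_hom[OF assms(2)]] refl])

lemma monoidal_functor_twist:
  "monoidal_functor (Hmod_fd k H R) (mon_op (Hmod_fd k H R)) (\<Phi> :: (('k, 'h, 'a) mob, ('k, 'h, 'a) mar, ('k, 'h, 'a) mob, ('k, 'h, 'a) mar) mfun)"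
  unfolding monoidal_functor_def mon_op_sel iso_mor_mon_op Hmod_fd_sel fob_tw
proof (intro conjI ballI, unfold mem_Collect_eq is_hom_mor; (elim exE)?)
qed (blast intro: fd_tw fmo_hom fmo_id fmo_comp f2_iso[OF _ _ mod_cat_H] hom_f2_nat f0_iso[OF mod_cat_H]
        hom_f2_assoc[OF _ _ _ mod_cat_H] hom_f2_lun hom_f2_run dest: fd_amodD)+

lemma monoidal_iso_twist:
  "monoidal_iso (Hmod_fd k H R) (Hmod_fd k H R)
    (mfun_comp (Hmod_fd k H R) (mfun_op \<Phi>) \<Phi> :: (('k, 'h, 'a) mob, ('k, 'h, 'a) mar, ('k, 'h, 'a) mob, ('k, 'h, 'a) mar) mfun)
    (mfun_id (Hmod_fd k H R)) sq_iso"
proof -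
  \<comment> \<open>In the composite, \<open>mfun_op\<close> exchanges the arguments of the outer
    \<open>f2\<close>, which gives \<open>f2 \<Phi> (tw Y) (tw X)\<close>.\<close>
  have sel: "fob (mfun_comp (Hmod_fd k H R) (mfun_op \<Phi>) (\<Phi> :: (('k, 'h, 'a) mob, ('k, 'h, 'a) mar, ('k, 'h, 'a) mob, ('k, 'h, 'a) mar) mfun)) = (\<lambda>X. tw (tw X))"
    "fmo (mfun_comp (Hmod_fd k H R) (mfun_op \<Phi>) (\<Phi> :: (('k, 'h, 'a) mob, ('k, 'h, 'a) mar, ('k, 'h, 'a) mob, ('k, 'h, 'a) mar) mfun)) = (\<lambda>f. fmo \<Phi> (fmo \<Phi> f))"
    "f2 (mfun_comp (Hmod_fd k H R) (mfun_op \<Phi>) (\<Phi> :: (('k, 'h, 'a) mob, ('k, 'h, 'a) mar, ('k, 'h, 'a) mob, ('k, 'h, 'a) mar) mfun))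
      = (\<lambda>X Y. amod_comp (fmo \<Phi> (f2 \<Phi> X Y)) (f2 \<Phi> (tw Y) (tw X)))"
    "f0 (mfun_comp (Hmod_fd k H R) (mfun_op \<Phi>) (\<Phi> :: (('k, 'h, 'a) mob, ('k, 'h, 'a) mar, ('k, 'h, 'a) mob, ('k, 'h, 'a) mar) mfun))
      = amod_comp (fmo \<Phi> (f0 \<Phi>)) (f0 \<Phi>)"
    by (simp_all add: mfun_comp_def mfun_op_def)
  have sel': "fob (mfun_id (Hmod_fd k H R)) = (\<lambda>X. X)" "fmo (mfun_id (Hmod_fd k H R)) = (\<lambda>f. f)"
    "f2 (mfun_id (Hmod_fd k H R)) = (\<lambda>X Y :: ('k, 'h, 'a) mob. amod_id (mod_tensor k \<Delta> X Y))"
    "f0 (mfun_id (Hmod_fd k H R)) = amod_id (mod_unit k H :: ('k, 'h, 'a) mob)"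
    by (simp_all add: mfun_id_def)
  show ?thesis
    unfolding monoidal_iso_def sel sel' Hmod_fd_sel
  proof (intro conjI ballI, unfold mem_Collect_eq is_hom_mor; (elim exE)?)
  qed (blast intro: sq_iso_iso[OF _ mod_cat_H] hom_sq_iso_nat hom_sq_iso_mult hom_sq_iso_unit dest: fd_amodD)+
qed

lemma braided_anti_involution_twist:
  "braided_anti_involution (Hmod_fd k H R :: (('k, 'h, 'a) mob, ('k, 'h, 'a) mar) brcat) \<Phi> sq_iso"
  unfolding braided_anti_involution_def anti_involution_def
proof (intro conjI ballI)
  show "fmo \<Phi> (sq_iso X) = sq_iso (fob \<Phi> X)" for X :: "('k, 'h, 'a) mob" by (simp add: sq_iso_twist)
  fix X Y :: "('k, 'h, 'a) mob" assume "X \<in> obj (Hmod_fd k H R)" "Y \<in> obj (Hmod_fd k H R)"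
  then show "fmo \<Phi> (brd (Hmod_fd k H R) X Y) \<bullet>\<^bsub>Hmod_fd k H R\<^esub> f2 \<Phi> X Y
    = f2 \<Phi> Y X \<bullet>\<^bsub>Hmod_fd k H R\<^esub> brd (Hmod_fd k H R) (fob \<Phi> Y) (fob \<Phi> X)"
    by (simp add: hom_f2_braid fd_amodD)
qed (rule monoidal_functor_twist monoidal_iso_twist)+

end

theorem proposition1p7:
  fixes k :: "'k ring" and H :: "('k, 'h) hopf"
    and R K :: "('h \<times> 'h) list" and \<nu> :: 'h and \<phi> :: "'h \<Rightarrow> 'h" and B :: "'h set"
  assumes "ribbon_hopf_algebra k H R \<nu>"
    and "hopf_involution k H \<phi>" and "tmap k H H \<phi> \<phi> R = R" and "\<phi> \<nu> = \<nu>"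
    and "coideal_subalgebra k H B" and "universal_K_matrix k H R \<phi> B K"
  shows "Z2_braided_pair
     (Hmod_fd k H R :: (('k, 'h, 'a) mob, ('k, 'h, 'a) mar) brcat)
     (Bmod_fd k H B :: (('k, 'h, 'a) mob, ('k, 'h, 'a) mar, ('k, 'h, 'a) mob, ('k, 'h, 'a) mar) modcat)
     (twist_functor k H R \<phi>) (twist_square_iso H \<phi> \<nu>) (K_action k H \<phi> B K)"
proof -
  have h: "field k" "hopf_algebra k H" "universal_R_matrix k H R" "ribbon_element k H R \<nu>"
    using assms(1) by (simp_all add: ribbon_hopf_algebra_def hopf_algebra_def)
  interpret ribbon_inv k H R \<phi> \<nu>
    by (intro ribbon_inv.intro inv_hopf.intro qt_hopf.intro hopf_alg.intro over_field.intro ribbon_inv_axioms.intro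
        inv_hopf_axioms.intro qt_hopf_axioms.intro hopf_alg_axioms.intro h assms)
  interpret kmat k H R \<phi> B K
    by (intro kmat.intro coideal.intro kmat_axioms.intro coideal_axioms.intro inv_hopf_axioms hopf_alg_axioms assms)
  let ?C = "Hmod_fd k H R :: (('k, 'h, 'a) mob, ('k, 'h, 'a) mar) brcat"
  let ?D = "Bmod_fd k H B :: (('k, 'h, 'a) mob, ('k, 'h, 'a) mar, ('k, 'h, 'a) mob, ('k, 'h, 'a) mar) modcat"
  interpret C: braided_monoidal_category ?C by (rule braided_Hmod_fd)
  interpret D: pointed_module_category ?C ?D
    by (rule module_category_Bmod_fd[OF C.monoidal_category_axioms])
  \<comment> \<open>Fixes the category in which the inverse associators of (BP1) and (BP2) are
    formed.\<close>
  note DB = mod_cat_B[where k = k and H = H and B = B]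
  show ?thesis
  proof (intro Z2_braided_pair.intro Z2_braided_pair_axioms.intro C.braided_monoidal_category_axioms
      D.pointed_module_category_axioms braided_anti_involution_twist; unfold Hmod_fd_sel Bmod_fd_sel fob_tw mem_Collect_eq is_hom_mor; (elim exE)?)
  qed (blast intro: K_iso[OF _ _ DB] hom_K_nat hom_BP1[OF _ _ _ DB] hom_BP2[OF _ _ _ DB] dest: fd_amodD)+
qed

end
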